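(* Let $\mathcal C\subset\mathcal H=\mathbb C^N[[z,z^{-1}]]$ be a generalized Givental cone, i.e. the cone of a calibrated flat F-manifold defined on the formal neighbourhood of a point $\bar t_{\mathrm{orig}}\in\mathbb C^N$, such that the algebra structure of the flat F-manifold at $\bar t_{\mathrm{orig}}$ is semisimple. Then $$\mathcal C=S(z)R(z)M\,\mathcal C^{\mathrm{triv}}_N$$ for some $S(z)\in G_-$, $R(z)\in G_+$ and $M\in\mathrm{GL}(\mathbb C^N)$.
   Context: Repeated Greek indices are summed from $1$ to $N$; the lower index $0$ in $\Omega^{\alpha,d}_{\beta,0}$ is part of the notation. Flat F-manifolds. For $\bar t_{\mathrm{orig}}\in\mathbb C^N$ let $\mathcal R^{\bar t_{\mathrm{orig}}}$ be the ring of formal power series in $t^\alpha-t^\alpha_{\mathrm{orig}}$. A flat F-manifold on the formal neighbourhood of $\bar t_{\mathrm{orig}}$ is given by $F^\alpha\in\mathcal R^{\bar t_{\mathrm{orig}}}$ and $A^\alpha\in\mathbb C$ (unit $A^\alpha\frac{\partial}{\partial t^\alpha}$) with $A^\mu\frac{\partial^2F^\alpha}{\partial t^\mu\partial t^\beta}=\delta^\alpha_\beta$ and $\frac{\partial^2F^\alpha}{\partial t^\beta\partial t^\mu}\frac{\partial^2F^\mu}{\partial t^\gamma\partial t^\delta}=\frac{\partial^2F^\alpha}{\partial t^\gamma\partial t^\mu}\frac{\partial^2F^\mu}{\partial t^\beta\partial t^\delta}$; structure constants $c^\alpha_{\beta\gamma}=\frac{\partial^2F^\alpha}{\partial t^\beta\partial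 t^\gamma}$. Semisimple at a point: the algebra at this point has a basis $\pi_1,\ldots,\pi_N$ with $\pi_k\circ\pi_l=\delta_{k,l}\pi_k$. Calibrations and descendant vector potentials. A calibration is a collection $\Omega^{\alpha,d}_{\beta,0}\in\mathcal R^{\bar t_{\mathrm{orig}}}$, $d\ge-1$, with $\Omega^{\alpha,-1}_{\beta,0}=\delta^\alpha_\beta$ and $\frac{\partial\Omega^{\alpha,d}_{\beta,0}}{\partial t^\gamma}=c^\mu_{\gamma\beta}\Omega^{\alpha,d-1}_{\mu,0}$, $d\ge0$. Put $\Omega^d_0=(\Omega^{\alpha,d}_{\beta,0})$, define $\Omega^0_d$, $d\ge 0$, by $(\mathrm{Id}+\sum_{d\ge1}(-1)^d\Omega^0_{d-1}z^d)(\mathrm{Id}+\sum_{d\ge1}\Omega^{d-1}_0z^d)=\mathrm{Id}$, $\Omega^0_{-1}=\mathrm{Id}$, and $\Omega^p_q=(\Omega^{\alpha,p}_{\beta,q})=\sum_{i=0}^q(-1)^{q-i}\Omega^{p+q-i}_0\Omega^0_{i-1}$. Then $A^\beta\Omega^{\alpha,0}_{\beta,0}=t^\alpha+c^\alpha$ for constants $\bar c=(c^\alpha)$; let $(\Omega^{\bar c})^{\alpha,p}_{\beta,q}=\Omega^{\alpha,p}_{\beta,q}|_{t^\gamma\mapsto t^\gamma-c^\gamma}$. Let $t^\alpha_0,t^\alpha_1,\ldots$ be variables (with $t^\alpha_0$ in the role of $t^\alpha$) and let $v^\alpha\in\mathcal R^{\bar t_{\mathrm{orig}}+\bar c}[[t^*_{\ge1}]]$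 be the solution of $\frac{\partial v^\alpha}{\partial t^\beta_d}=A^\gamma\frac{\partial}{\partial t^\gamma_0}\big((\Omega^{\bar c})^{\alpha,0}_{\beta,d}|_{t^*=v^*}\big)$ with $v^\alpha|_{t^*_{\ge1}=0}=t^\alpha_0$. With $q^\beta_b=t^\beta_b-A^\beta\delta_{b,1}$, the descendant vector potentials are $\mathcal F^{\alpha,a}=\sum_{b\ge0}\big((\Omega^{\bar c})^{\alpha,a}_{\beta,b}|_{t^*=v^*}\big)q^\beta_b$, $a\ge0$. Cones. Elements of $\mathcal H$ are written $\sum_{d\ge0}\frac{(-1)^{d+1}p^\alpha_d\phi_\alpha}{z^{d+1}}+\sum_{d\ge0}q^\alpha_d\phi_\alpha z^d$, $\phi_\alpha$ the standard basis of $\mathbb C^N$. The cone of a calibrated flat F-manifold (a generalized Givental cone) is the formal germ of the graph $\mathcal C=\{p^\alpha_a=\mathcal F^{\alpha,a}\}\subset\mathcal H$ over the point $q=\bar t_{\mathrm{orig}}+\bar c-A^\alpha\phi_\alpha z$. An ancestor cone is one with $\bar t_{\mathrm{orig}}+\bar c=0$ and $\frac{\partial\mathcal F^{\alpha,a}}{\partial t^\beta_b}|_{t^*_*=0}=0$ for all $a,b\ge0$; a flat F-manifold with $F^\alpha\in\mathbb C[[t^1,\ldots,t^N]]$ has a unique calibration with $\Omega^{\alpha,d}_{\beta,0}|_{t^*=0}=0$ for $d\ge 0$, and it gives an ancestor cone. $\mathcal C^{\mathrm{triv}}_N$ is the ancestor cone obtained in this way from the trivial flat F-manifold $F^\alpha=\frac{(t^\alpha)^2}2$,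 $A^\alpha=1$ ($1\le\alpha\le N$). Group actions. $G_+=\{\mathrm{Id}+\sum_{i\ge1}R_iz^i\in\mathrm{End}(\mathbb C^N)[[z]]\}$, $G_-=\{\mathrm{Id}+\sum_{i\ge1}S_iz^{-i}\in\mathrm{End}(\mathbb C^N)[[z^{-1}]]\}$. The groups act on cones by left multiplication on the points $f\in\mathcal H$ of the cone: $\mathrm{GL}(\mathbb C^N)$ and $G_-$ act on all generalized Givental cones, and $G_+$ acts on ancestor cones. The $G_+$-action is well defined since, with $\deg t^\beta_b=b-1$, ancestor potentials satisfy $\deg\mathcal F^{\alpha,a}\le-a-2$ (every monomial); the resulting potentials are re-expanded around $q=-A^\alpha\phi_\alpha z$ and are again ancestor. An element $S(z)\in G_-$ maps a germ over $q=\bar t_{\mathrm{orig}}+\bar c-A^\alpha\phi_\alpha z$ to a germ over $q=\bar t_{\mathrm{orig}}+\bar c-S_1(A^\alpha\phi_\alpha)-A^\alpha\phi_\alpha z$. *)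

theory Defs
  imports "HOL-Analysis.Analysis" "HOL-Library.Multiset"
begin

section \<open>Formal power series in arbitrarily many variables\<close>

text \<open>
  A monomial in the variables \<open>'v\<close> is a finite multiset of variables, and a series is an arbitrary
  family of coefficients indexed by monomials; \<open>'v\<close> may be infinite.
\<close>

typedef 'v mfps = "UNIV :: ('v multiset \<Rightarrow> complex) set"
  morphisms mfps_coeff Abs_mfps
  by simp

lemma mfps_coeff_Abs [simp]: "mfps_coeff (Abs_mfps f) = f"
  by (simp add: Abs_mfps_inverse)

lemma mfps_eqI: "(\<And>m. mfps_coeff f m = mfps_coeff g m) \<Longrightarrow> f = g"
  by (metis ext mfps_coeff_inject)

definition msplits :: "'v multiset \<Rightarrow> ('v multiset \<times> 'v multiset) set" where
  "msplits m = {(k, l). k + l = m}"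

lemma finite_submultisets: "finite {k. k \<subseteq># (m :: 'v multiset)}"
proof (induction m)
  case empty
  then show ?case by simp
next
  case (add x m)
  have "{k. k \<subseteq># add_mset x m} \<subseteq> {k. k \<subseteq># m} \<union> add_mset x ` {k. k \<subseteq># m}"
  proof
    fix k assume "k \<in> {k. k \<subseteq># add_mset x m}"
    then have k: "k \<subseteq># add_mset x m" by simp
    show "k \<in> {k. k \<subseteq># m} \<union> add_mset x ` {k. k \<subseteq># m}"
    proof (cases "x \<in># k")
      case True
      then obtain k' where "k = add_mset x k'" by (meson multi_member_split)
      with k show ?thesis by auto
    next
      case False
      with k have "k \<subseteq># m"
        by (metis diff_single_trivial subset_eq_diff_conv add_mset_add_single)
      then show ?thesis by simp
    qed
  qed
  with add.IH show ?case by (meson finite_UnI finite_imageI finite_subset)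
qed

lemma finite_msplits [simp]: "finite (msplits m)"
proof (rule finite_subset)
  show "msplits m \<subseteq> {k. k \<subseteq># m} \<times> {k. k \<subseteq># m}"
    by (auto simp: msplits_def)
qed (simp add: finite_submultisets)

lemma sum_msplits_assoc:
  fixes A B D :: "'v multiset \<Rightarrow> complex"
  shows "(\<Sum>(p, r)\<in>(SIGMA p:msplits m. msplits (fst p)). A (fst r) * B (snd r) * D (snd p)) =
    (\<Sum>(p, r)\<in>(SIGMA p:msplits m. msplits (snd p)). A (fst p) * B (fst r) * D (snd r))"
  by (rule sum.reindex_bij_witness[of _
        "\<lambda>(p, r). ((fst p + fst r, snd r), (fst p, fst r))"
        "\<lambda>(p, r). ((fst r, snd r + snd p), (snd r, snd p))"])
    (clarsimp simp: msplits_def add.assoc)+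

instantiation mfps :: (type) comm_ring_1
begin

definition "0 = Abs_mfps (\<lambda>_. 0)"
definition "1 = Abs_mfps (\<lambda>m. if m = {#} then 1 else 0)"
definition "f + g = Abs_mfps (\<lambda>m. mfps_coeff f m + mfps_coeff g m)"
definition "f - g = Abs_mfps (\<lambda>m. mfps_coeff f m - mfps_coeff g m)"
definition "- f = Abs_mfps (\<lambda>m. - mfps_coeff f m)"
definition "f * g = Abs_mfps (\<lambda>m. \<Sum>(k, l)\<in>msplits m. mfps_coeff f k * mfps_coeff g l)"

instance
proof
  fix a b c :: "'a mfps"
  show "a + b + c = a + (b + c)" "a + b = b + a" "0 + a = a" "- a + a = 0" "a - b = a + - b"
    by (simp_all add: zero_mfps_def plus_mfps_def minus_mfps_def uminus_mfps_def
        mfps_coeff_inverse add_ac)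
  have "mfps_coeff (0 :: 'a mfps) {#} \<noteq> mfps_coeff 1 {#}"
    by (simp add: zero_mfps_def one_mfps_def)
  then show "(0 :: 'a mfps) \<noteq> 1"
    by auto
  show "(a + b) * c = a * c + b * c"
    by (auto intro!: mfps_eqI
        simp: plus_mfps_def times_mfps_def case_prod_unfold ring_distribs sum.distrib)
  show "a * b = b * a"
  proof (rule mfps_eqI)
    fix m
    show "mfps_coeff (a * b) m = mfps_coeff (b * a) m"
      unfolding times_mfps_def mfps_coeff_Abs
      by (rule sum.reindex_bij_witness[of _ "\<lambda>(k, l). (l, k)" "\<lambda>(k, l). (l, k)"])
        (auto simp: msplits_def add.commute mult.commute)
  qed
  show "1 * a = a"
  proof (rule mfps_eqI)
    fix m
    have "mfps_coeff (1 * a) m =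
      (\<Sum>p\<in>msplits m. if p = ({#}, m) then mfps_coeff a m else 0)"
      unfolding times_mfps_def one_mfps_def mfps_coeff_Abs
    proof (rule sum.cong[OF refl])
      fix p assume "p \<in> msplits m"
      then obtain k l where p: "p = (k, l)" "m = k + l"
        by (auto simp: msplits_def)
      show "(case p of (k, l) \<Rightarrow> (if k = {#} then 1 else 0) * mfps_coeff a l) =
        (if p = ({#}, m) then mfps_coeff a m else 0)"
        by (cases "k = {#}") (simp_all add: p)
    qed
    also have "\<dots> = (if ({#}, m) \<in> msplits m then mfps_coeff a m else 0)"
      by (rule sum.delta) (rule finite_msplits)
    also have "\<dots> = mfps_coeff a m"
      by (simp add: msplits_def)
    finally show "mfps_coeff (1 * a) m = mfps_coeff a m" .
  qed
  show "a * b * c = a * (b * c)"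
  proof (rule mfps_eqI)
    fix m
    let ?t = "\<lambda>i j k. mfps_coeff a i * mfps_coeff b j * mfps_coeff c k"
    have "mfps_coeff (a * b * c) m =
      (\<Sum>p\<in>msplits m. \<Sum>r\<in>msplits (fst p). ?t (fst r) (snd r) (snd p))"
      by (simp add: times_mfps_def case_prod_unfold sum_distrib_right)
    also have "\<dots> = (\<Sum>(p, r)\<in>(SIGMA p:msplits m. msplits (fst p)). ?t (fst r) (snd r) (snd p))"
      by (simp add: sum.Sigma)
    also have "\<dots> = (\<Sum>(p, r)\<in>(SIGMA p:msplits m. msplits (snd p)). ?t (fst p) (fst r) (snd r))"
      by (rule sum_msplits_assoc)
    also have "\<dots> = (\<Sum>p\<in>msplits m. \<Sum>r\<in>msplits (snd p). ?t (fst p) (fst r) (snd r))"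
      by (simp add: sum.Sigma)
    also have "\<dots> = mfps_coeff (a * (b * c)) m"
      by (simp add: times_mfps_def case_prod_unfold sum_distrib_left mult.assoc)
    finally show "mfps_coeff (a * b * c) m = mfps_coeff (a * (b * c)) m" .
  qed
qed

end

definition mfps_const :: "complex \<Rightarrow> 'v mfps" where
  "mfps_const c = Abs_mfps (\<lambda>m. if m = {#} then c else 0)"

definition mfps_var :: "'v \<Rightarrow> 'v mfps" where
  "mfps_var v = Abs_mfps (\<lambda>m. if m = {#v#} then 1 else 0)"

definition mfps_deriv :: "'v \<Rightarrow> 'v mfps \<Rightarrow> 'v mfps" where
  "mfps_deriv v f =
     Abs_mfps (\<lambda>m. of_nat (Suc (count m v)) * mfps_coeff f (add_mset v m))"

text \<open>
  Infinite sums and substitutions are purely formal: they are well defined if for every monomial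
  only finitely many terms contribute to its coefficient.  The two total functions below are
  meaningful only under the corresponding finiteness condition.
\<close>

definition mfps_summable :: "('i \<Rightarrow> 'v mfps) \<Rightarrow> bool" where
  "mfps_summable f \<longleftrightarrow> (\<forall>m. finite {i. mfps_coeff (f i) m \<noteq> 0})"

definition mfps_Sum :: "('i \<Rightarrow> 'v mfps) \<Rightarrow> 'v mfps" where
  "mfps_Sum f = Abs_mfps (\<lambda>m. \<Sum>i | mfps_coeff (f i) m \<noteq> 0. mfps_coeff (f i) m)"

definition mfps_subst_term :: "('v \<Rightarrow> 'w mfps) \<Rightarrow> 'v mfps \<Rightarrow> 'v multiset \<Rightarrow> 'w mfps" where
  "mfps_subst_term g f m = mfps_const (mfps_coeff f m) * (\<Prod>v\<in>#m. g v)"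

definition mfps_substitutable :: "('v \<Rightarrow> 'w mfps) \<Rightarrow> 'v mfps \<Rightarrow> bool" where
  "mfps_substitutable g f \<longleftrightarrow> mfps_summable (mfps_subst_term g f)"

definition mfps_subst :: "('v \<Rightarrow> 'w mfps) \<Rightarrow> 'v mfps \<Rightarrow> 'w mfps" where
  "mfps_subst g f = mfps_Sum (mfps_subst_term g f)"


section \<open>Inverses of matrix-valued series\<close>

text \<open>
  The inverse of \<open>Id + \<Sum>i\<ge>1. X i * z^i\<close>, where a sequence \<open>X\<close> with \<open>X 0 = Id\<close> lists the
  coefficients.
\<close>

fun series_inv :: "(nat \<Rightarrow> ('a :: comm_ring_1)^'n^'n) \<Rightarrow> nat \<Rightarrow> 'a^'n^'n" where
  "series_inv X n =
     (if n = 0 then mat 1 else - (\<Sum>i<n. series_inv X i ** X (n - i)))"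

declare series_inv.simps [simp del]

lemma series_inv_left:
  assumes "X 0 = mat 1"
  shows "(\<Sum>i\<le>n. series_inv X i ** X (n - i)) = (if n = 0 then mat 1 else 0)"
proof (cases "n = 0")
  case True
  then show ?thesis by (simp add: assms series_inv.simps)
next
  case False
  have "(\<Sum>i\<le>n. series_inv X i ** X (n - i)) =
    (\<Sum>i<n. series_inv X i ** X (n - i)) + series_inv X n ** X 0"
    by (simp add: lessThan_Suc_atMost[symmetric])
  also have "\<dots> = 0"
    using False by (subst (2) series_inv.simps) (simp add: assms)
  finally show ?thesis using False by simp
qed


section \<open>Flat F-manifolds and calibrations\<close>

text \<open>
  The index type \<open>'n\<close> stands for \<open>{1..N}\<close>.  An element of the ring of formal power series in
  \<open>t^\<alpha> - t_orig^\<alpha>\<close> is a \<open>'n mfps\<close> whose variable \<open>\<alpha>\<close> is the difference \<open>t^\<alpha> - t_orig^\<alpha>\<close>, so that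
  the constant coefficient is the value at \<open>t_orig\<close>.
\<close>

definition structure_const :: "('n \<Rightarrow> 'n mfps) \<Rightarrow> 'n \<Rightarrow> 'n \<Rightarrow> 'n \<Rightarrow> 'n mfps" where
  "structure_const F \<alpha> \<beta> \<gamma> = mfps_deriv \<beta> (mfps_deriv \<gamma> (F \<alpha>))"

definition flat_F_manifold :: "('n::finite \<Rightarrow> 'n mfps) \<Rightarrow> complex^'n \<Rightarrow> bool" where
  "flat_F_manifold F A \<longleftrightarrow>
     (\<forall>\<alpha> \<beta>. (\<Sum>\<mu>\<in>UNIV. mfps_const (A $ \<mu>) * structure_const F \<alpha> \<mu> \<beta>) = (if \<alpha> = \<beta> then 1 else 0)) \<and>
     (\<forall>\<alpha> \<beta> \<gamma> \<delta>.
        (\<Sum>\<mu>\<in>UNIV. structure_const F \<alpha> \<beta> \<mu> * structure_const F \<mu> \<gamma> \<delta>) =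
        (\<Sum>\<mu>\<in>UNIV. structure_const F \<alpha> \<gamma> \<mu> * structure_const F \<mu> \<beta> \<delta>))"

definition origin_mult :: "('n::finite \<Rightarrow> 'n mfps) \<Rightarrow> complex^'n \<Rightarrow> complex^'n \<Rightarrow> complex^'n" where
  "origin_mult F x y =
     (\<chi> \<alpha>. \<Sum>\<beta>\<in>UNIV. \<Sum>\<gamma>\<in>UNIV. mfps_coeff (structure_const F \<alpha> \<beta> \<gamma>) {#} * x $ \<beta> * y $ \<gamma>)"

definition semisimple_at_origin :: "('n::finite \<Rightarrow> 'n mfps) \<Rightarrow> bool" where
  "semisimple_at_origin F \<longleftrightarrow>
     (\<exists>\<pi> :: 'n \<Rightarrow> complex^'n.
        inj \<pi> \<and> vec.independent (range \<pi>) \<and> vec.span (range \<pi>) = UNIV \<and>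
        (\<forall>k l. origin_mult F (\<pi> k) (\<pi> l) = (if k = l then \<pi> k else 0)))"

text \<open>
  The upper index of a calibration is shifted by one: \<open>J d $ \<alpha> $ \<beta>\<close> is
  \<open>\<Omega>^{\<alpha>,d-1}_{\<beta>,0}\<close>, i.e. \<open>J d\<close> is the coefficient of \<open>z^d\<close> in \<open>Id + \<Sum>d\<ge>1. \<Omega>^{d-1}_0 z^d\<close>.
\<close>

definition calibration :: "('n::finite \<Rightarrow> 'n mfps) \<Rightarrow> (nat \<Rightarrow> 'n mfps^'n^'n) \<Rightarrow> bool" where
  "calibration F J \<longleftrightarrow>
     J 0 = mat 1 \<and>
     (\<forall>d \<alpha> \<beta> \<gamma>. mfps_deriv \<gamma> (J (Suc d) $ \<alpha> $ \<beta>) =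
        (\<Sum>\<mu>\<in>UNIV. structure_const F \<mu> \<gamma> \<beta> * J d $ \<alpha> $ \<mu>))"

text \<open>\<open>lower_Omega J d\<close> is \<open>\<Omega>^0_{d-1}\<close>, again with the index shifted by one.\<close>

definition lower_Omega :: "(nat \<Rightarrow> 'n mfps^'n^'n) \<Rightarrow> nat \<Rightarrow> ('n::finite) mfps^'n^'n" where
  "lower_Omega J d = (if even d then series_inv J d else - series_inv J d)"

definition Omega :: "(nat \<Rightarrow> 'n mfps^'n^'n) \<Rightarrow> nat \<Rightarrow> nat \<Rightarrow> ('n::finite) mfps^'n^'n" where
  "Omega J p q =
     (\<Sum>i\<le>q. if even (q - i) then J (Suc (p + q - i)) ** lower_Omega J i
              else - (J (Suc (p + q - i)) ** lower_Omega J i))"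

text \<open>
  The constants \<open>c^\<alpha>\<close> in \<open>A^\<beta> \<Omega>^{\<alpha>,0}_{\<beta>,0} = t^\<alpha> + c^\<alpha>\<close>, read off at \<open>t = t_orig\<close>.
\<close>

definition calibration_shift ::
    "complex^'n \<Rightarrow> complex^'n \<Rightarrow> (nat \<Rightarrow> 'n mfps^'n^'n) \<Rightarrow> complex^('n::finite)" where
  "calibration_shift t_orig A J =
     (\<chi> \<alpha>. mfps_coeff (\<Sum>\<beta>\<in>UNIV. mfps_const (A $ \<beta>) * J 1 $ \<alpha> $ \<beta>) {#} - t_orig $ \<alpha>)"


section \<open>Descendant vector potentials and generalized Givental cones\<close>

text \<open>
  The germ of a graph \<open>{p = F(q)}\<close> over the point \<open>q = \<Sum>d. base d * z^d\<close>: \<open>pot C a \<alpha>\<close> is the power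
  series \<open>F^{\<alpha>,a}\<close> in the variables \<open>(\<beta>, b)\<close> standing for \<open>q^\<beta>_b - base b $ \<beta>\<close>.
\<close>

record ('n :: finite) germ =
  base :: "nat \<Rightarrow> complex^'n"
  pot :: "nat \<Rightarrow> 'n \<Rightarrow> ('n \<times> nat) mfps"

text \<open>
  Here \<open>w\<close> is \<open>v - (t_orig + c)\<close> and the variable \<open>(\<alpha>, 0)\<close> is \<open>t^\<alpha>_0 - (t_orig^\<alpha> + c^\<alpha>)\<close>.  In terms
  of series centred at the base points, passing from \<open>\<Omega>\<close> to its translate \<open>\<Omega>^c\<close>, which moves the
  base point from \<open>t_orig\<close> to \<open>t_orig + c\<close>, leaves all coefficients unchanged; hence
  \<open>\<Omega>^c|_{t = v}\<close> is \<open>mfps_subst w\<close> applied entrywise to \<open>Omega J\<close>.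
\<close>

definition descendant_solution ::
    "complex^'n \<Rightarrow> (nat \<Rightarrow> 'n mfps^'n^'n) \<Rightarrow> ('n::finite \<Rightarrow> ('n \<times> nat) mfps) \<Rightarrow> bool" where
  "descendant_solution A J w \<longleftrightarrow>
     (\<forall>\<alpha> \<beta> d. mfps_deriv (\<beta>, d) (w \<alpha>) =
        (\<Sum>\<gamma>\<in>UNIV. mfps_const (A $ \<gamma>) *
           mfps_deriv (\<gamma>, 0) (mfps_subst w (Omega J 0 d $ \<alpha> $ \<beta>)))) \<and>
     (\<forall>\<alpha> m. (\<forall>x\<in>#m. snd x = 0) \<longrightarrow>
        mfps_coeff (w \<alpha>) m = mfps_coeff (mfps_var (\<alpha>, 0)) m)"

definition cone_base :: "complex^'n \<Rightarrow> complex^'n \<Rightarrow> nat \<Rightarrow> complex^'n" where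
  "cone_base s A d = (if d = 0 then s else if d = 1 then - A else 0)"

definition q_coord :: "(nat \<Rightarrow> complex^'n) \<Rightarrow> nat \<Rightarrow> 'n::finite \<Rightarrow> ('n \<times> nat) mfps" where
  "q_coord bs d \<alpha> = mfps_const (bs d $ \<alpha>) + mfps_var (\<alpha>, d)"

definition descendant_potential ::
    "(nat \<Rightarrow> complex^'n) \<Rightarrow> (nat \<Rightarrow> 'n mfps^'n^'n) \<Rightarrow> ('n::finite \<Rightarrow> ('n \<times> nat) mfps) \<Rightarrow>
     nat \<Rightarrow> 'n \<Rightarrow> ('n \<times> nat) mfps" where
  "descendant_potential bs J w a \<alpha> =
     mfps_Sum (\<lambda>b. \<Sum>\<beta>\<in>UNIV. mfps_subst w (Omega J a b $ \<alpha> $ \<beta>) * q_coord bs b \<beta>)"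

definition cone_of ::
    "complex^'n \<Rightarrow> complex^'n \<Rightarrow> (nat \<Rightarrow> 'n mfps^'n^'n) \<Rightarrow> ('n::finite) germ \<Rightarrow> bool" where
  "cone_of t_orig A J C \<longleftrightarrow>
     base C = cone_base (t_orig + calibration_shift t_orig A J) A \<and>
     (\<exists>w. descendant_solution A J w \<and> pot C = descendant_potential (base C) J w)"

definition ancestor_cone :: "('n::finite) germ \<Rightarrow> bool" where
  "ancestor_cone C \<longleftrightarrow>
     (\<exists>t_orig F A J. flat_F_manifold F A \<and> calibration F J \<and> cone_of t_orig A J C \<and>
        t_orig + calibration_shift t_orig A J = 0) \<and>
     (\<forall>a \<alpha> \<beta> b. mfps_coeff (mfps_deriv (\<beta>, b) (pot C a \<alpha>)) {#} = 0)"

definition triv_F :: "'n \<Rightarrow> 'n mfps" where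
  "triv_F \<alpha> = mfps_const (1 / 2) * mfps_var \<alpha> ^ 2"

definition triv_cone :: "('n::finite) germ" where
  "triv_cone = (THE C. \<exists>J. calibration triv_F J \<and>
     (\<forall>d\<ge>1. \<forall>\<alpha> \<beta>. mfps_coeff (J d $ \<alpha> $ \<beta>) {#} = 0) \<and> cone_of 0 (\<chi> \<alpha>. 1) J C)"


section \<open>Group actions on cones\<close>

text \<open>
  A formal point of \<open>\<complex>^N[[z, z^{-1}]]\<close> is given by its coefficients at \<open>z^k\<close>, \<open>k\<close> an integer, which
  are vectors of power series.  \<open>cone_point C\<close> is the tautological point of the graph, whose
  coefficient at \<open>z^{-d-1}\<close> is \<open>(-1)^{d+1} p_d\<close>.
\<close>

definition cone_point :: "('n::finite) germ \<Rightarrow> int \<Rightarrow> 'n \<Rightarrow> ('n \<times> nat) mfps" where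
  "cone_point C k \<alpha> =
     (if k \<ge> 0 then q_coord (base C) (nat k) \<alpha>
      else (- 1) ^ nat (- k) * pot C (nat (- k - 1)) \<alpha>)"

definition laurent_term ::
    "(int \<Rightarrow> complex^'n^'n) \<Rightarrow> (int \<Rightarrow> ('n::finite) \<Rightarrow> 'v mfps) \<Rightarrow> int \<Rightarrow> 'n \<Rightarrow> int \<times> 'n \<Rightarrow> 'v mfps" where
  "laurent_term L f k \<alpha> = (\<lambda>(i, \<beta>). mfps_const (L i $ \<alpha> $ \<beta>) * f (k - i) \<beta>)"

definition laurent_mult ::
    "(int \<Rightarrow> complex^'n^'n) \<Rightarrow> (int \<Rightarrow> ('n::finite) \<Rightarrow> 'v mfps) \<Rightarrow> int \<Rightarrow> 'n \<Rightarrow> 'v mfps" where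
  "laurent_mult L f k \<alpha> = mfps_Sum (laurent_term L f k \<alpha>)"

text \<open>
  A formal point \<open>f\<close> lies on \<open>C\<close> if its \<open>p\<close>-coordinates are obtained by substituting its
  \<open>q\<close>-coordinates, re-expanded around the base point of \<open>C\<close>, into the potentials of \<open>C\<close>.
\<close>

definition point_on_germ :: "(int \<Rightarrow> ('n::finite) \<Rightarrow> 'v mfps) \<Rightarrow> 'n germ \<Rightarrow> bool" where
  "point_on_germ f C \<longleftrightarrow>
     (let Q = (\<lambda>(\<alpha>, d). f (int d) \<alpha> - mfps_const (base C d $ \<alpha>)) in
      \<forall>a \<alpha>. mfps_substitutable Q (pot C a \<alpha>) \<and>
        f (- int a - 1) \<alpha> = (- 1) ^ (a + 1) * mfps_subst Q (pot C a \<alpha>))"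

definition maps_into :: "(int \<Rightarrow> complex^'n^'n) \<Rightarrow> ('n::finite) germ \<Rightarrow> 'n germ \<Rightarrow> bool" where
  "maps_into L C C' \<longleftrightarrow>
     (\<forall>k \<alpha>. mfps_summable (laurent_term L (cone_point C) k \<alpha>)) \<and>
     point_on_germ (laurent_mult L (cone_point C)) C'"

definition maps_base :: "(int \<Rightarrow> complex^'n^'n) \<Rightarrow> ('n::finite) germ \<Rightarrow> 'n germ \<Rightarrow> bool" where
  "maps_base L C C' \<longleftrightarrow>
     (\<forall>d \<alpha>. mfps_coeff (laurent_mult L (cone_point C) (int d) \<alpha>) {#} = base C' d $ \<alpha>)"

definition laurent_const :: "complex^'n^'n \<Rightarrow> int \<Rightarrow> complex^'n^'n" where
  "laurent_const M k = (if k = 0 then M else 0)"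

definition laurent_plus :: "(nat \<Rightarrow> complex^'n^'n) \<Rightarrow> int \<Rightarrow> complex^'n^'n" where
  "laurent_plus R k = (if k \<ge> 0 then R (nat k) else 0)"

definition laurent_minus :: "(nat \<Rightarrow> complex^'n^'n) \<Rightarrow> int \<Rightarrow> complex^'n^'n" where
  "laurent_minus S k = (if k \<le> 0 then S (nat (- k)) else 0)"

text \<open>
  \<open>G_+\<close> and \<open>G_-\<close> have the same coefficient sequences; they differ in whether the \<open>i\<close>-th
  coefficient belongs to \<open>z^i\<close> (\<open>laurent_plus\<close>) or to \<open>z^{-i}\<close> (\<open>laurent_minus\<close>).
\<close>

definition G_plus :: "(nat \<Rightarrow> complex^('n::finite)^'n) set" where
  "G_plus = {R. R 0 = mat 1}"

definition G_minus :: "(nat \<Rightarrow> complex^('n::finite)^'n) set" where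
  "G_minus = {S. S 0 = mat 1}"

text \<open>
  The following relations express \<open>C' = M C\<close>, \<open>C' = S C\<close> and \<open>C' = R C\<close>; equality of germs is
  containment of the image of \<open>C\<close> in \<open>C'\<close> and of the inverse image of \<open>C'\<close> in \<open>C\<close>.  An element of
  \<open>G_+\<close> does not preserve the point \<open>-A z\<close>: the image of the ancestor cone \<open>C\<close> is re-expanded around
  the base point of \<open>C\<close> itself.
\<close>

definition GL_acts :: "complex^'n^'n \<Rightarrow> ('n::finite) germ \<Rightarrow> 'n germ \<Rightarrow> bool" where
  "GL_acts M C C' \<longleftrightarrow>
     maps_base (laurent_const M) C C' \<and>
     maps_into (laurent_const M) C C' \<and>
     maps_into (laurent_const (matrix_inv M)) C' C"

definition G_minus_acts :: "(nat \<Rightarrow> complex^'n^'n) \<Rightarrow> ('n::finite) germ \<Rightarrow> 'n germ \<Rightarrow> bool" where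
  "G_minus_acts S C C' \<longleftrightarrow>
     maps_base (laurent_minus S) C C' \<and>
     maps_into (laurent_minus S) C C' \<and>
     maps_into (laurent_minus (series_inv S)) C' C"

definition G_plus_acts :: "(nat \<Rightarrow> complex^'n^'n) \<Rightarrow> ('n::finite) germ \<Rightarrow> 'n germ \<Rightarrow> bool" where
  "G_plus_acts R C C' \<longleftrightarrow>
     ancestor_cone C \<and> ancestor_cone C' \<and> base C' = base C \<and>
     maps_into (laurent_plus R) C C' \<and>
     maps_into (laurent_plus (series_inv R)) C' C"

end

theory Submission
  imports Defs
begin

text \<open>
  The proof rests on the fundamental solution
  \<open>S(t, z) = Id + \<Sum>d\<ge>1. (-1)^d \<Omega>^{d-1}_0(t) z^{-d}\<close>, whose inverse has the coefficients
  \<open>\<Omega>^0_{d-1}\<close>.  The descendant hierarchy together with its initial condition is equivalent to the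
  Euler-Lagrange equation \<open>\<Sum>b. \<Omega>^0_{b-1}(w) q_b = 0\<close> (\<open>euler_solution_iff\<close>), that is, to the
  vanishing of the coefficient of \<open>z^0\<close> in \<open>S(w)^{-1} q\<close>.  Consequently the cone is swept out by
  linear spaces: its points are the series \<open>S(y) g\<close> with \<open>g\<close> divisible by \<open>z\<close>
  (\<open>cone_loop_point\<close>, \<open>loop_point_euler\<close>, \<open>loop_point_potential\<close>), and the Euler-Lagrange equation
  determines \<open>y\<close> uniquely, so that exhibiting any such presentation of a formal point near the base
  point proves that it lies on the cone (\<open>point_criterion\<close>).  All three group actions become statements about \<open>S\<close>.

  Changing the calibration multiplies \<open>S\<close> by a constant element of \<open>G_-\<close> (\<open>G_minus_maps\<close>), so the
  calibration may be normalised to be trivial at the origin, which gives an ancestor cone.  For a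
  constant algebra \<open>S\<close> is an exponential, and a linear isomorphism of algebras conjugates the
  exponentials (\<open>GL_maps\<close>).  Semisimplicity at the origin says that the algebra there is linearly
  isomorphic to the trivial one, which provides \<open>M\<close>.

  It remains to connect the ancestor cone of the flat F-manifold, with fundamental solution \<open>S_2\<close>,
  to the cone of the constant algebra given by its structure constants at the origin, with
  fundamental solution \<open>S_1\<close>.  A loop \<open>R\<close> maps the second cone into the first if
  \<open>R S_1(w) = S_2(y) G\<close> with \<open>G\<close> free of negative powers of \<open>z\<close>, because \<open>G\<close> preserves divisibility
  by \<open>z\<close> (\<open>G_plus_maps\<close>).  The idempotents of the algebra lift to idempotent power series \<open>P_k\<close> in
  \<open>z\<close> that are horizontal, \<open>z \<partial>P_k = [C, P_k]\<close> (\<open>horizontal_idempotent\<close>).  Their leading terms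
  diagonalise the multiplication, and the eigenvalues are closed 1-forms \<open>\<theta>_k\<close> with primitives, the
  canonical coordinates (\<open>semisimple_data\<close>).  With \<open>D_k\<close> the idempotents at the origin, the constant
  loop \<open>R = \<Sum>k. P_k(0) D_k\<close> conjugates \<open>D_k\<close> into \<open>P_k(0)\<close>.  Put \<open>G = S_2^{-1} R S_1(\<phi>)\<close>, where
  \<open>\<phi>\<close> is built from the canonical coordinates.  Then \<open>P_k G\<close> and \<open>G D_k\<close> solve the same linear
  system with the same initial value, so they agree, and therefore
  \<open>z \<partial>G = (C - \<Sum>k. \<theta>_k P_k) G\<close>.  The coefficient in brackets is divisible by \<open>z\<close>, since \<open>C\<close> is
  \<open>\<Sum>k. \<theta>_k P_k\<close> at \<open>z = 0\<close>, and so \<open>G\<close>, starting from the initial value \<open>R\<close>, never acquires negative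
  powers of \<open>z\<close> (\<open>factorisation\<close>).  The inverse of \<open>G\<close> has the same property, which gives the
  opposite inclusion.
\<close>

section \<open>Coefficients, derivations and infinite sums of formal power series\<close>

lemma mfps_coeff_basic [simp]:
  "mfps_coeff 0 m = 0"
  "mfps_coeff 1 m = (if m = {#} then 1 else 0)"
  "mfps_coeff (f + g) m = mfps_coeff f m + mfps_coeff g m"
  "mfps_coeff (f - g) m = mfps_coeff f m - mfps_coeff g m"
  "mfps_coeff (- f) m = - mfps_coeff f m"
  "mfps_coeff (mfps_const c) m = (if m = {#} then c else 0)"
  "mfps_coeff (mfps_var v) m = (if m = {#v#} then 1 else 0)"
  "mfps_coeff (mfps_deriv v f) m = of_nat (Suc (count m v)) * mfps_coeff f (add_mset v m)"
  by (simp_all add: zero_mfps_def one_mfps_def plus_mfps_def minus_mfps_def uminus_mfps_def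
      mfps_const_def mfps_var_def mfps_deriv_def)

lemma mfps_coeff_times:
  "mfps_coeff (f * g) m = (\<Sum>p\<in>msplits m. mfps_coeff f (fst p) * mfps_coeff g (snd p))"
  by (simp add: times_mfps_def case_prod_unfold)

lemma mfps_coeff_sum [simp]: "mfps_coeff (sum f A) m = (\<Sum>i\<in>A. mfps_coeff (f i) m)"
  by (induction A rule: infinite_finite_induct) auto

lemma msplits_empty [simp]: "msplits {#} = {({#}, {#})}"
  by (auto simp: msplits_def)

lemma mfps_coeff_times_empty [simp]:
  "mfps_coeff (f * g) {#} = mfps_coeff f {#} * mfps_coeff g {#}"
  by (simp add: mfps_coeff_times)

lemma mfps_coeff_const_times [simp]: "mfps_coeff (mfps_const c * f) m = c * mfps_coeff f m"
proof -
  have "mfps_coeff (mfps_const c * f) m =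
      (\<Sum>p\<in>msplits m. if p = ({#}, m) then c * mfps_coeff f m else 0)"
    unfolding mfps_coeff_times
    by (rule sum.cong) (auto simp: msplits_def)
  also have "\<dots> = c * mfps_coeff f m"
    by (subst sum.delta[OF finite_msplits]) (auto simp: msplits_def)
  finally show ?thesis .
qed

lemma mfps_const_simps:
  "mfps_const 0 = 0" "mfps_const 1 = 1"
  "mfps_const (a + b) = mfps_const a + mfps_const b"
  "mfps_const (a - b) = mfps_const a - mfps_const b"
  "mfps_const (- a) = - mfps_const a"
  "mfps_const (a * b) = mfps_const a * mfps_const b"
  by (auto intro!: mfps_eqI)

lemma mfps_const_sum: "mfps_const (sum f A) = (\<Sum>i\<in>A. mfps_const (f i))"
  by (auto intro!: mfps_eqI)

lemma mfps_deriv_simps [simp]: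
  "mfps_deriv v 0 = 0"
  "mfps_deriv v 1 = 0"
  "mfps_deriv v (mfps_const c) = 0"
  "mfps_deriv v (mfps_var u) = (if u = v then 1 else 0)"
  by (auto intro!: mfps_eqI)

lemma mfps_deriv_linear:
  "mfps_deriv v (f + g) = mfps_deriv v f + mfps_deriv v g"
  "mfps_deriv v (f - g) = mfps_deriv v f - mfps_deriv v g"
  "mfps_deriv v (- f) = - mfps_deriv v f"
  by (auto intro!: mfps_eqI simp: algebra_simps)

lemma mfps_deriv_sum: "mfps_deriv v (sum f A) = (\<Sum>i\<in>A. mfps_deriv v (f i))"
  by (auto intro!: mfps_eqI simp: sum_distrib_left)

text \<open>
  A splitting of \<open>add_mset v m\<close> whose left part contains \<open>v\<close> is a splitting of \<open>m\<close>; counting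
  multiplicities this way gives the product rule.
\<close>

lemma sum_msplits_add_mset:
  fixes F :: "'v multiset \<Rightarrow> 'v multiset \<Rightarrow> complex"
  shows "(\<Sum>p\<in>msplits (add_mset v m). of_nat (count (fst p) v) * F (fst p) (snd p)) =
    (\<Sum>p\<in>msplits m. of_nat (Suc (count (fst p) v)) * F (add_mset v (fst p)) (snd p))"
proof -
  let ?h = "\<lambda>p :: 'v multiset \<times> 'v multiset. (add_mset v (fst p), snd p)"
  have inj: "inj_on ?h (msplits m)" by (auto simp: inj_on_def)
  have "(\<Sum>p\<in>msplits m. of_nat (Suc (count (fst p) v)) * F (add_mset v (fst p)) (snd p)) =
      (\<Sum>p\<in>?h ` msplits m. of_nat (count (fst p) v) * F (fst p) (snd p))"
    by (subst sum.reindex[OF inj]) simp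
  also have "\<dots> = (\<Sum>p\<in>msplits (add_mset v m). of_nat (count (fst p) v) * F (fst p) (snd p))"
  proof (rule sum.mono_neutral_left)
    show "?h ` msplits m \<subseteq> msplits (add_mset v m)" by (auto simp: msplits_def)
    show "\<forall>p\<in>msplits (add_mset v m) - ?h ` msplits m.
        of_nat (count (fst p) v) * F (fst p) (snd p) = 0"
    proof
      fix p assume p: "p \<in> msplits (add_mset v m) - ?h ` msplits m"
      have "v \<notin># fst p"
      proof
        assume "v \<in># fst p"
        then obtain k where k: "fst p = add_mset v k" by (meson multi_member_split)
        with p have "(k, snd p) \<in> msplits m" by (auto simp: msplits_def)
        moreover have "p = ?h (k, snd p)" using k by (simp add: prod_eq_iff)
        ultimately show False using p by blast
      qed
      then show "of_nat (count (fst p) v) * F (fst p) (snd p) = 0"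
        by (simp add: not_in_iff)
    qed
  qed simp
  finally show ?thesis by simp
qed

lemma sum_msplits_swap:
  fixes F :: "'v multiset \<Rightarrow> 'v multiset \<Rightarrow> complex"
  shows "(\<Sum>p\<in>msplits m. F (fst p) (snd p)) = (\<Sum>p\<in>msplits m. F (snd p) (fst p))"
  by (rule sum.reindex_bij_witness[of _ "\<lambda>(k, l). (l, k)" "\<lambda>(k, l). (l, k)"])
    (auto simp: msplits_def add.commute)

lemma mfps_deriv_mult: "mfps_deriv v (f * g) = mfps_deriv v f * g + f * mfps_deriv v g"
proof (rule mfps_eqI)
  fix m
  have *: "of_nat (Suc (count m v)) = of_nat (count (fst p) v) + (of_nat (count (snd p) v) :: complex)"
    if "p \<in> msplits (add_mset v m)" for p
  proof -
    have "fst p + snd p = add_mset v m" using that by (auto simp: msplits_def)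
    then have "count (fst p) v + count (snd p) v = Suc (count m v)"
      by (metis count_add_mset count_union)
    then show ?thesis by (metis of_nat_add)
  qed
  have "mfps_coeff (mfps_deriv v (f * g)) m =
      (\<Sum>p\<in>msplits (add_mset v m). of_nat (Suc (count m v)) * (mfps_coeff f (fst p) * mfps_coeff g (snd p)))"
    by (simp add: mfps_coeff_times sum_distrib_left del: of_nat_Suc)
  also have "\<dots> = (\<Sum>p\<in>msplits (add_mset v m). of_nat (count (fst p) v) * (mfps_coeff f (fst p) * mfps_coeff g (snd p)))
     + (\<Sum>p\<in>msplits (add_mset v m). of_nat (count (snd p) v) * (mfps_coeff f (fst p) * mfps_coeff g (snd p)))"
    unfolding sum.distrib[symmetric]
    by (rule sum.cong[OF refl]) (simp only: * ring_distribs)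
  also have "(\<Sum>p\<in>msplits (add_mset v m). of_nat (count (snd p) v) * (mfps_coeff f (fst p) * mfps_coeff g (snd p)))
     = (\<Sum>p\<in>msplits (add_mset v m). of_nat (count (fst p) v) * (mfps_coeff f (snd p) * mfps_coeff g (fst p)))"
    by (rule sum_msplits_swap)
  also have "\<dots> = (\<Sum>p\<in>msplits m. of_nat (Suc (count (fst p) v)) * (mfps_coeff f (snd p) * mfps_coeff g (add_mset v (fst p))))"
    by (rule sum_msplits_add_mset)
  also have "\<dots> = (\<Sum>p\<in>msplits m. of_nat (Suc (count (snd p) v)) * (mfps_coeff f (fst p) * mfps_coeff g (add_mset v (snd p))))"
    by (rule sum_msplits_swap)
  also have "(\<Sum>p\<in>msplits (add_mset v m). of_nat (count (fst p) v) * (mfps_coeff f (fst p) * mfps_coeff g (snd p)))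
     = (\<Sum>p\<in>msplits m. of_nat (Suc (count (fst p) v)) * (mfps_coeff f (add_mset v (fst p)) * mfps_coeff g (snd p)))"
    by (rule sum_msplits_add_mset)
  finally show "mfps_coeff (mfps_deriv v (f * g)) m = mfps_coeff (mfps_deriv v f * g + f * mfps_deriv v g) m"
    unfolding mfps_coeff_basic(3) mfps_coeff_times[of "mfps_deriv v f"] mfps_coeff_times[of f "mfps_deriv v g"]
    by (simp add: mult_ac del: of_nat_Suc)
qed

lemma mfps_deriv_const_mult [simp]: "mfps_deriv v (mfps_const c * f) = mfps_const c * mfps_deriv v f"
  by (simp add: mfps_deriv_mult)

lemma mfps_deriv_commute: "mfps_deriv u (mfps_deriv v f) = mfps_deriv v (mfps_deriv u f)"
  by (rule mfps_eqI) (auto simp: add_mset_commute algebra_simps)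

lemma mfps_eq_by_deriv:
  assumes "mfps_coeff f {#} = mfps_coeff g {#}" and "\<And>v. mfps_deriv v f = mfps_deriv v g"
  shows "f = g"
proof (rule mfps_eqI)
  fix m
  show "mfps_coeff f m = mfps_coeff g m"
  proof (cases m)
    case empty
    then show ?thesis using assms(1) by simp
  next
    case (add v n)
    have "mfps_coeff (mfps_deriv v f) n = mfps_coeff (mfps_deriv v g) n" by (simp only: assms(2))
    moreover have "(of_nat (Suc (count n v)) :: complex) \<noteq> 0" by (simp del: of_nat_Suc)
    ultimately show ?thesis by (simp add: add del: of_nat_Suc)
  qed
qed

text \<open>
  Convergence of all infinite sums is controlled by the weights of the monomials that occur.  Two
  weights are used: the number of variables, which gives the order of vanishing, and a grading of the
  jet variables that takes both signs.
\<close>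

definition additive_weight :: "('v multiset \<Rightarrow> int) \<Rightarrow> bool" where
  "additive_weight W \<longleftrightarrow> W {#} = 0 \<and> (\<forall>a b. W (a + b) = W a + W b)"

definition vge :: "('v multiset \<Rightarrow> int) \<Rightarrow> int \<Rightarrow> 'v mfps \<Rightarrow> bool" where
  "vge W j f \<longleftrightarrow> (\<forall>m. mfps_coeff f m \<noteq> 0 \<longrightarrow> j \<le> W m)"

abbreviation ord_ge :: "nat \<Rightarrow> 'v mfps \<Rightarrow> bool" where
  "ord_ge d \<equiv> vge (\<lambda>m. int (size m)) (int d)"

lemma additive_weight_size: "additive_weight (\<lambda>m. int (size m))"
  by (simp add: additive_weight_def)

lemma ord_ge_def': "ord_ge d f \<longleftrightarrow> (\<forall>m. size m < d \<longrightarrow> mfps_coeff f m = 0)"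
  unfolding vge_def by (metis linorder_not_le of_nat_le_iff)

lemma ord_geD: "ord_ge d f \<Longrightarrow> size m < d \<Longrightarrow> mfps_coeff f m = 0"
  by (simp add: ord_ge_def')

lemma ord_ge_0 [simp]: "ord_ge 0 f" by (simp add: vge_def)

lemma vge_mono: "vge W j f \<Longrightarrow> i \<le> j \<Longrightarrow> vge W i f"
  unfolding vge_def by force

lemma ord_ge_mono: "ord_ge j f \<Longrightarrow> i \<le> j \<Longrightarrow> ord_ge i f"
  by (erule vge_mono) simp

lemma ord_ge_1: "ord_ge 1 f \<longleftrightarrow> mfps_coeff f {#} = 0"
  unfolding ord_ge_def' by (metis less_one size_empty size_eq_0_iff_empty)

lemma vge_0 [simp]: "vge W j 0" by (simp add: vge_def)

lemma vge_add: "vge W j f \<Longrightarrow> vge W j g \<Longrightarrow> vge W j (f + g)"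
  unfolding vge_def by (metis add.right_neutral add_cancel_left_left mfps_coeff_basic(3))

lemma vge_uminus: "vge W j f \<Longrightarrow> vge W j (- f)"
  unfolding vge_def by simp

lemma vge_diff: "vge W j f \<Longrightarrow> vge W j g \<Longrightarrow> vge W j (f - g)"
  using vge_add[of W j f "- g"] vge_uminus by (metis diff_conv_add_uminus)

lemma vge_sum: "(\<And>i. i \<in> A \<Longrightarrow> vge W j (f i)) \<Longrightarrow> vge W j (sum f A)"
  by (induction A rule: infinite_finite_induct) (auto intro: vge_add)

lemma vge_times:
  assumes W: "additive_weight W" and "vge W i f" "vge W j g"
  shows "vge W (i + j) (f * g)"
  unfolding vge_def
proof (intro allI impI)
  fix m assume "mfps_coeff (f * g) m \<noteq> 0"
  then obtain p where p: "p \<in> msplits m" "mfps_coeff f (fst p) * mfps_coeff g (snd p) \<noteq> 0"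
    unfolding mfps_coeff_times by (meson sum.neutral)
  then have "i \<le> W (fst p)" "j \<le> W (snd p)" "W m = W (fst p) + W (snd p)"
    using assms by (auto simp: vge_def additive_weight_def msplits_def)
  then show "i + j \<le> W m" by simp
qed

lemma ord_ge_times: "ord_ge i f \<Longrightarrow> ord_ge j g \<Longrightarrow> ord_ge (i + j) (f * g)"
  using vge_times[OF additive_weight_size, of "int i" f "int j" g] by simp

lemma vge_const_times: "vge W j f \<Longrightarrow> vge W j (mfps_const c * f)"
  by (simp add: vge_def)

lemma vge_1: "additive_weight W \<Longrightarrow> vge W 0 1"
  by (simp add: vge_def additive_weight_def)

text \<open>
  In characteristic zero a series is recovered from its constant term and its derivatives, and
  differentiation lowers the order by exactly one.  This turns differential equations into
  inductions on the order.
\<close>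

lemma ord_ge_deriv:
  assumes "mfps_coeff f {#} = 0" and "\<And>v. ord_ge d (mfps_deriv v f)"
  shows "ord_ge (Suc d) f"
  unfolding ord_ge_def'
proof (intro allI impI)
  fix m :: "'a multiset" assume m: "size m < Suc d"
  show "mfps_coeff f m = 0"
  proof (cases m)
    case (add v n)
    then have "mfps_coeff (mfps_deriv v f) n = 0"
      using assms(2)[of v] m by (intro ord_geD) auto
    moreover have "(of_nat (Suc (count n v)) :: complex) \<noteq> 0" by (simp del: of_nat_Suc)
    ultimately show ?thesis by (simp add: add del: of_nat_Suc)
  qed (use assms(1) in simp)
qed

text \<open>
  Truncations (to bounded degree, or to the small phase space) are compared by agreement on a set of
  monomials closed under divisors, which is compatible with products and substitutions.
\<close>

definition divisor_closed :: "'v multiset set \<Rightarrow> bool" where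
  "divisor_closed D \<longleftrightarrow> (\<forall>m\<in>D. \<forall>k. k \<subseteq># m \<longrightarrow> k \<in> D)"

definition agree :: "'v multiset set \<Rightarrow> 'v mfps \<Rightarrow> 'v mfps \<Rightarrow> bool" where
  "agree D f g \<longleftrightarrow> (\<forall>m\<in>D. mfps_coeff f m = mfps_coeff g m)"

lemma agree_refl [simp]: "agree D f f" by (simp add: agree_def)

lemma agree_times:
  assumes "divisor_closed D" "agree D f f'" "agree D g g'"
  shows "agree D (f * g) (f' * g')"
  unfolding agree_def mfps_coeff_times
proof (intro ballI sum.cong[OF refl])
  fix m p assume "m \<in> D" "p \<in> msplits m"
  then have "fst p \<in> D" "snd p \<in> D"
    using assms(1) by (auto simp: divisor_closed_def msplits_def)
  then show "mfps_coeff f (fst p) * mfps_coeff g (snd p) = mfps_coeff f' (fst p) * mfps_coeff g' (snd p)"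
    using assms by (simp add: agree_def)
qed

lemma divisor_closed_size: "divisor_closed {m. size m < d}"
  unfolding divisor_closed_def using size_mset_mono by fastforce

lemma mfps_summable_divisors:
  assumes "mfps_summable f"
  shows "finite {i. \<exists>k. k \<subseteq># m \<and> mfps_coeff (f i) k \<noteq> 0}"
proof -
  have "{i. \<exists>k. k \<subseteq># m \<and> mfps_coeff (f i) k \<noteq> 0} = (\<Union>k\<in>{k. k \<subseteq># m}. {i. mfps_coeff (f i) k \<noteq> 0})"
    by auto
  then show ?thesis
    using assms by (simp only: mfps_summable_def finite_UN_I[OF finite_submultisets])
qed

lemma mfps_coeff_Sum: "mfps_coeff (mfps_Sum f) m = (\<Sum>i | mfps_coeff (f i) m \<noteq> 0. mfps_coeff (f i) m)"
  by (simp add: mfps_Sum_def)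

text \<open>
  Any finite set containing the contributing indices may be used, so that sums with different
  supports can be compared term by term.
\<close>

lemma mfps_coeff_Sum_superset:
  assumes "finite I" and "\<And>i. mfps_coeff (f i) m \<noteq> 0 \<Longrightarrow> i \<in> I"
  shows "mfps_coeff (mfps_Sum f) m = (\<Sum>i\<in>I. mfps_coeff (f i) m)"
  unfolding mfps_coeff_Sum by (rule sum.mono_neutral_left) (use assms in auto)

lemma mfps_Sum_cong: "(\<And>i. f i = g i) \<Longrightarrow> mfps_Sum f = mfps_Sum g"
  by presburger

lemma mfps_summable_0 [simp]: "mfps_summable (\<lambda>i. 0)" by (simp add: mfps_summable_def)

lemma mfps_Sum_0 [simp]: "mfps_Sum (\<lambda>i. 0) = 0"
  by (rule mfps_eqI) (simp add: mfps_coeff_Sum)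

lemma mfps_summable_finite: "finite (UNIV :: 'i set) \<Longrightarrow> mfps_summable (f :: 'i \<Rightarrow> _)"
  unfolding mfps_summable_def by (auto intro: finite_subset[OF subset_UNIV])

lemma mfps_summable_add:
  assumes "mfps_summable f" "mfps_summable g"
  shows "mfps_summable (\<lambda>i. f i + g i)"
  unfolding mfps_summable_def
proof
  fix m
  have "{i. mfps_coeff (f i + g i) m \<noteq> 0} \<subseteq> {i. mfps_coeff (f i) m \<noteq> 0} \<union> {i. mfps_coeff (g i) m \<noteq> 0}"
    by auto
  moreover have "finite ({i. mfps_coeff (f i) m \<noteq> 0} \<union> {i. mfps_coeff (g i) m \<noteq> 0})"
    using assms by (intro finite_UnI) (simp_all only: mfps_summable_def)
  ultimately show "finite {i. mfps_coeff (f i + g i) m \<noteq> 0}" by (rule finite_subset)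
qed

lemma mfps_Sum_add:
  assumes "mfps_summable f" "mfps_summable g"
  shows "mfps_Sum (\<lambda>i. f i + g i) = mfps_Sum f + mfps_Sum g"
proof (rule mfps_eqI)
  fix m
  let ?I = "{i. mfps_coeff (f i) m \<noteq> 0} \<union> {i. mfps_coeff (g i) m \<noteq> 0}"
  have fin: "finite ?I" using assms by (intro finite_UnI) (simp_all only: mfps_summable_def)
  have "mfps_coeff (mfps_Sum (\<lambda>i. f i + g i)) m = (\<Sum>i\<in>?I. mfps_coeff (f i + g i) m)"
    by (rule mfps_coeff_Sum_superset[OF fin]) auto
  moreover have "mfps_coeff (mfps_Sum f) m = (\<Sum>i\<in>?I. mfps_coeff (f i) m)"
    by (rule mfps_coeff_Sum_superset[OF fin]) auto
  moreover have "mfps_coeff (mfps_Sum g) m = (\<Sum>i\<in>?I. mfps_coeff (g i) m)"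
    by (rule mfps_coeff_Sum_superset[OF fin]) auto
  ultimately show "mfps_coeff (mfps_Sum (\<lambda>i. f i + g i)) m = mfps_coeff (mfps_Sum f + mfps_Sum g) m"
    by (simp add: sum.distrib)
qed

lemma mfps_summable_sum:
  assumes "\<And>x. x \<in> A \<Longrightarrow> mfps_summable (f x)"
  shows "mfps_summable (\<lambda>i. \<Sum>x\<in>A. f x i)"
  using assms by (induction A rule: infinite_finite_induct) (auto intro: mfps_summable_add)

lemma mfps_Sum_sum:
  assumes "\<And>x. x \<in> A \<Longrightarrow> mfps_summable (f x)"
  shows "mfps_Sum (\<lambda>i. \<Sum>x\<in>A. f x i) = (\<Sum>x\<in>A. mfps_Sum (f x))"
  using assms
  by (induction A rule: infinite_finite_induct) (auto simp: mfps_Sum_add mfps_summable_sum)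

text \<open>
  The factors \<open>c i\<close> are arbitrary: a monomial has finitely many divisors, so it only sees the
  finitely many terms \<open>f i\<close> that contain one of them.
\<close>

lemma mfps_summable_mult_gen:
  assumes "mfps_summable f"
  shows "mfps_summable (\<lambda>i. c i * f i)"
  unfolding mfps_summable_def
proof
  fix m
  have "{i. mfps_coeff (c i * f i) m \<noteq> 0} \<subseteq> {i. \<exists>k. k \<subseteq># m \<and> mfps_coeff (f i) k \<noteq> 0}"
  proof
    fix i assume "i \<in> {i. mfps_coeff (c i * f i) m \<noteq> 0}"
    then have "mfps_coeff (c i * f i) m \<noteq> 0" by simp
    then obtain p where p: "p \<in> msplits m" "mfps_coeff (c i) (fst p) * mfps_coeff (f i) (snd p) \<noteq> 0"
      unfolding mfps_coeff_times by (meson sum.neutral)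
    then have "snd p \<subseteq># m" by (auto simp: msplits_def)
    then show "i \<in> {i. \<exists>k. k \<subseteq># m \<and> mfps_coeff (f i) k \<noteq> 0}" using p by auto
  qed
  then show "finite {i. mfps_coeff (c i * f i) m \<noteq> 0}"
    using mfps_summable_divisors[OF assms] finite_subset by blast
qed

lemma mfps_Sum_mult_left:
  assumes "mfps_summable f"
  shows "mfps_Sum (\<lambda>i. c * f i) = c * mfps_Sum f"
proof (rule mfps_eqI)
  fix m
  let ?I = "{i. \<exists>k. k \<subseteq># m \<and> mfps_coeff (f i) k \<noteq> 0}"
  have fin: "finite ?I" by (rule mfps_summable_divisors[OF assms])
  have sub: "snd p \<subseteq># m" if "p \<in> msplits m" for p using that by (auto simp: msplits_def)
  have in1: "i \<in> ?I" if "mfps_coeff (c * f i) m \<noteq> 0" for i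
  proof -
    from that obtain p where p: "p \<in> msplits m" "mfps_coeff c (fst p) * mfps_coeff (f i) (snd p) \<noteq> 0"
      unfolding mfps_coeff_times by (meson sum.neutral)
    then show ?thesis using sub[OF p(1)] by auto
  qed
  have "mfps_coeff (mfps_Sum (\<lambda>i. c * f i)) m = (\<Sum>i\<in>?I. mfps_coeff (c * f i) m)"
    by (rule mfps_coeff_Sum_superset[OF fin in1])
  also have "\<dots> = (\<Sum>p\<in>msplits m. mfps_coeff c (fst p) * (\<Sum>i\<in>?I. mfps_coeff (f i) (snd p)))"
    unfolding mfps_coeff_times sum_distrib_left by (rule sum.swap)
  also have "\<dots> = (\<Sum>p\<in>msplits m. mfps_coeff c (fst p) * mfps_coeff (mfps_Sum f) (snd p))"
  proof (rule sum.cong[OF refl])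
    fix p assume p: "p \<in> msplits m"
    have "mfps_coeff (mfps_Sum f) (snd p) = (\<Sum>i\<in>?I. mfps_coeff (f i) (snd p))"
      by (rule mfps_coeff_Sum_superset[OF fin]) (use sub[OF p] in auto)
    then show "mfps_coeff c (fst p) * (\<Sum>i\<in>?I. mfps_coeff (f i) (snd p)) =
        mfps_coeff c (fst p) * mfps_coeff (mfps_Sum f) (snd p)" by simp
  qed
  also have "\<dots> = mfps_coeff (c * mfps_Sum f) m" by (simp add: mfps_coeff_times)
  finally show "mfps_coeff (mfps_Sum (\<lambda>i. c * f i)) m = mfps_coeff (c * mfps_Sum f) m" .
qed

lemma mfps_Sum_mult_right:
  assumes "mfps_summable f"
  shows "mfps_Sum (\<lambda>i. f i * c) = mfps_Sum f * c"
  using mfps_Sum_mult_left[OF assms, of c] by (simp add: mult.commute)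

lemma mfps_summable_mult_gen':
  "mfps_summable f \<Longrightarrow> mfps_summable (\<lambda>i. f i * c i)"
  using mfps_summable_mult_gen[of f c] by (simp add: mult.commute)

lemma mfps_deriv_Sum:
  assumes "mfps_summable f"
  shows "mfps_deriv v (mfps_Sum f) = mfps_Sum (\<lambda>i. mfps_deriv v (f i))"
proof (rule mfps_eqI)
  fix m
  let ?I = "{i. mfps_coeff (f i) (add_mset v m) \<noteq> 0}"
  have fin: "finite ?I" using assms by (simp add: mfps_summable_def)
  have "mfps_coeff (mfps_Sum (\<lambda>i. mfps_deriv v (f i))) m = (\<Sum>i\<in>?I. mfps_coeff (mfps_deriv v (f i)) m)"
    by (rule mfps_coeff_Sum_superset[OF fin]) auto
  then show "mfps_coeff (mfps_deriv v (mfps_Sum f)) m = mfps_coeff (mfps_Sum (\<lambda>i. mfps_deriv v (f i))) m"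
    by (simp add: mfps_coeff_Sum sum_distrib_left del: of_nat_Suc)
qed

lemma mfps_summable_inj:
  assumes "mfps_summable f" "inj h"
  shows "mfps_summable (\<lambda>i. f (h i))"
  unfolding mfps_summable_def
proof
  fix m
  have "finite (h -` {i. mfps_coeff (f i) m \<noteq> 0})"
    using assms by (intro finite_vimageI) (simp_all only: mfps_summable_def)
  then show "finite {i. mfps_coeff (f (h i)) m \<noteq> 0}" by (simp add: vimage_def)
qed

lemma mfps_Sum_reindex:
  assumes "inj h" and "\<And>i. i \<notin> range h \<Longrightarrow> f i = 0"
  shows "mfps_Sum (\<lambda>i. f (h i)) = mfps_Sum f"
proof (rule mfps_eqI)
  fix m
  have "{i. mfps_coeff (f i) m \<noteq> 0} = h ` {i. mfps_coeff (f (h i)) m \<noteq> 0}"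
    using assms(2) by force
  then show "mfps_coeff (mfps_Sum (\<lambda>i. f (h i))) m = mfps_coeff (mfps_Sum f) m"
    unfolding mfps_coeff_Sum
    by (simp add: sum.reindex[OF inj_on_subset[OF assms(1) subset_UNIV]])
qed

lemma mfps_summable_reindex:
  assumes "inj h" and "\<And>i. i \<notin> range h \<Longrightarrow> f i = 0" and "mfps_summable (\<lambda>i. f (h i))"
  shows "mfps_summable f"
  unfolding mfps_summable_def
proof
  fix m
  have "{i. mfps_coeff (f i) m \<noteq> 0} = h ` {i. mfps_coeff (f (h i)) m \<noteq> 0}"
    using assms(2) by force
  then show "finite {i. mfps_coeff (f i) m \<noteq> 0}"
    using assms(3) by (simp add: mfps_summable_def)
qed

lemma mfps_Sum_eq_sum:
  assumes "finite A" and "\<And>i. i \<notin> A \<Longrightarrow> f i = 0"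
  shows "mfps_Sum f = (\<Sum>i\<in>A. f i)"
  by (rule mfps_eqI, subst mfps_coeff_Sum_superset[OF assms(1)]) (use assms(2) in force)+

lemma mfps_summable_finite_support:
  assumes "finite A" and "\<And>i. i \<notin> A \<Longrightarrow> f i = 0"
  shows "mfps_summable f"
  unfolding mfps_summable_def
proof
  fix m
  have "{i. mfps_coeff (f i) m \<noteq> 0} \<subseteq> A" using assms(2) by force
  then show "finite {i. mfps_coeff (f i) m \<noteq> 0}" using assms(1) finite_subset by blast
qed

lemma mfps_summable_Sigma:
  assumes "mfps_summable (\<lambda>(i, j). f i j)"
  shows "mfps_summable (f i)" "mfps_summable (\<lambda>i. mfps_Sum (f i))"
proof -
  have fin: "finite {(i, j). mfps_coeff (f i j) m \<noteq> 0}" for m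
    using assms by (simp add: mfps_summable_def case_prod_unfold)
  show "mfps_summable (f i)"
    unfolding mfps_summable_def
  proof
    fix m
    have "{j. mfps_coeff (f i j) m \<noteq> 0} \<subseteq> snd ` {(i, j). mfps_coeff (f i j) m \<noteq> 0}" by force
    then show "finite {j. mfps_coeff (f i j) m \<noteq> 0}" using fin finite_subset by blast
  qed
  show "mfps_summable (\<lambda>i. mfps_Sum (f i))"
    unfolding mfps_summable_def
  proof
    fix m
    have "{i. mfps_coeff (mfps_Sum (f i)) m \<noteq> 0} \<subseteq> fst ` {(i, j). mfps_coeff (f i j) m \<noteq> 0}"
    proof
      fix i assume "i \<in> {i. mfps_coeff (mfps_Sum (f i)) m \<noteq> 0}"
      then have "(\<Sum>j | mfps_coeff (f i j) m \<noteq> 0. mfps_coeff (f i j) m) \<noteq> 0" by (simp add: mfps_coeff_Sum)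
      then obtain j where "mfps_coeff (f i j) m \<noteq> 0" by (metis (mono_tags, lifting) mem_Collect_eq sum.neutral)
      then show "i \<in> fst ` {(i, j). mfps_coeff (f i j) m \<noteq> 0}" by force
    qed
    then show "finite {i. mfps_coeff (mfps_Sum (f i)) m \<noteq> 0}" using fin finite_subset by blast
  qed
qed

lemma mfps_Sum_Sigma:
  assumes "mfps_summable (\<lambda>(i, j). f i j)"
  shows "mfps_Sum (\<lambda>i. mfps_Sum (f i)) = mfps_Sum (\<lambda>(i, j). f i j)"
proof (rule mfps_eqI)
  fix m
  let ?A = "{(i, j). mfps_coeff (f i j) m \<noteq> 0}"
  have fin: "finite ?A"
    using assms by (simp add: mfps_summable_def case_prod_unfold)
  have 1: "mfps_coeff (mfps_Sum (f i)) m = (\<Sum>j\<in>snd ` ?A. mfps_coeff (f i j) m)" for i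
    by (rule mfps_coeff_Sum_superset) (use fin in force)+
  have "mfps_coeff (mfps_Sum (\<lambda>i. mfps_Sum (f i))) m = (\<Sum>i\<in>fst ` ?A. mfps_coeff (mfps_Sum (f i)) m)"
  proof (rule mfps_coeff_Sum_superset)
    fix i assume "mfps_coeff (mfps_Sum (f i)) m \<noteq> 0"
    then obtain j where "mfps_coeff (f i j) m \<noteq> 0" unfolding 1 by (meson sum.neutral)
    then show "i \<in> fst ` ?A" by force
  qed (use fin in simp)
  also have "\<dots> = (\<Sum>i\<in>fst ` ?A. \<Sum>j\<in>snd ` ?A. mfps_coeff (f i j) m)" by (simp add: 1)
  also have "\<dots> = (\<Sum>p\<in>fst ` ?A \<times> snd ` ?A. mfps_coeff (f (fst p) (snd p)) m)"
    by (simp add: sum.cartesian_product case_prod_unfold)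
  also have "\<dots> = mfps_coeff (mfps_Sum (\<lambda>(i, j). f i j)) m"
    unfolding case_prod_unfold
    by (rule mfps_coeff_Sum_superset[symmetric]) (use fin in \<open>auto simp: case_prod_unfold mem_Times_iff\<close>)
  finally show "mfps_coeff (mfps_Sum (\<lambda>i. mfps_Sum (f i))) m = mfps_coeff (mfps_Sum (\<lambda>(i, j). f i j)) m" .
qed

lemma mfps_Sum_swap:
  assumes "mfps_summable (\<lambda>(i, j). f i j)"
  shows "mfps_Sum (\<lambda>i. mfps_Sum (f i)) = mfps_Sum (\<lambda>j. mfps_Sum (\<lambda>i. f i j))"
proof -
  have s: "mfps_summable (\<lambda>(j, i). f i j)"
    using mfps_summable_inj[OF assms, of "\<lambda>(j, i). (i, j)"] by (simp add: case_prod_unfold inj_def)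
  have r: "range prod.swap = (UNIV :: ('a \<times> 'b) set)" by (rule surj_swap)
  have "mfps_Sum (\<lambda>p. (\<lambda>(i, j). f i j) (prod.swap p)) = mfps_Sum (\<lambda>(i, j). f i j)"
    by (rule mfps_Sum_reindex) (simp_all add: r)
  then have "mfps_Sum (\<lambda>(j, i). f i j) = mfps_Sum (\<lambda>(i, j). f i j)"
    by (simp add: case_prod_unfold)
  then show ?thesis using mfps_Sum_Sigma[OF assms] mfps_Sum_Sigma[OF s] by simp
qed

lemma vge_Sum:
  assumes "\<And>i. vge W j (f i)"
  shows "vge W j (mfps_Sum f)"
  unfolding vge_def
proof (intro allI impI)
  fix m assume "mfps_coeff (mfps_Sum f) m \<noteq> 0"
  then obtain i where "mfps_coeff (f i) m \<noteq> 0"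
    unfolding mfps_coeff_Sum by (metis (mono_tags, lifting) mem_Collect_eq sum.neutral)
  then show "j \<le> W m" using assms by (auto simp: vge_def)
qed

lemma agree_Sum:
  assumes "\<And>i. agree D (f i) (g i)"
  shows "agree D (mfps_Sum f) (mfps_Sum g)"
  using assms by (simp add: agree_def mfps_coeff_Sum)

section \<open>Substitution\<close>

definition gpow :: "('v \<Rightarrow> 'w mfps) \<Rightarrow> 'v multiset \<Rightarrow> 'w mfps" where
  "gpow g n = (\<Prod>v\<in>#n. g v)"

lemma gpow_simps [simp]:
  "gpow g {#} = 1" "gpow g (add_mset v n) = g v * gpow g n" "gpow g (a + b) = gpow g a * gpow g b"
  by (simp_all add: gpow_def)

lemma mfps_subst_eq: "mfps_subst g f = mfps_Sum (\<lambda>n. mfps_const (mfps_coeff f n) * gpow g n)"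
  by (simp add: mfps_subst_def mfps_subst_term_def[abs_def] gpow_def)

lemma mfps_substitutable_iff:
  "mfps_substitutable g f \<longleftrightarrow> mfps_summable (\<lambda>n. mfps_const (mfps_coeff f n) * gpow g n)"
  by (simp add: mfps_substitutable_def mfps_subst_term_def[abs_def] gpow_def)

text \<open>
  Admissibility of a substitution for all series supported in a set \<open>T\<close> of monomials: a coefficient
  of the result receives contributions from finitely many monomials of \<open>T\<close> only.
  For \<open>T = UNIV\<close> this is the usual situation of series without constant term; for the action of
  \<open>G_+\<close> infinitely many of the substituted series do have a constant term, and \<open>T\<close> is cut out by
  the degree condition on ancestor potentials.
\<close>

definition subst_adm :: "('v \<Rightarrow> 'w mfps) \<Rightarrow> 'v multiset set \<Rightarrow> bool" where
  "subst_adm g T \<longleftrightarrow> (\<forall>m. finite {n \<in> T. mfps_coeff (gpow g n) m \<noteq> 0})"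

definition supp_in :: "'v multiset set \<Rightarrow> 'v mfps \<Rightarrow> bool" where
  "supp_in T f \<longleftrightarrow> (\<forall>n. mfps_coeff f n \<noteq> 0 \<longrightarrow> n \<in> T)"

definition submonoid :: "'v multiset set \<Rightarrow> bool" where
  "submonoid T \<longleftrightarrow> {#} \<in> T \<and> (\<forall>a\<in>T. \<forall>b\<in>T. a + b \<in> T)"

lemma submonoid_UNIV [simp]: "submonoid UNIV" by (simp add: submonoid_def)
lemma supp_in_UNIV [simp]: "supp_in UNIV f" by (simp add: supp_in_def)

lemma mfps_coeff_times_nonzero:
  assumes "mfps_coeff (f * g) m \<noteq> 0"
  obtains k l where "k + l = m" "mfps_coeff f k \<noteq> 0" "mfps_coeff g l \<noteq> 0"
proof -
  from assms obtain p where "p \<in> msplits m" "mfps_coeff f (fst p) * mfps_coeff g (snd p) \<noteq> 0"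
    unfolding mfps_coeff_times by (meson sum.neutral)
  then show ?thesis using that[of "fst p" "snd p"] by (auto simp: msplits_def)
qed

lemma supp_in_times: "submonoid T \<Longrightarrow> supp_in T f \<Longrightarrow> supp_in T g \<Longrightarrow> supp_in T (f * g)"
  unfolding supp_in_def submonoid_def by (metis mfps_coeff_times_nonzero)

lemma supp_in_const: "submonoid T \<Longrightarrow> supp_in T (mfps_const c)"
  unfolding supp_in_def submonoid_def by simp

lemma supp_in_gpow: "submonoid T \<Longrightarrow> (\<And>v. supp_in T (g v)) \<Longrightarrow> supp_in T (gpow g n)"
proof (induction n)
  case empty
  then show ?case using supp_in_const[of T 1] by (simp add: mfps_const_simps)
qed (simp add: supp_in_times)

lemma supp_in_vge: "vge W j f \<Longrightarrow> 0 \<le> j \<Longrightarrow> supp_in {n. 0 \<le> W n} f"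
  unfolding vge_def supp_in_def by fastforce

lemma submonoid_weight: "additive_weight W \<Longrightarrow> submonoid {n. 0 \<le> W n}"
  by (simp add: additive_weight_def submonoid_def)

text \<open>
  Without constant terms every factor contributes at least one variable to the monomial, and
  that variable must occur in one of the finitely many divisors.
\<close>

lemma gpow_bound:
  assumes zero: "\<And>v. mfps_coeff (g v) {#} = 0"
  shows "mfps_coeff (gpow g n) m \<noteq> 0 \<Longrightarrow>
    size n \<le> size m \<and> set_mset n \<subseteq> {v. \<exists>k. k \<subseteq># m \<and> mfps_coeff (g v) k \<noteq> 0}"
proof (induction n arbitrary: m)
  case (add v n)
  from add.prems have "mfps_coeff (g v * gpow g n) m \<noteq> 0" by simp
  then obtain k l where kl: "k + l = m" "mfps_coeff (g v) k \<noteq> 0" "mfps_coeff (gpow g n) l \<noteq> 0"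
    by (rule mfps_coeff_times_nonzero)
  have "k \<noteq> {#}" using zero kl(2) by auto
  then have "size k \<ge> 1" by (simp add: Suc_leI nonempty_has_size)
  moreover have "k \<subseteq># m" "l \<subseteq># m" using kl(1) by auto
  ultimately show ?case using add.IH[OF kl(3)] kl by (auto intro: subset_mset.order_trans)
qed simp

lemma finite_bounded_multisets: "finite V \<Longrightarrow> finite {n. set_mset n \<subseteq> V \<and> size n \<le> N}"
proof (rule finite_subset)
  show "{n. set_mset n \<subseteq> V \<and> size n \<le> N} \<subseteq> mset ` {xs. set xs \<subseteq> V \<and> length xs \<le> N}"
  proof
    fix n assume n: "n \<in> {n. set_mset n \<subseteq> V \<and> size n \<le> N}"
    obtain xs where "mset xs = n" using ex_mset by blast
    with n show "n \<in> mset ` {xs. set xs \<subseteq> V \<and> length xs \<le> N}" by force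
  qed
qed (simp add: finite_lists_length_le)

lemma subst_adm_UNIV:
  assumes zero: "\<And>v. mfps_coeff (g v) {#} = 0" and "mfps_summable g"
  shows "subst_adm g UNIV"
  unfolding subst_adm_def
proof
  fix m
  let ?V = "{v. \<exists>k. k \<subseteq># m \<and> mfps_coeff (g v) k \<noteq> 0}"
  have "{n \<in> UNIV. mfps_coeff (gpow g n) m \<noteq> 0} \<subseteq> {n. set_mset n \<subseteq> ?V \<and> size n \<le> size m}"
    using gpow_bound[of g, OF zero] by blast
  moreover have "finite {n. set_mset n \<subseteq> ?V \<and> size n \<le> size m}"
    by (intro finite_bounded_multisets mfps_summable_divisors[OF assms(2)])
  ultimately show "finite {n \<in> UNIV. mfps_coeff (gpow g n) m \<noteq> 0}"
    by (rule finite_subset)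
qed

lemma subst_adm_finite:
  fixes g :: "'v :: finite \<Rightarrow> 'w mfps"
  assumes "\<And>v. mfps_coeff (g v) {#} = 0"
  shows "subst_adm g UNIV"
  by (rule subst_adm_UNIV[OF assms mfps_summable_finite]) simp_all

lemma substitutable_adm:
  assumes "subst_adm g T" "supp_in T f"
  shows "mfps_substitutable g f"
  unfolding mfps_substitutable_iff mfps_summable_def
proof
  fix m
  have "{n. mfps_coeff (mfps_const (mfps_coeff f n) * gpow g n) m \<noteq> 0} \<subseteq> {n \<in> T. mfps_coeff (gpow g n) m \<noteq> 0}"
    using assms(2) by (auto simp: supp_in_def)
  then show "finite {n. mfps_coeff (mfps_const (mfps_coeff f n) * gpow g n) m \<noteq> 0}"
    using assms(1) finite_subset unfolding subst_adm_def by blast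
qed

lemma substitutable_UNIV: "subst_adm g UNIV \<Longrightarrow> mfps_substitutable g f"
  by (rule substitutable_adm) auto

lemma substitutable_finite_support:
  assumes "finite {n. mfps_coeff f n \<noteq> 0}"
  shows "mfps_substitutable g f"
  unfolding mfps_substitutable_iff
  by (rule mfps_summable_finite_support[OF assms]) (simp add: mfps_const_simps)

lemma substitutable_const [simp]: "mfps_substitutable g (mfps_const c)"
  by (rule substitutable_finite_support) (simp add: finite_subset[of _ "{{#}}"])

lemma substitutable_var [simp]: "mfps_substitutable g (mfps_var v)"
  by (rule substitutable_finite_support) (simp add: finite_subset[of _ "{{#v#}}"])

lemma subst_const [simp]: "mfps_subst g (mfps_const c) = mfps_const c"
  unfolding mfps_subst_eq by (subst mfps_Sum_eq_sum[of "{{#}}"]) (auto simp: mfps_const_simps)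

lemma subst_0 [simp]: "mfps_subst g 0 = 0"
  using subst_const[of g 0] by (simp add: mfps_const_simps)

lemma subst_1 [simp]: "mfps_subst g 1 = 1"
  using subst_const[of g 1] by (simp add: mfps_const_simps)

lemma subst_var [simp]: "mfps_subst g (mfps_var v) = g v"
  unfolding mfps_subst_eq by (subst mfps_Sum_eq_sum[of "{{#v#}}"]) (auto simp: mfps_const_simps)

lemma substitutable_add:
  assumes "mfps_substitutable g f" "mfps_substitutable g h"
  shows "mfps_substitutable g (f + h)"
  using mfps_summable_add[OF assms[unfolded mfps_substitutable_iff]]
  by (simp add: mfps_substitutable_iff mfps_const_simps ring_distribs)

lemma subst_add:
  assumes "mfps_substitutable g f" "mfps_substitutable g h"
  shows "mfps_subst g (f + h) = mfps_subst g f + mfps_subst g h"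
  using mfps_Sum_add[OF assms[unfolded mfps_substitutable_iff]]
  by (simp add: mfps_subst_eq mfps_const_simps ring_distribs)

text \<open>
  Both sides are sums over pairs \<open>(a, b)\<close> of monomials of \<open>f\<close> and \<open>h\<close>.  The pairs relevant for a
  given coefficient form a finite set, because \<open>a\<close> and \<open>b\<close> must each contribute to a divisor of the
  monomial; over this set the double sum may be regrouped by the product \<open>a + b\<close>.
\<close>

lemma subst_mult_aux:
  assumes f: "mfps_substitutable g f" and h: "mfps_substitutable g h"
  shows "mfps_substitutable g (f * h) \<and> mfps_subst g (f * h) = mfps_subst g f * mfps_subst g h"
proof -
  let ?c = "\<lambda>n. mfps_coeff (gpow g n)"
  define A where "A m = {a. \<exists>k. k \<subseteq># m \<and> mfps_coeff f a * ?c a k \<noteq> 0}" for m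
  define B where "B m = {b. \<exists>k. k \<subseteq># m \<and> mfps_coeff h b * ?c b k \<noteq> 0}" for m
  have finA: "finite (A m)" and finB: "finite (B m)" for m
    using mfps_summable_divisors[OF f[unfolded mfps_substitutable_iff], of m]
      mfps_summable_divisors[OF h[unfolded mfps_substitutable_iff], of m]
    by (simp_all add: A_def B_def)
  have inAB: "a \<in> A m \<and> b \<in> B m"
    if "mfps_coeff f a * mfps_coeff h b \<noteq> 0" "?c (a + b) m \<noteq> 0" for a b m
  proof -
    from that(2) have "mfps_coeff (gpow g a * gpow g b) m \<noteq> 0" by simp
    then obtain k l where "k + l = m" "?c a k \<noteq> 0" "?c b l \<noteq> 0"
      by (rule mfps_coeff_times_nonzero)
    then have "k \<subseteq># m" "l \<subseteq># m" "mfps_coeff f a * ?c a k \<noteq> 0" "mfps_coeff h b * ?c b l \<noteq> 0"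
      using that(1) by auto
    then show ?thesis unfolding A_def B_def by blast
  qed
  define N where "N m = (\<lambda>p. fst p + snd p) ` (A m \<times> B m)" for m
  have finN: "finite (N m)" for m by (simp add: N_def finA finB)
  have inN: "n \<in> N m" if "mfps_coeff (f * h) n * ?c n m \<noteq> 0" for n m
  proof -
    from that have "mfps_coeff (f * h) n \<noteq> 0" "?c n m \<noteq> 0" by auto
    then obtain a b where "a + b = n" "mfps_coeff f a \<noteq> 0" "mfps_coeff h b \<noteq> 0"
      by (meson mfps_coeff_times_nonzero)
    then show ?thesis using inAB[of a b m] \<open>?c n m \<noteq> 0\<close> by (force simp: N_def)
  qed
  have sub: "mfps_substitutable g (f * h)"
    unfolding mfps_substitutable_iff mfps_summable_def
  proof
    fix m
    have "{n. mfps_coeff (mfps_const (mfps_coeff (f * h) n) * gpow g n) m \<noteq> 0} \<subseteq> N m"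
      using inN by auto
    then show "finite {n. mfps_coeff (mfps_const (mfps_coeff (f * h) n) * gpow g n) m \<noteq> 0}"
      using finN finite_subset by blast
  qed
  moreover have "mfps_subst g (f * h) = mfps_subst g f * mfps_subst g h"
  proof (rule mfps_eqI)
    fix m
    let ?t = "\<lambda>p. mfps_coeff f (fst p) * mfps_coeff h (snd p) * ?c (fst p + snd p) m"
    have "mfps_coeff (mfps_subst g (f * h)) m = (\<Sum>n\<in>N m. mfps_coeff (f * h) n * ?c n m)"
      unfolding mfps_subst_eq
      by (subst mfps_coeff_Sum_superset[OF finN[of m]]) (use inN in auto)
    also have "\<dots> = (\<Sum>n\<in>N m. \<Sum>p | p \<in> A m \<times> B m \<and> fst p + snd p = n. ?t p)"
    proof (rule sum.cong[OF refl])
      fix n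
      have "mfps_coeff (f * h) n * ?c n m = (\<Sum>p\<in>msplits n. ?t p)"
        unfolding mfps_coeff_times sum_distrib_right
        by (rule sum.cong) (auto simp: msplits_def)
      also have "\<dots> = (\<Sum>p | p \<in> A m \<times> B m \<and> fst p + snd p = n. ?t p)"
      proof (rule sum.mono_neutral_right)
        show "{p. p \<in> A m \<times> B m \<and> fst p + snd p = n} \<subseteq> msplits n" by (auto simp: msplits_def)
        show "\<forall>p\<in>msplits n - {p. p \<in> A m \<times> B m \<and> fst p + snd p = n}. ?t p = 0"
          using inAB by (fastforce simp: msplits_def)
      qed simp
      finally show "mfps_coeff (f * h) n * ?c n m =
          (\<Sum>p | p \<in> A m \<times> B m \<and> fst p + snd p = n. ?t p)" .
    qed
    also have "\<dots> = (\<Sum>p\<in>A m \<times> B m. ?t p)"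
      by (rule sum.group) (auto simp: finA finB finN N_def)
    also have "\<dots> = (\<Sum>p\<in>A m \<times> B m. \<Sum>r\<in>msplits m.
        (mfps_coeff f (fst p) * ?c (fst p) (fst r)) * (mfps_coeff h (snd p) * ?c (snd p) (snd r)))"
      by (rule sum.cong[OF refl]) (simp add: mfps_coeff_times sum_distrib_left mult_ac)
    also have "\<dots> = (\<Sum>r\<in>msplits m. \<Sum>p\<in>A m \<times> B m.
        (mfps_coeff f (fst p) * ?c (fst p) (fst r)) * (mfps_coeff h (snd p) * ?c (snd p) (snd r)))"
      by (rule sum.swap)
    also have "\<dots> = (\<Sum>r\<in>msplits m. mfps_coeff (mfps_subst g f) (fst r) * mfps_coeff (mfps_subst g h) (snd r))"
    proof (rule sum.cong[OF refl])
      fix r assume r: "r \<in> msplits m"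
      then have le: "fst r \<subseteq># m" "snd r \<subseteq># m" by (auto simp: msplits_def)
      have 1: "mfps_coeff (mfps_subst g f) (fst r) = (\<Sum>a\<in>A m. mfps_coeff f a * ?c a (fst r))"
        unfolding mfps_subst_eq
        by (subst mfps_coeff_Sum_superset[OF finA[of m]]) (use le in \<open>auto simp: A_def\<close>)
      have 2: "mfps_coeff (mfps_subst g h) (snd r) = (\<Sum>a\<in>B m. mfps_coeff h a * ?c a (snd r))"
        unfolding mfps_subst_eq
        by (subst mfps_coeff_Sum_superset[OF finB[of m]]) (use le in \<open>auto simp: B_def\<close>)
      show "(\<Sum>p\<in>A m \<times> B m.
        (mfps_coeff f (fst p) * ?c (fst p) (fst r)) * (mfps_coeff h (snd p) * ?c (snd p) (snd r))) =
        mfps_coeff (mfps_subst g f) (fst r) * mfps_coeff (mfps_subst g h) (snd r)"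
        unfolding 1 2 sum_product sum.cartesian_product by (simp add: case_prod_unfold)
    qed
    also have "\<dots> = mfps_coeff (mfps_subst g f * mfps_subst g h) m" by (simp add: mfps_coeff_times)
    finally show "mfps_coeff (mfps_subst g (f * h)) m = mfps_coeff (mfps_subst g f * mfps_subst g h) m" .
  qed
  ultimately show ?thesis by blast
qed

lemmas substitutable_mult = subst_mult_aux[THEN conjunct1]
lemmas subst_mult = subst_mult_aux[THEN conjunct2]

lemma subst_const_mult:
  "mfps_substitutable g f \<Longrightarrow> mfps_subst g (mfps_const c * f) = mfps_const c * mfps_subst g f"
  by (simp add: subst_mult)

lemma substitutable_sum:
  "(\<And>i. i \<in> I \<Longrightarrow> mfps_substitutable g (f i)) \<Longrightarrow> mfps_substitutable g (sum f I)"
proof (induction I rule: infinite_finite_induct)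
  case empty
  then show ?case using substitutable_const[of g 0] by (simp add: mfps_const_simps)
next
  case (infinite I)
  then show ?case using substitutable_const[of g 0] by (simp add: mfps_const_simps)
qed (simp add: substitutable_add)

lemma subst_sum:
  "(\<And>i. i \<in> I \<Longrightarrow> mfps_substitutable g (f i)) \<Longrightarrow> mfps_subst g (sum f I) = (\<Sum>i\<in>I. mfps_subst g (f i))"
  by (induction I rule: infinite_finite_induct) (simp_all add: subst_add substitutable_sum)

lemma subst_uminus:
  assumes "mfps_substitutable g f"
  shows "mfps_subst g (- f) = - mfps_subst g f"
proof -
  have "- h = mfps_const (-1) * h" for h :: "'x mfps" by (simp add: mfps_const_simps)
  then show ?thesis using subst_const_mult[OF assms] by metis
qed

lemma subst_gpow:
  assumes "\<And>v. mfps_substitutable Q (w v)"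
  shows "mfps_substitutable Q (gpow w n) \<and> mfps_subst Q (gpow w n) = gpow (\<lambda>v. mfps_subst Q (w v)) n"
proof (induction n)
  case empty
  then show ?case using substitutable_const[of Q 1] by (simp add: mfps_const_simps)
qed (simp add: assms substitutable_mult subst_mult)

text \<open>
  Substitution is continuous on series supported in \<open>T\<close>: for a given coefficient finitely many
  monomials of \<open>T\<close> matter, and each of them occurs in finitely many of the summands.
\<close>

lemma subst_Sum_aux:
  assumes adm: "subst_adm g T" and sm: "mfps_summable F" and supp: "\<And>i. supp_in T (F i)"
  shows "mfps_summable (\<lambda>i. mfps_subst g (F i)) \<and>
    mfps_subst g (mfps_Sum F) = mfps_Sum (\<lambda>i. mfps_subst g (F i))"
proof -
  let ?t = "\<lambda>i n. mfps_const (mfps_coeff (F i) n) * gpow g n"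
  have s: "mfps_summable (\<lambda>(i, n). ?t i n)"
    unfolding mfps_summable_def
  proof
    fix m
    let ?M = "{n \<in> T. mfps_coeff (gpow g n) m \<noteq> 0}"
    have "{p. mfps_coeff (case p of (i, n) \<Rightarrow> ?t i n) m \<noteq> 0} \<subseteq>
        (\<Union>n\<in>?M. {i. mfps_coeff (F i) n \<noteq> 0} \<times> {n})"
      using supp by (auto simp: supp_in_def)
    moreover have "finite (\<Union>n\<in>?M. {i. mfps_coeff (F i) n \<noteq> 0} \<times> {n})"
    proof (rule finite_UN_I)
      show "finite ?M" using adm by (simp add: subst_adm_def)
      show "finite ({i. mfps_coeff (F i) n \<noteq> 0} \<times> {n})" for n
        using sm by (simp add: mfps_summable_def)
    qed
    ultimately show "finite {p. mfps_coeff (case p of (i, n) \<Rightarrow> ?t i n) m \<noteq> 0}"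
      by (rule finite_subset)
  qed
  have c: "mfps_Sum (\<lambda>i. mfps_const (mfps_coeff (F i) n)) = mfps_const (mfps_coeff (mfps_Sum F) n)" for n
    by (rule mfps_eqI) (simp add: mfps_coeff_Sum)
  have cs: "mfps_summable (\<lambda>i. mfps_const (mfps_coeff (F i) n))" for n
    using sm by (simp add: mfps_summable_def)
  have "mfps_Sum (\<lambda>i. mfps_subst g (F i)) = mfps_Sum (\<lambda>n. mfps_Sum (\<lambda>i. ?t i n))"
    unfolding mfps_subst_eq by (rule mfps_Sum_swap[OF s])
  also have "\<dots> = mfps_subst g (mfps_Sum F)"
    unfolding mfps_Sum_mult_right[OF cs] c mfps_subst_eq ..
  finally show ?thesis using mfps_summable_Sigma(2)[OF s] by (simp add: mfps_subst_eq)
qed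

text \<open>
  The inner substitution is a limit of polynomials in the series \<open>w v\<close>, all supported in the
  submonoid \<open>T\<close>, on which the outer substitution is a continuous ring homomorphism.
\<close>

lemma subst_subst:
  assumes w: "subst_adm w UNIV" and Q: "subst_adm Q T" and T: "submonoid T" "\<And>v. supp_in T (w v)"
  shows "mfps_substitutable Q (mfps_subst w f)"
    and "mfps_subst Q (mfps_subst w f) = mfps_subst (\<lambda>v. mfps_subst Q (w v)) f"
proof -
  let ?F = "\<lambda>n. mfps_const (mfps_coeff f n) * gpow w n"
  have supp: "supp_in T (?F n)" for n
    by (intro supp_in_times supp_in_const supp_in_gpow T)
  have sm: "mfps_summable ?F"
    using substitutable_UNIV[OF w, of f] by (simp add: mfps_substitutable_iff)
  have subw: "mfps_substitutable Q (w v)" for v by (rule substitutable_adm[OF Q T(2)])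
  have "supp_in T (mfps_Sum ?F)"
    unfolding supp_in_def
  proof (intro allI impI)
    fix n assume "mfps_coeff (mfps_Sum ?F) n \<noteq> 0"
    then obtain i where "mfps_coeff (?F i) n \<noteq> 0"
      unfolding mfps_coeff_Sum by (metis (mono_tags, lifting) mem_Collect_eq sum.neutral)
    then show "n \<in> T" using supp by (simp add: supp_in_def)
  qed
  then show "mfps_substitutable Q (mfps_subst w f)"
    unfolding mfps_subst_eq by (rule substitutable_adm[OF Q])
  have "mfps_subst Q (mfps_subst w f) = mfps_Sum (\<lambda>n. mfps_subst Q (?F n))"
    unfolding mfps_subst_eq[of w] by (rule subst_Sum_aux[OF Q sm supp, THEN conjunct2])
  also have "\<dots> = mfps_subst (\<lambda>v. mfps_subst Q (w v)) f"
    using subst_gpow[of Q w, OF subw]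
    by (simp add: subst_const_mult mfps_subst_eq[of "\<lambda>v. mfps_subst Q (w v)"])
  finally show "mfps_subst Q (mfps_subst w f) = mfps_subst (\<lambda>v. mfps_subst Q (w v)) f" .
qed

lemma vge_gpow:
  assumes "additive_weight W" "\<And>v. vge W 1 (g v)"
  shows "vge W (int (size n)) (gpow g n)"
proof (induction n)
  case (add v n)
  show ?case using vge_times[OF assms(1) assms(2)[of v] add] by (simp add: add.commute)
qed (simp add: vge_1 assms)

lemma vge_subst:
  assumes W: "additive_weight W" and g: "\<And>v. vge W 1 (g v)" and f: "ord_ge d f"
  shows "vge W (int d) (mfps_subst g f)"
  unfolding mfps_subst_eq
proof (rule vge_Sum)
  fix n
  show "vge W (int d) (mfps_const (mfps_coeff f n) * gpow g n)"
  proof (cases "size n < d")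
    case True
    then show ?thesis using ord_geD[OF f] by (simp add: mfps_const_simps)
  next
    case False
    then show ?thesis using vge_mono[OF vge_gpow[OF W g, of n]] by (auto intro: vge_const_times)
  qed
qed

lemma ord_ge_subst:
  assumes "\<And>v. mfps_coeff (g v) {#} = 0" and f: "ord_ge d f"
  shows "ord_ge d (mfps_subst g f)"
  by (rule vge_subst[OF additive_weight_size _ f]) (use assms(1) ord_ge_1 in auto)

lemma agree_gpow:
  assumes "divisor_closed D" "\<And>v. agree D (g v) (h v)"
  shows "agree D (gpow g n) (gpow h n)"
  by (induction n) (simp_all add: agree_times assms)

lemma agree_subst:
  assumes "divisor_closed D" "\<And>v. agree D (g v) (h v)"
  shows "agree D (mfps_subst g f) (mfps_subst h f)"
  unfolding mfps_subst_eq
  by (rule agree_Sum) (intro agree_times agree_gpow assms agree_refl)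

lemma coeff_subst_empty:
  assumes zero: "\<And>v. mfps_coeff (g v) {#} = 0"
  shows "mfps_coeff (mfps_subst g f) {#} = mfps_coeff f {#}"
proof -
  have "mfps_coeff (mfps_subst g f) {#} = (\<Sum>n\<in>{{#}}. mfps_coeff (mfps_const (mfps_coeff f n) * gpow g n) {#})"
    unfolding mfps_subst_eq
  proof (rule mfps_coeff_Sum_superset)
    fix n assume "mfps_coeff (mfps_const (mfps_coeff f n) * gpow g n) {#} \<noteq> 0"
    then have "mfps_coeff (gpow g n) {#} \<noteq> 0" by simp
    then show "n \<in> {{#}}" using gpow_bound[of g, OF zero] by fastforce
  qed simp
  then show ?thesis by simp
qed

text \<open>
  Leading-order comparison of two substitutions that agree in degrees below \<open>d\<close>.  In degree \<open>d\<close> a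
  product of two or more series without constant term does not see the difference, so only the
  linear part of \<open>f\<close> does.
\<close>

lemma agree_times_next:
  assumes "mfps_coeff f {#} = 0" "mfps_coeff f' {#} = 0" "mfps_coeff g {#} = 0" "mfps_coeff g' {#} = 0"
    and "agree {m. size m < d} f f'" "agree {m. size m < d} g g'" and "size m \<le> d"
  shows "mfps_coeff (f * g) m = mfps_coeff (f' * g') m"
  unfolding mfps_coeff_times
proof (rule sum.cong[OF refl])
  fix p assume p: "p \<in> msplits m"
  then have sz: "size (fst p) + size (snd p) = size m" by (auto simp: msplits_def)
  show "mfps_coeff f (fst p) * mfps_coeff g (snd p) = mfps_coeff f' (fst p) * mfps_coeff g' (snd p)"
  proof (cases "fst p = {#} \<or> snd p = {#}")
    case True
    then show ?thesis using assms by auto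
  next
    case False
    then have "size (fst p) > 0" "size (snd p) > 0" by (auto simp: nonempty_has_size)
    then have "size (fst p) < d" "size (snd p) < d" using sz assms(7) by auto
    then show ?thesis using assms(5,6) by (simp add: agree_def)
  qed
qed

lemma coeff_subst_diff:
  fixes y y' :: "'v :: finite \<Rightarrow> 'w mfps"
  assumes z: "\<And>v. mfps_coeff (y v) {#} = 0" "\<And>v. mfps_coeff (y' v) {#} = 0"
    and a: "\<And>v. agree {m. size m < d} (y v) (y' v)" and m: "size m \<le> d"
  shows "mfps_coeff (mfps_subst y f) m - mfps_coeff (mfps_subst y' f) m =
    (\<Sum>v\<in>UNIV. mfps_coeff f {#v#} * (mfps_coeff (y v) m - mfps_coeff (y' v) m))"
proof -
  let ?t = "\<lambda>y n. mfps_const (mfps_coeff f n) * gpow y n"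
  let ?S = "(\<lambda>v. {#v#}) ` (UNIV :: 'v set)"
  have inj: "inj (\<lambda>v :: 'v. {#v#})" by (simp add: inj_def)
  have s: "mfps_summable (?t y)" "mfps_summable (?t y')"
    using substitutable_UNIV[OF subst_adm_finite, of y f] substitutable_UNIV[OF subst_adm_finite, of y' f] z
    by (simp_all add: mfps_substitutable_iff)
  let ?I = "{n. mfps_coeff (?t y n) m \<noteq> 0} \<union> {n. mfps_coeff (?t y' n) m \<noteq> 0} \<union> ?S"
  have fin: "finite ?I" using s by (simp add: mfps_summable_def)
  have same: "mfps_coeff (gpow y n) m = mfps_coeff (gpow y' n) m" if "n \<notin> ?S" for n
  proof (cases n)
    case (add v n')
    with that have "n' \<noteq> {#}" by auto
    then obtain u n'' where n': "n' = add_mset u n''" by (meson multiset_cases)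
    have "mfps_coeff (y v * gpow y n') m = mfps_coeff (y' v * gpow y' n') m"
      by (rule agree_times_next[where d = d])
        (use z a m in \<open>simp_all add: n' agree_times agree_gpow divisor_closed_size\<close>)
    then show ?thesis by (simp add: add)
  qed simp
  have "mfps_coeff (mfps_subst y f) m - mfps_coeff (mfps_subst y' f) m =
      (\<Sum>n\<in>?I. mfps_coeff (?t y n) m - mfps_coeff (?t y' n) m)"
    unfolding mfps_subst_eq sum_subtractf
    by (intro arg_cong2[where f = minus] mfps_coeff_Sum_superset[OF fin]) auto
  also have "\<dots> = (\<Sum>n\<in>?S. mfps_coeff (?t y n) m - mfps_coeff (?t y' n) m)"
    by (rule sum.mono_neutral_right[OF fin]) (use same in auto)
  also have "\<dots> = (\<Sum>v\<in>UNIV. mfps_coeff f {#v#} * (mfps_coeff (y v) m - mfps_coeff (y' v) m))"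
    by (subst sum.reindex[OF inj]) (simp add: ring_distribs)
  finally show ?thesis .
qed

lemma mfps_const_two: "mfps_const 2 = 2"
  using mfps_const_simps(3)[of 1 1] by (simp add: mfps_const_simps(2))

lemma mfps_deriv_gpow:
  fixes w :: "'u :: finite \<Rightarrow> 'w mfps"
  shows "mfps_deriv v (gpow w n) =
    (\<Sum>u\<in>UNIV. mfps_const (of_nat (count n u)) * gpow w (n - {#u#}) * mfps_deriv v (w u))"
proof (induction n)
  case (add x n)
  have *: "w x * (mfps_const (of_nat (count n u)) * gpow w (n - {#u#}) * mfps_deriv v (w u)) +
      (if u = x then mfps_deriv v (w x) * gpow w n else 0) =
      mfps_const (of_nat (count (add_mset x n) u)) * gpow w (add_mset x n - {#u#}) * mfps_deriv v (w u)" for u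
  proof (cases "u \<in># n")
    case True
    then obtain n' where n': "n = add_mset u n'" by (meson multi_member_split)
    show ?thesis
      by (cases "u = x") (simp_all add: n' mfps_const_simps algebra_simps add_mset_commute
          del: mfps_const_simps(3), simp add: mfps_const_simps ring_distribs mfps_const_two)
  next
    case False
    then have "count n u = 0" by (simp add: not_in_iff)
    then show ?thesis by (cases "u = x") (simp_all add: mfps_const_simps)
  qed
  have "mfps_deriv v (gpow w (add_mset x n)) = w x * mfps_deriv v (gpow w n) +
      (\<Sum>u\<in>UNIV. if u = x then mfps_deriv v (w x) * gpow w n else 0)"
    by (simp add: mfps_deriv_mult add.commute)
  also have "\<dots> = (\<Sum>u\<in>UNIV. w x * (mfps_const (of_nat (count n u)) * gpow w (n - {#u#}) * mfps_deriv v (w u)) +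
      (if u = x then mfps_deriv v (w x) * gpow w n else 0))"
    by (simp only: add.IH sum.distrib sum_distrib_left)
  finally show ?case by (simp only: *)
qed (simp add: mfps_const_simps)

text \<open>
  The chain rule holds for monomials by the product rule and extends by continuity.
\<close>

lemma mfps_deriv_subst:
  fixes w :: "'u :: finite \<Rightarrow> 'w mfps"
  assumes z: "\<And>u. mfps_coeff (w u) {#} = 0"
  shows "mfps_deriv v (mfps_subst w f) = (\<Sum>u\<in>UNIV. mfps_subst w (mfps_deriv u f) * mfps_deriv v (w u))"
proof -
  have adm: "subst_adm w UNIV" by (rule subst_adm_finite[OF z])
  have s: "mfps_summable (\<lambda>n. mfps_const (mfps_coeff h n) * gpow w n)" for h
    using substitutable_UNIV[OF adm, of h] by (simp add: mfps_substitutable_iff)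
  let ?a = "\<lambda>u n. mfps_const (mfps_coeff f n) * mfps_const (of_nat (count n u)) * gpow w (n - {#u#})"
  have inj: "inj (add_mset u)" for u :: 'u by (simp add: inj_def)
  have out: "?a u n = 0" if "n \<notin> range (add_mset u)" for u n
  proof -
    have "u \<notin># n" using that by (metis multi_member_split rangeI)
    then show ?thesis by (simp add: not_in_iff mfps_const_simps)
  qed
  have shift: "?a u (add_mset u n) = mfps_const (mfps_coeff (mfps_deriv u f) n) * gpow w n" for u n
    by (simp add: mfps_const_simps(6)[symmetric] mult_ac del: of_nat_Suc)
  have sa: "mfps_summable (?a u)" for u
    by (rule mfps_summable_reindex[OF inj out]) (assumption, unfold shift, rule s)
  have Sa: "mfps_Sum (?a u) = mfps_subst w (mfps_deriv u f)" for u
    using mfps_Sum_reindex[of "add_mset u" "?a u", OF inj out] unfolding shift mfps_subst_eq by simp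
  have "mfps_deriv v (mfps_subst w f) = mfps_Sum (\<lambda>n. mfps_const (mfps_coeff f n) * mfps_deriv v (gpow w n))"
    unfolding mfps_subst_eq by (subst mfps_deriv_Sum[OF s]) simp
  also have "\<dots> = mfps_Sum (\<lambda>n. \<Sum>u\<in>UNIV. ?a u n * mfps_deriv v (w u))"
    unfolding mfps_deriv_gpow sum_distrib_left by (simp add: mult.assoc)
  also have "\<dots> = (\<Sum>u\<in>UNIV. mfps_Sum (\<lambda>n. ?a u n * mfps_deriv v (w u)))"
    by (rule mfps_Sum_sum) (rule mfps_summable_mult_gen'[OF sa])
  also have "\<dots> = (\<Sum>u\<in>UNIV. mfps_subst w (mfps_deriv u f) * mfps_deriv v (w u))"
    by (simp only: mfps_Sum_mult_right[OF sa] Sa)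
  finally show ?thesis .
qed

text \<open>
  The formal implicit function theorem.  The iterates from zero stabilise degree by degree; the last
  clause records this, so that bounds on supports pass from the iterates to the fixed point.
\<close>

theorem formal_fixpoint:
  fixes \<Phi> :: "('a \<Rightarrow> 'v mfps) \<Rightarrow> ('a \<Rightarrow> 'v mfps)"
  assumes Z: "\<And>y a. (\<And>a. mfps_coeff (y a) {#} = 0) \<Longrightarrow> mfps_coeff (\<Phi> y a) {#} = 0"
    and contr: "\<And>y y' d a. (\<And>a. mfps_coeff (y a) {#} = 0) \<Longrightarrow> (\<And>a. mfps_coeff (y' a) {#} = 0) \<Longrightarrow>
      (\<And>a. agree {m. size m < d} (y a) (y' a)) \<Longrightarrow> agree {m. size m < Suc d} (\<Phi> y a) (\<Phi> y' a)"
  obtains w where "\<And>a. mfps_coeff (w a) {#} = 0" and "\<Phi> w = w"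
    and "\<And>m. \<exists>k. \<forall>a. mfps_coeff (w a) m = mfps_coeff ((\<Phi> ^^ k) (\<lambda>_. 0) a) m"
proof -
  define y where "y k = (\<Phi> ^^ k) (\<lambda>_. 0)" for k
  have yS: "y (Suc k) = \<Phi> (y k)" for k by (simp add: y_def)
  have yz: "mfps_coeff (y k a) {#} = 0" for k a
    by (induction k arbitrary: a) (simp_all add: yS Z, simp add: y_def)
  have step: "agree {m. size m < k} (y k a) (y (Suc k) a)" for k a
  proof (induction k arbitrary: a)
    case (Suc k)
    show ?case unfolding yS[of "Suc k"] unfolding yS[of k]
      by (rule contr[OF yz]) (use yz[of "Suc k"] Suc in \<open>simp_all add: yS\<close>)
  qed (simp add: agree_def)
  have stab: "mfps_coeff (y (size m + 1 + j) a) m = mfps_coeff (y (size m + 1) a) m" for m j a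
  proof (induction j)
    case (Suc j)
    then show ?case using step[of "size m + 1 + j" a] by (simp add: agree_def)
  qed simp
  define w where "w a = Abs_mfps (\<lambda>m. mfps_coeff (y (size m + 1) a) m)" for a
  have wy: "agree {m. size m < k} (w a) (y k a)" for k a
    unfolding agree_def
  proof
    fix m assume "m \<in> {m :: 'v multiset. size m < k}"
    then have "size m + 1 \<le> k" by simp
    then obtain j where "k = size m + 1 + j" using le_Suc_ex by blast
    then show "mfps_coeff (w a) m = mfps_coeff (y k a) m"
      using stab[of m j a] by (simp add: w_def)
  qed
  have wz: "mfps_coeff (w a) {#} = 0" for a by (simp add: w_def yz)
  have "\<Phi> w a = w a" for a
  proof (rule mfps_eqI)
    fix m :: "'v multiset"
    let ?d = "size m"
    have "agree {n. size n < Suc ?d} (\<Phi> w a) (\<Phi> (y ?d) a)"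
      by (rule contr[OF wz yz wy])
    moreover have "agree {n. size n < Suc ?d} (w a) (y (Suc ?d) a)" by (rule wy)
    ultimately show "mfps_coeff (\<Phi> w a) m = mfps_coeff (w a) m" by (simp add: agree_def yS)
  qed
  moreover have "\<exists>k. \<forall>a. mfps_coeff (w a) m = mfps_coeff ((\<Phi> ^^ k) (\<lambda>_. 0) a) m" for m
    by (rule exI[of _ "size m + 1"]) (simp add: w_def y_def)
  ultimately show ?thesis using that[of w] wz by blast
qed

section \<open>The ring of square matrices\<close>

text \<open>
  Square matrices over a commutative ring as a type of class \<open>ring_1\<close>, so that power series with
  matrix coefficients and noncommutative rewriting are available.
\<close>

typedef ('a, 'n :: finite) sqm = "UNIV :: ('a^'n^'n) set"
  morphisms unsq SQ
  by simp

definition entry :: "('a, 'n :: finite) sqm \<Rightarrow> 'n \<Rightarrow> 'n \<Rightarrow> 'a" where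
  "entry A i j = unsq A $ i $ j"

definition mat_of :: "('n :: finite \<Rightarrow> 'n \<Rightarrow> 'a) \<Rightarrow> ('a, 'n) sqm" where
  "mat_of f = SQ (\<chi> i j. f i j)"

lemma unsq_SQ [simp]: "unsq (SQ A) = A" by (simp add: SQ_inverse)

lemma entry_SQ [simp]: "entry (SQ A) i j = A $ i $ j" by (simp add: entry_def)

lemma entry_mat_of [simp]: "entry (mat_of f) i j = f i j" by (simp add: mat_of_def)

lemma sqm_eqI: "(\<And>i j. entry A i j = entry B i j) \<Longrightarrow> A = B"
  unfolding entry_def by (metis unsq_inject vec_eq_iff)

instantiation sqm :: (comm_ring_1, finite) ring_1
begin

definition "0 = mat_of (\<lambda>i j. 0)"
definition "1 = mat_of (\<lambda>i j. if i = j then 1 else 0)"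
definition "A + B = mat_of (\<lambda>i j. entry A i j + entry B i j)"
definition "A - B = mat_of (\<lambda>i j. entry A i j - entry B i j)"
definition "- A = mat_of (\<lambda>i j. - entry A i j)"
definition "A * B = mat_of (\<lambda>i j. \<Sum>k\<in>UNIV. entry A i k * entry B k j)"

instance
proof
  fix a b c :: "('a, 'b) sqm"
  show "a * b * c = a * (b * c)"
    by (rule sqm_eqI) (simp add: times_sqm_def sum_distrib_left sum_distrib_right mult.assoc, rule sum.swap)
  show "1 * a = a" "a * 1 = a"
    by (rule sqm_eqI, simp add: times_sqm_def one_sqm_def if_distrib[of "\<lambda>x. x * _"] if_distrib[of "\<lambda>x. _ * x"]
        sum.delta cong: if_cong)+
  show "(a + b) * c = a * c + b * c" "a * (b + c) = a * b + a * c"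
    by (rule sqm_eqI, simp add: times_sqm_def plus_sqm_def ring_distribs sum.distrib)+
  have "entry (0 :: ('a, 'b) sqm) undefined undefined \<noteq> entry 1 undefined undefined"
    by (simp add: zero_sqm_def one_sqm_def)
  then show "(0 :: ('a, 'b) sqm) \<noteq> 1" by auto
qed (rule sqm_eqI, simp add: zero_sqm_def plus_sqm_def minus_sqm_def uminus_sqm_def algebra_simps)+

end

lemma entry_simps [simp]:
  "entry 0 i j = 0" "entry 1 i j = (if i = j then 1 else 0)"
  "entry (A + B) i j = entry A i j + entry B i j" "entry (A - B) i j = entry A i j - entry B i j"
  "entry (- A) i j = - entry A i j"
  by (simp_all add: zero_sqm_def one_sqm_def plus_sqm_def minus_sqm_def uminus_sqm_def)

lemma entry_times: "entry (A * B) i j = (\<Sum>k\<in>UNIV. entry A i k * entry B k j)"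
  by (simp add: times_sqm_def)

lemma entry_sum [simp]: "entry (sum f S) i j = (\<Sum>x\<in>S. entry (f x) i j)"
  by (induction S rule: infinite_finite_induct) simp_all

lemma SQ_simps:
  "SQ (mat 1) = 1" "SQ 0 = 0" "SQ (A + B) = SQ A + SQ B" "SQ (- A) = - SQ A" "SQ (A ** B) = SQ A * SQ B"
  by (rule sqm_eqI, simp add: mat_def matrix_matrix_mult_def entry_times)+

lemma SQ_sum: "SQ (sum f S) = (\<Sum>x\<in>S. SQ (f x))"
  by (induction S rule: infinite_finite_induct) (simp_all add: SQ_simps)

definition scal :: "'a \<Rightarrow> ('a :: comm_ring_1, 'n :: finite) sqm \<Rightarrow> ('a, 'n) sqm" where
  "scal c A = mat_of (\<lambda>i j. c * entry A i j)"

lemma entry_scal [simp]: "entry (scal c A) i j = c * entry A i j" by (simp add: scal_def)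

lemma scal_simps:
  "scal c A * B = scal c (A * B)" "A * scal c B = scal c (A * B)"
  "scal c (A + B) = scal c A + scal c B" "scal c (A - B) = scal c A - scal c B"
  "scal c (scal d A) = scal (c * d) A" "scal c 0 = 0" "scal 0 A = 0" "scal 1 A = A"
  "scal (c + d) A = scal c A + scal d A"
  by (rule sqm_eqI, simp add: entry_times sum_distrib_left algebra_simps)+

lemma scal_sum: "scal c (sum f S) = (\<Sum>x\<in>S. scal c (f x))"
  by (rule sqm_eqI) (simp add: sum_distrib_left)

definition smap :: "('a \<Rightarrow> 'b) \<Rightarrow> ('a, 'n :: finite) sqm \<Rightarrow> ('b, 'n) sqm" where
  "smap f A = mat_of (\<lambda>i j. f (entry A i j))"

lemma entry_smap [simp]: "entry (smap f A) i j = f (entry A i j)" by (simp add: smap_def)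

abbreviation sderiv :: "'v \<Rightarrow> ('v mfps, 'n :: finite) sqm \<Rightarrow> ('v mfps, 'n) sqm" where
  "sderiv v \<equiv> smap (mfps_deriv v)"

lemma sderiv_simps:
  "sderiv v 0 = 0" "sderiv v 1 = 0" "sderiv v (A + B) = sderiv v A + sderiv v B"
  "sderiv v (A - B) = sderiv v A - sderiv v B" "sderiv v (- A) = - sderiv v A"
  "sderiv v (A * B) = sderiv v A * B + A * sderiv v B"
  by (rule sqm_eqI, auto simp: mfps_deriv_linear entry_times mfps_deriv_sum mfps_deriv_mult sum.distrib)+

lemma sderiv_sum: "sderiv v (sum f S) = (\<Sum>x\<in>S. sderiv v (f x))"
  by (rule sqm_eqI) (simp add: mfps_deriv_sum)

lemma sderiv_scal: "sderiv v (scal c A) = scal (mfps_deriv v c) A + scal c (sderiv v A)"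
  by (rule sqm_eqI) (simp add: mfps_deriv_mult)

definition fderiv :: "'v \<Rightarrow> ('v mfps, 'n :: finite) sqm fps \<Rightarrow> ('v mfps, 'n) sqm fps" where
  "fderiv v P = Abs_fps (\<lambda>n. sderiv v (fps_nth P n))"

lemma fderiv_nth [simp]: "fps_nth (fderiv v P) n = sderiv v (fps_nth P n)"
  by (simp add: fderiv_def)

lemma fderiv_simps:
  "fderiv v 0 = 0" "fderiv v 1 = 0" "fderiv v (P + Q) = fderiv v P + fderiv v Q"
  "fderiv v (P - Q) = fderiv v P - fderiv v Q" "fderiv v (- P) = - fderiv v P"
  "fderiv v (P * Q) = fderiv v P * Q + P * fderiv v Q" "fderiv v fps_X = 0"
  "fderiv v (fps_const c) = fps_const (sderiv v c)"
  by (rule fps_ext, simp add: sderiv_simps fps_mult_nth sderiv_sum sum.distrib)+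

lemma left_inverse_imp_right_inverse:
  fixes K J L :: "'a :: monoid_mult"
  assumes "K * J = 1" "L * K = 1"
  shows "J * K = 1"
proof -
  have "L = L * (K * J)" by (simp add: assms(1))
  also have "\<dots> = J" by (simp add: assms(2) mult.assoc[symmetric])
  finally show ?thesis using assms(2) by simp
qed

section \<open>Calibrations\<close>

definition sq_fps :: "(nat \<Rightarrow> 'a^'n^'n) \<Rightarrow> ('a, 'n :: finite) sqm fps" where
  "sq_fps X = Abs_fps (\<lambda>d. SQ (X d))"

lemma sq_fps_nth [simp]: "fps_nth (sq_fps X) d = SQ (X d)" by (simp add: sq_fps_def)

lemma series_inv_0 [simp]: "series_inv X 0 = mat 1" by (simp add: series_inv.simps)

lemma sq_fps_series_inv_left:
  assumes "X 0 = mat 1"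
  shows "sq_fps (series_inv X) * sq_fps X = 1"
proof (rule fps_ext)
  fix n
  have "fps_nth (sq_fps (series_inv X) * sq_fps X) n = SQ (\<Sum>i\<le>n. series_inv X i ** X (n - i))"
    by (simp add: fps_mult_nth SQ_sum SQ_simps atLeast0AtMost)
  also have "\<dots> = fps_nth 1 n"
    unfolding series_inv_left[of X n, OF assms] by (simp add: SQ_simps)
  finally show "fps_nth (sq_fps (series_inv X) * sq_fps X) n = fps_nth 1 n" .
qed

lemma sq_fps_series_inv_right:
  assumes "X 0 = mat 1"
  shows "sq_fps X * sq_fps (series_inv X) = 1"
  by (rule left_inverse_imp_right_inverse[OF sq_fps_series_inv_left[of X, OF assms]
        sq_fps_series_inv_left[of "series_inv X"]]) simp

definition struct_mat :: "('n :: finite \<Rightarrow> 'n mfps) \<Rightarrow> 'n \<Rightarrow> ('n mfps, 'n) sqm" where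
  "struct_mat F \<gamma> = mat_of (\<lambda>\<alpha> \<mu>. structure_const F \<alpha> \<gamma> \<mu>)"

lemma entry_struct_mat [simp]: "entry (struct_mat F \<gamma>) \<alpha> \<mu> = structure_const F \<alpha> \<gamma> \<mu>" by (simp add: struct_mat_def)

lemma structure_const_sym: "structure_const F \<alpha> \<beta> \<gamma> = structure_const F \<alpha> \<gamma> \<beta>"
  unfolding structure_const_def by (rule mfps_deriv_commute)

lemma struct_mat_deriv_sym: "sderiv \<gamma> (struct_mat F \<delta>) = sderiv \<delta> (struct_mat F \<gamma>)"
  by (rule sqm_eqI, simp only: entry_smap entry_struct_mat structure_const_def)
    (metis mfps_deriv_commute)

lemma struct_mat_commute: "flat_F_manifold F A \<Longrightarrow> struct_mat F \<gamma> * struct_mat F \<delta> = struct_mat F \<delta> * struct_mat F \<gamma>"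
  by (rule sqm_eqI) (simp add: entry_times flat_F_manifold_def)

lemma flat_unit:
  "flat_F_manifold F A \<Longrightarrow> (\<Sum>\<mu>\<in>UNIV. mfps_const (A $ \<mu>) * structure_const F \<alpha> \<mu> \<beta>) = (if \<alpha> = \<beta> then 1 else 0)"
  by (simp add: flat_F_manifold_def)

lemma flat_unit':
  "flat_F_manifold F A \<Longrightarrow> (\<Sum>\<mu>\<in>UNIV. mfps_const (A $ \<mu>) * structure_const F \<alpha> \<beta> \<mu>) = (if \<alpha> = \<beta> then 1 else 0)"
  using flat_unit[of F A \<alpha> \<beta>] by (simp add: structure_const_sym[of F \<alpha> \<beta>])

lemma calibration_0: "calibration F J \<Longrightarrow> J 0 = mat 1"
  by (simp add: calibration_def)

lemma calibration_deriv: "calibration F J \<Longrightarrow> sderiv \<gamma> (SQ (J (Suc d))) = SQ (J d) * struct_mat F \<gamma>"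
  by (rule sqm_eqI) (simp add: entry_times calibration_def mult.commute)

lemma calibrationI:
  assumes "J 0 = mat 1" "\<And>d \<gamma>. sderiv \<gamma> (SQ (J (Suc d))) = SQ (J d) * struct_mat F \<gamma>"
  shows "calibration F J"
  unfolding calibration_def
proof (intro conjI allI assms(1))
  fix d \<alpha> \<beta> \<gamma>
  have "entry (sderiv \<gamma> (SQ (J (Suc d)))) \<alpha> \<beta> = entry (SQ (J d) * struct_mat F \<gamma>) \<alpha> \<beta>" by (simp only: assms(2))
  then show "mfps_deriv \<gamma> (J (Suc d) $ \<alpha> $ \<beta>) =
        (\<Sum>\<mu>\<in>UNIV. structure_const F \<mu> \<gamma> \<beta> * J d $ \<alpha> $ \<mu>)"
    by (simp add: entry_times mult.commute)
qed

text \<open>In terms of generating series, \<open>\<partial>J = z J C\<close>, hence \<open>\<partial>J\<inverse> = - z C J\<inverse>\<close>.\<close>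

context
  fixes F :: "'n :: finite \<Rightarrow> 'n mfps" and J :: "nat \<Rightarrow> 'n mfps^'n^'n"
  assumes cal: "calibration F J"
begin

lemma calibration_inverse:
  shows "sq_fps (series_inv J) * sq_fps J = 1" "sq_fps J * sq_fps (series_inv J) = 1"
  using sq_fps_series_inv_left sq_fps_series_inv_right calibration_0[OF cal] by blast+

lemma fderiv_calibration: "fderiv \<gamma> (sq_fps J) = fps_X * (sq_fps J * fps_const (struct_mat F \<gamma>))"
proof (rule fps_ext)
  fix n show "fps_nth (fderiv \<gamma> (sq_fps J)) n = fps_nth (fps_X * (sq_fps J * fps_const (struct_mat F \<gamma>))) n"
  proof (cases n)
    case 0
    then show ?thesis using calibration_0[OF cal] by (simp add: SQ_simps sderiv_simps)
  next
    case (Suc d)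
    then show ?thesis using calibration_deriv[OF cal] by simp
  qed
qed

lemma fderiv_inverse_calibration: "fderiv \<gamma> (sq_fps (series_inv J)) = - (fps_X * (fps_const (struct_mat F \<gamma>) * sq_fps (series_inv J)))"
proof -
  have "fderiv \<gamma> (sq_fps (series_inv J) * sq_fps J) = 0" by (simp add: calibration_inverse fderiv_simps)
  then have "fderiv \<gamma> (sq_fps (series_inv J)) * sq_fps J = - (sq_fps (series_inv J) * fderiv \<gamma> (sq_fps J))"
    by (simp add: fderiv_simps eq_neg_iff_add_eq_0)
  then have "fderiv \<gamma> (sq_fps (series_inv J)) * sq_fps J * sq_fps (series_inv J) = - (sq_fps (series_inv J) * (fps_X * (sq_fps J * fps_const (struct_mat F \<gamma>)))) * sq_fps (series_inv J)"
    by (simp only: fderiv_calibration)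
  also have "sq_fps (series_inv J) * (fps_X * (sq_fps J * fps_const (struct_mat F \<gamma>))) =
      fps_X * (sq_fps (series_inv J) * (sq_fps J * fps_const (struct_mat F \<gamma>)))"
    by (metis fps_mult_fps_X_commute mult.assoc)
  also have "- (fps_X * (sq_fps (series_inv J) * (sq_fps J * fps_const (struct_mat F \<gamma>)))) * sq_fps (series_inv J) =
      - (fps_X * ((sq_fps (series_inv J) * sq_fps J) * fps_const (struct_mat F \<gamma>) * sq_fps (series_inv J)))"
    by (simp add: mult.assoc)
  finally show ?thesis by (simp add: mult.assoc calibration_inverse)
qed

lemma deriv_inverse_calibration:
  "sderiv \<gamma> (SQ (series_inv J (Suc d))) = - (struct_mat F \<gamma> * SQ (series_inv J d))"
proof -
  have "fps_nth (fderiv \<gamma> (sq_fps (series_inv J))) (Suc d) = fps_nth (- (fps_X * (fps_const (struct_mat F \<gamma>) * sq_fps (series_inv J)))) (Suc d)"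
    by (simp only: fderiv_inverse_calibration)
  then show ?thesis by simp
qed

lemma deriv_lower_Omega:
  "mfps_deriv \<gamma> (lower_Omega J (Suc d) $ \<alpha> $ \<beta>) =
    (\<Sum>\<mu>\<in>UNIV. structure_const F \<alpha> \<gamma> \<mu> * lower_Omega J d $ \<mu> $ \<beta>)"
proof -
  have "entry (sderiv \<gamma> (SQ (series_inv J (Suc d)))) \<alpha> \<beta> = entry (- (struct_mat F \<gamma> * SQ (series_inv J d))) \<alpha> \<beta>"
    by (simp only: deriv_inverse_calibration)
  then show ?thesis
    by (simp add: lower_Omega_def entry_times mfps_deriv_linear sum_negf)
qed

lemma lower_Omega_0: "lower_Omega J 0 = mat 1"
  by (simp add: lower_Omega_def)

lemma Omega_eq:
  "SQ (Omega J a b) = (if even b then 1 else - 1) * fps_nth (fps_shift (Suc a) (sq_fps J) * sq_fps (series_inv J)) b"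
proof -
  have "SQ (Omega J a b) = (\<Sum>i\<le>b. (if even b then 1 else - 1) * (SQ (J (b - i + Suc a)) * SQ (series_inv J i)))"
    unfolding Omega_def SQ_sum
  proof (rule sum.cong[OF refl])
    fix i assume i: "i \<in> {..b}"
    then have e: "Suc (a + b - i) = b - i + Suc a" by auto
    from i have "even (b - i) \<longleftrightarrow> (even b \<longleftrightarrow> even i)" by auto
    then show "SQ (if even (b - i) then J (Suc (a + b - i)) ** lower_Omega J i
              else - (J (Suc (a + b - i)) ** lower_Omega J i)) =
        (if even b then 1 else - 1) * (SQ (J (b - i + Suc a)) * SQ (series_inv J i))"
      unfolding e by (auto simp: lower_Omega_def SQ_simps)
  qed
  also have "\<dots> = (\<Sum>i\<le>b. (if even b then 1 else - 1) * (SQ (J (i + Suc a)) * SQ (series_inv J (b - i))))"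
    by (rule sum.reindex_bij_witness[of _ "\<lambda>i. b - i" "\<lambda>i. b - i"]) auto
  finally show ?thesis
    by (simp add: fps_mult_nth sum_distrib_left atLeast0AtMost)
qed

lemma deriv_Omega_0:
  "mfps_deriv \<gamma> (Omega J 0 d $ \<alpha> $ \<beta>) = (\<Sum>\<mu>\<in>UNIV. structure_const F \<alpha> \<gamma> \<mu> * lower_Omega J d $ \<mu> $ \<beta>)"
proof -
  let ?S = "fps_shift (Suc 0) (sq_fps J)"
  have J: "sq_fps J = 1 + fps_X * ?S"
    by (rule fps_ext) (use calibration_0[OF cal] in \<open>auto simp: SQ_simps\<close>)
  have dS: "fderiv \<gamma> ?S = sq_fps J * fps_const (struct_mat F \<gamma>)"
    by (rule fps_ext) (simp add: calibration_deriv[OF cal])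
  have "fderiv \<gamma> (?S * sq_fps (series_inv J)) = sq_fps J * fps_const (struct_mat F \<gamma>) * sq_fps (series_inv J) - ?S * fps_X * fps_const (struct_mat F \<gamma>) * sq_fps (series_inv J)"
    by (simp add: fderiv_simps dS fderiv_inverse_calibration mult.assoc)
  also have "\<dots> = fps_const (struct_mat F \<gamma>) * sq_fps (series_inv J)"
    by (subst J) (simp add: ring_distribs fps_mult_fps_X_commute)
  finally have "fps_nth (fderiv \<gamma> (?S * sq_fps (series_inv J))) d = struct_mat F \<gamma> * SQ (series_inv J d)" by simp
  then have "entry (sderiv \<gamma> (fps_nth (?S * sq_fps (series_inv J)) d)) \<alpha> \<beta> = entry (struct_mat F \<gamma> * SQ (series_inv J d)) \<alpha> \<beta>"
    by simp
  moreover have "SQ (Omega J 0 d) = (if even d then fps_nth (?S * sq_fps (series_inv J)) d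
      else - fps_nth (?S * sq_fps (series_inv J)) d)"
    by (simp add: Omega_eq)
  then have "Omega J 0 d $ \<alpha> $ \<beta> = (if even d then entry (fps_nth (?S * sq_fps (series_inv J)) d) \<alpha> \<beta>
      else - entry (fps_nth (?S * sq_fps (series_inv J)) d) \<alpha> \<beta>)"
    by (metis entry_SQ entry_simps(5))
  ultimately show ?thesis
    by (auto simp: lower_Omega_def entry_times mfps_deriv_linear sum_negf)
qed

lemma calibration_unit:
  assumes flat: "flat_F_manifold F A"
  shows "(\<Sum>\<beta>\<in>UNIV. mfps_const (A $ \<beta>) * J 1 $ \<alpha> $ \<beta>) =
    mfps_const ((0 + calibration_shift 0 A J) $ \<alpha>) + mfps_var \<alpha>"
proof (rule mfps_eq_by_deriv)
  fix \<gamma>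
  have "mfps_deriv \<gamma> (J 1 $ \<alpha> $ \<beta>) = structure_const F \<alpha> \<gamma> \<beta>" for \<beta>
  proof -
    have "entry (sderiv \<gamma> (SQ (J (Suc 0)))) \<alpha> \<beta> = entry (SQ (J 0) * struct_mat F \<gamma>) \<alpha> \<beta>"
      by (simp only: calibration_deriv[OF cal])
    then show ?thesis by (simp add: calibration_0[OF cal] SQ_simps)
  qed
  then show "mfps_deriv \<gamma> (\<Sum>\<beta>\<in>UNIV. mfps_const (A $ \<beta>) * J 1 $ \<alpha> $ \<beta>) =
      mfps_deriv \<gamma> (mfps_const ((0 + calibration_shift 0 A J) $ \<alpha>) + mfps_var \<alpha>)"
    using flat_unit'[OF flat] by (simp add: mfps_deriv_sum mfps_deriv_linear)
qed (simp add: calibration_shift_def)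

end

lemma vge_size_0 [simp]: "vge (\<lambda>m. int (size m)) 0 f"
  by (simp add: vge_def)

definition normalised :: "(nat \<Rightarrow> ('n :: finite) mfps^'n^'n) \<Rightarrow> bool" where
  "normalised J \<longleftrightarrow> (\<forall>d\<ge>1. \<forall>\<alpha> \<beta>. mfps_coeff (J d $ \<alpha> $ \<beta>) {#} = 0)"

lemma ord_ge_calibration:
  assumes cal: "calibration F J" and n: "normalised J"
  shows "ord_ge d (J d $ \<alpha> $ \<beta>)"
proof (induction d arbitrary: \<alpha> \<beta>)
  case (Suc d)
  show ?case
  proof (rule ord_ge_deriv)
    fix \<gamma>
    have "mfps_deriv \<gamma> (J (Suc d) $ \<alpha> $ \<beta>) = (\<Sum>\<mu>\<in>UNIV. J d $ \<alpha> $ \<mu> * structure_const F \<mu> \<gamma> \<beta>)"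
      using cal by (simp add: calibration_def mult.commute)
    also have "ord_ge d \<dots>"
      by (rule vge_sum) (use ord_ge_times[OF Suc ord_ge_0] in simp)
    finally show "ord_ge d (mfps_deriv \<gamma> (J (Suc d) $ \<alpha> $ \<beta>))" .
  qed (use n in \<open>simp add: normalised_def\<close>)
qed simp

lemma normalised_series_inv:
  assumes J0: "J 0 = mat 1" and n: "normalised J"
  shows "normalised (series_inv J)"
  unfolding normalised_def
proof (intro allI impI)
  fix d \<alpha> \<beta> assume d: "(1::nat) \<le> d"
  have "mfps_coeff ((series_inv J i ** J (d - i)) $ \<alpha> $ \<beta>) {#} = 0" if "i < d" for i
    using that n by (simp add: matrix_matrix_mult_def normalised_def)
  then show "mfps_coeff (series_inv J d $ \<alpha> $ \<beta>) {#} = 0"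
    using d by (subst series_inv.simps) simp
qed

lemma ord_ge_lower_Omega:
  assumes cal: "calibration F J" and n: "normalised J"
  shows "ord_ge d (lower_Omega J d $ \<alpha> $ \<beta>)"
proof (induction d arbitrary: \<alpha> \<beta>)
  case (Suc d)
  show ?case
  proof (rule ord_ge_deriv)
    fix \<gamma>
    have "ord_ge d (\<Sum>\<mu>\<in>UNIV. lower_Omega J d $ \<mu> $ \<beta> * structure_const F \<alpha> \<gamma> \<mu>)"
      by (rule vge_sum) (use ord_ge_times[OF Suc ord_ge_0] in simp)
    then show "ord_ge d (mfps_deriv \<gamma> (lower_Omega J (Suc d) $ \<alpha> $ \<beta>))"
      by (simp add: deriv_lower_Omega[OF cal] mult.commute)
    show "mfps_coeff (lower_Omega J (Suc d) $ \<alpha> $ \<beta>) {#} = 0"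
      using normalised_series_inv[of J, OF calibration_0[OF cal] n]
      by (simp add: normalised_def lower_Omega_def)
  qed
qed simp

lemma ord_ge_Omega:
  assumes cal: "calibration F J" and n: "normalised J"
  shows "ord_ge (a + b + 1) (Omega J a b $ \<alpha> $ \<beta>)"
proof -
  have "ord_ge (a + b + 1) ((J (Suc (a + b - i)) ** lower_Omega J i) $ \<alpha> $ \<beta>)" if "i \<le> b" for i
  proof -
    have "ord_ge (Suc (a + b - i) + i) (J (Suc (a + b - i)) $ \<alpha> $ k * lower_Omega J i $ k $ \<beta>)" for k
      by (intro ord_ge_times ord_ge_calibration[OF assms] ord_ge_lower_Omega[OF assms])
    moreover have "Suc (a + b - i) + i = a + b + 1" using that by simp
    ultimately show ?thesis by (simp add: matrix_matrix_mult_def vge_sum)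
  qed
  then show ?thesis unfolding Omega_def by (simp, intro vge_sum) (auto intro: vge_uminus)
qed

section \<open>The Euler-Lagrange equation of a cone\<close>

text \<open>
  The \<open>b\<close>-th term of \<open>\<Sum>b. X_b(y) q_b\<close>.  The Euler-Lagrange equation and the
  potentials are both series of this shape.
\<close>

definition pterm :: "('n :: finite \<Rightarrow> 'v mfps) \<Rightarrow> (nat \<Rightarrow> 'n mfps^'n^'n) \<Rightarrow> (nat \<Rightarrow> 'n \<Rightarrow> 'v mfps) \<Rightarrow>
    'n \<Rightarrow> nat \<Rightarrow> 'v mfps" where
  "pterm y X q \<alpha> b = (\<Sum>\<beta>\<in>UNIV. mfps_subst y (X b $ \<alpha> $ \<beta>) * q b \<beta>)"

definition pairing :: "('n :: finite \<Rightarrow> 'v mfps) \<Rightarrow> (nat \<Rightarrow> 'n mfps^'n^'n) \<Rightarrow> (nat \<Rightarrow> 'n \<Rightarrow> 'v mfps) \<Rightarrow>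
    'n \<Rightarrow> 'v mfps" where
  "pairing y X q \<alpha> = mfps_Sum (pterm y X q \<alpha>)"

lemma descendant_potential_pairing: "descendant_potential bs J w a = pairing w (Omega J a) (q_coord bs)"
  by (rule ext) (simp add: descendant_potential_def pairing_def pterm_def[abs_def])

lemma pterm_summable:
  assumes "\<And>\<beta>. mfps_summable (\<lambda>b. q b \<beta>)"
  shows "mfps_summable (pterm y X q \<alpha>)"
  unfolding pterm_def[abs_def] by (intro mfps_summable_sum mfps_summable_mult_gen assms)

lemma mfps_summable_ord:
  assumes "\<And>b. ord_ge b (f b)"
  shows "mfps_summable f"
  unfolding mfps_summable_def
proof
  fix m
  have "{b. mfps_coeff (f b) m \<noteq> 0} \<subseteq> {..size m}"
    using assms ord_geD not_le_imp_less by fastforce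
  then show "finite {b. mfps_coeff (f b) m \<noteq> 0}" using finite_subset by blast
qed

lemma pterm_summable_ord:
  assumes "\<And>\<alpha>. mfps_coeff (y \<alpha>) {#} = 0" "\<And>b \<alpha> \<beta>. ord_ge b (X b $ \<alpha> $ \<beta>)"
  shows "mfps_summable (pterm y X q \<alpha>)"
proof (rule mfps_summable_ord)
  fix b
  show "ord_ge b (pterm y X q \<alpha> b)"
    unfolding pterm_def
  proof (rule vge_sum)
    fix \<beta>
    show "ord_ge b (mfps_subst y (X b $ \<alpha> $ \<beta>) * q b \<beta>)"
      using ord_ge_times[OF ord_ge_subst[of y, OF assms(1,2)] ord_ge_0] by simp
  qed
qed

lemma q_coord_summable:
  fixes \<beta> :: "'n :: finite"
  shows "mfps_summable (\<lambda>b. q_coord (cone_base s A) b \<beta>)"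
proof -
  have "mfps_summable (\<lambda>b. mfps_const (cone_base s A b $ \<beta>) :: ('n \<times> nat) mfps)"
    by (rule mfps_summable_finite_support[of "{0, 1}"]) (auto simp: cone_base_def mfps_const_simps)
  moreover have "mfps_summable (\<lambda>b. mfps_var (\<beta>, b) :: ('n \<times> nat) mfps)"
    unfolding mfps_summable_def
  proof
    fix m :: "('n \<times> nat) multiset"
    have "{b. mfps_coeff (mfps_var (\<beta>, b) :: ('n \<times> nat) mfps) m \<noteq> 0} \<subseteq> snd ` set_mset m"
      by (auto split: if_splits)
    then show "finite {b. mfps_coeff (mfps_var (\<beta>, b) :: ('n \<times> nat) mfps) m \<noteq> 0}"
      by (rule finite_subset) simp
  qed
  ultimately show ?thesis unfolding q_coord_def by (rule mfps_summable_add)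
qed

lemma q_coord_deriv: "mfps_deriv (\<beta>, d) (q_coord bs b \<gamma>) = (if b = d \<and> \<gamma> = \<beta> then 1 else 0)"
  by (auto simp: q_coord_def mfps_deriv_linear)

text \<open>
  In degree \<open>d\<close> the difference of the factors can only meet the constant term of \<open>g\<close>.
\<close>

lemma coeff_times_diff:
  assumes "agree {m. size m < d} f f'" "size m \<le> d"
  shows "mfps_coeff (f * g) m - mfps_coeff (f' * g) m = (mfps_coeff f m - mfps_coeff f' m) * mfps_coeff g {#}"
proof -
  have "mfps_coeff (f * g) m - mfps_coeff (f' * g) m =
      (\<Sum>p\<in>msplits m. (mfps_coeff f (fst p) - mfps_coeff f' (fst p)) * mfps_coeff g (snd p))"
    by (simp add: mfps_coeff_times sum_subtractf ring_distribs)
  also have "\<dots> = (\<Sum>p\<in>{(m, {#})}. (mfps_coeff f (fst p) - mfps_coeff f' (fst p)) * mfps_coeff g (snd p))"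
  proof (rule sum.mono_neutral_right)
    show "\<forall>p\<in>msplits m - {(m, {#})}. (mfps_coeff f (fst p) - mfps_coeff f' (fst p)) * mfps_coeff g (snd p) = 0"
    proof
      fix p assume p: "p \<in> msplits m - {(m, {#})}"
      then have m: "fst p + snd p = m" by (auto simp: msplits_def)
      then have "snd p \<noteq> {#}" using p by (cases p) auto
      then have "size (fst p) < d" using m assms(2)
        by (metis add_less_same_cancel1 less_le_trans linorder_neqE_nat nonempty_has_size size_union
            trans_less_add1 not_less_zero less_add_same_cancel1)
      then show "(mfps_coeff f (fst p) - mfps_coeff f' (fst p)) * mfps_coeff g (snd p) = 0"
        using assms(1) by (simp add: agree_def)
    qed
  qed (rule finite_msplits, auto simp: msplits_def)
  finally show ?thesis by simp
qed

lemma lower_Omega_1: "lower_Omega J 1 = J 1"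
proof -
  have "series_inv J 1 = - J 1" by (subst series_inv.simps) simp
  then show ?thesis by (simp add: lower_Omega_def)
qed

text \<open>
  As all series are centred at the base point of the manifold, the base point of the cone can be
  computed as if the former were zero.
\<close>

abbreviation cal_shift :: "complex^('n::finite) \<Rightarrow> (nat \<Rightarrow> 'n mfps^'n^'n) \<Rightarrow> complex^'n" where
  "cal_shift A J \<equiv> calibration_shift 0 A J"

lemma calibration_shift_eq: "t + calibration_shift t A J = cal_shift A J"
  by (simp add: calibration_shift_def vec_eq_iff)

abbreviation q_point :: "complex^('n::finite) \<Rightarrow> (nat \<Rightarrow> 'n mfps^'n^'n) \<Rightarrow> nat \<Rightarrow> 'n \<Rightarrow> ('n \<times> nat) mfps" where
  "q_point A J \<equiv> q_coord (cone_base (cal_shift A J) A)"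

definition euler_solution ::
    "complex^('n::finite) \<Rightarrow> (nat \<Rightarrow> 'n mfps^'n^'n) \<Rightarrow> ('n \<Rightarrow> ('n \<times> nat) mfps) \<Rightarrow> bool" where
  "euler_solution A J w \<longleftrightarrow> (\<forall>\<alpha>. mfps_coeff (w \<alpha>) {#} = 0) \<and> (\<forall>\<alpha>. pairing w (lower_Omega J) (q_point A J) \<alpha> = 0)"

lemma pterm_q_point_summable [simp]: "mfps_summable (pterm w X (q_point A J) \<alpha>)"
  by (intro pterm_summable q_coord_summable)

lemma coeff_q_coord_empty: "mfps_coeff (q_coord bs b \<beta>) {#} = bs b $ \<beta>"
  by (simp add: q_coord_def)

text \<open>
  The opposite of the degree that gives \<open>q_d\<close> the value \<open>d - 1\<close>.  Ancestor potentials
  have weight at least \<open>a + 2\<close>, so that the weight bounds from below how many of the variables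
  \<open>q_0\<close> must occur.
\<close>

definition jet_weight :: "('n \<times> nat) multiset \<Rightarrow> int" where
  "jet_weight n = (\<Sum>x\<in>#n. 1 - int (snd x))"

lemma additive_weight_jet_weight: "additive_weight jet_weight"
  by (simp add: additive_weight_def jet_weight_def)

lemma jet_weight_le_size: "jet_weight n \<le> int (size n)"
  by (induction n) (auto simp: jet_weight_def)

lemma ord_ge_jet_weight: "vge jet_weight (int d) f \<Longrightarrow> ord_ge d f"
  unfolding vge_def using jet_weight_le_size order_trans by blast

text \<open>
  The \<open>q_d\<close> with \<open>d \<ge> 2\<close> may be replaced by series with a constant term, as happens when \<open>G_+\<close>
  moves the point \<open>-A z\<close>.  A monomial of nonnegative weight contains enough variables with \<open>d = 0\<close>
  to compensate for those with \<open>d \<ge> 2\<close>; as every variable with \<open>d \<le> 1\<close> costs at least one degree in the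
  result, its length and its jet order are bounded.
\<close>

lemma subst_adm_ancestor:
  fixes Q :: "('n :: finite) \<times> nat \<Rightarrow> 'v mfps"
  assumes zero: "\<And>\<alpha> d. d \<le> 1 \<Longrightarrow> mfps_coeff (Q (\<alpha>, d)) {#} = 0"
  shows "subst_adm Q {n. 0 \<le> jet_weight n}"
  unfolding subst_adm_def
proof
  fix m :: "'v multiset"
  \<comment> \<open>\<open>low\<close> counts the variables with \<open>d \<le> 1\<close>, \<open>hi\<close> adds up the jet orders above one; the weight is at most their difference.\<close>
  define low where "low n = (\<Sum>x\<in>#n. if snd x \<le> 1 then 1 else 0 :: nat)" for n :: "('n \<times> nat) multiset"
  define hi where "hi n = (\<Sum>x\<in>#n. snd x - 1)" for n :: "('n \<times> nat) multiset"
  have low: "low n \<le> size k" if "mfps_coeff (gpow Q n) k \<noteq> 0" for n k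
    using that
  proof (induction n arbitrary: k)
    case (add x n)
    from add.prems have "mfps_coeff (Q x * gpow Q n) k \<noteq> 0" by simp
    then obtain k1 k2 where k: "k1 + k2 = k" "mfps_coeff (Q x) k1 \<noteq> 0" "mfps_coeff (gpow Q n) k2 \<noteq> 0"
      by (rule mfps_coeff_times_nonzero)
    have "k1 \<noteq> {#}" if "snd x \<le> 1" using zero[of "snd x" "fst x"] k(2) that by auto
    then have "(if snd x \<le> 1 then 1 else 0) \<le> size k1" by (auto simp: Suc_le_eq nonempty_has_size)
    moreover have "size k = size k1 + size k2" using k(1) by auto
    ultimately show ?case using add.IH[OF k(3)] by (auto simp: low_def)
  qed (simp add: low_def)
  have wle: "jet_weight n \<le> int (low n) - int (hi n)" for n
    by (induction n) (auto simp: jet_weight_def low_def hi_def)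
  have sz: "size n \<le> low n + hi n" for n
    by (induction n) (auto simp: low_def hi_def)
  have mem: "snd x \<le> hi n + 1" if "x \<in># n" for x n
    using that by (induction n) (auto simp: hi_def)
  let ?V = "UNIV \<times> {..size m + 1} :: ('n \<times> nat) set"
  have "{n \<in> {n. 0 \<le> jet_weight n}. mfps_coeff (gpow Q n) m \<noteq> 0} \<subseteq> {n. set_mset n \<subseteq> ?V \<and> size n \<le> 2 * size m}"
  proof
    fix n assume "n \<in> {n \<in> {n. 0 \<le> jet_weight n}. mfps_coeff (gpow Q n) m \<noteq> 0}"
    then have n: "0 \<le> jet_weight n" "mfps_coeff (gpow Q n) m \<noteq> 0" by auto
    have "low n \<le> size m" by (rule low[OF n(2)])
    moreover have "hi n \<le> size m" using wle[of n] n(1) \<open>low n \<le> size m\<close> by linarith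
    ultimately have "size n \<le> 2 * size m" using sz[of n] by linarith
    moreover have "set_mset n \<subseteq> ?V"
    proof
      fix x assume "x \<in># n"
      then have "snd x \<le> size m + 1" using mem[of x n] \<open>hi n \<le> size m\<close> by linarith
      then show "x \<in> ?V" by (cases x) auto
    qed
    ultimately show "n \<in> {n. set_mset n \<subseteq> ?V \<and> size n \<le> 2 * size m}" by blast
  qed
  moreover have "finite {n. set_mset n \<subseteq> ?V \<and> size n \<le> 2 * size m}"
    by (rule finite_bounded_multisets) simp
  ultimately show "finite {n \<in> {n. 0 \<le> jet_weight n}. mfps_coeff (gpow Q n) m \<noteq> 0}" by (rule finite_subset)
qed

context
  fixes F :: "'n :: finite \<Rightarrow> 'n mfps" and A :: "complex^'n" and J :: "nat \<Rightarrow> 'n mfps^'n^'n"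
  assumes flat: "flat_F_manifold F A" and cal: "calibration F J"
begin

lemma calibration_first:
  "(\<Sum>\<beta>\<in>UNIV. mfps_const (A $ \<beta>) * J 1 $ \<alpha> $ \<beta>) = mfps_const (cal_shift A J $ \<alpha>) + mfps_var \<alpha>"
  using calibration_unit[OF cal flat, of \<alpha>] by simp

text \<open>
  To leading order only the term \<open>b = 1\<close> of the Euler-Lagrange equation depends on \<open>y\<close>, and the unit
  axiom shows that it depends on it through \<open>-y\<close>.  This is the nondegeneracy behind existence and
  uniqueness of the solution.
\<close>

lemma euler_diff:
  fixes y y' :: "'n \<Rightarrow> 'v mfps"
  assumes z: "\<And>\<alpha>. mfps_coeff (y \<alpha>) {#} = 0" "\<And>\<alpha>. mfps_coeff (y' \<alpha>) {#} = 0"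
    and a: "\<And>\<alpha>. agree {m. size m < d} (y \<alpha>) (y' \<alpha>)" and m: "size m \<le> d"
    and s: "mfps_summable (pterm y (lower_Omega J) q \<alpha>)" "mfps_summable (pterm y' (lower_Omega J) q \<alpha>)"
    and q1: "\<And>\<beta>. mfps_coeff (q 1 \<beta>) {#} = - (A $ \<beta>)"
    and q: "\<And>b \<alpha> \<beta> \<gamma>. b \<noteq> 1 \<Longrightarrow> mfps_coeff (lower_Omega J b $ \<alpha> $ \<beta>) {#\<gamma>#} * mfps_coeff (q b \<beta>) {#} = 0"
  shows "mfps_coeff (pairing y (lower_Omega J) q \<alpha>) m - mfps_coeff (pairing y' (lower_Omega J) q \<alpha>) m =
    - (mfps_coeff (y \<alpha>) m - mfps_coeff (y' \<alpha>) m)"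
proof -
  let ?L = "lower_Omega J"
  have t: "mfps_coeff (pterm y ?L q \<alpha> b) m - mfps_coeff (pterm y' ?L q \<alpha> b) m =
      (\<Sum>\<gamma>\<in>UNIV. (\<Sum>\<beta>\<in>UNIV. mfps_coeff (?L b $ \<alpha> $ \<beta>) {#\<gamma>#} * mfps_coeff (q b \<beta>) {#}) *
        (mfps_coeff (y \<gamma>) m - mfps_coeff (y' \<gamma>) m))" for b
  proof -
    have "mfps_coeff (pterm y ?L q \<alpha> b) m - mfps_coeff (pterm y' ?L q \<alpha> b) m =
      (\<Sum>\<beta>\<in>UNIV. mfps_coeff (mfps_subst y (?L b $ \<alpha> $ \<beta>) * q b \<beta>) m - mfps_coeff (mfps_subst y' (?L b $ \<alpha> $ \<beta>) * q b \<beta>) m)"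
      by (simp add: pterm_def sum_subtractf)
    also have "\<dots> = (\<Sum>\<beta>\<in>UNIV. (mfps_coeff (mfps_subst y (?L b $ \<alpha> $ \<beta>)) m - mfps_coeff (mfps_subst y' (?L b $ \<alpha> $ \<beta>)) m) * mfps_coeff (q b \<beta>) {#})"
      by (intro sum.cong refl coeff_times_diff[OF _ m] agree_subst divisor_closed_size a)
    also have "\<dots> = (\<Sum>\<beta>\<in>UNIV. \<Sum>\<gamma>\<in>UNIV. mfps_coeff (?L b $ \<alpha> $ \<beta>) {#\<gamma>#} * mfps_coeff (q b \<beta>) {#} *
        (mfps_coeff (y \<gamma>) m - mfps_coeff (y' \<gamma>) m))"
      by (simp add: coeff_subst_diff[of y y' d, OF z a m] sum_distrib_left sum_distrib_right mult_ac)
    also have "\<dots> = (\<Sum>\<gamma>\<in>UNIV. (\<Sum>\<beta>\<in>UNIV. mfps_coeff (?L b $ \<alpha> $ \<beta>) {#\<gamma>#} * mfps_coeff (q b \<beta>) {#}) *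
        (mfps_coeff (y \<gamma>) m - mfps_coeff (y' \<gamma>) m))"
      by (subst sum.swap) (simp add: sum_distrib_right)
    finally show ?thesis .
  qed
  have lin: "(\<Sum>\<beta>\<in>UNIV. mfps_coeff (?L 1 $ \<alpha> $ \<beta>) {#\<gamma>#} * mfps_coeff (q 1 \<beta>) {#}) = (if \<alpha> = \<gamma> then - 1 else 0)" for \<gamma>
  proof -
    have "(\<Sum>\<beta>\<in>UNIV. mfps_coeff (?L 1 $ \<alpha> $ \<beta>) {#\<gamma>#} * mfps_coeff (q 1 \<beta>) {#}) =
        - mfps_coeff (\<Sum>\<beta>\<in>UNIV. mfps_const (A $ \<beta>) * J 1 $ \<alpha> $ \<beta>) {#\<gamma>#}"
      by (simp only: q1 lower_Omega_1) (simp add: sum_negf mult.commute)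
    then show ?thesis unfolding calibration_first by simp
  qed
  let ?I = "{b. mfps_coeff (pterm y ?L q \<alpha> b) m \<noteq> 0} \<union> {b. mfps_coeff (pterm y' ?L q \<alpha> b) m \<noteq> 0} \<union> {1}"
  have fin: "finite ?I" using s by (simp add: mfps_summable_def)
  have "mfps_coeff (pairing y ?L q \<alpha>) m - mfps_coeff (pairing y' ?L q \<alpha>) m =
      (\<Sum>b\<in>?I. mfps_coeff (pterm y ?L q \<alpha> b) m - mfps_coeff (pterm y' ?L q \<alpha> b) m)"
    unfolding pairing_def sum_subtractf
    by (intro arg_cong2[where f = minus] mfps_coeff_Sum_superset[OF fin]) auto
  also have "\<dots> = (\<Sum>b\<in>{1}. mfps_coeff (pterm y ?L q \<alpha> b) m - mfps_coeff (pterm y' ?L q \<alpha> b) m)"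
    by (rule sum.mono_neutral_right[OF fin]) (auto simp: t q)
  also have "\<dots> = (\<Sum>\<gamma>\<in>UNIV. (if \<alpha> = \<gamma> then - 1 else 0) * (mfps_coeff (y \<gamma>) m - mfps_coeff (y' \<gamma>) m))"
    by (simp only: t lin finite.emptyI sum.insert[of "{}"] empty_iff not_False_eq_True sum.empty add_0_right)
  also have "\<dots> = - (mfps_coeff (y \<alpha>) m - mfps_coeff (y' \<alpha>) m)"
    by (simp add: if_distrib[of "\<lambda>x. x * _"] cong: if_cong)
  finally show ?thesis .
qed

text \<open>
  Agreement of the two solutions propagates from one degree to the next.
\<close>

lemma euler_unique:
  fixes y y' :: "'n \<Rightarrow> 'v mfps"
  assumes z: "\<And>\<alpha>. mfps_coeff (y \<alpha>) {#} = 0" "\<And>\<alpha>. mfps_coeff (y' \<alpha>) {#} = 0"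
    and s: "\<And>\<alpha>. mfps_summable (pterm y (lower_Omega J) q \<alpha>)" "\<And>\<alpha>. mfps_summable (pterm y' (lower_Omega J) q \<alpha>)"
    and q1: "\<And>\<beta>. mfps_coeff (q 1 \<beta>) {#} = - (A $ \<beta>)"
    and q: "\<And>b \<alpha> \<beta> \<gamma>. b \<noteq> 1 \<Longrightarrow> mfps_coeff (lower_Omega J b $ \<alpha> $ \<beta>) {#\<gamma>#} * mfps_coeff (q b \<beta>) {#} = 0"
    and E: "\<And>\<alpha>. pairing y (lower_Omega J) q \<alpha> = pairing y' (lower_Omega J) q \<alpha>"
  shows "y = y'"
proof -
  have "\<forall>\<alpha>. agree {m. size m < d} (y \<alpha>) (y' \<alpha>)" for d
  proof (induction d)
    case (Suc d)
    show ?case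
    proof
      fix \<alpha>
      show "agree {m. size m < Suc d} (y \<alpha>) (y' \<alpha>)"
        unfolding agree_def
      proof
        fix m :: "'v multiset" assume "m \<in> {m. size m < Suc d}"
        then have m: "size m \<le> d" by simp
        show "mfps_coeff (y \<alpha>) m = mfps_coeff (y' \<alpha>) m"
          using euler_diff[of y y' d m q \<alpha>, OF z Suc[rule_format] m s q1 q] by (simp add: E)
      qed
    qed
  qed (simp add: agree_def)
  then show ?thesis
    by (intro ext mfps_eqI) (metis (mono_tags, lifting) agree_def lessI mem_Collect_eq)
qed

lemma cone_base_linear:
  assumes "b \<noteq> 1"
  shows "mfps_coeff (lower_Omega J b $ \<alpha> $ \<beta>) {#\<gamma>#} * (cone_base s A b $ \<beta>) = 0"
  using assms by (cases "b = 0") (auto simp: cone_base_def lower_Omega_0[OF cal] mat_def)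

lemma euler_empty:
  assumes z: "\<And>\<alpha>. mfps_coeff (w \<alpha>) {#} = 0"
  shows "mfps_coeff (pairing w (lower_Omega J) (q_point A J) \<alpha>) {#} = 0"
proof -
  have "mfps_coeff (pairing w (lower_Omega J) (q_point A J) \<alpha>) {#} =
      (\<Sum>b\<in>{0, 1}. mfps_coeff (pterm w (lower_Omega J) (q_point A J) \<alpha> b) {#})"
    unfolding pairing_def
  proof (rule mfps_coeff_Sum_superset)
    fix b assume "mfps_coeff (pterm w (lower_Omega J) (q_point A J) \<alpha> b) {#} \<noteq> 0"
    then obtain \<beta> where "mfps_coeff ((q_point A J) b \<beta>) {#} \<noteq> 0"
      unfolding pterm_def by (simp) (metis (no_types, lifting) mult_zero_right sum.neutral)
    then show "b \<in> {0, 1}" by (auto simp: coeff_q_coord_empty cone_base_def split: if_splits)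
  qed simp
  also have "\<dots> = cal_shift A J $ \<alpha> - (\<Sum>\<beta>\<in>UNIV. mfps_coeff (J 1 $ \<alpha> $ \<beta>) {#} * A $ \<beta>)"
    by (simp add: pterm_def coeff_subst_empty[of w, OF z] coeff_q_coord_empty lower_Omega_0[OF cal]
        cone_base_def mat_def lower_Omega_1[unfolded One_nat_def] sum_negf
        if_distrib[of "\<lambda>x. mfps_coeff x _"] if_distrib[of "\<lambda>x. x * _"] cong: if_cong)
  also have "(\<Sum>\<beta>\<in>UNIV. mfps_coeff (J 1 $ \<alpha> $ \<beta>) {#} * A $ \<beta>) = cal_shift A J $ \<alpha>"
    by (simp add: calibration_shift_def mult.commute)
  finally show ?thesis by simp
qed

text \<open>
  The solution is the fixed point of \<open>y \<mapsto> y + \<Sum>b. \<Omega>^0_{b-1}(y) q_b\<close>, which gains one degree of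
  agreement in each iteration.  For a normalised calibration all iterates have weight at least one,
  and hence so does the limit.
\<close>

lemma euler_solution_exists:
  obtains w where "euler_solution A J w"
    and "normalised J \<Longrightarrow> (\<forall>\<alpha>. vge jet_weight 1 (w \<alpha>))"
proof -
  let ?\<Phi> = "\<lambda>y \<alpha>. y \<alpha> + pairing y (lower_Omega J) (q_point A J) \<alpha>"
  have "\<exists>w. (\<forall>\<alpha>. mfps_coeff (w \<alpha>) {#} = 0) \<and> ?\<Phi> w = w \<and>
      (\<forall>m. \<exists>k. \<forall>a. mfps_coeff (w a) m = mfps_coeff ((?\<Phi> ^^ k) (\<lambda>_. 0) a) m)"
  proof (rule formal_fixpoint[of ?\<Phi>])
    fix y :: "'n \<Rightarrow> ('n \<times> nat) mfps" and a assume "\<And>a. mfps_coeff (y a) {#} = 0"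
    then show "mfps_coeff (y a + pairing y (lower_Omega J) (q_point A J) a) {#} = 0"
      using euler_empty[of y] by simp
  next
    fix y y' :: "'n \<Rightarrow> ('n \<times> nat) mfps" and d a
    assume z: "\<And>a. mfps_coeff (y a) {#} = 0" "\<And>a. mfps_coeff (y' a) {#} = 0"
      and a: "\<And>a. agree {m. size m < d} (y a) (y' a)"
    show "agree {m. size m < Suc d} (y a + pairing y (lower_Omega J) (q_point A J) a) (y' a + pairing y' (lower_Omega J) (q_point A J) a)"
      unfolding agree_def
    proof
      fix m :: "('n \<times> nat) multiset" assume "m \<in> {m. size m < Suc d}"
      then have m: "size m \<le> d" by simp
      show "mfps_coeff (y a + pairing y (lower_Omega J) (q_point A J) a) m = mfps_coeff (y' a + pairing y' (lower_Omega J) (q_point A J) a) m"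
        using euler_diff[of y y' d m "q_point A J" a, OF z a m] cone_base_linear
        by (simp add: coeff_q_coord_empty cone_base_def algebra_simps)
    qed
  qed blast
  then obtain w where w: "\<And>\<alpha>. mfps_coeff (w \<alpha>) {#} = 0" "?\<Phi> w = w"
    "\<And>m. \<exists>k. \<forall>a. mfps_coeff (w a) m = mfps_coeff ((?\<Phi> ^^ k) (\<lambda>_. 0) a) m" by blast
  have "w \<alpha> + pairing w (lower_Omega J) (q_point A J) \<alpha> = w \<alpha>" for \<alpha> using w(2) by (rule fun_cong)
  then have sol: "euler_solution A J w" using w(1) by (simp add: euler_solution_def)
  moreover have "\<forall>\<alpha>. vge jet_weight 1 (w \<alpha>)" if n: "normalised J"
  proof -
    have "vge jet_weight 1 ((?\<Phi> ^^ k) (\<lambda>_. 0) \<alpha>)" for k \<alpha>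
    proof (induction k arbitrary: \<alpha>)
      case (Suc k)
      let ?y = "(?\<Phi> ^^ k) (\<lambda>_. 0)"
      have "vge jet_weight 1 (mfps_subst ?y (lower_Omega J b $ \<alpha> $ \<beta>) * (q_point A J) b \<beta>)" for b \<beta>
      proof -
        have "cal_shift A J = 0"
          using n by (simp add: calibration_shift_def normalised_def vec_eq_iff)
        then have "vge jet_weight (1 - int b) ((q_point A J) b \<beta>)"
          unfolding q_coord_def by (intro vge_add) (auto simp: vge_def cone_base_def jet_weight_def)
        from vge_times[OF additive_weight_jet_weight vge_subst[OF additive_weight_jet_weight Suc ord_ge_lower_Omega[OF cal n, of b \<alpha> \<beta>]] this]
        show ?thesis by simp
      qed
      then have "vge jet_weight 1 (pairing ?y (lower_Omega J) (q_point A J) \<alpha>)"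
        unfolding pairing_def pterm_def by (intro vge_Sum vge_sum)
      then show ?case using Suc by (simp add: vge_add)
    qed simp
    then have "\<forall>k \<alpha> m. mfps_coeff ((?\<Phi> ^^ k) (\<lambda>_. 0) \<alpha>) m \<noteq> 0 \<longrightarrow> 1 \<le> jet_weight m" unfolding vge_def by blast
    then have "1 \<le> jet_weight m" if "mfps_coeff (w \<alpha>) m \<noteq> 0" for \<alpha> m
      using w(3)[of m] that by auto
    then show ?thesis unfolding vge_def by blast
  qed
  ultimately show ?thesis using that by blast
qed

lemma euler_solution_unique: "euler_solution A J w \<Longrightarrow> euler_solution A J w' \<Longrightarrow> w = w'"
  unfolding euler_solution_def
  by (rule euler_unique[where q = "q_point A J"]) (use cone_base_linear in \<open>auto simp: coeff_q_coord_empty cone_base_def\<close>)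

lemma euler_solution_jet_weight: "normalised J \<Longrightarrow> euler_solution A J w \<Longrightarrow> vge jet_weight 1 (w \<alpha>)"
  by (metis euler_solution_exists euler_solution_unique)

end

section \<open>The Euler-Lagrange equation and the descendant hierarchy\<close>

context
  fixes F :: "'n :: finite \<Rightarrow> 'n mfps" and A :: "complex^'n" and J :: "nat \<Rightarrow> 'n mfps^'n^'n"
  assumes flat: "flat_F_manifold F A" and cal: "calibration F J"
begin

context
  fixes w :: "'n \<Rightarrow> ('n \<times> nat) mfps"
  assumes z: "\<And>\<alpha>. mfps_coeff (w \<alpha>) {#} = 0"
begin

definition C_at :: "'n \<Rightarrow> (('n \<times> nat) mfps, 'n) sqm" where
  "C_at u = smap (mfps_subst w) (struct_mat F u)"

definition lower_at :: "nat \<Rightarrow> (('n \<times> nat) mfps, 'n) sqm" where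
  "lower_at d = smap (mfps_subst w) (SQ (lower_Omega J d))"

definition euler_jacobi_coeff :: "'n \<Rightarrow> ('n \<times> nat) mfps" where
  "euler_jacobi_coeff \<mu> = pairing w (lower_Omega J) (\<lambda>b. q_point A J (Suc b)) \<mu>"

text \<open>
  The matrix through which the Euler-Lagrange expression depends on \<open>w\<close> infinitesimally.
\<close>

definition euler_jacobi :: "(('n \<times> nat) mfps, 'n) sqm" where
  "euler_jacobi = (\<Sum>\<mu>\<in>UNIV. scal (euler_jacobi_coeff \<mu>) (C_at \<mu>))"

definition flow :: "nat \<Rightarrow> (('n \<times> nat) mfps, 'n) sqm" where
  "flow d = mat_of (\<lambda>\<alpha> \<beta>. mfps_deriv (\<beta>, d) (w \<alpha>))"

text \<open>
  Multiplication by \<open>\<partial>_x w\<close>, where \<open>x\<close> is the direction of the unit on the small phase space.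
\<close>

definition x_flow_mult :: "(('n \<times> nat) mfps, 'n) sqm" where
  "x_flow_mult = (\<Sum>u\<in>UNIV. scal (\<Sum>\<gamma>\<in>UNIV. mfps_const (A $ \<gamma>) * mfps_deriv (\<gamma>, 0) (w u)) (C_at u))"

definition euler_flow :: "nat \<Rightarrow> (('n \<times> nat) mfps, 'n) sqm" where
  "euler_flow d = mat_of (\<lambda>\<alpha> \<beta>. mfps_deriv (\<beta>, d) (pairing w (lower_Omega J) (q_point A J) \<alpha>))"

lemma substw [simp]: "mfps_substitutable w f"
  by (rule substitutable_UNIV[OF subst_adm_finite[OF z]])

lemma lower_at_0: "lower_at 0 = 1"
  by (rule sqm_eqI) (simp add: lower_at_def lower_Omega_0[OF cal] mat_def)

lemma subst_structure_sum:
  "mfps_subst w (\<Sum>\<mu>\<in>UNIV. structure_const F \<alpha> \<gamma> \<mu> * lower_Omega J d $ \<mu> $ \<beta>) = entry (C_at \<gamma> * lower_at d) \<alpha> \<beta>"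
  by (simp add: subst_sum subst_mult entry_times C_at_def lower_at_def)

text \<open>
  Differentiating the Euler-Lagrange expression produces \<open>\<Omega>^0_{d-1}(w)\<close> from the explicit \<open>q_d\<close>, and
  from the dependence on \<open>w\<close>, by \<open>\<partial>\<Omega>^0_b = C \<Omega>^0_{b-1}\<close>, the derivative of \<open>w\<close> multiplied by a
  combination of the structure matrices.
\<close>

lemma euler_deriv: "euler_flow d = euler_jacobi * flow d + lower_at d"
proof (rule sqm_eqI)
  fix \<alpha> \<beta>
  let ?L = "lower_Omega J"
  let ?T = "\<lambda>b. \<Sum>\<delta>\<in>UNIV. mfps_deriv (\<beta>, d) (mfps_subst w (?L b $ \<alpha> $ \<delta>)) * q_point A J b \<delta>"
  let ?U = "\<lambda>b. \<Sum>\<delta>\<in>UNIV. mfps_subst w (?L b $ \<alpha> $ \<delta>) * mfps_deriv (\<beta>, d) (q_point A J b \<delta>)"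
  have sT: "mfps_summable ?T"
    by (intro mfps_summable_sum mfps_summable_mult_gen q_coord_summable)
  have U0: "?U b = (if b = d then mfps_subst w (?L d $ \<alpha> $ \<beta>) else 0)" for b
    by (simp add: q_coord_deriv if_distrib[of "\<lambda>x. _ * x"] cong: if_cong)
  have sU: "mfps_summable ?U" unfolding U0
    by (rule mfps_summable_finite_support[of "{d}"]) auto
  have U: "mfps_Sum ?U = entry (lower_at d) \<alpha> \<beta>" unfolding U0
    by (subst mfps_Sum_eq_sum[of "{d}"]) (auto simp: lower_at_def)
  have "mfps_subst w (?L 0 $ \<alpha> $ \<delta>) = (if \<alpha> = \<delta> then 1 else 0)" for \<delta>
    by (simp add: lower_Omega_0[OF cal] mat_def)
  then have T0: "?T 0 = 0" by (auto intro!: sum.neutral)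
  have TS: "?T (Suc b) = (\<Sum>u\<in>UNIV. \<Sum>\<mu>\<in>UNIV. (entry (C_at u) \<alpha> \<mu> * entry (flow d) u \<beta>) * pterm w ?L (\<lambda>b. q_point A J (Suc b)) \<mu> b)" for b
  proof -
    have "mfps_deriv (\<beta>, d) (mfps_subst w (?L (Suc b) $ \<alpha> $ \<delta>)) =
        (\<Sum>u\<in>UNIV. \<Sum>\<mu>\<in>UNIV. entry (C_at u) \<alpha> \<mu> * entry (lower_at b) \<mu> \<delta> * entry (flow d) u \<beta>)" for \<delta>
      by (simp add: mfps_deriv_subst[of w, OF z] deriv_lower_Omega[OF cal] subst_structure_sum entry_times flow_def sum_distrib_right)
    then have "?T (Suc b) = (\<Sum>\<delta>\<in>UNIV. \<Sum>u\<in>UNIV. \<Sum>\<mu>\<in>UNIV. entry (C_at u) \<alpha> \<mu> * entry (lower_at b) \<mu> \<delta> * entry (flow d) u \<beta> * q_point A J (Suc b) \<delta>)"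
      by (simp add: sum_distrib_right)
    also have "\<dots> = (\<Sum>u\<in>UNIV. \<Sum>\<mu>\<in>UNIV. \<Sum>\<delta>\<in>UNIV. entry (C_at u) \<alpha> \<mu> * entry (lower_at b) \<mu> \<delta> * entry (flow d) u \<beta> * q_point A J (Suc b) \<delta>)"
      by (subst sum.swap) (intro sum.cong refl sum.swap)
    finally show ?thesis by (simp add: pterm_def sum_distrib_left lower_at_def mult_ac)
  qed
  have sp: "mfps_summable (pterm w ?L (\<lambda>b. q_point A J (Suc b)) \<mu>)" for \<mu>
    by (rule pterm_summable) (use mfps_summable_inj[OF q_coord_summable, of Suc] in simp)
  have Tout: "?T b = 0" if "b \<notin> range Suc" for b
    using that T0 by (cases b) auto
  have "mfps_Sum ?T = mfps_Sum (\<lambda>b. ?T (Suc b))"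
    by (rule mfps_Sum_reindex[of Suc ?T, symmetric]) (use T0 in \<open>auto intro: Tout\<close>)
  also have "\<dots> = (\<Sum>u\<in>UNIV. \<Sum>\<mu>\<in>UNIV. (entry (C_at u) \<alpha> \<mu> * entry (flow d) u \<beta>) * euler_jacobi_coeff \<mu>)"
    unfolding TS
    by (simp add: mfps_Sum_sum mfps_summable_sum mfps_summable_mult_gen sp mfps_Sum_mult_left euler_jacobi_coeff_def pairing_def)
  also have "\<dots> = (\<Sum>u\<in>UNIV. \<Sum>\<mu>\<in>UNIV. euler_jacobi_coeff \<mu> * entry (C_at \<mu>) \<alpha> u * entry (flow d) u \<beta>)"
  proof (intro sum.cong refl)
    fix u \<mu>
    have "entry (C_at u) \<alpha> \<mu> = entry (C_at \<mu>) \<alpha> u"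
      by (simp add: C_at_def structure_const_sym[of F \<alpha> u \<mu>])
    then show "entry (C_at u) \<alpha> \<mu> * entry (flow d) u \<beta> * euler_jacobi_coeff \<mu> = euler_jacobi_coeff \<mu> * entry (C_at \<mu>) \<alpha> u * entry (flow d) u \<beta>"
      by (simp add: mult_ac)
  qed
  also have "\<dots> = entry (euler_jacobi * flow d) \<alpha> \<beta>"
    by (simp add: entry_times euler_jacobi_def sum_distrib_right, rule sum.swap)
  finally have T: "mfps_Sum ?T = entry (euler_jacobi * flow d) \<alpha> \<beta>" .
  have "entry (euler_flow d) \<alpha> \<beta> = mfps_Sum (\<lambda>b. ?T b + ?U b)"
    by (simp add: euler_flow_def pairing_def mfps_deriv_Sum)
      (simp add: pterm_def mfps_deriv_sum mfps_deriv_mult sum.distrib)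
  also have "\<dots> = mfps_Sum ?T + mfps_Sum ?U" by (rule mfps_Sum_add[OF sT sU])
  finally show "entry (euler_flow d) \<alpha> \<beta> = entry (euler_jacobi * flow d + lower_at d) \<alpha> \<beta>" by (simp add: T U)
qed

lemma hierarchy_rhs:
  "(\<Sum>\<gamma>\<in>UNIV. mfps_const (A $ \<gamma>) * mfps_deriv (\<gamma>, 0) (mfps_subst w (Omega J 0 d $ \<alpha> $ \<beta>))) =
    entry (x_flow_mult * lower_at d) \<alpha> \<beta>"
proof -
  have "(\<Sum>\<gamma>\<in>UNIV. mfps_const (A $ \<gamma>) * mfps_deriv (\<gamma>, 0) (mfps_subst w (Omega J 0 d $ \<alpha> $ \<beta>))) =
     (\<Sum>\<gamma>\<in>UNIV. \<Sum>u\<in>UNIV. mfps_const (A $ \<gamma>) * (entry (C_at u * lower_at d) \<alpha> \<beta> * mfps_deriv (\<gamma>, 0) (w u)))"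
    by (simp add: mfps_deriv_subst[of w, OF z] deriv_Omega_0[OF cal] subst_structure_sum sum_distrib_left)
  also have "\<dots> = (\<Sum>u\<in>UNIV. \<Sum>\<gamma>\<in>UNIV. mfps_const (A $ \<gamma>) * (entry (C_at u * lower_at d) \<alpha> \<beta> * mfps_deriv (\<gamma>, 0) (w u)))"
    by (rule sum.swap)
  also have "\<dots> = entry (x_flow_mult * lower_at d) \<alpha> \<beta>"
    unfolding x_flow_mult_def sum_distrib_right entry_sum scal_simps entry_scal by (simp add: mult_ac)
  finally show ?thesis .
qed

lemma hierarchy_iff:
  "(\<forall>\<alpha> \<beta> d. mfps_deriv (\<beta>, d) (w \<alpha>) =
        (\<Sum>\<gamma>\<in>UNIV. mfps_const (A $ \<gamma>) * mfps_deriv (\<gamma>, 0) (mfps_subst w (Omega J 0 d $ \<alpha> $ \<beta>)))) \<longleftrightarrow>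
    (\<forall>d. flow d = x_flow_mult * lower_at d)"
  unfolding hierarchy_rhs by (auto simp: flow_def intro!: sqm_eqI) (metis entry_mat_of)

text \<open>
  On the small phase space only the terms with \<open>b \<le> 1\<close> survive, and the unit axiom evaluates the
  term \<open>b = 1\<close>.
\<close>

lemma euler_small_phase_space:
  "agree {m. \<forall>x\<in>#m. snd x = 0} (pairing w (lower_Omega J) (q_point A J) \<alpha>) (mfps_var (\<alpha>, 0) - w \<alpha>)"
proof -
  let ?L = "lower_Omega J" and ?D = "{m :: ('n \<times> nat) multiset. \<forall>x\<in>#m. snd x = 0}"
  have D: "divisor_closed ?D" by (auto simp: divisor_closed_def dest: mset_subset_eqD)
  let ?q = "\<lambda>b \<beta>. if b = 0 then q_point A J 0 \<beta> else mfps_const (cone_base (cal_shift A J) A b $ \<beta>)"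
  have q: "agree ?D (q_point A J b \<beta>) (?q b \<beta>)" for b \<beta>
    by (cases "b = 0") (auto simp: agree_def q_coord_def)
  have "agree ?D (pterm w ?L (q_point A J) \<alpha> b) (pterm w ?L ?q \<alpha> b)" for b
    unfolding pterm_def
    by (simp add: agree_def del: mfps_coeff_times_empty)
      (intro ballI allI impI sum.cong refl agree_times[OF D agree_refl q, unfolded agree_def, rule_format], simp)
  then have "agree ?D (pairing w ?L (q_point A J) \<alpha>) (pairing w ?L ?q \<alpha>)"
    unfolding pairing_def by (rule agree_Sum)
  moreover have "pairing w ?L ?q \<alpha> = mfps_var (\<alpha>, 0) - w \<alpha>"
  proof -
    have "pairing w ?L ?q \<alpha> = pterm w ?L ?q \<alpha> 0 + pterm w ?L ?q \<alpha> 1"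
      unfolding pairing_def
      by (subst mfps_Sum_eq_sum[of "{0, 1}"]) (auto simp: pterm_def cone_base_def mfps_const_simps)
    moreover have "pterm w ?L ?q \<alpha> 0 = q_point A J 0 \<alpha>"
      by (simp add: pterm_def lower_Omega_0[OF cal] mat_def if_distrib[of "mfps_subst w"]
          if_distrib[of "\<lambda>x. x * _"] cong: if_cong)
    moreover have "pterm w ?L ?q \<alpha> 1 = - mfps_subst w (\<Sum>\<beta>\<in>UNIV. mfps_const (A $ \<beta>) * J 1 $ \<alpha> $ \<beta>)"
      by (simp add: pterm_def lower_Omega_1[unfolded One_nat_def] cone_base_def mfps_const_simps
          subst_sum subst_mult sum_negf mult.commute)
    then have "pterm w ?L ?q \<alpha> 1 = - (mfps_const (cal_shift A J $ \<alpha>) + w \<alpha>)"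
      unfolding calibration_first[OF flat cal] by (simp add: subst_add)
    ultimately show ?thesis
      by (simp add: q_coord_def cone_base_def)
  qed
  ultimately show ?thesis by simp
qed

text \<open>
  Under the hierarchy the derivatives of the Euler-Lagrange expression with respect to the higher
  times are combinations of its derivatives with respect to \<open>t_0\<close>.  Since the expression
  vanishes on the small phase space, induction on the number of higher times in a monomial kills
  all its coefficients.
\<close>

lemma hierarchy_imp_euler:
  assumes "\<And>d. flow d = x_flow_mult * lower_at d"
    and small: "\<And>\<alpha> m. (\<forall>x\<in>#m. snd x = 0) \<Longrightarrow> mfps_coeff (w \<alpha>) m = mfps_coeff (mfps_var (\<alpha>, 0)) m"
  shows "pairing w (lower_Omega J) (q_point A J) \<alpha> = 0"
proof -
  let ?E = "pairing w (lower_Omega J) (q_point A J)"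
  have "euler_flow d = euler_flow 0 * lower_at d" for d
    unfolding euler_deriv assms(1) by (simp add: lower_at_0 ring_distribs mult.assoc)
  then have dE: "mfps_deriv (\<beta>, d) (?E \<alpha>) = (\<Sum>\<mu>\<in>UNIV. mfps_deriv (\<mu>, 0) (?E \<alpha>) * entry (lower_at d) \<mu> \<beta>)" for d \<alpha> \<beta>
    by (metis (no_types, lifting) euler_flow_def entry_mat_of entry_times sum.cong)
  \<comment> \<open>\<open>h\<close> counts the higher times; the right-hand side of \<open>dE\<close> replaces one of them by a variable \<open>t_0\<close>.\<close>
  define h where "h m = size (filter_mset (\<lambda>x. snd x \<noteq> 0) m)" for m :: "('n \<times> nat) multiset"
  have "mfps_coeff (?E \<alpha>) m = 0" if "h m = k" for k m \<alpha>
    using that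
  proof (induction k arbitrary: m \<alpha> rule: less_induct)
    case (less k)
    show ?case
    proof (cases "\<forall>x\<in>#m. snd x = 0")
      case True
      then show ?thesis
        using euler_small_phase_space[of \<alpha>] small[of m \<alpha>] by (simp add: agree_def)
    next
      case False
      then obtain \<beta> d where x: "(\<beta>, d) \<in># m" "d \<noteq> 0" by auto
      then obtain n where m: "m = add_mset (\<beta>, d) n" "d \<noteq> 0" by (meson multi_member_split)
      have "mfps_coeff (mfps_deriv (\<beta>, d) (?E \<alpha>)) n = 0"
        unfolding dE[of \<beta> d \<alpha>] mfps_coeff_sum mfps_coeff_times
      proof (intro sum.neutral ballI)
        fix \<mu> p assume p: "p \<in> msplits n"
        have "h (add_mset (\<mu>, 0) (fst p)) < k"
          using p m less.prems by (auto simp: h_def msplits_def)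
        then have "mfps_coeff (?E \<alpha>) (add_mset (\<mu>, 0) (fst p)) = 0" using less.IH by blast
        then show "mfps_coeff (mfps_deriv (\<mu>, 0) (?E \<alpha>)) (fst p) * mfps_coeff (entry (lower_at d) \<mu> \<beta>) (snd p) = 0"
          by simp
      qed
      moreover have "(of_nat (Suc (count n (\<beta>, d))) :: complex) \<noteq> 0" by (simp del: of_nat_Suc)
      ultimately show ?thesis by (simp add: m del: of_nat_Suc)
    qed
  qed
  then show ?thesis by (intro mfps_eqI) simp
qed

text \<open>
  Differentiating the equation gives \<open>\<Gamma> \<partial>_d w = - \<Omega>^0_{d-1}\<close> for a matrix \<open>\<Gamma>\<close> which is a
  combination of structure matrices.  Multiplication by \<open>\<partial>_x w\<close> is the negative of the inverse of
  \<open>\<Gamma>\<close>: by commutativity it suffices to know \<open>\<Gamma> \<partial>_x w\<close>, which the case \<open>d = 0\<close> evaluates to minus the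
  unit.
\<close>

lemma euler_imp_hierarchy:
  assumes E: "\<And>\<alpha>. pairing w (lower_Omega J) (q_point A J) \<alpha> = 0"
  shows "flow d = x_flow_mult * lower_at d"
proof -
  have "euler_flow d = 0" for d by (rule sqm_eqI) (simp add: euler_flow_def E)
  then have D: "euler_jacobi * flow d = - lower_at d" for d
    using euler_deriv[of d] by (simp add: eq_neg_iff_add_eq_0)
  have ChC: "C_at u * C_at v = C_at v * C_at u" for u v
  proof -
    have "C_at u * C_at v = smap (mfps_subst w) (struct_mat F u * struct_mat F v)" for u v
      by (rule sqm_eqI) (simp add: entry_times C_at_def subst_sum subst_mult)
    then show ?thesis by (simp add: struct_mat_commute[OF flat, of u v])
  qed
  have GC: "euler_jacobi * C_at u = C_at u * euler_jacobi" for u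
    by (simp add: euler_jacobi_def sum_distrib_left sum_distrib_right scal_simps ChC[of _ u])
  have GW: "euler_jacobi * x_flow_mult = x_flow_mult * euler_jacobi"
    by (simp add: x_flow_mult_def sum_distrib_left sum_distrib_right scal_simps GC)
  have "euler_jacobi * x_flow_mult = - 1"
  proof (rule sqm_eqI)
    fix \<alpha> \<delta>
    let ?a = "\<lambda>\<gamma>. mfps_const (A $ \<gamma>) :: ('n \<times> nat) mfps"
    define wx where "wx u = (\<Sum>\<gamma>\<in>UNIV. entry (flow 0) u \<gamma> * ?a \<gamma>)" for u
    have W: "entry x_flow_mult \<mu> \<delta> = (\<Sum>u\<in>UNIV. entry (C_at \<delta>) \<mu> u * wx u)" for \<mu>
      by (simp add: wx_def x_flow_mult_def flow_def C_at_def structure_const_sym[of F \<mu> \<delta>] mult_ac)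
    have "entry (euler_jacobi * x_flow_mult) \<alpha> \<delta> = (\<Sum>u\<in>UNIV. entry (euler_jacobi * C_at \<delta>) \<alpha> u * wx u)"
      unfolding entry_times W sum_distrib_left sum_distrib_right
      by (subst sum.swap) (simp add: mult.assoc)
    also have "\<dots> = (\<Sum>\<gamma>\<in>UNIV. entry (C_at \<delta> * (euler_jacobi * flow 0)) \<alpha> \<gamma> * ?a \<gamma>)"
      unfolding GC mult.assoc[symmetric] entry_times[of _ "flow 0"] wx_def sum_distrib_left sum_distrib_right
      by (subst sum.swap) (simp add: mult.assoc)
    also have "\<dots> = - (\<Sum>\<gamma>\<in>UNIV. ?a \<gamma> * entry (C_at \<delta>) \<alpha> \<gamma>)"
      by (simp add: D lower_at_0 sum_negf mult.commute)
    also have "(\<Sum>\<gamma>\<in>UNIV. ?a \<gamma> * entry (C_at \<delta>) \<alpha> \<gamma>) = mfps_subst w (\<Sum>\<gamma>\<in>UNIV. mfps_const (A $ \<gamma>) * structure_const F \<alpha> \<delta> \<gamma>)"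
      by (simp add: subst_sum subst_mult C_at_def)
    finally show "entry (euler_jacobi * x_flow_mult) \<alpha> \<delta> = entry (- 1) \<alpha> \<delta>"
      by (simp add: flat_unit'[OF flat])
  qed
  then have "- flow d = x_flow_mult * (euler_jacobi * flow d)" by (simp add: mult.assoc[symmetric] GW[symmetric])
  then show ?thesis by (simp add: D)
qed

end

lemma euler_solution_iff: "descendant_solution A J w \<longleftrightarrow> euler_solution A J w"
proof
  assume d: "descendant_solution A J w"
  have z: "mfps_coeff (w \<alpha>) {#} = 0" for \<alpha>
    using d by (auto simp: descendant_solution_def)
  note d' = d[unfolded descendant_solution_def]
  have "\<forall>d. flow w d = x_flow_mult w * lower_at w d"
    using hierarchy_iff[of w, OF z] d'[THEN conjunct1] by (rule iffD1)
  then have "pairing w (lower_Omega J) (q_point A J) \<alpha> = 0" for \<alpha>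
    using d'[THEN conjunct2] by (intro hierarchy_imp_euler[of w, OF z]) simp_all
  then show "euler_solution A J w"
    unfolding euler_solution_def using z by simp
next
  assume e: "euler_solution A J w"
  then have z: "mfps_coeff (w \<alpha>) {#} = 0" for \<alpha> by (simp add: euler_solution_def)
  have "mfps_coeff (w \<alpha>) m = mfps_coeff (mfps_var (\<alpha>, 0)) m" if "\<forall>x\<in>#m. snd x = 0" for \<alpha> m
    using euler_small_phase_space[of w \<alpha>, OF z] that e by (simp add: agree_def euler_solution_def)
  moreover have "\<forall>d. flow w d = x_flow_mult w * lower_at w d"
    using euler_imp_hierarchy[of w, OF z] e by (simp add: euler_solution_def)
  note iffD2[OF hierarchy_iff[of w, OF z] this]
  ultimately show "descendant_solution A J w"
    unfolding descendant_solution_def by blast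
qed

end

section \<open>Points on a cone\<close>

text \<open>
  The solution \<open>w\<close> is determined by the calibration, but it is kept as an argument because the
  points of the cone are described in terms of it.
\<close>

definition cone_data ::
    "('n::finite \<Rightarrow> 'n mfps) \<Rightarrow> complex^'n \<Rightarrow> (nat \<Rightarrow> 'n mfps^'n^'n) \<Rightarrow> ('n \<Rightarrow> ('n \<times> nat) mfps) \<Rightarrow>
     'n germ \<Rightarrow> bool" where
  "cone_data F A J w C \<longleftrightarrow> flat_F_manifold F A \<and> calibration F J \<and> euler_solution A J w \<and>
     base C = cone_base (cal_shift A J) A \<and> pot C = (\<lambda>a. pairing w (Omega J a) (q_point A J))"

text \<open>
  The point \<open>t_orig\<close> drops out: all series are centred at it, and the base point of the cone is the
  value of \<open>A^\<beta> \<Omega>_{\<beta>,0}\<close>.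
\<close>

lemma cone_of_iff:
  assumes "flat_F_manifold F A" "calibration F J"
  shows "cone_of t A J C \<longleftrightarrow> (\<exists>w. cone_data F A J w C)"
proof -
  have p: "descendant_potential bs J w = (\<lambda>a. pairing w (Omega J a) (q_coord bs))" for bs w
    by (rule ext) (rule descendant_potential_pairing)
  show ?thesis
    unfolding cone_of_def cone_data_def calibration_shift_eq euler_solution_iff[OF assms] p
    using assms by auto
qed

lemma cone_data_exists:
  fixes F :: "'n :: finite \<Rightarrow> 'n mfps"
  assumes "flat_F_manifold F A" "calibration F J"
  shows "\<exists>C w. cone_data F A J w C"
proof -
  obtain w where "euler_solution A J w" using euler_solution_exists[OF assms] by blast
  then have "cone_data F A J w \<lparr>base = cone_base (cal_shift A J) A,
      pot = (\<lambda>a. pairing w (Omega J a) (q_point A J))\<rparr>"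
    using assms by (simp add: cone_data_def)
  then show ?thesis by blast
qed

lemma cone_data_unique:
  assumes "cone_data F A J w C" "cone_data F A J w' C'"
  shows "C = C'"
proof -
  have "w = w'" using assms euler_solution_unique unfolding cone_data_def by blast
  then show ?thesis using assms unfolding cone_data_def by (intro germ.equality) auto
qed

lemma cal_shift_normalised: "normalised J \<Longrightarrow> cal_shift A J = 0"
  by (simp add: calibration_shift_def normalised_def vec_eq_iff)

text \<open>
  Substituting \<open>w\<close>, of weight at least one, into a series of order \<open>j + b\<close> gives weight \<open>j + b\<close>, of
  which multiplication by \<open>q_b\<close> loses at most \<open>b - 1\<close>.
\<close>

lemma pterm_jet_weight:
  assumes w: "\<And>v. vge jet_weight 1 (w v)" and X: "\<And>b \<alpha> \<beta>. ord_ge (j + b) (X b $ \<alpha> $ \<beta>)"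
    and n: "normalised J"
  shows "vge jet_weight (int j + 1) (pterm w X (q_point A J) \<alpha> b)"
  unfolding pterm_def
proof (rule vge_sum)
  fix \<beta>
  have "vge jet_weight (1 - int b) (q_point A J b \<beta>)"
    unfolding q_coord_def
    by (intro vge_add) (auto simp: vge_def cone_base_def jet_weight_def cal_shift_normalised[OF n])
  from vge_times[OF additive_weight_jet_weight vge_subst[OF additive_weight_jet_weight w X[of b \<alpha> \<beta>]] this]
  show "vge jet_weight (int j + 1) (mfps_subst w (X b $ \<alpha> $ \<beta>) * q_point A J b \<beta>)"
    by (rule vge_mono) simp
qed

lemma pot_jet_weight:
  assumes "cone_data F A J w C" and n: "normalised J"
  shows "vge jet_weight (int a + 2) (pot C a \<alpha>)"
proof -
  note cd = assms(1)[unfolded cone_data_def]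
  have w: "vge jet_weight 1 (w v)" for v using euler_solution_jet_weight n cd by blast
  have "vge jet_weight (int (a + 1) + 1) (pterm w (Omega J a) (q_point A J) \<alpha> b)" for b
    using ord_ge_Omega[of F J a] cd n
    by (intro pterm_jet_weight w n) (auto simp: add_ac intro: ord_ge_mono)
  then show ?thesis using cd by (simp add: pairing_def vge_Sum add_ac)
qed

lemma pot_ord:
  assumes "cone_data F A J w C" and n: "normalised J"
  shows "ord_ge (a + 2) (pot C a \<alpha>)"
  by (rule ord_ge_jet_weight) (use pot_jet_weight[OF assms, of a \<alpha>] in \<open>simp add: add.commute\<close>)

lemma ancestor_coneI:
  assumes "cone_data F A J w C" and n: "normalised J"
  shows "ancestor_cone C"
proof -
  have "cone_of 0 A J C" "0 + calibration_shift 0 A J = 0"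
    using assms cone_of_iff[of F A J 0 C] cal_shift_normalised[OF n, of A] unfolding cone_data_def by auto
  moreover have "mfps_coeff (mfps_deriv (\<beta>, b) (pot C a \<alpha>)) {#} = 0" for a \<alpha> \<beta> b
    using ord_geD[OF pot_ord[OF assms, of a \<alpha>], of "{#(\<beta>, b)#}"] by simp
  ultimately show ?thesis
    using assms unfolding ancestor_cone_def cone_data_def by blast
qed

text \<open>
  Re-expansion around another point: since \<open>q_b\<close> is a base value plus a variable, substituting the
  shifted coordinates turns it into the coordinate of the new point.
\<close>

lemma pairing_subst:
  fixes Q :: "'n :: finite \<times> nat \<Rightarrow> 'v mfps"
  assumes z: "\<And>v. mfps_coeff (w v) {#} = 0"
    and adm: "subst_adm Q T" "submonoid T" "\<And>v. supp_in T (w v)"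
    and supp: "\<And>b. supp_in T (pterm w X (q_point A J) \<alpha> b)"
    and Q: "\<And>\<alpha> d. Q (\<alpha>, d) = q d \<alpha> - mfps_const (cone_base (cal_shift A J) A d $ \<alpha>)"
  shows "mfps_summable (pterm (\<lambda>\<alpha>. mfps_subst Q (w \<alpha>)) X q \<alpha>)"
    and "mfps_substitutable Q (pairing w X (q_point A J) \<alpha>)"
    and "mfps_subst Q (pairing w X (q_point A J) \<alpha>) = pairing (\<lambda>\<alpha>. mfps_subst Q (w \<alpha>)) X q \<alpha>"
proof -
  have sq: "mfps_substitutable Q (q_point A J b \<beta>)" "mfps_subst Q (q_point A J b \<beta>) = q b \<beta>" for b \<beta>
    by (simp_all add: q_coord_def substitutable_add subst_add Q)
  have sw: "mfps_substitutable Q (mfps_subst w f)"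
    "mfps_subst Q (mfps_subst w f) = mfps_subst (\<lambda>v. mfps_subst Q (w v)) f" for f
    using subst_subst[OF subst_adm_finite[of w, OF z] adm] by auto
  have t: "mfps_subst Q (pterm w X (q_point A J) \<alpha> b) = pterm (\<lambda>\<alpha>. mfps_subst Q (w \<alpha>)) X q \<alpha> b" for b
    unfolding pterm_def by (subst subst_sum) (simp_all add: substitutable_mult subst_mult sq sw)
  have s: "mfps_summable (pterm w X (q_point A J) \<alpha>)" by (intro pterm_summable q_coord_summable)
  note * = subst_Sum_aux[OF adm(1) s supp]
  show "mfps_summable (pterm (\<lambda>\<alpha>. mfps_subst Q (w \<alpha>)) X q \<alpha>)"
    "mfps_subst Q (pairing w X (q_point A J) \<alpha>) = pairing (\<lambda>\<alpha>. mfps_subst Q (w \<alpha>)) X q \<alpha>"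
    using * unfolding t pairing_def by simp_all
  have "supp_in T (pairing w X (q_point A J) \<alpha>)"
    unfolding supp_in_def pairing_def
  proof (intro allI impI)
    fix n assume "mfps_coeff (mfps_Sum (pterm w X (q_point A J) \<alpha>)) n \<noteq> 0"
    then obtain b where "mfps_coeff (pterm w X (q_point A J) \<alpha> b) n \<noteq> 0"
      unfolding mfps_coeff_Sum by (metis (mono_tags, lifting) mem_Collect_eq sum.neutral)
    then show "n \<in> T" using supp[of b] by (simp add: supp_in_def)
  qed
  then show "mfps_substitutable Q (pairing w X (q_point A J) \<alpha>)" by (rule substitutable_adm[OF adm(1)])
qed

text \<open>
  Substituting the point into \<open>w\<close> gives a solution of the Euler-Lagrange equation for its
  \<open>q\<close>-coordinates.  By uniqueness every solution \<open>y\<close> coincides with it, so that the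
  \<open>p\<close>-coordinates may be tested on any \<open>y\<close> at hand.
\<close>

lemma point_criterion:
  fixes Q :: "'n :: finite \<times> nat \<Rightarrow> 'v mfps" and f :: "int \<Rightarrow> 'n \<Rightarrow> 'v mfps"
  assumes cd: "cone_data F A J w C"
    and adm: "subst_adm Q T" "submonoid T" "\<And>v. supp_in T (w v)"
    and suppO: "\<And>a b \<alpha>. supp_in T (pterm w (Omega J a) (q_point A J) \<alpha> b)"
    and suppL: "\<And>b \<alpha>. supp_in T (pterm w (lower_Omega J) (q_point A J) \<alpha> b)"
    and wQ: "\<And>v n. mfps_coeff (w v) n \<noteq> 0 \<Longrightarrow> mfps_coeff (gpow Q n) {#} = 0"
    and Q: "Q = (\<lambda>(\<alpha>, d). f (int d) \<alpha> - mfps_const (base C d $ \<alpha>))"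
    and y: "\<And>\<alpha>. mfps_coeff (y \<alpha>) {#} = 0"
    and s: "\<And>\<alpha>. mfps_summable (pterm y (lower_Omega J) (\<lambda>d. f (int d)) \<alpha>)"
    and E: "\<And>\<alpha>. pairing y (lower_Omega J) (\<lambda>d. f (int d)) \<alpha> = 0"
    and q1: "\<And>\<beta>. mfps_coeff (f 1 \<beta>) {#} = - (A $ \<beta>)"
    and ql: "\<And>b \<alpha> \<beta> \<gamma>. b \<noteq> 1 \<Longrightarrow> mfps_coeff (lower_Omega J b $ \<alpha> $ \<beta>) {#\<gamma>#} * mfps_coeff (f (int b) \<beta>) {#} = 0"
    and p: "\<And>a \<alpha>. f (- int a - 1) \<alpha> = (- 1) ^ (a + 1) * pairing y (Omega J a) (\<lambda>d. f (int d)) \<alpha>"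
  shows "point_on_germ f C"
proof -
  note cd' = cd[unfolded cone_data_def]
  have z: "mfps_coeff (w v) {#} = 0" for v using cd' by (simp add: euler_solution_def)
  have Q': "Q (\<alpha>, d) = f (int d) \<alpha> - mfps_const (cone_base (cal_shift A J) A d $ \<alpha>)" for \<alpha> d
    using cd' by (simp add: Q)
  note ps = pairing_subst[of w Q T _ A J _ "\<lambda>d. f (int d)", OF z adm _ Q']
  \<comment> \<open>Re-expanding the equation of the germ gives one solution at the point, \<open>y\<close> is another.\<close>
  let ?y = "\<lambda>\<alpha>. mfps_subst Q (w \<alpha>)"
  have y0: "mfps_coeff (?y \<alpha>) {#} = 0" for \<alpha>
    unfolding mfps_subst_eq mfps_coeff_Sum using wQ by (auto intro!: sum.neutral)
  have "pairing ?y (lower_Omega J) (\<lambda>d. f (int d)) \<alpha> = 0" for \<alpha>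
    using ps(3)[of "lower_Omega J" \<alpha>, OF suppL] cd' by (simp add: euler_solution_def)
  then have yy: "?y = y"
    using cd' q1 ql
    by (intro euler_unique[of F A J ?y y "\<lambda>d. f (int d)"] y0 y s ps(1)[OF suppL]) (auto simp: E)
  have "mfps_substitutable Q (pot C a \<alpha>) \<and> f (- int a - 1) \<alpha> = (- 1) ^ (a + 1) * mfps_subst Q (pot C a \<alpha>)" for a \<alpha>
    using ps(2,3)[of "Omega J a" \<alpha>, OF suppO] cd' by (simp only: yy p)
  then show ?thesis by (simp add: point_on_germ_def Let_def Q)
qed

text \<open>
  If the point starts at the base point of the germ, ordinary substitution of series without
  constant term applies.
\<close>

lemma point_criterion_linear:
  fixes f :: "int \<Rightarrow> 'n :: finite \<Rightarrow> 'v mfps"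
  assumes cd: "cone_data F A J w C"
    and f0: "\<And>d \<alpha>. mfps_coeff (f (int d) \<alpha>) {#} = base C d $ \<alpha>"
    and fs: "\<And>\<alpha>. mfps_summable (\<lambda>d. f (int d) \<alpha>)"
    and y: "\<And>\<alpha>. mfps_coeff (y \<alpha>) {#} = 0"
    and E: "\<And>\<alpha>. pairing y (lower_Omega J) (\<lambda>d. f (int d)) \<alpha> = 0"
    and p: "\<And>a \<alpha>. f (- int a - 1) \<alpha> = (- 1) ^ (a + 1) * pairing y (Omega J a) (\<lambda>d. f (int d)) \<alpha>"
  shows "point_on_germ f C"
proof -
  note cd' = cd[unfolded cone_data_def]
  let ?Q = "\<lambda>(\<alpha>, d). f (int d) \<alpha> - mfps_const (base C d $ \<alpha>)"
  have Q0: "mfps_coeff (?Q x) {#} = 0" for x by (cases x) (simp add: f0)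
  have "mfps_summable ?Q"
    unfolding mfps_summable_def
  proof
    fix m
    have "{x. mfps_coeff (?Q x) m \<noteq> 0} \<subseteq> (\<Union>\<alpha>\<in>UNIV. {\<alpha>} \<times> ({d. mfps_coeff (f (int d) \<alpha>) m \<noteq> 0} \<union> {0, 1}))"
      using cd' by (auto simp: cone_base_def split: if_splits)
    moreover have "finite (\<Union>\<alpha>\<in>UNIV. {\<alpha>} \<times> ({d. mfps_coeff (f (int d) \<alpha>) m \<noteq> 0} \<union> {0, 1}))"
      using fs by (auto simp: mfps_summable_def)
    ultimately show "finite {x. mfps_coeff (?Q x) m \<noteq> 0}" by (rule finite_subset)
  qed
  then have adm: "subst_adm ?Q UNIV" using subst_adm_UNIV[of ?Q, OF Q0] by blast
  show ?thesis
  proof (rule point_criterion[OF cd adm _ _ _ _ _ refl y _ E _ _ p])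
    fix v n assume "mfps_coeff (w v) n \<noteq> 0"
    then have "n \<noteq> {#}" using cd' by (auto simp: euler_solution_def)
    then obtain x k where "n = add_mset x k" by (meson multiset_cases)
    then show "mfps_coeff (gpow ?Q n) {#} = 0" using Q0[of x] by simp
  next
    show "mfps_coeff (f 1 \<beta>) {#} = - (A $ \<beta>)" for \<beta>
      using f0[of 1 \<beta>] cd' by (simp add: cone_base_def)
    show "mfps_coeff (lower_Omega J b $ \<alpha> $ \<beta>) {#\<gamma>#} * mfps_coeff (f (int b) \<beta>) {#} = 0" if "b \<noteq> 1" for b \<alpha> \<beta> \<gamma>
      using cone_base_linear[of F A J b \<alpha> \<beta> \<gamma>] that cd' by (simp add: f0)
  qed (simp_all add: fs pterm_summable)
qed

text \<open>
  Only the coordinates \<open>q_0\<close> and \<open>q_1\<close> start at the base point here.  The substitution nevertheless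
  converges on ancestor potentials because of their weight.
\<close>

lemma point_criterion_ancestor:
  fixes f :: "int \<Rightarrow> 'n :: finite \<Rightarrow> 'v mfps"
  assumes cd: "cone_data F A J w C" and n: "normalised J"
    and f0: "\<And>\<alpha>. mfps_coeff (f 0 \<alpha>) {#} = 0" and f1: "\<And>\<alpha>. mfps_coeff (f 1 \<alpha>) {#} = - (A $ \<alpha>)"
    and y: "\<And>\<alpha>. mfps_coeff (y \<alpha>) {#} = 0"
    and E: "\<And>\<alpha>. pairing y (lower_Omega J) (\<lambda>d. f (int d)) \<alpha> = 0"
    and p: "\<And>a \<alpha>. f (- int a - 1) \<alpha> = (- 1) ^ (a + 1) * pairing y (Omega J a) (\<lambda>d. f (int d)) \<alpha>"
  shows "point_on_germ f C"
proof -
  note cd' = cd[unfolded cone_data_def]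
  let ?Q = "\<lambda>(\<alpha>, d). f (int d) \<alpha> - mfps_const (base C d $ \<alpha>)"
  let ?T = "{n. 0 \<le> jet_weight n}"
  have Q0: "mfps_coeff (?Q (\<alpha>, d)) {#} = 0" if "d \<le> 1" for \<alpha> d
    using that f0 f1 cd' cal_shift_normalised[OF n, of A] by (cases "d = 0") (auto simp: cone_base_def le_Suc_eq)
  have adm: "subst_adm ?Q ?T" by (rule subst_adm_ancestor) (rule Q0)
  have w: "vge jet_weight 1 (w v)" for v using euler_solution_jet_weight n cd' by blast
  have L: "ord_ge b (lower_Omega J b $ \<alpha> $ \<beta>)" for b \<alpha> \<beta> using ord_ge_lower_Omega n cd' by blast
  have O: "ord_ge (a + b) (Omega J a b $ \<alpha> $ \<beta>)" for a b \<alpha> \<beta>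
    by (rule ord_ge_mono[OF ord_ge_Omega[of F J]]) (use n cd' in auto)
  show ?thesis
  proof (rule point_criterion[OF cd adm submonoid_weight[OF additive_weight_jet_weight] _ _ _ _ refl y _ E f1 _ p])
    show "supp_in ?T (w v)" for v by (rule supp_in_vge[OF w]) simp
    show "supp_in ?T (pterm w (Omega J a) (q_point A J) \<alpha> b)" for a b \<alpha>
      by (rule supp_in_vge[OF pterm_jet_weight[OF w O n]]) simp
    show "supp_in ?T (pterm w (lower_Omega J) (q_point A J) \<alpha> b)" for b \<alpha>
      by (rule supp_in_vge[OF pterm_jet_weight[of w 0, OF w _ n]]) (simp_all add: L)
    show "mfps_coeff (gpow ?Q k) {#} = 0" if "mfps_coeff (w v) k \<noteq> 0" for v k
    proof -
      have "1 \<le> jet_weight k" using w[of v] that by (simp add: vge_def)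
      then have "\<exists>x\<in>#k. snd x \<le> 1"
      proof (rule contrapos_pp)
        assume "\<not> (\<exists>x\<in>#k. snd x \<le> 1)"
        then have "jet_weight k \<le> 0" by (induction k) (auto simp: jet_weight_def)
        then show "\<not> 1 \<le> jet_weight k" by simp
      qed
      then obtain x k' where x: "snd x \<le> 1" "k = add_mset x k'" by (meson multi_member_split)
      then show ?thesis using Q0[of "snd x" "fst x"] by simp
    qed
    show "mfps_summable (pterm y (lower_Omega J) (\<lambda>d. f (int d)) \<alpha>)" for \<alpha>
      by (rule pterm_summable_ord[OF y L])
    show "mfps_coeff (lower_Omega J b $ \<alpha> $ \<beta>) {#\<gamma>#} * mfps_coeff (f (int b) \<beta>) {#} = 0" if "b \<noteq> 1" for b \<alpha> \<beta> \<gamma>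
      using that f0[of \<beta>] ord_geD[OF L[of b \<alpha> \<beta>], of "{#\<gamma>#}"] by (cases "b = 0") simp_all
  qed
qed

section \<open>The action of \<open>G_-\<close>\<close>

definition mat_vec :: "('a :: comm_ring_1, 'n :: finite) sqm \<Rightarrow> ('n \<Rightarrow> 'a) \<Rightarrow> 'n \<Rightarrow> 'a" where
  "mat_vec X x i = (\<Sum>j\<in>UNIV. entry X i j * x j)"

lemma mat_vec_mult: "mat_vec (X * Y) x = mat_vec X (mat_vec Y x)"
proof (rule ext)
  fix i
  have "mat_vec (X * Y) x i = (\<Sum>j\<in>UNIV. \<Sum>k\<in>UNIV. entry X i k * entry Y k j * x j)"
    by (simp add: mat_vec_def entry_times sum_distrib_right)
  also have "\<dots> = (\<Sum>k\<in>UNIV. \<Sum>j\<in>UNIV. entry X i k * entry Y k j * x j)" by (rule sum.swap)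
  finally show "mat_vec (X * Y) x i = mat_vec X (mat_vec Y x) i" by (simp add: mat_vec_def sum_distrib_left mult.assoc)
qed

lemma mat_vec_simps:
  "mat_vec 1 x i = x i" "mat_vec (X + Y) x i = mat_vec X x i + mat_vec Y x i" "mat_vec (- X) x i = - mat_vec X x i"
  "mat_vec X (\<lambda>j. c * x j) i = c * mat_vec X x i" "mat_vec 0 x i = 0"
  subgoal by (simp add: mat_vec_def if_distrib[of "\<lambda>x. x * _"] cong: if_cong)
  by (simp_all add: mat_vec_def ring_distribs sum.distrib sum_negf sum_distrib_left mult_ac)

lemma mat_vec_sum: "mat_vec (sum X S) x i = (\<Sum>s\<in>S. mat_vec (X s) x i)"
  by (induction S rule: infinite_finite_induct) (simp_all add: mat_vec_simps)

definition const_mat :: "complex^'n^'n \<Rightarrow> ('v mfps, 'n :: finite) sqm" where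
  "const_mat M = mat_of (\<lambda>i j. mfps_const (M $ i $ j))"

lemma entry_const_mat [simp]: "entry (const_mat M) i j = mfps_const (M $ i $ j)" by (simp add: const_mat_def)

lemma const_mat_simps:
  "const_mat (mat 1) = 1" "const_mat 0 = 0" "const_mat (X + Y) = const_mat X + const_mat Y" "const_mat (- X) = - const_mat X" "const_mat (X ** Y) = const_mat X * const_mat Y"
  by (rule sqm_eqI, simp add: mat_def matrix_matrix_mult_def entry_times mfps_const_simps mfps_const_sum)+

lemma const_mat_sum: "const_mat (sum f S) = (\<Sum>x\<in>S. const_mat (f x))"
  by (induction S rule: infinite_finite_induct) (simp_all add: const_mat_simps)

lemma sderiv_const_mat [simp]: "sderiv v (const_mat M) = 0"
  by (rule sqm_eqI) simp

definition const_loop :: "(nat \<Rightarrow> complex^'n^'n) \<Rightarrow> ('v mfps, 'n :: finite) sqm fps" where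
  "const_loop L = Abs_fps (\<lambda>i. const_mat (L i))"

lemma const_loop_nth [simp]: "fps_nth (const_loop L) i = const_mat (L i)" by (simp add: const_loop_def)

text \<open>
  A left inverse that itself has a left inverse is two-sided.
\<close>

lemma const_loop_inverse:
  assumes "L 0 = mat 1"
  shows "const_loop (series_inv L) * const_loop L = 1" "const_loop L * const_loop (series_inv L) = 1"
proof -
  have l: "const_loop (series_inv L) * const_loop L = 1" if "L 0 = mat 1" for L :: "nat \<Rightarrow> complex^'n^'n"
  proof (rule fps_ext)
    fix n
    have "fps_nth (const_loop (series_inv L) * const_loop L) n = const_mat (\<Sum>i\<le>n. series_inv L i ** L (n - i))"
      by (simp add: fps_mult_nth const_mat_sum const_mat_simps atLeast0AtMost)
    also have "\<dots> = fps_nth 1 n"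
      unfolding series_inv_left[of L n, OF that] by (simp add: const_mat_simps)
    finally show "fps_nth (const_loop (series_inv L) * const_loop L) n = fps_nth 1 n" .
  qed
  show "const_loop (series_inv L) * const_loop L = 1" by (rule l[of L, OF assms])
  show "const_loop L * const_loop (series_inv L) = 1"
    by (rule left_inverse_imp_right_inverse[OF l[of L, OF assms] l[of "series_inv L"]]) simp
qed

text \<open>
  The substitution \<open>z \<mapsto> -z\<close> commutes with inversion.
\<close>

lemma series_inv_sign:
  assumes "X 0 = mat 1"
  shows "series_inv (\<lambda>d. if even d then X d else - X d) d = (if even d then series_inv X d else - series_inv X d)"
proof (induction d rule: less_induct)
  case (less d)
  show ?case
  proof (cases "d = 0")
    case False
    let ?X = "\<lambda>d. if even d then X d else - X d"
    have "(\<Sum>i<d. series_inv ?X i ** ?X (d - i)) = (\<Sum>i<d. if even d then series_inv X i ** X (d - i) else - (series_inv X i ** X (d - i)))"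
    proof (rule sum.cong[OF refl])
      fix i assume "i \<in> {..<d}"
      then have "i < d" "even (d - i) \<longleftrightarrow> (even d \<longleftrightarrow> even i)" by auto
      then show "series_inv ?X i ** ?X (d - i) = (if even d then series_inv X i ** X (d - i) else - (series_inv X i ** X (d - i)))"
        using less[of i] by (auto simp: matrix_matrix_mult_def vec_eq_iff sum_negf)
    qed
    then have "(\<Sum>i<d. series_inv ?X i ** ?X (d - i)) =
        (if even d then \<Sum>i<d. series_inv X i ** X (d - i) else - (\<Sum>i<d. series_inv X i ** X (d - i)))"
      by (simp add: sum_negf)
    then show ?thesis
      using False by (subst (1 2 3) series_inv.simps) simp
  qed simp
qed

lemma mfps_Sum_antidiagonal:
  fixes T :: "nat \<Rightarrow> nat \<Rightarrow> 'v mfps"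
  assumes "mfps_summable (\<lambda>(b, j). T b j)"
  shows "mfps_Sum (\<lambda>b. mfps_Sum (T b)) = mfps_Sum (\<lambda>c. \<Sum>b\<le>c. T b (c - b))"
proof -
  let ?U = "\<lambda>(c, b). if b \<le> c then T b (c - b) else 0"
  let ?h = "\<lambda>(b, j). (b + j, b) :: nat \<times> nat"
  have inj: "inj ?h" by (auto simp: inj_def)
  have out: "?U x = 0" if "x \<notin> range ?h" for x
  proof (cases x)
    case (Pair c b)
    have "\<not> b \<le> c"
    proof
      assume "b \<le> c"
      then have "x = ?h (b, c - b)" by (simp add: Pair)
      then show False using that by blast
    qed
    then show ?thesis by (simp add: Pair)
  qed
  have comp: "(\<lambda>x. ?U (?h x)) = (\<lambda>(b, j). T b j)" by auto
  have sU: "mfps_summable ?U"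
    by (rule mfps_summable_reindex[OF inj out]) (assumption, unfold comp, rule assms)
  have "mfps_Sum (\<lambda>b. mfps_Sum (T b)) = mfps_Sum (\<lambda>(b, j). T b j)" by (rule mfps_Sum_Sigma[OF assms])
  also have "\<dots> = mfps_Sum ?U"
  proof -
    have "mfps_Sum (\<lambda>x. ?U (?h x)) = mfps_Sum ?U" by (rule mfps_Sum_reindex[OF inj out])
    then show ?thesis by (simp only: comp)
  qed
  also have "\<dots> = mfps_Sum (\<lambda>c. mfps_Sum (\<lambda>b. if b \<le> c then T b (c - b) else 0))"
    by (rule mfps_Sum_Sigma[symmetric]) (rule sU)
  also have "\<dots> = mfps_Sum (\<lambda>c. \<Sum>b\<le>c. T b (c - b))"
    by (rule mfps_Sum_cong, subst mfps_Sum_eq_sum[of "{..c}" for c]) auto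
  finally show ?thesis .
qed

lemma mfps_Sum_split:
  fixes f :: "nat \<Rightarrow> 'v mfps"
  assumes "mfps_summable f"
  shows "mfps_Sum f = (\<Sum>j<N. f j) + mfps_Sum (\<lambda>i. f (i + N))"
proof -
  have inj: "inj (\<lambda>i. i + N)" by (simp add: inj_def)
  let ?a = "\<lambda>j. if j < N then f j else 0" and ?b = "\<lambda>j. if j < N then 0 else f j"
  have sa: "mfps_summable ?a" by (rule mfps_summable_finite_support[of "{..<N}"]) auto
  have sb: "mfps_summable ?b"
    using assms by (auto simp: mfps_summable_def intro: rev_finite_subset)
  have "mfps_Sum f = mfps_Sum (\<lambda>j. ?a j + ?b j)" by (rule mfps_Sum_cong) simp
  also have "\<dots> = mfps_Sum ?a + mfps_Sum ?b" by (rule mfps_Sum_add[OF sa sb])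
  also have "mfps_Sum ?a = (\<Sum>j<N. f j)" by (subst mfps_Sum_eq_sum[of "{..<N}"]) auto
  also have "mfps_Sum ?b = mfps_Sum (\<lambda>i. ?b (i + N))"
    by (rule mfps_Sum_reindex[OF inj, symmetric])
      (metis le_add_diff_inverse2 not_less rangeI)
  finally show ?thesis by simp
qed

lemma mfps_summable_shift:
  fixes f :: "nat \<Rightarrow> 'v mfps"
  assumes "mfps_summable (\<lambda>j. f (j + N))"
  shows "mfps_summable f"
  unfolding mfps_summable_def
proof
  fix m
  have "{j. mfps_coeff (f j) m \<noteq> 0} \<subseteq> {..<N} \<union> (\<lambda>j. j + N) ` {j. mfps_coeff (f (j + N)) m \<noteq> 0}"
  proof
    fix j assume j: "j \<in> {j. mfps_coeff (f j) m \<noteq> 0}"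
    show "j \<in> {..<N} \<union> (\<lambda>j. j + N) ` {j. mfps_coeff (f (j + N)) m \<noteq> 0}"
    proof (cases "j < N")
      case False
      then have "j = (j - N) + N" by simp
      then show ?thesis using j by (metis (mono_tags, lifting) UnI2 imageI mem_Collect_eq)
    qed simp
  qed
  then show "finite {j. mfps_coeff (f j) m \<noteq> 0}"
    using assms by (elim finite_subset) (simp add: mfps_summable_def)
qed

definition mat_pairing :: "(nat \<Rightarrow> ('v mfps, 'n :: finite) sqm) \<Rightarrow> (nat \<Rightarrow> 'n \<Rightarrow> 'v mfps) \<Rightarrow> 'n \<Rightarrow> 'v mfps" where
  "mat_pairing X q \<alpha> = mfps_Sum (\<lambda>b. mat_vec (X b) (q b) \<alpha>)"

lemma pairing_mat_pairing: "pairing y X q = mat_pairing (\<lambda>b. smap (mfps_subst y) (SQ (X b))) q"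
  by (rule ext) (simp add: pairing_def mat_pairing_def mat_vec_def pterm_def[abs_def])

lemma mat_vec_summable:
  "(\<And>\<beta>. mfps_summable (\<lambda>b. q b \<beta>)) \<Longrightarrow> mfps_summable (\<lambda>b. mat_vec (X b) (q b) \<alpha>)"
  unfolding mat_vec_def by (intro mfps_summable_sum mfps_summable_mult_gen)

lemma mat_vec_Sum:
  assumes "\<And>\<beta>. mfps_summable (\<lambda>j. g j \<beta>)"
  shows "mat_vec X (\<lambda>\<beta>. mfps_Sum (\<lambda>j. g j \<beta>)) \<alpha> = mfps_Sum (\<lambda>j. mat_vec X (g j) \<alpha>)"
  unfolding mat_vec_def
  by (subst mfps_Sum_sum) (simp_all add: mfps_summable_mult_gen assms mfps_Sum_mult_left)

lemma mat_vec_coeff_nonzero: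
  assumes "mfps_coeff (mat_vec X x \<alpha>) m \<noteq> 0"
  obtains k \<beta> where "k \<subseteq># m" "mfps_coeff (x \<beta>) k \<noteq> 0"
proof -
  from assms obtain \<beta> where "mfps_coeff (entry X \<alpha> \<beta> * x \<beta>) m \<noteq> 0"
    unfolding mat_vec_def by (simp del: mfps_coeff_times_empty) (meson sum.neutral)
  then show ?thesis using that by (metis mfps_coeff_times_nonzero mset_subset_eq_add_right)
qed

text \<open>
  The action of a series in \<open>1/z\<close> on \<open>q\<close> can be shifted to the matrices paired with \<open>q\<close>, where it
  becomes a Cauchy product.
\<close>

lemma mat_pairing_convolution:
  assumes q': "\<And>\<beta>. mfps_summable (\<lambda>b. q' b \<beta>)"
    and q: "\<And>b \<alpha>. q b \<alpha> = mfps_Sum (\<lambda>j. mat_vec (S j) (q' (b + j)) \<alpha>)"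
  shows "mat_pairing X q \<alpha> = mat_pairing (\<lambda>c. \<Sum>b\<le>c. X b * S (c - b)) q' \<alpha>"
proof -
  let ?T = "\<lambda>b j. mat_vec (X b * S j) (q' (b + j)) \<alpha>"
  have inj: "inj (\<lambda>j. b + j)" for b :: nat by (simp add: inj_def)
  have s: "mfps_summable (\<lambda>j. mat_vec (S j) (q' (b + j)) \<beta>)" for b \<beta>
    using mfps_summable_inj[OF q' inj] by (intro mat_vec_summable)
  have "mat_vec (X b) (q b) \<alpha> = mfps_Sum (?T b)" for b
  proof -
    have "mat_vec (X b) (q b) \<alpha> = mat_vec (X b) (\<lambda>\<beta>. mfps_Sum (\<lambda>j. mat_vec (S j) (q' (b + j)) \<beta>)) \<alpha>"
      by (rule arg_cong[where f = "\<lambda>x. mat_vec (X b) x \<alpha>"]) (simp add: fun_eq_iff q)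
    also have "\<dots> = mfps_Sum (\<lambda>j. mat_vec (X b) (\<lambda>\<beta>. mat_vec (S j) (q' (b + j)) \<beta>) \<alpha>)"
      by (rule mat_vec_Sum[OF s])
    finally show ?thesis by (simp add: mat_vec_mult)
  qed
  moreover have "mfps_summable (\<lambda>(b, j). ?T b j)"
    unfolding mfps_summable_def
  proof
    fix m
    let ?B = "\<Union>\<beta>\<in>UNIV. {c. \<exists>k. k \<subseteq># m \<and> mfps_coeff (q' c \<beta>) k \<noteq> 0}"
    have "finite ?B" by (intro finite_UN_I finite mfps_summable_divisors q')
    then have "finite (\<Union>c\<in>?B. {..c} \<times> {..c})" by blast
    moreover have "{x. mfps_coeff (case x of (b, j) \<Rightarrow> ?T b j) m \<noteq> 0} \<subseteq> (\<Union>c\<in>?B. {..c} \<times> {..c})"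
    proof
      fix x assume "x \<in> {x. mfps_coeff (case x of (b, j) \<Rightarrow> ?T b j) m \<noteq> 0}"
      then obtain b j where x: "x = (b, j)" "mfps_coeff (?T b j) m \<noteq> 0" by (cases x) auto
      from x(2) obtain k \<beta> where "k \<subseteq># m" "mfps_coeff (q' (b + j) \<beta>) k \<noteq> 0" by (rule mat_vec_coeff_nonzero)
      then have "b + j \<in> ?B" by blast
      moreover have "x \<in> {..b + j} \<times> {..b + j}" using x by simp
      ultimately show "x \<in> (\<Union>c\<in>?B. {..c} \<times> {..c})" by blast
    qed
    ultimately show "finite {x. mfps_coeff (case x of (b, j) \<Rightarrow> ?T b j) m \<noteq> 0}" using finite_subset by blast
  qed
  note mfps_Sum_antidiagonal[OF this]
  ultimately have "mat_pairing X q \<alpha> = mfps_Sum (\<lambda>c. \<Sum>b\<le>c. ?T b (c - b))" by (simp add: mat_pairing_def)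
  also have "\<dots> = mat_pairing (\<lambda>c. \<Sum>b\<le>c. X b * S (c - b)) q' \<alpha>"
    unfolding mat_pairing_def mat_vec_sum by (intro mfps_Sum_cong sum.cong) auto
  finally show ?thesis .
qed

text \<open>
  Loops with powers of one sign only reduce to ordinary sequences; \<open>h\<close> lists the exponents.
\<close>

lemma laurent_mult_nat:
  assumes inj: "inj h" and L: "\<And>i. i \<notin> range h \<Longrightarrow> L i = 0"
    and f: "\<And>\<beta>. mfps_summable (\<lambda>j :: nat. f (k - h j) \<beta>)"
  shows "mfps_summable (laurent_term L f k \<alpha>)"
    and "laurent_mult L f k \<alpha> = mfps_Sum (\<lambda>j. mat_vec (const_mat (L (h j))) (f (k - h j)) \<alpha>)"
proof -
  let ?h = "\<lambda>(j, \<beta>). (h j, \<beta>)"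
  let ?g = "\<lambda>j \<beta>. mfps_const (L (h j) $ \<alpha> $ \<beta>) * f (k - h j) \<beta>"
  have injh: "inj ?h" using inj by (auto simp: inj_def)
  have out: "laurent_term L f k \<alpha> x = 0" if "x \<notin> range ?h" for x
  proof -
    have "fst x \<notin> range h" using that by (cases x) force
    then show ?thesis by (cases x) (simp add: laurent_term_def L mfps_const_simps)
  qed
  have comp: "(\<lambda>x. laurent_term L f k \<alpha> (?h x)) = (\<lambda>(j, \<beta>). ?g j \<beta>)"
    by (auto simp: laurent_term_def)
  have s: "mfps_summable (\<lambda>(j, \<beta>). ?g j \<beta>)"
    unfolding mfps_summable_def
  proof
    fix m
    have "{x. mfps_coeff (case x of (j, \<beta>) \<Rightarrow> ?g j \<beta>) m \<noteq> 0} \<subseteq>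
        (\<Union>\<beta>\<in>UNIV. {j. mfps_coeff (f (k - h j) \<beta>) m \<noteq> 0} \<times> {\<beta>})" by auto
    moreover have "finite (\<Union>\<beta>\<in>UNIV. {j. mfps_coeff (f (k - h j) \<beta>) m \<noteq> 0} \<times> {\<beta>})"
      using f by (auto simp: mfps_summable_def)
    ultimately show "finite {x. mfps_coeff (case x of (j, \<beta>) \<Rightarrow> ?g j \<beta>) m \<noteq> 0}" by (rule finite_subset)
  qed
  show "mfps_summable (laurent_term L f k \<alpha>)"
    by (rule mfps_summable_reindex[OF injh out]) (assumption, unfold comp, rule s)
  have "mfps_Sum (\<lambda>x. laurent_term L f k \<alpha> (?h x)) = mfps_Sum (laurent_term L f k \<alpha>)"
    by (rule mfps_Sum_reindex[OF injh out])
  then have "laurent_mult L f k \<alpha> = mfps_Sum (\<lambda>(j, \<beta>). ?g j \<beta>)"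
    by (simp only: comp laurent_mult_def)
  also have "\<dots> = mfps_Sum (\<lambda>j. mfps_Sum (?g j))" by (rule mfps_Sum_Sigma[OF s, symmetric])
  also have "\<dots> = mfps_Sum (\<lambda>j. mat_vec (const_mat (L (h j))) (f (k - h j)) \<alpha>)"
    unfolding mat_vec_def by (intro mfps_Sum_cong, subst mfps_Sum_eq_sum[of UNIV]) simp_all
  finally show "laurent_mult L f k \<alpha> = mfps_Sum (\<lambda>j. mat_vec (const_mat (L (h j))) (f (k - h j)) \<alpha>)" .
qed

definition alt_sign :: "nat \<Rightarrow> 'a :: ring_1" where "alt_sign n = (if even n then 1 else - 1)"

lemma alt_sign_simps: "alt_sign b * (X :: 'a :: ring_1) * (alt_sign c * Y) = alt_sign (b + c) * (X * Y)" "X * alt_sign b = alt_sign b * X"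
  by (auto simp: alt_sign_def)

lemma sum_lessThan_add:
  fixes f :: "nat \<Rightarrow> 'a :: comm_monoid_add"
  shows "(\<Sum>i<m + n. f i) = (\<Sum>i<m. f i) + (\<Sum>i<n. f (m + i))"
  by (induction n) (simp_all add: add.assoc)

lemma fps_shift_mult_expand:
  fixes L J :: "'a :: ring_1 fps"
  shows "fps_shift (Suc a) (L * J) =
    (\<Sum>j\<le>a. fps_const (fps_nth L j) * fps_shift (Suc (a - j)) J) + fps_shift (Suc a) L * J"
proof (rule fps_ext)
  fix n
  have "fps_nth (fps_shift (Suc a) (L * J)) n = (\<Sum>i<Suc a + Suc n. fps_nth L i * fps_nth J (n + Suc a - i))"
    by (simp add: fps_mult_nth lessThan_Suc_atMost atLeast0AtMost add_ac)
  also have "\<dots> = (\<Sum>i<Suc a. fps_nth L i * fps_nth J (n + Suc a - i)) +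
      (\<Sum>i<Suc n. fps_nth L (Suc a + i) * fps_nth J (n + Suc a - (Suc a + i)))"
    by (rule sum_lessThan_add)
  also have "\<dots> = fps_nth ((\<Sum>j\<le>a. fps_const (fps_nth L j) * fps_shift (Suc (a - j)) J) + fps_shift (Suc a) L * J) n"
    by (simp add: fps_sum_nth fps_mult_nth[of "fps_shift (Suc a) L"] lessThan_Suc_atMost atLeast0AtMost
        add_ac Suc_diff_le)
  finally show "fps_nth (fps_shift (Suc a) (L * J)) n =
      fps_nth ((\<Sum>j\<le>a. fps_const (fps_nth L j) * fps_shift (Suc (a - j)) J) + fps_shift (Suc a) L * J) n" .
qed

lemma SQ_lower_Omega: "SQ (lower_Omega X j) = alt_sign j * fps_nth (sq_fps (series_inv X)) j"
  by (simp add: lower_Omega_def alt_sign_def SQ_simps)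

lemma SQ_Omega: "calibration F X \<Longrightarrow>
    SQ (Omega X a b) = alt_sign b * fps_nth (fps_shift (Suc a) (sq_fps X) * sq_fps (series_inv X)) b"
  by (subst Omega_eq) (simp_all add: alt_sign_def)

lemma alt_sign_convolution:
  fixes X Y :: "'a :: ring_1 fps"
  shows "(\<Sum>b\<le>c. (alt_sign b * fps_nth X b) * (alt_sign (c - b) * fps_nth Y (c - b))) = alt_sign c * fps_nth (X * Y) c"
proof -
  have "(\<Sum>b\<le>c. (alt_sign b * fps_nth X b) * (alt_sign (c - b) * fps_nth Y (c - b))) =
      (\<Sum>b\<le>c. alt_sign c * (fps_nth X b * fps_nth Y (c - b)))"
    by (rule sum.cong) (simp_all add: alt_sign_simps(1))
  then show ?thesis by (simp add: fps_mult_nth sum_distrib_left atLeast0AtMost)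
qed

text \<open>
  Matrix identities behind the action of \<open>G_-\<close>: for \<open>J = L J'\<close> with constant \<open>L\<close> one has
  \<open>J\<inverse> L = J'\<inverse>\<close>, and the negative part of \<open>L J' J'\<inverse>\<close> splits accordingly.
\<close>

context
  fixes F :: "'n :: finite \<Rightarrow> 'n mfps" and J J' :: "nat \<Rightarrow> 'n mfps^'n^'n" and L S :: "nat \<Rightarrow> complex^'n^'n"
  assumes cal: "calibration F J" and cal': "calibration F J'"
    and JL: "sq_fps J = const_loop L * sq_fps J'"
    and S: "S = (\<lambda>d. if even d then L d else - L d)"
begin

lemma const_mat_S: "const_mat (S j) = alt_sign j * fps_nth (const_loop L) j"
  by (simp add: S alt_sign_def const_mat_simps)

lemma inverse_factor: "sq_fps (series_inv J) * const_loop L = sq_fps (series_inv J')"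
proof -
  have "sq_fps (series_inv J) * const_loop L = sq_fps (series_inv J) * (const_loop L * sq_fps J') * sq_fps (series_inv J')"
    by (simp add: mult.assoc calibration_inverse[OF cal'])
  then show ?thesis by (simp add: JL[symmetric] calibration_inverse[OF cal])
qed

lemma lower_Omega_convolution:
  "(\<Sum>b\<le>c. SQ (lower_Omega J b) * const_mat (S (c - b))) = SQ (lower_Omega J' c)"
  by (simp only: SQ_lower_Omega const_mat_S alt_sign_convolution inverse_factor)

text \<open>
  The sum over \<open>j \<le> a\<close> comes from the coefficients of \<open>L\<close> that act on the potentials, the last term
  from those that carry some \<open>q_c\<close> into the negative part.
\<close>

lemma Omega_convolution:
  "(\<Sum>b\<le>c. SQ (Omega J a b) * const_mat (S (c - b))) =
    (\<Sum>j\<le>a. const_mat (L j) * SQ (Omega J' (a - j) c)) + alt_sign c * const_mat (L (Suc a + c))"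
proof -
  have "(\<Sum>b\<le>c. SQ (Omega J a b) * const_mat (S (c - b))) =
      alt_sign c * fps_nth (fps_shift (Suc a) (const_loop L * sq_fps J') * sq_fps (series_inv J')) c"
    by (simp only: SQ_Omega[OF cal] const_mat_S alt_sign_convolution) (simp only: mult.assoc inverse_factor JL)
  also have "fps_shift (Suc a) (const_loop L * sq_fps J') * sq_fps (series_inv J') =
      (\<Sum>j\<le>a. fps_const (fps_nth (const_loop L) j) * (fps_shift (Suc (a - j)) (sq_fps J') * sq_fps (series_inv J'))) +
      fps_shift (Suc a) (const_loop L)"
    by (simp only: fps_shift_mult_expand ring_distribs sum_distrib_right mult.assoc
        calibration_inverse[OF cal'] mult_1_right)
  finally show ?thesis
    by (simp add: SQ_Omega[OF cal'] ring_distribs fps_sum_nth sum_distrib_left add.commute)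
      (intro sum.cong refl, simp add: alt_sign_def)
qed

text \<open>
  The fundamental solution of \<open>J\<close> is that of \<open>J'\<close> multiplied by \<open>S\<close>, so that the same tuple \<open>w'\<close>
  solves the Euler-Lagrange equation at a point of \<open>C'\<close> and at its image.  The proof works with
  coefficients instead of loops since neither calibration is normalised in general.
\<close>

lemma G_minus_maps:
  assumes cd: "cone_data F A J w C" and cd': "cone_data F A J' w' C'" and L0: "L 0 = mat 1"
  shows "maps_base (laurent_minus S) C' C \<and> maps_into (laurent_minus S) C' C"
proof -
  note c = cd[unfolded cone_data_def] and c' = cd'[unfolded cone_data_def]
  have z: "mfps_coeff (w' v) {#} = 0" for v using c' by (simp add: euler_solution_def)
  note subst_w = substitutable_UNIV[OF subst_adm_finite[of w', OF z]]
  let ?q' = "q_point A J'"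
  let ?g = "cone_point C'"
  let ?f = "laurent_mult (laurent_minus S) ?g"
  let ?s = "\<lambda>X :: ('n mfps, 'n) sqm. smap (mfps_subst w') X"
  have hom: "?s (X * Y) = ?s X * ?s Y" "?s (X + Y) = ?s X + ?s Y" for X Y
    by (rule sqm_eqI, simp add: entry_times subst_sum subst_mult substitutable_mult subst_add subst_w)+
  have hom_sum: "?s (sum X I) = (\<Sum>i\<in>I. ?s (X i))" for X and I :: "nat set"
    by (rule sqm_eqI) (simp add: subst_sum subst_w)
  have hom_cm: "?s (const_mat M) = const_mat M" for M by (rule sqm_eqI) simp
  have gq: "?g (int d) = ?q' d" for d using c' by (intro ext) (simp add: cone_point_def)
  have gp: "?g (- int a - 1) \<alpha> = (- 1) ^ (a + 1) * mat_pairing (\<lambda>b. ?s (SQ (Omega J' a b))) ?q' \<alpha>" for a \<alpha>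
  proof -
    have "nat (- (- int a - 1)) = a + 1" "nat (- (- int a - 1) - 1) = a" by auto
    then show ?thesis using c' by (simp add: cone_point_def pairing_mat_pairing)
  qed
  have q's: "mfps_summable (\<lambda>b. ?q' b \<beta>)" for \<beta> by (rule q_coord_summable)
  have gs: "mfps_summable (\<lambda>j :: nat. ?g (k + int j) \<beta>)" for k \<beta>
  proof (rule mfps_summable_shift[of _ "nat (- k)"])
    have "(\<lambda>j. ?g (k + int (j + nat (- k))) \<beta>) = (\<lambda>j. ?q' (j + nat k) \<beta>)"
    proof
      fix j
      have "k + int (j + nat (- k)) = int (j + nat k)" by simp
      then show "?g (k + int (j + nat (- k))) \<beta> = ?q' (j + nat k) \<beta>" by (simp only: gq)
    qed
    then show "mfps_summable (\<lambda>j. ?g (k + int (j + nat (- k))) \<beta>)"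
      using mfps_summable_inj[OF q's, of "\<lambda>j. j + nat k"] by (simp add: inj_def)
  qed
  have inj: "inj (\<lambda>j. - int j)" by (simp add: inj_def)
  have out: "laurent_minus S i = 0" if "i \<notin> range (\<lambda>j. - int j)" for i
  proof -
    have "\<not> i \<le> 0"
    proof
      assume "i \<le> 0"
      then have "i = - int (nat (- i))" by simp
      then show False using that by blast
    qed
    then show ?thesis by (simp add: laurent_minus_def)
  qed
  note lm = laurent_mult_nat[of "\<lambda>j. - int j" "laurent_minus S" ?g, OF inj out]
  have sm: "mfps_summable (laurent_term (laurent_minus S) ?g k \<alpha>)" for k \<alpha>
    by (rule lm(1)) (use gs in simp_all)
  have f: "?f k \<alpha> = mfps_Sum (\<lambda>j. mat_vec (const_mat (S j)) (?g (k + int j)) \<alpha>)" for k \<alpha>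
    by (subst lm(2)) (use gs in \<open>simp_all add: laurent_minus_def\<close>)
  have fq: "?f (int d) \<alpha> = mfps_Sum (\<lambda>j. mat_vec (const_mat (S j)) (?q' (d + j)) \<alpha>)" for d \<alpha>
    unfolding f using gq[of "d + j" for j] by simp
  have f0: "mfps_coeff (?f (int d) \<alpha>) {#} = base C d $ \<alpha>" for d \<alpha>
  proof -
    have co: "mfps_coeff (mat_vec (const_mat (S j)) (?q' (d + j)) \<alpha>) {#} = (S j *v cone_base (cal_shift A J') A (d + j)) $ \<alpha>" for j
      by (simp add: mat_vec_def coeff_q_coord_empty matrix_vector_mult_def)
    have "mfps_coeff (?f (int d) \<alpha>) {#} = (\<Sum>j\<in>{0, 1}. (S j *v cone_base (cal_shift A J') A (d + j)) $ \<alpha>)"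
      unfolding fq
      by (subst mfps_coeff_Sum_superset[of "{0, 1}"]) (auto simp: co cone_base_def split: if_splits)
    also have "\<dots> = base C d $ \<alpha>"
    proof -
      have "J 1 = unsq (fps_nth (const_loop L * sq_fps J') 1)" by (simp only: JL[symmetric] sq_fps_nth unsq_SQ)
      then have "J 1 $ \<alpha> $ \<beta> = J' 1 $ \<alpha> $ \<beta> + mfps_const (L 1 $ \<alpha> $ \<beta>)" for \<beta>
        by (simp add: entry_def[symmetric] const_mat_simps L0 calibration_0[OF cal'] SQ_simps)
      then have "cal_shift A J $ \<alpha> = cal_shift A J' $ \<alpha> + (L 1 *v A) $ \<alpha>"
        by (simp add: calibration_shift_def matrix_vector_mult_def ring_distribs sum.distrib mult.commute)
      then show ?thesis
        using c by (auto simp: cone_base_def S L0 matrix_vector_mult_def sum_negf mat_def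
            if_distrib[of "\<lambda>x. x * _"] cong: if_cong)
    qed
    finally show ?thesis .
  qed
  have base: "maps_base (laurent_minus S) C' C" by (simp add: maps_base_def f0)
  have fs: "mfps_summable (\<lambda>d. ?f (int d) \<alpha>)" for \<alpha>
    unfolding mfps_summable_def
  proof
    fix m
    let ?B = "\<Union>\<beta>\<in>UNIV. {b. \<exists>k. k \<subseteq># m \<and> mfps_coeff (?q' b \<beta>) k \<noteq> 0}"
    have "finite (\<Union>b\<in>?B. {..b})" by (intro finite_UN_I finite mfps_summable_divisors q's) simp
    moreover have "{d. mfps_coeff (?f (int d) \<alpha>) m \<noteq> 0} \<subseteq> (\<Union>b\<in>?B. {..b})"
    proof
      fix d assume "d \<in> {d. mfps_coeff (?f (int d) \<alpha>) m \<noteq> 0}"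
      then have "(\<Sum>j | mfps_coeff (mat_vec (const_mat (S j)) (?q' (d + j)) \<alpha>) m \<noteq> 0. mfps_coeff (mat_vec (const_mat (S j)) (?q' (d + j)) \<alpha>) m) \<noteq> 0"
        by (simp only: fq mfps_coeff_Sum mem_Collect_eq) simp
      then obtain j where "mfps_coeff (mat_vec (const_mat (S j)) (?q' (d + j)) \<alpha>) m \<noteq> 0"
        by (meson sum.neutral)
      then obtain k \<beta> where "k \<subseteq># m" "mfps_coeff (?q' (d + j) \<beta>) k \<noteq> 0" by (rule mat_vec_coeff_nonzero)
      then have "d + j \<in> ?B" by blast
      moreover have "d \<in> {..d + j}" by simp
      ultimately show "d \<in> (\<Union>b\<in>?B. {..b})" by blast
    qed
    ultimately show "finite {d. mfps_coeff (?f (int d) \<alpha>) m \<noteq> 0}" using finite_subset by blast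
  qed
  have conv: "pairing w' X (\<lambda>d. ?f (int d)) \<alpha> = mat_pairing (\<lambda>c. ?s (\<Sum>b\<le>c. SQ (X b) * const_mat (S (c - b)))) ?q' \<alpha>" for X \<alpha>
    unfolding pairing_mat_pairing
    by (subst mat_pairing_convolution[OF q's fq]) (simp add: hom hom_sum hom_cm)
  have E: "pairing w' (lower_Omega J) (\<lambda>d. ?f (int d)) \<alpha> = 0" for \<alpha>
    using c' unfolding conv lower_Omega_convolution by (simp add: euler_solution_def pairing_mat_pairing)
  have p: "?f (- int a - 1) \<alpha> = (- 1) ^ (a + 1) * pairing w' (Omega J a) (\<lambda>d. ?f (int d)) \<alpha>" for a \<alpha>
  proof -
    let ?X = "\<lambda>j b. ?s (SQ (Omega J' (a - j) b))"
    have sp: "mfps_summable (\<lambda>b. mat_vec (X b) (?q' b) \<beta>)" for X \<beta> by (rule mat_vec_summable[OF q's])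
    \<comment> \<open>The first \<open>a + 1\<close> coefficients of \<open>S\<close> meet potentials, all others meet some \<open>q_i\<close>.\<close>
    have "?f (- int a - 1) \<alpha> = (\<Sum>j<Suc a. mat_vec (const_mat (S j)) (?g (- int a - 1 + int j)) \<alpha>) +
        mfps_Sum (\<lambda>i. mat_vec (const_mat (S (i + Suc a))) (?g (- int a - 1 + int (i + Suc a))) \<alpha>)"
      unfolding f by (rule mfps_Sum_split) (intro mat_vec_summable gs)
    also have "(\<lambda>i. mat_vec (const_mat (S (i + Suc a))) (?g (- int a - 1 + int (i + Suc a))) \<alpha>) =
        (\<lambda>i. mat_vec (const_mat (S (i + Suc a))) (?q' i) \<alpha>)"
      by (simp add: gq)
    also have "(\<Sum>j<Suc a. mat_vec (const_mat (S j)) (?g (- int a - 1 + int j)) \<alpha>) =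
        (\<Sum>j\<le>a. (- 1) ^ (a + 1) * mat_pairing (\<lambda>b. const_mat (L j) * ?X j b) ?q' \<alpha>)"
      unfolding lessThan_Suc_atMost
    proof (rule sum.cong[OF refl])
      fix j assume "j \<in> {..a}"
      then have j: "j \<le> a" by simp
      then have "- int a - 1 + int j = - int (a - j) - 1" by simp
      then have g: "?g (- int a - 1 + int j) = (\<lambda>\<beta>. (- 1) ^ (a - j + 1) * mat_pairing (?X j) ?q' \<beta>)"
        by (intro ext) (simp only: gp)
      have "mat_vec (const_mat (S j)) (mat_pairing (?X j) ?q') \<alpha> = mat_pairing (\<lambda>b. const_mat (S j) * ?X j b) ?q' \<alpha>"
        unfolding mat_pairing_def[abs_def] mat_vec_mult by (rule mat_vec_Sum[OF sp])
      also have "\<dots> = alt_sign j * mat_pairing (\<lambda>b. const_mat (L j) * ?X j b) ?q' \<alpha>"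
        unfolding mat_pairing_def
        by (subst mfps_Sum_mult_left[symmetric, OF sp]) (simp add: S const_mat_simps mat_vec_simps alt_sign_def)
      finally have "mat_vec (const_mat (S j)) (?g (- int a - 1 + int j)) \<alpha> =
          (- 1) ^ (a - j + 1) * (alt_sign j * mat_pairing (\<lambda>b. const_mat (L j) * ?X j b) ?q' \<alpha>)"
        by (simp only: g mat_vec_simps)
      also have "\<dots> = (- 1) ^ (a + 1) * mat_pairing (\<lambda>b. const_mat (L j) * ?X j b) ?q' \<alpha>"
        using j by (auto simp: alt_sign_def minus_one_power_iff)
      finally show "mat_vec (const_mat (S j)) (?g (- int a - 1 + int j)) \<alpha> =
          (- 1) ^ (a + 1) * mat_pairing (\<lambda>b. const_mat (L j) * ?X j b) ?q' \<alpha>" .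
    qed
    also have "mfps_Sum (\<lambda>i. mat_vec (const_mat (S (i + Suc a))) (?q' i) \<alpha>) =
        (- 1) ^ (a + 1) * mat_pairing (\<lambda>c. alt_sign c * const_mat (L (Suc a + c))) ?q' \<alpha>"
      unfolding mat_pairing_def
      by (subst mfps_Sum_mult_left[symmetric, OF sp], rule mfps_Sum_cong)
        (simp add: S const_mat_simps mat_vec_simps alt_sign_def minus_one_power_iff add.commute)
    also have "(\<Sum>j\<le>a. (- 1) ^ (a + 1) * mat_pairing (\<lambda>b. const_mat (L j) * ?X j b) ?q' \<alpha>) +
        (- 1) ^ (a + 1) * mat_pairing (\<lambda>c. alt_sign c * const_mat (L (Suc a + c))) ?q' \<alpha> =
        (- 1) ^ (a + 1) * mat_pairing (\<lambda>c. (\<Sum>j\<le>a. const_mat (L j) * ?X j c) + alt_sign c * const_mat (L (Suc a + c))) ?q' \<alpha>"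
      unfolding mat_pairing_def mat_vec_simps mat_vec_sum
      by (simp only: mfps_Sum_add mfps_Sum_sum mfps_summable_sum sp ring_distribs sum_distrib_left)
    also have "(\<lambda>c. (\<Sum>j\<le>a. const_mat (L j) * ?X j c) + alt_sign c * const_mat (L (Suc a + c))) =
        (\<lambda>c. ?s (\<Sum>b\<le>c. SQ (Omega J a b) * const_mat (S (c - b))))"
    proof
      fix c
      have "?s 1 = 1" "?s (- 1) = - 1"
        by (rule sqm_eqI, simp add: subst_uminus subst_w if_distrib[of "mfps_subst w'"])+
      then have "?s (alt_sign c) = alt_sign c" by (simp add: alt_sign_def)
      then show "(\<Sum>j\<le>a. const_mat (L j) * ?X j c) + alt_sign c * const_mat (L (Suc a + c)) =
          ?s (\<Sum>b\<le>c. SQ (Omega J a b) * const_mat (S (c - b)))"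
        unfolding Omega_convolution by (simp add: hom hom_sum hom_cm)
    qed
    finally show ?thesis by (simp only: conv)
  qed
  have "point_on_germ ?f C"
    by (rule point_criterion_linear[OF cd f0 fs z E p])
  then show ?thesis using base sm by (simp add: maps_into_def)
qed

end

section \<open>Constant algebras, the trivial cone and the action of \<open>GL\<close>\<close>

text \<open>
  Flat F-manifolds with constant structure constants: the normalised calibration is the exponential
  of \<open>z\<close> times multiplication by the position vector.
\<close>

definition const_alg :: "('n :: finite \<Rightarrow> 'n mfps) \<Rightarrow> ('n \<Rightarrow> complex^'n^'n) \<Rightarrow> bool" where
  "const_alg F Cc \<longleftrightarrow> (\<forall>\<gamma>. struct_mat F \<gamma> = const_mat (Cc \<gamma>))"

definition position_mult :: "('n :: finite \<Rightarrow> complex^'n^'n) \<Rightarrow> ('n \<Rightarrow> 'v mfps) \<Rightarrow> ('v mfps, 'n) sqm" where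
  "position_mult Cc y = (\<Sum>\<gamma>\<in>UNIV. scal (y \<gamma>) (const_mat (Cc \<gamma>)))"

definition exp_cal :: "('n :: finite \<Rightarrow> complex^'n^'n) \<Rightarrow> nat \<Rightarrow> 'n mfps^'n^'n" where
  "exp_cal Cc d = unsq (scal (mfps_const (1 / fact d)) (position_mult Cc mfps_var ^ d))"

lemma SQ_unsq [simp]: "SQ (unsq A) = A" by (simp add: unsq_inverse)

lemma SQ_exp_cal: "SQ (exp_cal Cc d) = scal (mfps_const (1 / fact d)) (position_mult Cc mfps_var ^ d)"
  by (simp add: exp_cal_def)

lemma scal_const_of_nat: "scal (mfps_const (of_nat n)) A = of_nat n * A"
  by (induction n) (simp_all add: scal_simps mfps_const_simps ring_distribs)

lemma sderiv_power_commuting: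
  assumes "sderiv v X * X = X * sderiv v X"
  shows "sderiv v (X ^ Suc d) = of_nat (Suc d) * (X ^ d * sderiv v X)"
proof (induction d)
  case (Suc d)
  have "sderiv v (X ^ Suc (Suc d)) = sderiv v X * X ^ Suc d + X * sderiv v (X ^ Suc d)"
    by (subst power_Suc) (simp only: sderiv_simps)
  also have "sderiv v X * X ^ Suc d = X ^ Suc d * sderiv v X"
    by (rule power_commuting_commutes[symmetric]) (use assms in simp)
  also have "X * sderiv v (X ^ Suc d) = of_nat (Suc d) * (X ^ Suc d * sderiv v X)"
  proof -
    have "X * (of_nat (Suc d) * (X ^ d * sderiv v X)) = of_nat (Suc d) * (X * (X ^ d * sderiv v X))"
      by (simp only: mult.assoc[symmetric] mult_of_nat_commute[of "Suc d" X])
    then show ?thesis unfolding Suc by (simp only: power_Suc mult.assoc)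
  qed
  finally show ?case by (simp add: ring_distribs)
qed (simp add: sderiv_simps)

text \<open>
  The derivative of the exponential is the exponential times the derivative of the exponent because
  the structure matrices commute.
\<close>

lemma exp_cal_calibration:
  assumes F: "const_alg F Cc" and comm: "\<And>\<gamma> \<delta>. struct_mat F \<gamma> * struct_mat F \<delta> = struct_mat F \<delta> * struct_mat F \<gamma>"
  shows "calibration F (exp_cal Cc)"
proof (rule calibrationI)
  show "exp_cal Cc 0 = mat 1"
    by (rule SQ_inject[THEN iffD1]) (simp_all add: SQ_exp_cal SQ_simps mfps_const_simps scal_simps)
  fix d \<gamma>
  let ?X = "position_mult Cc mfps_var :: ('a mfps, 'a) sqm"
  have C: "const_mat (Cc \<delta>) = struct_mat F \<delta>" for \<delta> using F by (simp add: const_alg_def)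
  have dX: "sderiv \<gamma> ?X = struct_mat F \<gamma>"
  proof -
    have "sderiv \<gamma> ?X = (\<Sum>\<delta>\<in>UNIV. scal (if \<delta> = \<gamma> then 1 else 0) (const_mat (Cc \<delta>)))"
      by (simp add: position_mult_def sderiv_sum sderiv_scal scal_simps)
    also have "\<dots> = (\<Sum>\<delta>\<in>UNIV. if \<delta> = \<gamma> then const_mat (Cc \<delta>) else 0)"
      by (rule sum.cong) (auto simp: scal_simps)
    finally show ?thesis by (simp add: C)
  qed
  have "struct_mat F \<gamma> * ?X = ?X * struct_mat F \<gamma>"
    by (simp add: position_mult_def C sum_distrib_left sum_distrib_right scal_simps comm[of \<gamma>])
  then have "sderiv \<gamma> (?X ^ Suc d) = of_nat (Suc d) * (?X ^ d * struct_mat F \<gamma>)"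
    using sderiv_power_commuting[of \<gamma> ?X d] by (simp add: dX)
  then have "sderiv \<gamma> (SQ (exp_cal Cc (Suc d))) = scal (mfps_const (1 / fact (Suc d)) * mfps_const (of_nat (Suc d))) (?X ^ d * struct_mat F \<gamma>)"
    by (simp only: SQ_exp_cal sderiv_scal scal_const_of_nat[symmetric] mfps_deriv_simps scal_simps add_0)
  also have "mfps_const (1 / fact (Suc d)) * mfps_const (of_nat (Suc d)) = (mfps_const (1 / fact d) :: 'a mfps)"
    by (simp add: mfps_const_simps(6)[symmetric] del: of_nat_Suc)
  finally show "sderiv \<gamma> (SQ (exp_cal Cc (Suc d))) = SQ (exp_cal Cc d) * struct_mat F \<gamma>"
    by (simp add: SQ_exp_cal scal_simps)
qed

lemma exp_cal_normalised: "normalised (exp_cal Cc)"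
  unfolding normalised_def
proof (intro allI impI)
  fix d \<alpha> \<beta> assume d: "(1::nat) \<le> d"
  let ?X = "position_mult Cc mfps_var :: ('a mfps, 'a) sqm"
  have X: "mfps_coeff (entry ?X i j) {#} = 0" for i j by (simp add: position_mult_def)
  have "mfps_coeff (entry (?X ^ d) \<alpha> \<beta>) {#} = 0"
    using d by (cases d) (simp_all add: entry_times X)
  then have "mfps_coeff (entry (SQ (exp_cal Cc d)) \<alpha> \<beta>) {#} = 0" by (simp add: SQ_exp_cal)
  then show "mfps_coeff (exp_cal Cc d $ \<alpha> $ \<beta>) {#} = 0" by simp
qed

lemma smap_subst_hom:
  fixes y :: "'n :: finite \<Rightarrow> 'v mfps" and A B :: "('n mfps, 'm :: finite) sqm"
    and M :: "complex^'m^'m" and X :: "'i \<Rightarrow> ('n mfps, 'm) sqm"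
  assumes "\<And>v. mfps_coeff (y v) {#} = 0"
  shows "smap (mfps_subst y) (A * B) = smap (mfps_subst y) A * smap (mfps_subst y) B"
    and "smap (mfps_subst y) (A + B) = smap (mfps_subst y) A + smap (mfps_subst y) B"
    and "smap (mfps_subst y) (- A) = - smap (mfps_subst y) A"
    and "smap (mfps_subst y) (1 :: ('n mfps, 'm) sqm) = 1" "smap (mfps_subst y) (0 :: ('n mfps, 'm) sqm) = 0" "smap (mfps_subst y) (const_mat M) = const_mat M"
    and "smap (mfps_subst y) (scal c A) = scal (mfps_subst y c) (smap (mfps_subst y) A)"
    and "smap (mfps_subst y) (sum X I) = (\<Sum>i\<in>I. smap (mfps_subst y) (X i))"
    and "smap (mfps_subst y) (A ^ n) = smap (mfps_subst y) A ^ n"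
proof -
  note s = substitutable_UNIV[OF subst_adm_finite[of y, OF assms]]
  have m: "smap (mfps_subst y) (A * B) = smap (mfps_subst y) A * smap (mfps_subst y) B" for A B :: "('n mfps, 'm :: finite) sqm"
    by (rule sqm_eqI) (simp add: entry_times subst_sum subst_mult s)
  show "smap (mfps_subst y) (A * B) = smap (mfps_subst y) A * smap (mfps_subst y) B" by (rule m)
  show "smap (mfps_subst y) (A + B) = smap (mfps_subst y) A + smap (mfps_subst y) B"
    by (rule sqm_eqI) (simp add: subst_add s)
  show "smap (mfps_subst y) (- A) = - smap (mfps_subst y) A"
    by (rule sqm_eqI) (simp add: subst_uminus s)
  show o: "smap (mfps_subst y) 1 = (1 :: ('v mfps, 'm) sqm)"
    by (rule sqm_eqI) simp
  show "smap (mfps_subst y) 0 = (0 :: ('v mfps, 'm) sqm)" "smap (mfps_subst y) (const_mat M) = const_mat M"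
    by (rule sqm_eqI, simp)+
  show "smap (mfps_subst y) (scal c A) = scal (mfps_subst y c) (smap (mfps_subst y) A)"
    by (rule sqm_eqI) (simp add: subst_mult s)
  show "smap (mfps_subst y) (sum X I) = (\<Sum>i\<in>I. smap (mfps_subst y) (X i))"
    by (rule sqm_eqI) (simp add: subst_sum s)
  show "smap (mfps_subst y) (A ^ n) = smap (mfps_subst y) A ^ n"
    by (induction n) (simp_all add: m o)
qed

lemma subst_exp_cal:
  assumes z: "\<And>v. mfps_coeff (y v) {#} = 0"
  shows "smap (mfps_subst y) (SQ (exp_cal Cc d)) = scal (mfps_const (1 / fact d)) (position_mult Cc y ^ d)"
  by (simp add: SQ_exp_cal smap_subst_hom[of y, OF z] position_mult_def)

lemma laurent_mult_const: "laurent_mult (laurent_const M) f k \<alpha> = mat_vec (const_mat M) (f k) \<alpha>"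
  "mfps_summable (laurent_term (laurent_const M) f k \<alpha>)"
proof -
  have o: "laurent_term (laurent_const M) f k \<alpha> x = 0" if "x \<notin> {0} \<times> UNIV" for x
    using that by (cases x) (auto simp: laurent_term_def laurent_const_def mfps_const_simps)
  show "laurent_mult (laurent_const M) f k \<alpha> = mat_vec (const_mat M) (f k) \<alpha>"
    unfolding laurent_mult_def
    by (subst mfps_Sum_eq_sum[of "{0} \<times> UNIV"], simp, rule o)
      (simp_all add: laurent_term_def laurent_const_def mat_vec_def sum.cartesian_product[symmetric])
  show "mfps_summable (laurent_term (laurent_const M) f k \<alpha>)"
    by (rule mfps_summable_finite_support[of "{0} \<times> UNIV"]) (simp, rule o)
qed

lemma intertwine_mult:
  fixes a b m :: "'a :: semigroup_mult"
  assumes "a * m = m * a'" "b * m = m * b'"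
  shows "(a * b) * m = m * (a' * b')"
  by (metis assms mult.assoc)

text \<open>
  If \<open>M\<close> intertwines the calibrations along \<open>w\<close> and \<open>M w\<close>, it intertwines everything built from
  them by products and inverses.  Hence \<open>M w\<close> solves the Euler-Lagrange equation at the image of a
  point, and the potentials are carried along.
\<close>

lemma GL_maps:
  assumes cd: "cone_data F A J w C" and cd1: "cone_data F1 A1 J1 w1 C1"
    and A1: "A1 = M *v A" and n: "normalised J" "normalised J1"
    and y: "y = mat_vec (const_mat M) w"
    and H: "\<And>d. smap (mfps_subst y) (SQ (J1 d)) * const_mat M = const_mat M * smap (mfps_subst w) (SQ (J d))"
  shows "maps_base (laurent_const M) C C1 \<and> maps_into (laurent_const M) C C1"
proof -
  note c = cd[unfolded cone_data_def] and c1 = cd1[unfolded cone_data_def]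
  have z: "mfps_coeff (w v) {#} = 0" for v using c by (simp add: euler_solution_def)
  have zy: "mfps_coeff (y v) {#} = 0" for v by (simp add: y mat_vec_def z)
  let ?g = "cone_point C"
  let ?f = "laurent_mult (laurent_const M) ?g"
  have f: "?f k \<alpha> = mat_vec (const_mat M) (?g k) \<alpha>" for k \<alpha> by (rule laurent_mult_const)
  have gq: "?g (int d) = q_point A J d" for d using c by (intro ext) (simp add: cone_point_def)
  have fq: "?f (int d) = mat_vec (const_mat M) (q_point A J d)" for d by (rule ext) (simp add: f gq)
  have gp: "?g (- int a - 1) \<alpha> = (- 1) ^ (a + 1) * pairing w (Omega J a) (q_point A J) \<alpha>" for a \<alpha>
  proof -
    have "nat (- (- int a - 1)) = a + 1" "nat (- (- int a - 1) - 1) = a" by auto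
    then show ?thesis using c by (simp add: cone_point_def)
  qed
  have b0: "mfps_coeff (?f (int d) \<alpha>) {#} = base C1 d $ \<alpha>" for d \<alpha>
    using c c1 cal_shift_normalised[OF n(1), of A] cal_shift_normalised[OF n(2), of A1]
    by (auto simp: fq mat_vec_def coeff_q_coord_empty cone_base_def A1 matrix_vector_mult_def sum_negf)
  \<comment> \<open>The intertwining relation passes to the inverses and to the bilinear expressions in both.\<close>
  let ?\<Phi> = "\<lambda>P. Abs_fps (\<lambda>n. smap (mfps_subst y) (fps_nth P n)) * fps_const (const_mat M)"
  let ?\<Psi> = "\<lambda>P. fps_const (const_mat M) * Abs_fps (\<lambda>n. smap (mfps_subst w) (fps_nth P n))"
  have mult: "?\<Phi> (P * Q) = ?\<Psi> (P' * Q')" if "?\<Phi> P = ?\<Psi> P'" "?\<Phi> Q = ?\<Psi> Q'" for P Q P' Q'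
  proof -
    have h: "Abs_fps (\<lambda>n. smap (mfps_subst u) (fps_nth (X * Y) n)) =
        Abs_fps (\<lambda>n. smap (mfps_subst u) (fps_nth X n)) * Abs_fps (\<lambda>n. smap (mfps_subst u) (fps_nth Y n))"
      if "\<And>v. mfps_coeff (u v) {#} = 0" for u :: "'a \<Rightarrow> ('a \<times> nat) mfps" and X Y
      by (rule fps_ext) (simp add: fps_mult_nth smap_subst_hom[of u, OF that])
    show ?thesis
      unfolding h[of y, OF zy] h[of w, OF z] by (rule intertwine_mult[OF that])
  qed
  have J: "?\<Phi> (sq_fps J1) = ?\<Psi> (sq_fps J)"
    by (rule fps_ext) (simp add: H)
  have one: "?\<Phi> 1 = ?\<Psi> 1"
    by (rule fps_ext) (simp add: smap_subst_hom[of y, OF zy] smap_subst_hom[of w, OF z] if_distrib[of "\<lambda>x. x * _"] if_distrib[of "\<lambda>x. _ * x"] if_distrib[of "smap _"] cong: if_cong)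
  have sh: "?\<Phi> (fps_shift k P) = ?\<Psi> (fps_shift k P')" if "?\<Phi> P = ?\<Psi> P'" for k P P'
    using that by (simp add: fps_eq_iff)
  have K: "?\<Phi> (sq_fps (series_inv J1)) = ?\<Psi> (sq_fps (series_inv J))"
  proof -
    have h: "Abs_fps (\<lambda>n. smap (mfps_subst u) (fps_nth (X * Y) n)) =
        Abs_fps (\<lambda>n. smap (mfps_subst u) (fps_nth X n)) * Abs_fps (\<lambda>n. smap (mfps_subst u) (fps_nth Y n))"
      if "\<And>v. mfps_coeff (u v) {#} = 0" for u :: "'a \<Rightarrow> ('a \<times> nat) mfps" and X Y
      by (rule fps_ext) (simp add: fps_mult_nth smap_subst_hom[of u, OF that])
    have o: "Abs_fps (\<lambda>n. smap (mfps_subst u) (fps_nth 1 n)) = 1"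
      if "\<And>v. mfps_coeff (u v) {#} = 0" for u :: "'a \<Rightarrow> ('a \<times> nat) mfps"
      by (rule fps_ext) (simp add: smap_subst_hom[of u, OF that])
    define a1 k1 a k where "a1 = Abs_fps (\<lambda>n. smap (mfps_subst y) (fps_nth (sq_fps J1) n))"
      and "k1 = Abs_fps (\<lambda>n. smap (mfps_subst y) (fps_nth (sq_fps (series_inv J1)) n))"
      and "a = Abs_fps (\<lambda>n. smap (mfps_subst w) (fps_nth (sq_fps J) n))"
      and "k = Abs_fps (\<lambda>n. smap (mfps_subst w) (fps_nth (sq_fps (series_inv J)) n))"
    have ka: "k1 * a1 = 1" "a * k = 1"
      unfolding a1_def k1_def a_def k_def h[of y, OF zy, symmetric] h[of w, OF z, symmetric]
      using calibration_inverse[of F1 J1] calibration_inverse[of F J] c c1 o[of y, OF zy] o[of w, OF z] by simp_all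
    have "a1 * fps_const (const_mat M) = fps_const (const_mat M) * a" using J by (simp only: a1_def a_def)
    then have "k1 * (a1 * fps_const (const_mat M)) * k = k1 * (fps_const (const_mat M) * a) * k" by simp
    then have "k1 * a1 * fps_const (const_mat M) * k = k1 * fps_const (const_mat M) * (a * k)" by (simp only: mult.assoc)
    then have "fps_const (const_mat M) * k = k1 * fps_const (const_mat M)" by (simp only: ka mult_1_left mult_1_right)
    then show ?thesis by (simp only: k1_def k_def)
  qed
  have nth: "smap (mfps_subst y) (fps_nth P n) * const_mat M = const_mat M * smap (mfps_subst w) (fps_nth P' n)"
    if "?\<Phi> P = ?\<Psi> P'" for P P' n
    using arg_cong[OF that, of "\<lambda>P. fps_nth P n"] by simp
  have sgn: "smap (mfps_subst u) (alt_sign b * X) = alt_sign b * smap (mfps_subst u) X"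
    if "\<And>v. mfps_coeff (u v) {#} = 0" for u :: "'a \<Rightarrow> ('a \<times> nat) mfps" and X b
    by (auto simp: alt_sign_def smap_subst_hom[of u, OF that])
  have L: "smap (mfps_subst y) (SQ (lower_Omega J1 b)) * const_mat M = const_mat M * smap (mfps_subst w) (SQ (lower_Omega J b))" for b
    using nth[OF K, of b]
    by (simp add: lower_Omega_def SQ_simps smap_subst_hom[of y, OF zy] smap_subst_hom[of w, OF z])
  have O: "smap (mfps_subst y) (SQ (Omega J1 a b)) * const_mat M = const_mat M * smap (mfps_subst w) (SQ (Omega J a b))" for a b
    using nth[OF mult[OF sh[OF J] K], of "Suc a" b] c c1
    by (simp add: Omega_eq[of F J] Omega_eq[of F1 J1] smap_subst_hom(3)[of y, OF zy] smap_subst_hom(3)[of w, OF z])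
  have pair: "pairing y X1 (\<lambda>d. ?f (int d)) \<alpha> = mat_vec (const_mat M) (pairing w X (q_point A J)) \<alpha>"
    if "\<And>b. smap (mfps_subst y) (SQ (X1 b)) * const_mat M = const_mat M * smap (mfps_subst w) (SQ (X b))" for X1 X \<alpha>
  proof -
    have "pairing y X1 (\<lambda>d. ?f (int d)) \<alpha> = mfps_Sum (\<lambda>b. mat_vec (smap (mfps_subst y) (SQ (X1 b)) * const_mat M) (q_point A J b) \<alpha>)"
      by (simp add: pairing_mat_pairing mat_pairing_def fq mat_vec_mult)
    also have "\<dots> = mat_vec (const_mat M) (pairing w X (q_point A J)) \<alpha>"
      unfolding that pairing_mat_pairing mat_pairing_def[abs_def] mat_vec_mult
      by (rule mat_vec_Sum[symmetric]) (intro mat_vec_summable q_coord_summable)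
    finally show ?thesis .
  qed
  have "point_on_germ ?f C1"
  proof (rule point_criterion_linear[OF cd1 b0 _ zy])
    show "mfps_summable (\<lambda>d. ?f (int d) \<alpha>)" for \<alpha>
      unfolding fq by (intro mat_vec_summable q_coord_summable)
    show "pairing y (lower_Omega J1) (\<lambda>d. ?f (int d)) \<alpha> = 0" for \<alpha>
      using c by (simp add: pair[of "lower_Omega J1" "lower_Omega J", OF L] euler_solution_def mat_vec_def)
    show "?f (- int a - 1) \<alpha> = (- 1) ^ (a + 1) * pairing y (Omega J1 a) (\<lambda>d. ?f (int d)) \<alpha>" for a \<alpha>
      proof -
      have "?g (- int a - 1) = (\<lambda>\<beta>. (- 1) ^ (a + 1) * pairing w (Omega J a) (q_point A J) \<beta>)"
        by (rule ext) (rule gp)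
      then show ?thesis by (simp only: pair[of "Omega J1 a" "Omega J a", OF O] f mat_vec_simps(4))
    qed
  qed
  then show ?thesis
    using b0 by (simp add: maps_base_def maps_into_def laurent_mult_const(2))
qed

text \<open>
  An isomorphism of algebras intertwines the multiplications by position vectors, hence their
  exponentials.
\<close>

lemma exp_cal_intertwine:
  assumes z: "\<And>v. mfps_coeff (y v) {#} = 0"
    and R: "\<And>\<beta>. (\<Sum>\<gamma>\<in>UNIV. scal (mfps_const (M $ \<gamma> $ \<beta>)) (const_mat (Cc1 \<gamma>))) * const_mat M = (const_mat M * const_mat (Cc \<beta>) :: ('v mfps, 'n :: finite) sqm)"
  shows "smap (mfps_subst (mat_vec (const_mat M) y)) (SQ (exp_cal Cc1 d)) * const_mat M =
    (const_mat M * smap (mfps_subst y) (SQ (exp_cal Cc d)) :: ('v mfps, 'n) sqm)"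
proof -
  have z1: "mfps_coeff (mat_vec (const_mat M) y v) {#} = 0" for v by (simp add: mat_vec_def z)
  let ?X1 = "position_mult Cc1 (mat_vec (const_mat M) y)" and ?X = "position_mult Cc y"
  have "?X1 = (\<Sum>\<gamma>\<in>UNIV. \<Sum>\<beta>\<in>UNIV. scal (y \<beta>) (scal (mfps_const (M $ \<gamma> $ \<beta>)) (const_mat (Cc1 \<gamma>))))"
    unfolding position_mult_def
    by (intro sum.cong refl sqm_eqI) (simp add: mat_vec_def sum_distrib_left sum_distrib_right mult_ac)
  also have "\<dots> = (\<Sum>\<beta>\<in>UNIV. scal (y \<beta>) (\<Sum>\<gamma>\<in>UNIV. scal (mfps_const (M $ \<gamma> $ \<beta>)) (const_mat (Cc1 \<gamma>))))"
    by (subst sum.swap) (simp add: scal_sum)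
  finally have "?X1 * const_mat M = (\<Sum>\<beta>\<in>UNIV. scal (y \<beta>) (\<Sum>\<gamma>\<in>UNIV. scal (mfps_const (M $ \<gamma> $ \<beta>)) (const_mat (Cc1 \<gamma>))) * const_mat M)"
    by (simp only: sum_distrib_right[of _ _ "const_mat M"])
  also have "\<dots> = (\<Sum>\<beta>\<in>UNIV. scal (y \<beta>) (const_mat M * const_mat (Cc \<beta>)))"
    by (simp only: scal_simps(1) R)
  finally have "?X1 * const_mat M = const_mat M * ?X"
    by (simp add: sum_distrib_left scal_simps position_mult_def)
  then have "?X1 ^ d * const_mat M = const_mat M * ?X ^ d"
  proof (induction d)
    case (Suc d)
    show ?case unfolding power_Suc by (rule intertwine_mult[OF Suc.prems Suc.IH[OF Suc.prems]])
  qed simp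
  then show ?thesis
    by (simp add: subst_exp_cal[of y, OF z] subst_exp_cal[of "mat_vec (const_mat M) y", OF z1] scal_simps)
qed

lemma calibration_normalised_unique:
  assumes "calibration F J" "calibration F J'" "normalised J" "normalised J'"
  shows "J = J'"
proof
  fix d show "J d = J' d"
  proof (induction d)
    case 0
    then show ?case using calibration_0 assms by metis
  next
    case (Suc d)
    have "J (Suc d) $ \<alpha> $ \<beta> = J' (Suc d) $ \<alpha> $ \<beta>" for \<alpha> \<beta>
      by (rule mfps_eq_by_deriv) (use assms Suc in \<open>simp_all add: calibration_def normalised_def\<close>)
    then show ?case by (simp add: vec_eq_iff)
  qed
qed

lemma deriv_quadratic:
  "mfps_deriv \<delta> (mfps_deriv \<epsilon> (mfps_const c * (mfps_var \<beta> * mfps_var \<gamma>))) =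
    (if \<gamma> = \<epsilon> then (if \<beta> = \<delta> then mfps_const c else 0) else 0) +
    (if \<gamma> = \<delta> then (if \<beta> = \<epsilon> then mfps_const c else 0) else 0)"
  by (auto simp: mfps_deriv_mult mfps_deriv_linear ring_distribs)

definition triv_C :: "'n :: finite \<Rightarrow> complex^'n^'n" where
  "triv_C \<gamma> = (\<chi> i j. if i = \<gamma> \<and> j = \<gamma> then 1 else 0)"

lemma structure_const_triv: "structure_const triv_F \<alpha> \<beta> \<gamma> = (if \<alpha> = \<beta> \<and> \<alpha> = \<gamma> then 1 else 0)"
proof -
  have "mfps_const (1 / 2) + mfps_const (1 / 2) = (1 :: 'a mfps)"
    by (simp only: mfps_const_simps(3)[symmetric]) (simp add: mfps_const_simps(2))
  then show ?thesis
    unfolding structure_const_def triv_F_def power2_eq_square deriv_quadratic by auto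
qed

lemma triv_const_alg: "const_alg triv_F triv_C"
  unfolding const_alg_def
  by (intro allI sqm_eqI) (auto simp: structure_const_triv triv_C_def mfps_const_simps)

lemma triv_flat: "flat_F_manifold triv_F (\<chi> \<alpha>. 1)"
proof -
  have "(\<Sum>\<mu>\<in>UNIV. structure_const triv_F \<alpha> \<beta> \<mu> * structure_const triv_F \<mu> \<gamma> \<delta>) =
      (if \<alpha> = \<beta> \<and> \<alpha> = \<gamma> \<and> \<alpha> = \<delta> then 1 else 0 :: 'a mfps)" for \<alpha> \<beta> \<gamma> \<delta>
  proof -
    have "(\<Sum>\<mu>\<in>UNIV. structure_const triv_F \<alpha> \<beta> \<mu> * structure_const triv_F \<mu> \<gamma> \<delta>) =
        (\<Sum>\<mu>\<in>UNIV. if \<mu> = \<alpha> then (if \<alpha> = \<beta> \<and> \<alpha> = \<gamma> \<and> \<alpha> = \<delta> then 1 else 0 :: 'a mfps) else 0)"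
      by (rule sum.cong) (auto simp: structure_const_triv)
    then show ?thesis by simp
  qed
  moreover have "(\<Sum>\<mu>\<in>UNIV. mfps_const ((\<chi> \<alpha>. 1) $ \<mu>) * structure_const triv_F \<alpha> \<mu> \<beta>) = (if \<alpha> = \<beta> then 1 else 0 :: 'a mfps)" for \<alpha> \<beta>
  proof -
    have "(\<Sum>\<mu>\<in>UNIV. mfps_const ((\<chi> \<alpha>. 1) $ \<mu>) * structure_const triv_F \<alpha> \<mu> \<beta>) =
        (\<Sum>\<mu>\<in>UNIV. if \<mu> = \<alpha> then (if \<alpha> = \<beta> then 1 else 0 :: 'a mfps) else 0)"
      by (rule sum.cong) (auto simp: structure_const_triv mfps_const_simps)
    then show ?thesis by simp
  qed
  ultimately show ?thesis by (auto simp: flat_F_manifold_def)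
qed

text \<open>
  Uniqueness of the normalised calibration and of its cone makes the description in the definition
  of the trivial cone a definite one.
\<close>

lemma triv_cone_data: "\<exists>w. cone_data triv_F (\<chi> \<alpha>. 1) (exp_cal triv_C) w triv_cone"
proof -
  have cal: "calibration triv_F (exp_cal (triv_C :: 'a \<Rightarrow> _))"
    by (rule exp_cal_calibration[OF triv_const_alg struct_mat_commute[OF triv_flat]])
  obtain C w where cd: "cone_data triv_F (\<chi> \<alpha>. 1) (exp_cal (triv_C :: 'a \<Rightarrow> _)) w C"
    using cone_data_exists[OF triv_flat cal] by blast
  have "triv_cone = C"
    unfolding triv_cone_def
  proof (rule the_equality)
    show "\<exists>J. calibration triv_F J \<and> (\<forall>d\<ge>1. \<forall>\<alpha> \<beta>. mfps_coeff (J d $ \<alpha> $ \<beta>) {#} = 0) \<and> cone_of 0 (\<chi> \<alpha>. 1) J C"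
      using cal cd exp_cal_normalised[of "triv_C :: 'a \<Rightarrow> _"] cone_of_iff[OF triv_flat cal, of 0 C]
      unfolding normalised_def by blast
    fix C' :: "'a germ"
    assume "\<exists>J. calibration triv_F J \<and> (\<forall>d\<ge>1. \<forall>\<alpha> \<beta>. mfps_coeff (J d $ \<alpha> $ \<beta>) {#} = 0) \<and> cone_of 0 (\<chi> \<alpha>. 1) J C'"
    then obtain J where J: "calibration triv_F J" "normalised J" "cone_of 0 (\<chi> \<alpha>. 1) J C'"
      unfolding normalised_def by blast
    have "J = exp_cal triv_C"
      by (rule calibration_normalised_unique[OF J(1) cal J(2) exp_cal_normalised])
    then obtain w' where "cone_data triv_F (\<chi> \<alpha>. 1) (exp_cal (triv_C :: 'a \<Rightarrow> _)) w' C'"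
      using J(3) cone_of_iff[OF triv_flat cal, of 0 C'] by blast
    then show "C' = C" by (rule cone_data_unique[OF _ cd])
  qed
  then show ?thesis using cd by blast
qed

definition quad_F :: "('n :: finite \<Rightarrow> complex^'n^'n) \<Rightarrow> 'n \<Rightarrow> 'n mfps" where
  "quad_F Cc \<alpha> = mfps_const (1 / 2) * (\<Sum>\<beta>\<in>UNIV. \<Sum>\<gamma>\<in>UNIV. mfps_const (Cc \<beta> $ \<alpha> $ \<gamma>) * (mfps_var \<beta> * mfps_var \<gamma>))"

lemma quad_const_alg:
  assumes sym: "\<And>\<alpha> \<beta> \<gamma>. Cc \<beta> $ \<alpha> $ \<gamma> = Cc \<gamma> $ \<alpha> $ \<beta>"
  shows "const_alg (quad_F Cc) Cc"
  unfolding const_alg_def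
proof (intro allI sqm_eqI)
  fix \<delta> \<alpha> \<epsilon>
  have "entry (struct_mat (quad_F Cc) \<delta>) \<alpha> \<epsilon> = mfps_const (1 / 2) * (mfps_const (Cc \<delta> $ \<alpha> $ \<epsilon>) + mfps_const (Cc \<epsilon> $ \<alpha> $ \<delta>))"
    unfolding entry_struct_mat structure_const_def quad_F_def mfps_deriv_const_mult[of _ "1 / 2"] mfps_deriv_sum deriv_quadratic
    by (simp add: sum.distrib)
  also have "\<dots> = mfps_const (Cc \<delta> $ \<alpha> $ \<epsilon>)"
    by (simp add: sym[of \<epsilon>] mfps_const_simps(3,6)[symmetric])
  finally show "entry (struct_mat (quad_F Cc) \<delta>) \<alpha> \<epsilon> = entry (const_mat (Cc \<delta>)) \<alpha> \<epsilon>" by simp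
qed

section \<open>Laurent series whose negative powers of \<open>z\<close> are small\<close>

text \<open>
  Points of the loop space are Laurent series in \<open>z\<close> that are infinite in both directions, and their
  products make sense because the coefficient of \<open>z\<^sup>-\<^sup>k\<close> vanishes to order \<open>k\<close>.  Writing
  \<open>v = z x\<close> for every variable \<open>v\<close> turns such a series into an ordinary power series in \<open>z\<close>
  (the variable \<open>None\<close>) and the \<open>x\<close> (the variables \<open>Some v\<close>), so that the ring structure comes
  for free; \<open>zcoeff k\<close> extracts the coefficient of \<open>z\<^sup>k\<close>, and \<open>pack\<close> is the inverse passage.
  The derivation \<open>mfps_deriv (Some v)\<close> is \<open>z \<partial>\<^sub>v\<close>.
\<close>

definition x_part :: "'v option multiset \<Rightarrow> 'v multiset" where
  "x_part M = image_mset the (filter_mset (\<lambda>x. x \<noteq> None) M)"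

definition zdeg :: "'v option multiset \<Rightarrow> int" where
  "zdeg M = int (count M None) - int (size (x_part M))"

definition enc :: "int \<Rightarrow> 'v multiset \<Rightarrow> 'v option multiset" where
  "enc k m = image_mset Some m + replicate_mset (nat (k + int (size m))) None"

definition zcoeff :: "int \<Rightarrow> 'v option mfps \<Rightarrow> 'v mfps" where
  "zcoeff k F = Abs_mfps (\<lambda>m. if 0 \<le> k + int (size m) then mfps_coeff F (enc k m) else 0)"

definition pack :: "(int \<Rightarrow> 'v mfps) \<Rightarrow> 'v option mfps" where
  "pack f = Abs_mfps (\<lambda>M. mfps_coeff (f (zdeg M)) (x_part M))"

text \<open>
  The condition under which \<open>pack\<close> loses nothing: exponents of \<open>z\<close> in the new variables must be
  nonnegative.
\<close>

definition loop_bounded :: "(int \<Rightarrow> 'v mfps) \<Rightarrow> bool" where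
  "loop_bounded f \<longleftrightarrow> (\<forall>k m. mfps_coeff (f k) m \<noteq> 0 \<longrightarrow> 0 \<le> k + int (size m))"

lemma x_part_simps [simp]:
  "x_part {#} = {#}" "x_part (add_mset None M) = x_part M" "x_part (add_mset (Some v) M) = add_mset v (x_part M)"
  "x_part (M + N) = x_part M + x_part N" "x_part (replicate_mset n None) = {#}"
  by (simp_all add: x_part_def)

lemma x_part_image [simp]: "x_part (image_mset Some m) = m"
  by (induction m) simp_all

lemma image_x_part: "image_mset Some (x_part M) + replicate_mset (count M None) None = M"
proof (induction M)
  case (add x M)
  then show ?case by (cases x) auto
qed simp

lemma enc_x_part: "enc (zdeg M) (x_part M) = M"
  by (simp add: enc_def zdeg_def image_x_part)

lemma x_part_enc [simp]: "x_part (enc k m) = m"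
  by (simp add: enc_def)

lemma zdeg_enc: "0 \<le> k + int (size m) \<Longrightarrow> zdeg (enc k m) = k"
proof -
  have "count (image_mset Some m) None = 0" by (simp add: count_eq_zero_iff)
  then show "0 \<le> k + int (size m) \<Longrightarrow> zdeg (enc k m) = k" by (simp add: zdeg_def) (simp add: enc_def)
qed

lemma zdeg_add: "zdeg (M + N) = zdeg M + zdeg N"
  by (simp add: zdeg_def)

lemma zdeg_ge: "0 \<le> zdeg M + int (size (x_part M))" by (simp add: zdeg_def)

lemma coeff_zcoeff: "mfps_coeff (zcoeff k F) m = (if 0 \<le> k + int (size m) then mfps_coeff F (enc k m) else 0)"
  by (simp add: zcoeff_def)

lemma coeff_eq_zcoeff: "mfps_coeff F M = mfps_coeff (zcoeff (zdeg M) F) (x_part M)"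
  using zdeg_ge[of M] by (simp add: coeff_zcoeff enc_x_part)

lemma zcoeff_eqI: "(\<And>k. zcoeff k F = zcoeff k G) \<Longrightarrow> F = G"
  by (rule mfps_eqI) (metis coeff_eq_zcoeff)

lemma zcoeff_pack: "loop_bounded f \<Longrightarrow> zcoeff k (pack f) = f k"
  by (rule mfps_eqI) (auto simp: coeff_zcoeff pack_def zdeg_enc loop_bounded_def)

lemma zcoeff_simps [simp]:
  "zcoeff k (F + G) = zcoeff k F + zcoeff k G" "zcoeff k (F - G) = zcoeff k F - zcoeff k G" "zcoeff k (- F) = - zcoeff k F"
  "zcoeff k 0 = 0"
  by (auto intro!: mfps_eqI simp: coeff_zcoeff)

lemma zcoeff_sum: "zcoeff k (sum F I) = (\<Sum>i\<in>I. zcoeff k (F i))"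
  by (induction I rule: infinite_finite_induct) simp_all

lemma enc_eq_empty: "enc k m = {#} \<longleftrightarrow> m = {#} \<and> k \<le> 0"
  by (auto simp: enc_def)

lemma zcoeff_const: "zcoeff k (mfps_const c) = (if k = 0 then mfps_const c else 0)"
  by (rule mfps_eqI) (auto simp: coeff_zcoeff enc_eq_empty)

lemma zcoeff_1: "zcoeff k 1 = (if k = 0 then 1 else 0)"
  using zcoeff_const[of k 1] by (auto simp: mfps_const_simps)

lemma zcoeff_z: "zcoeff k (mfps_var None) = (if k = 1 then 1 else 0)"
proof (rule mfps_eqI)
  fix m :: "'a multiset"
  have "enc k m = {#None#} \<longleftrightarrow> m = {#} \<and> k = 1"
  proof
    assume e: "enc k m = {#None#}"
    then have "x_part (enc k m) = {#}" by simp
    then have "m = {#}" by simp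
    then show "m = {#} \<and> k = 1" using arg_cong[OF e, of size] by (simp add: enc_def)
  qed (simp add: enc_def)
  then show "mfps_coeff (zcoeff k (mfps_var None)) m = mfps_coeff (if k = 1 then 1 else 0) m"
    by (auto simp: coeff_zcoeff)
qed

text \<open>
  The product of doubly infinite Laurent series.  For a monomial of size \<open>s\<close> only the exponents
  between \<open>-s\<close> and \<open>k + s\<close> contribute, so that the convolution is locally finite; it is the product
  of power series regrouped by the exponent of \<open>z\<close>.
\<close>

lemma zcoeff_mult_aux:
  "mfps_summable (\<lambda>i. zcoeff i F * zcoeff (k - i) G) \<and>
    zcoeff k (F * G) = mfps_Sum (\<lambda>i. zcoeff i F * zcoeff (k - i) G)"
proof -
  let ?t = "\<lambda>i. zcoeff i F * zcoeff (k - i) G"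
  have bound: "i \<in> {- int (size m)..k + int (size m)}" if nz: "mfps_coeff (?t i) m \<noteq> 0" for i m
  proof -
    from nz obtain m1 m2 where m: "m1 + m2 = m" "mfps_coeff (zcoeff i F) m1 \<noteq> 0" "mfps_coeff (zcoeff (k - i) G) m2 \<noteq> 0"
      by (rule mfps_coeff_times_nonzero)
    then have "0 \<le> i + int (size m1)" "0 \<le> k - i + int (size m2)" "size m = size m1 + size m2"
      by (auto simp: coeff_zcoeff split: if_splits)
    then show ?thesis by auto
  qed
  have "mfps_summable ?t"
    unfolding mfps_summable_def
  proof
    fix m
    have "{i. mfps_coeff (?t i) m \<noteq> 0} \<subseteq> {- int (size m)..k + int (size m)}" using bound by blast
    then show "finite {i. mfps_coeff (?t i) m \<noteq> 0}" by (rule finite_subset) simp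
  qed
  moreover have "zcoeff k (F * G) = mfps_Sum ?t"
  proof (rule mfps_eqI)
    fix m :: "'a multiset"
    let ?I = "{- int (size m)..k + int (size m)}"
    let ?S = "{(i, p). p \<in> msplits m \<and> i \<in> ?I \<and> 0 \<le> i + int (size (fst p)) \<and> 0 \<le> k - i + int (size (snd p))}"
    let ?v = "\<lambda>i p. mfps_coeff (zcoeff i F) (fst p) * mfps_coeff (zcoeff (k - i) G) (snd p)"
    have S: "?S \<subseteq> ?I \<times> msplits m" by auto
    have "mfps_coeff (mfps_Sum ?t) m = (\<Sum>i\<in>?I. mfps_coeff (?t i) m)"
      by (rule mfps_coeff_Sum_superset[OF _ bound]) simp
    also have "\<dots> = (\<Sum>x\<in>?I \<times> msplits m. ?v (fst x) (snd x))"
      by (simp add: mfps_coeff_times sum.cartesian_product case_prod_unfold)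
    also have "\<dots> = (\<Sum>x\<in>?S. ?v (fst x) (snd x))"
      by (rule sum.mono_neutral_right) (auto simp: coeff_zcoeff)
    finally have rhs: "mfps_coeff (mfps_Sum ?t) m = (\<Sum>x\<in>?S. ?v (fst x) (snd x))" .
    show "mfps_coeff (zcoeff k (F * G)) m = mfps_coeff (mfps_Sum ?t) m"
    proof (cases "0 \<le> k + int (size m)")
      case False
      then have "?S = {}" by (auto simp: msplits_def)
      from rhs[unfolded this sum.empty] show ?thesis using False by (simp add: coeff_zcoeff)
    next
      case True
      have "mfps_coeff (zcoeff k (F * G)) m = (\<Sum>p\<in>msplits (enc k m). mfps_coeff F (fst p) * mfps_coeff G (snd p))"
        using True by (simp add: coeff_zcoeff mfps_coeff_times)
      also have "\<dots> = (\<Sum>x\<in>?S. ?v (fst x) (snd x))"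
      proof (rule sum.reindex_bij_witness[of _ "\<lambda>(i, p). (enc i (fst p), enc (k - i) (snd p))"
            "\<lambda>(K, L). (zdeg K, (x_part K, x_part L))"])
        fix p assume "p \<in> msplits (enc k m)"
        then obtain K L where p: "p = (K, L)" "K + L = enc k m" by (auto simp: msplits_def)
        have sm: "x_part K + x_part L = m" using p(2) by (metis x_part_enc x_part_simps(4))
        have zd: "zdeg K + zdeg L = k" using p(2) zdeg_enc[OF True] by (metis zdeg_add)
        then have zl: "zdeg L = k - zdeg K" by simp
        show "(case case p of (K, L) \<Rightarrow> (zdeg K, (x_part K, x_part L)) of
            (i, p) \<Rightarrow> (enc i (fst p), enc (k - i) (snd p))) = p"
          by (simp add: p enc_x_part zl[symmetric])
        have "size m = size (x_part K) + size (x_part L)" using sm by (metis size_union)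
        then show "(case p of (K, L) \<Rightarrow> (zdeg K, (x_part K, x_part L))) \<in> ?S"
          using zdeg_ge[of K] zdeg_ge[of L] zl sm by (auto simp: p msplits_def)
        show "?v (fst (case p of (K, L) \<Rightarrow> (zdeg K, (x_part K, x_part L)))) (snd (case p of (K, L) \<Rightarrow> (zdeg K, (x_part K, x_part L)))) =
            mfps_coeff F (fst p) * mfps_coeff G (snd p)"
          by (simp add: p zl[symmetric] coeff_eq_zcoeff[symmetric])
      next
        fix x assume "x \<in> ?S"
        then obtain i m1 m2 where x: "x = (i, (m1, m2))" "m1 + m2 = m" "0 \<le> i + int (size m1)" "0 \<le> k - i + int (size m2)"
          by (auto simp: msplits_def)
        show "(case case x of (i, p) \<Rightarrow> (enc i (fst p), enc (k - i) (snd p)) of (K, L) \<Rightarrow> (zdeg K, (x_part K, x_part L))) = x"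
          using x by (simp add: zdeg_enc)
        have "nat (i + int (size m1)) + nat (k - i + int (size m2)) = nat (k + int (size m))"
          using x by auto
        then have "enc i m1 + enc (k - i) m2 = enc k m"
        proof -
          assume n: "nat (i + int (size m1)) + nat (k - i + int (size m2)) = nat (k + int (size m))"
          have r: "replicate_mset a None + replicate_mset b None = replicate_mset (a + b) None" for a b
            by (induction a) simp_all
          have "enc i m1 + enc (k - i) m2 = image_mset Some (m1 + m2) +
              replicate_mset (nat (i + int (size m1)) + nat (k - i + int (size m2))) None"
            by (simp add: enc_def r[symmetric])
          then show ?thesis unfolding n x(2) enc_def .
        qed
        then show "(case x of (i, p) \<Rightarrow> (enc i (fst p), enc (k - i) (snd p))) \<in> msplits (enc k m)"
          by (simp add: x msplits_def)
      qed
      finally show ?thesis by (simp only: rhs)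
    qed
  qed
  ultimately show ?thesis by blast
qed

lemmas zcoeff_mult_summable = zcoeff_mult_aux[THEN conjunct1]
lemmas zcoeff_mult = zcoeff_mult_aux[THEN conjunct2]

lemma zcoeff_deriv: "zcoeff k (mfps_deriv (Some v) F) = mfps_deriv v (zcoeff (k - 1) F)"
proof (rule mfps_eqI)
  fix m
  have c: "count (enc k m) (Some v) = count m v"
  proof -
    have "count (image_mset Some m) (Some v) = count m v"
      by (induction m) auto
    then show ?thesis by (simp add: enc_def)
  qed
  have "add_mset (Some v) (enc k m) = enc (k - 1) (add_mset v m)"
    by (simp add: enc_def)
  then show "mfps_coeff (zcoeff k (mfps_deriv (Some v) F)) m = mfps_coeff (mfps_deriv v (zcoeff (k - 1) F)) m"
    by (simp add: coeff_zcoeff c del: of_nat_Suc)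
qed

definition single :: "'v option mfps \<Rightarrow> int \<Rightarrow> 'v mfps \<Rightarrow> bool" where
  "single F i c \<longleftrightarrow> (\<forall>k. zcoeff k F = (if k = i then c else 0))"

lemma zcoeff_mult_single_right:
  assumes "single G i c"
  shows "zcoeff k (F * G) = zcoeff (k - i) F * c"
  unfolding zcoeff_mult
  by (subst mfps_Sum_eq_sum[of "{k - i}"]) (use assms in \<open>auto simp: single_def\<close>)

lemma zcoeff_mult_single_left:
  assumes "single F i c"
  shows "zcoeff k (F * G) = c * zcoeff (k - i) G"
  using zcoeff_mult_single_right[OF assms, of k G] by (simp add: mult.commute)

lemma single_mult: "single F i c \<Longrightarrow> single G j d \<Longrightarrow> single (F * G) (i + j) (c * d)"
  by (auto simp: single_def zcoeff_mult_single_left[of F i c])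

lemma single_z: "single (mfps_var None) 1 1" by (simp add: single_def zcoeff_z)
lemma single_1: "single 1 0 1" by (simp add: single_def zcoeff_1)

definition iota :: "'v mfps \<Rightarrow> 'v option mfps" where
  "iota c = pack (\<lambda>k. if k = 0 then c else 0)"

lemma single_iota: "single (iota c) 0 c"
  unfolding single_def iota_def by (subst zcoeff_pack) (auto simp: loop_bounded_def)

definition over_z :: "'v mfps \<Rightarrow> 'v option mfps" where
  "over_z c = pack (\<lambda>k. if k = - 1 then c else 0)"

text \<open>
  Without constant term, \<open>c\<close> divided by \<open>z\<close> is a power series in \<open>z\<close> and \<open>x\<close>.
\<close>

lemma single_over_z:
  assumes "mfps_coeff c {#} = 0"
  shows "single (over_z c) (- 1) c"
proof -
  have "0 \<le> - 1 + int (size m)" if "mfps_coeff c m \<noteq> 0" for m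
  proof -
    have "m \<noteq> {#}" using that assms by auto
    then show ?thesis by (simp add: Suc_le_eq nonempty_has_size)
  qed
  then have "loop_bounded (\<lambda>k. if k = - 1 then c else 0)" by (auto simp: loop_bounded_def)
  then show ?thesis by (simp add: single_def over_z_def zcoeff_pack)
qed

lemma zcoeff_Sum:
  "mfps_summable F \<Longrightarrow> zcoeff k (mfps_Sum F) = mfps_Sum (\<lambda>i. zcoeff k (F i))"
  by (rule mfps_eqI) (auto simp: coeff_zcoeff mfps_coeff_Sum)

text \<open>Substituting \<open>y\<close> for the variable \<open>v = z x\<close> means substituting \<open>y / z\<close> for \<open>x\<close>.\<close>

definition ysub :: "('u :: finite \<Rightarrow> 'v mfps) \<Rightarrow> 'u option mfps \<Rightarrow> 'v option mfps" where
  "ysub y = mfps_subst (case_option (mfps_var None) (\<lambda>u. over_z (y u)))"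

context
  fixes y :: "'u :: finite \<Rightarrow> 'v mfps"
  assumes z: "\<And>u. mfps_coeff (y u) {#} = 0"
begin

lemma ysub_zero: "mfps_coeff (case u of None \<Rightarrow> mfps_var None | Some u \<Rightarrow> over_z (y u)) {#} = 0"
  by (cases u) (auto simp: over_z_def pack_def zdeg_def)

lemma ysub_adm: "subst_adm (case_option (mfps_var None) (\<lambda>u. over_z (y u))) UNIV"
  by (rule subst_adm_finite) (rule ysub_zero)

lemma ysub_hom:
  "ysub y (F * G) = ysub y F * ysub y G" "ysub y (F + G) = ysub y F + ysub y G"
  "ysub y 1 = 1" "ysub y 0 = 0" "ysub y (sum H I) = (\<Sum>i\<in>I. ysub y (H i))"
  by (simp_all add: ysub_def subst_mult subst_add subst_sum substitutable_UNIV[OF ysub_adm])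

lemma single_gpow: "single (gpow (case_option (mfps_var None) (\<lambda>u. over_z (y u))) M) (zdeg M) (gpow y (x_part M))"
proof (induction M)
  case empty
  then show ?case by (simp add: zdeg_def single_1)
next
  case (add x M)
  show ?case
  proof (cases x)
    case None
    then show ?thesis using single_mult[OF single_z add] by (simp add: zdeg_def add_diff_eq)
  next
    case (Some u)
    then show ?thesis using single_mult[OF single_over_z[OF z, of u] add]
      by (simp add: zdeg_def algebra_simps)
  qed
qed

lemma zcoeff_ysub: "zcoeff k (ysub y F) = mfps_subst y (zcoeff k F)"
proof -
  let ?g = "case_option (mfps_var None) (\<lambda>u. over_z (y u))"
  let ?f = "\<lambda>M. if k = zdeg M then mfps_const (mfps_coeff F M) * gpow y (x_part M) else 0"
  have s: "mfps_summable (\<lambda>M. mfps_const (mfps_coeff F M) * gpow ?g M)"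
    using substitutable_UNIV[OF ysub_adm, of F] by (simp add: mfps_substitutable_iff)
  have c: "zcoeff k (mfps_const a * gpow ?g M) = (if k = zdeg M then mfps_const a * gpow y (x_part M) else 0)" for a M
  proof -
    have "single (mfps_const a) 0 (mfps_const a)" by (simp add: single_def zcoeff_const)
    from single_mult[OF this single_gpow[of M]] show ?thesis by (simp add: single_def)
  qed
  have inj: "inj (enc k :: 'u multiset \<Rightarrow> _)" by (metis injI x_part_enc)
  have "zcoeff k (ysub y F) = mfps_Sum ?f"
    unfolding ysub_def mfps_subst_eq zcoeff_Sum[OF s] c ..
  also have "\<dots> = mfps_Sum (\<lambda>m. ?f (enc k m))"
  proof (rule mfps_Sum_reindex[OF inj, symmetric])
    fix M :: "'u option multiset" assume "M \<notin> range (enc k)"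
    then have "k \<noteq> zdeg M" by (metis enc_x_part rangeI)
    then show "?f M = 0" by simp
  qed
  also have "\<dots> = mfps_subst y (zcoeff k F)"
    unfolding mfps_subst_eq
  proof (rule mfps_Sum_cong)
    fix m
    show "?f (enc k m) = mfps_const (mfps_coeff (zcoeff k F) m) * gpow y m"
    proof (cases "0 \<le> k + int (size m)")
      case True
      then show ?thesis by (simp add: zdeg_enc coeff_zcoeff)
    next
      case False
      then have "zdeg (enc k m) \<noteq> k" using zdeg_ge[of "enc k m"] by auto
      then show ?thesis using False by (simp add: coeff_zcoeff mfps_const_simps)
    qed
  qed
  finally show ?thesis .
qed

end

section \<open>The cone as a union of subspaces\<close>

text \<open>
  A loop with powers of one sign, listed by \<open>h\<close>, acts coefficientwise by a series over \<open>nat\<close>.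
\<close>

lemma zcoeff_mat_vec:
  assumes inj: "inj h" and X: "\<And>i \<beta>. i \<notin> range h \<Longrightarrow> zcoeff i (entry X \<alpha> \<beta>) = 0"
  shows "mfps_summable (\<lambda>b :: nat. mat_vec (smap (zcoeff (h b)) X) (\<lambda>\<beta>. zcoeff (j - h b) (f \<beta>)) \<alpha>)"
    and "zcoeff j (mat_vec X f \<alpha>) = mfps_Sum (\<lambda>b. mat_vec (smap (zcoeff (h b)) X) (\<lambda>\<beta>. zcoeff (j - h b) (f \<beta>)) \<alpha>)"
proof -
  let ?t = "\<lambda>\<beta> i. zcoeff i (entry X \<alpha> \<beta>) * zcoeff (j - i) (f \<beta>)"
  have s: "mfps_summable (\<lambda>b. ?t \<beta> (h b))" for \<beta>
    by (rule mfps_summable_inj[OF zcoeff_mult_summable inj])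
  have S: "mfps_Sum (?t \<beta>) = mfps_Sum (\<lambda>b. ?t \<beta> (h b))" for \<beta>
    by (rule mfps_Sum_reindex[OF inj, symmetric]) (simp add: X)
  show "mfps_summable (\<lambda>b. mat_vec (smap (zcoeff (h b)) X) (\<lambda>\<beta>. zcoeff (j - h b) (f \<beta>)) \<alpha>)"
    unfolding mat_vec_def entry_smap by (rule mfps_summable_sum) (rule s)
  show "zcoeff j (mat_vec X f \<alpha>) = mfps_Sum (\<lambda>b. mat_vec (smap (zcoeff (h b)) X) (\<lambda>\<beta>. zcoeff (j - h b) (f \<beta>)) \<alpha>)"
    unfolding mat_vec_def entry_smap zcoeff_sum zcoeff_mult S by (rule mfps_Sum_sum[OF s, symmetric])
qed

definition plus_loop :: "('v mfps, 'n :: finite) sqm fps \<Rightarrow> ('v option mfps, 'n) sqm" where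
  "plus_loop P = mat_of (\<lambda>i j. pack (\<lambda>k. if 0 \<le> k then entry (fps_nth P (nat k)) i j else 0))"

definition minus_loop :: "('v mfps, 'n :: finite) sqm fps \<Rightarrow> ('v option mfps, 'n) sqm" where
  "minus_loop P = mat_of (\<lambda>i j. pack (\<lambda>k. if k \<le> 0 then entry (fps_nth P (nat (- k))) i j else 0))"

text \<open>
  The decay that negative powers of \<open>z\<close> need.
\<close>

definition decaying :: "('v mfps, 'n :: finite) sqm fps \<Rightarrow> bool" where
  "decaying P \<longleftrightarrow> (\<forall>d i j. ord_ge d (entry (fps_nth P d) i j))"

lemma zcoeff_plus_loop: "zcoeff k (entry (plus_loop P) i j) = (if 0 \<le> k then entry (fps_nth P (nat k)) i j else 0)"
  unfolding plus_loop_def entry_mat_of by (subst zcoeff_pack) (auto simp: loop_bounded_def)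

lemma zcoeff_minus_loop:
  assumes "decaying P"
  shows "zcoeff k (entry (minus_loop P) i j) = (if k \<le> 0 then entry (fps_nth P (nat (- k))) i j else 0)"
proof -
  have "0 \<le> k + int (size m)" if "mfps_coeff (entry (fps_nth P (nat (- k))) i j) m \<noteq> 0" "k \<le> 0" for k m
  proof -
    have "ord_ge (nat (- k)) (entry (fps_nth P (nat (- k))) i j)" using assms by (simp only: decaying_def)
    then have "\<not> size m < nat (- k)" using ord_geD that(1) by blast
    then show ?thesis by linarith
  qed
  then show ?thesis
    unfolding minus_loop_def entry_mat_of by (subst zcoeff_pack) (auto simp: loop_bounded_def split: if_splits)
qed

text \<open>
  For factors supported in one half of the exponents the convolution is finite; \<open>e\<close> is the sign of
  the exponents.
\<close>

lemma zcoeff_mult_half: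
  assumes h: "h = (\<lambda>n :: nat. e * int n)" and e: "e = 1 \<or> e = - 1"
    and F: "\<And>i. i \<notin> range h \<Longrightarrow> zcoeff i F = 0" and G: "\<And>i. i \<notin> range h \<Longrightarrow> zcoeff i G = 0"
  shows "zcoeff k (F * G) = (if k \<in> range h then (\<Sum>i\<le>nat (e * k). zcoeff (h i) F * zcoeff (k - h i) G) else 0)"
proof -
  let ?n = "nat (e * k)"
  have inj: "inj h" using e by (auto simp: h inj_def)
  have rg: "i \<in> range h \<longleftrightarrow> 0 \<le> e * i" for i
  proof
    assume "0 \<le> e * i"
    then have "i = h (nat (e * i))" using e by (auto simp: h)
    then show "i \<in> range h" by blast
  qed (use e in \<open>auto simp: h\<close>)
  have "zcoeff k (F * G) = (\<Sum>i\<in>h ` (if k \<in> range h then {..?n} else {}). zcoeff i F * zcoeff (k - i) G)"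
    unfolding zcoeff_mult
  proof (rule mfps_Sum_eq_sum)
    fix i assume i: "i \<notin> h ` (if k \<in> range h then {..?n} else {})"
    show "zcoeff i F * zcoeff (k - i) G = 0"
    proof (cases "i \<in> range h \<and> k - i \<in> range h")
      case True
      then have "0 \<le> e * i" "0 \<le> e * (k - i)" by (simp_all add: rg)
      then have "0 \<le> e * k" "i = h (nat (e * i))" "nat (e * i) \<le> ?n" using e by (auto simp: h)
      then show ?thesis using i by (auto simp: rg)
    next
      case False
      then show ?thesis using F G by auto
    qed
  qed simp
  then show ?thesis by (simp add: sum.reindex[OF inj_on_subset[OF inj subset_UNIV]])
qed

lemma plus_loop_mult: "plus_loop (P * Q) = plus_loop P * plus_loop Q"
proof (rule sqm_eqI, rule zcoeff_eqI)
  fix i j k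
  have F: "zcoeff l (entry (plus_loop P) a b) = 0" if "l \<notin> range int" for P :: "('a mfps, 'b) sqm fps" and a b l
    using that by (auto simp: zcoeff_plus_loop) (metis nonneg_int_cases rangeI)
  have rg: "k \<in> range int \<longleftrightarrow> 0 \<le> k" by (auto simp: image_iff) (metis nonneg_int_cases)
  have "zcoeff k (entry (plus_loop P * plus_loop Q) i j) =
      (\<Sum>\<mu>\<in>UNIV. if k \<in> range int then (\<Sum>a\<le>nat (1 * k). zcoeff (int a) (entry (plus_loop P) i \<mu>) * zcoeff (k - int a) (entry (plus_loop Q) \<mu> j)) else 0)"
    unfolding entry_times zcoeff_sum
    by (intro sum.cong refl zcoeff_mult_half) (simp_all add: F)
  also have "\<dots> = (if 0 \<le> k then entry (fps_nth (P * Q) (nat k)) i j else 0)"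
  proof (cases "0 \<le> k")
    case True
    have "(\<Sum>\<mu>\<in>UNIV. \<Sum>a\<le>nat k. zcoeff (int a) (entry (plus_loop P) i \<mu>) * zcoeff (k - int a) (entry (plus_loop Q) \<mu> j)) =
        (\<Sum>\<mu>\<in>UNIV. \<Sum>a\<le>nat k. entry (fps_nth P a) i \<mu> * entry (fps_nth Q (nat k - a)) \<mu> j)"
      using True by (intro sum.cong refl) (auto simp: zcoeff_plus_loop nat_diff_distrib' le_nat_iff)
    also have "\<dots> = entry (fps_nth (P * Q) (nat k)) i j"
      by (subst sum.swap) (simp add: fps_mult_nth entry_times atLeast0AtMost)
    finally show ?thesis using True by (simp add: rg)
  qed (simp add: rg)
  finally show "zcoeff k (entry (plus_loop (P * Q)) i j) = zcoeff k (entry (plus_loop P * plus_loop Q) i j)"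
    by (simp add: zcoeff_plus_loop)
qed

lemma decaying_mult: "decaying P \<Longrightarrow> decaying Q \<Longrightarrow> decaying (P * Q)"
  unfolding decaying_def
proof (intro allI)
  fix d i j assume P: "\<forall>d i j. ord_ge d (entry (fps_nth P d) i j)" and Q: "\<forall>d i j. ord_ge d (entry (fps_nth Q d) i j)"
  have "ord_ge d (entry (fps_nth P a) i k * entry (fps_nth Q (d - a)) k j)" if "a \<le> d" for a k
    using ord_ge_times[OF P[rule_format, of a i k] Q[rule_format, of "d - a" k j]] that by simp
  then show "ord_ge d (entry (fps_nth (P * Q) d) i j)"
    by (auto simp: fps_mult_nth entry_times intro!: vge_sum)
qed

lemma minus_loop_mult:
  assumes P: "decaying P" and Q: "decaying Q"
  shows "minus_loop (P * Q) = minus_loop P * minus_loop Q"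
proof (rule sqm_eqI, rule zcoeff_eqI)
  fix i j k
  let ?h = "\<lambda>n :: nat. - 1 * int n"
  have rg: "k \<in> range ?h \<longleftrightarrow> k \<le> 0" for k
  proof
    assume "k \<le> 0" then have "k = ?h (nat (- k))" by simp
    then show "k \<in> range ?h" by blast
  qed auto
  have F: "zcoeff l (entry (minus_loop P) a b) = 0" if "l \<notin> range ?h" "decaying P" for P :: "('a mfps, 'b) sqm fps" and a b l
    using that unfolding rg by (simp add: zcoeff_minus_loop)
  have "zcoeff k (entry (minus_loop P * minus_loop Q) i j) =
      (\<Sum>\<mu>\<in>UNIV. if k \<in> range ?h then (\<Sum>a\<le>nat (- 1 * k). zcoeff (?h a) (entry (minus_loop P) i \<mu>) * zcoeff (k - ?h a) (entry (minus_loop Q) \<mu> j)) else 0)"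
    unfolding entry_times zcoeff_sum
    by (intro sum.cong refl zcoeff_mult_half) (simp, rule F, assumption, rule P, rule F, assumption, rule Q)
  also have "\<dots> = (if k \<le> 0 then entry (fps_nth (P * Q) (nat (- k))) i j else 0)"
  proof (cases "k \<le> 0")
    case True
    have "(\<Sum>\<mu>\<in>UNIV. \<Sum>a\<le>nat (- k). zcoeff (- int a) (entry (minus_loop P) i \<mu>) * zcoeff (k + int a) (entry (minus_loop Q) \<mu> j)) =
        (\<Sum>\<mu>\<in>UNIV. \<Sum>a\<le>nat (- k). entry (fps_nth P a) i \<mu> * entry (fps_nth Q (nat (- k) - a)) \<mu> j)"
    proof (intro sum.cong refl)
      fix \<mu> a assume "a \<in> {..nat (- k)}"
      then have "k + int a \<le> 0" "nat (- (k + int a)) = nat (- k) - a" using True by auto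
      then show "zcoeff (- int a) (entry (minus_loop P) i \<mu>) * zcoeff (k + int a) (entry (minus_loop Q) \<mu> j) =
          entry (fps_nth P a) i \<mu> * entry (fps_nth Q (nat (- k) - a)) \<mu> j"
        by (simp add: zcoeff_minus_loop P Q)
    qed
    also have "\<dots> = entry (fps_nth (P * Q) (nat (- k))) i j"
      by (subst sum.swap) (simp add: fps_mult_nth entry_times atLeast0AtMost)
    finally show ?thesis using True rg[of k] by simp
  qed (use rg[of k] in simp)
  finally show "zcoeff k (entry (minus_loop (P * Q)) i j) = zcoeff k (entry (minus_loop P * minus_loop Q) i j)"
    by (simp add: zcoeff_minus_loop decaying_mult P Q)
qed

lemma plus_loop_minus_loop_1: "plus_loop 1 = 1" "minus_loop 1 = 1"
proof -
  have s: "decaying 1" by (auto simp: decaying_def)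
  show "plus_loop 1 = 1" "minus_loop 1 = 1"
    by (rule sqm_eqI, rule zcoeff_eqI, auto simp: zcoeff_plus_loop zcoeff_minus_loop[OF s] zcoeff_1)+
qed

text \<open>
  The fundamental solution \<open>J(-1/z)\<close> and its inverse; the coefficients of the latter are the
  \<open>\<Omega>^0_{d-1}\<close>.
\<close>

definition fund_sol :: "(nat \<Rightarrow> ('n :: finite) mfps^'n^'n) \<Rightarrow> ('n option mfps, 'n) sqm" where
  "fund_sol J = minus_loop (Abs_fps (\<lambda>d. alt_sign d * SQ (J d)))"

definition fund_inv :: "(nat \<Rightarrow> ('n :: finite) mfps^'n^'n) \<Rightarrow> ('n option mfps, 'n) sqm" where
  "fund_inv J = minus_loop (Abs_fps (\<lambda>d. SQ (lower_Omega J d)))"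

context
  fixes F :: "'n :: finite \<Rightarrow> 'n mfps" and J :: "nat \<Rightarrow> 'n mfps^'n^'n"
  assumes cal: "calibration F J" and n: "normalised J"
begin

lemma entry_alt_sign: "entry (alt_sign d * X) i j = alt_sign d * entry X i j"
  by (simp add: alt_sign_def)

lemma decaying_S: "decaying (Abs_fps (\<lambda>d. alt_sign d * SQ (J d)))"
  unfolding decaying_def using ord_ge_calibration[OF cal n] by (auto simp: alt_sign_def intro: vge_uminus)

lemma decaying_K: "decaying (Abs_fps (\<lambda>d. SQ (lower_Omega J d)))"
  unfolding decaying_def using ord_ge_lower_Omega[OF cal n] by simp

lemma zcoeff_fund_sol: "zcoeff k (entry (fund_sol J) i j) = (if k \<le> 0 then alt_sign (nat (- k)) * J (nat (- k)) $ i $ j else 0)"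
  by (simp add: fund_sol_def zcoeff_minus_loop[OF decaying_S] entry_alt_sign)

lemma zcoeff_fund_inv: "zcoeff k (entry (fund_inv J) i j) = (if k \<le> 0 then lower_Omega J (nat (- k)) $ i $ j else 0)"
  by (simp add: fund_inv_def zcoeff_minus_loop[OF decaying_K])

lemma fund_inverse: "fund_sol J * fund_inv J = 1" "fund_inv J * fund_sol J = 1"
proof -
  let ?s = "Abs_fps (\<lambda>d. alt_sign d * SQ (J d))" and ?k = "Abs_fps (\<lambda>d. SQ (lower_Omega J d))"
  have conv: "Abs_fps (\<lambda>d. alt_sign d * fps_nth X d) * Abs_fps (\<lambda>d. alt_sign d * fps_nth Y d) = Abs_fps (\<lambda>d. alt_sign d * fps_nth (X * Y) d)"
    for X Y :: "('n mfps, 'n) sqm fps"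
    by (rule fps_ext) (simp add: fps_mult_nth[of "Abs_fps _"] atLeast0AtMost alt_sign_convolution)
  have "?s = Abs_fps (\<lambda>d. alt_sign d * fps_nth (sq_fps J) d)" "?k = Abs_fps (\<lambda>d. alt_sign d * fps_nth (sq_fps (series_inv J)) d)"
    by (simp_all add: SQ_lower_Omega)
  then have "?s * ?k = 1" "?k * ?s = 1"
    by (simp_all only: conv calibration_inverse[OF cal]) (rule fps_ext, simp add: alt_sign_def)+
  then show "fund_sol J * fund_inv J = 1" "fund_inv J * fund_sol J = 1"
    unfolding fund_sol_def fund_inv_def minus_loop_mult[OF decaying_S decaying_K, symmetric] minus_loop_mult[OF decaying_K decaying_S, symmetric]
    by (simp_all add: plus_loop_minus_loop_1)
qed

context
  fixes y :: "'n \<Rightarrow> 'v mfps"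
  assumes z: "\<And>\<alpha>. mfps_coeff (y \<alpha>) {#} = 0"
begin

definition fund_sol_at :: "('v option mfps, 'n) sqm" where "fund_sol_at = smap (ysub y) (fund_sol J)"
definition fund_inv_at :: "('v option mfps, 'n) sqm" where "fund_inv_at = smap (ysub y) (fund_inv J)"

lemma smap_ysub_hom:
  "smap (ysub y) (X * Y) = smap (ysub y) X * smap (ysub y) (Y :: ('n option mfps, 'n) sqm)"
  "smap (ysub y) (1 :: ('n option mfps, 'n) sqm) = 1"
  by (rule sqm_eqI, simp add: entry_times ysub_hom[of y, OF z])+

lemma fund_at_inverse: "fund_sol_at * fund_inv_at = 1" "fund_inv_at * fund_sol_at = 1"
  unfolding fund_sol_at_def fund_inv_at_def smap_ysub_hom(1)[symmetric] by (simp_all add: fund_inverse smap_ysub_hom)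

lemma zcoeff_fund_sol_at: "smap (zcoeff k) fund_sol_at = (if k \<le> 0 then smap (mfps_subst y) (alt_sign (nat (- k)) * SQ (J (nat (- k)))) else 0)"
  by (rule sqm_eqI) (simp add: fund_sol_at_def zcoeff_ysub[of y, OF z] zcoeff_fund_sol entry_alt_sign)

lemma zcoeff_fund_inv_at: "smap (zcoeff k) fund_inv_at = (if k \<le> 0 then smap (mfps_subst y) (SQ (lower_Omega J (nat (- k)))) else 0)"
  by (rule sqm_eqI) (simp add: fund_inv_at_def zcoeff_ysub[of y, OF z] zcoeff_fund_inv)

lemma zcoeff_fund_sol_at_mat_vec: "mfps_summable (\<lambda>b. mat_vec (smap (mfps_subst y) (alt_sign b * SQ (J b))) (\<lambda>\<beta>. zcoeff (j + int b) (f \<beta>)) \<alpha>)"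
    "zcoeff j (mat_vec fund_sol_at f \<alpha>) = mfps_Sum (\<lambda>b. mat_vec (smap (mfps_subst y) (alt_sign b * SQ (J b))) (\<lambda>\<beta>. zcoeff (j + int b) (f \<beta>)) \<alpha>)"
  and zcoeff_fund_inv_at_mat_vec: "mfps_summable (\<lambda>b. mat_vec (smap (mfps_subst y) (SQ (lower_Omega J b))) (\<lambda>\<beta>. zcoeff (j + int b) (f \<beta>)) \<alpha>)"
    "zcoeff j (mat_vec fund_inv_at f \<alpha>) = mfps_Sum (\<lambda>b. mat_vec (smap (mfps_subst y) (SQ (lower_Omega J b))) (\<lambda>\<beta>. zcoeff (j + int b) (f \<beta>)) \<alpha>)"
proof -
  have inj: "inj (\<lambda>b. - int b)" by (simp add: inj_def)
  have rg: "\<not> i \<le> 0" if "i \<notin> range (\<lambda>b. - int b)" for i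
  proof
    assume "i \<le> 0" then have "i = - int (nat (- i))" by simp
    then show False using that by blast
  qed
  have out: "zcoeff i (entry X \<alpha> \<beta>) = 0" if "smap (zcoeff i) X = 0" for i X \<beta>
  proof -
    have "entry (smap (zcoeff i) X) \<alpha> \<beta> = 0" by (simp only: that entry_simps)
    then show ?thesis by simp
  qed
  note S = zcoeff_mat_vec[OF inj, of fund_sol_at \<alpha> j f] and K = zcoeff_mat_vec[OF inj, of fund_inv_at \<alpha> j f]
  have oS: "zcoeff i (entry fund_sol_at \<alpha> \<beta>) = 0" if "i \<notin> range (\<lambda>b. - int b)" for i \<beta>
    by (rule out) (use rg[OF that] in \<open>simp add: zcoeff_fund_sol_at\<close>)
  have oK: "zcoeff i (entry fund_inv_at \<alpha> \<beta>) = 0" if "i \<notin> range (\<lambda>b. - int b)" for i \<beta>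
    by (rule out) (use rg[OF that] in \<open>simp add: zcoeff_fund_inv_at\<close>)
  show "mfps_summable (\<lambda>b. mat_vec (smap (mfps_subst y) (alt_sign b * SQ (J b))) (\<lambda>\<beta>. zcoeff (j + int b) (f \<beta>)) \<alpha>)"
    "zcoeff j (mat_vec fund_sol_at f \<alpha>) = mfps_Sum (\<lambda>b. mat_vec (smap (mfps_subst y) (alt_sign b * SQ (J b))) (\<lambda>\<beta>. zcoeff (j + int b) (f \<beta>)) \<alpha>)"
    using S[OF oS] by (simp_all add: zcoeff_fund_sol_at)
  show "mfps_summable (\<lambda>b. mat_vec (smap (mfps_subst y) (SQ (lower_Omega J b))) (\<lambda>\<beta>. zcoeff (j + int b) (f \<beta>)) \<alpha>)"
    "zcoeff j (mat_vec fund_inv_at f \<alpha>) = mfps_Sum (\<lambda>b. mat_vec (smap (mfps_subst y) (SQ (lower_Omega J b))) (\<lambda>\<beta>. zcoeff (j + int b) (f \<beta>)) \<alpha>)"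
    using K[OF oK] by (simp_all add: zcoeff_fund_inv_at)
qed

text \<open>
  The Euler-Lagrange expression is the coefficient of \<open>z\<^sup>0\<close> in \<open>S(y)\<inverse> f\<close>.  If only positive powers
  occur there, \<open>f = S(y) (S(y)\<inverse> f)\<close> expresses each negative coefficient of \<open>f\<close> through the
  nonnegative ones, and the matrices which occur are the \<open>\<Omega>^a_b\<close>.
\<close>

lemma loop_point_euler:
  assumes g: "\<And>\<alpha>. zcoeff 0 (mat_vec fund_inv_at f \<alpha>) = 0"
  shows "pairing y (lower_Omega J) (\<lambda>d \<beta>. zcoeff (int d) (f \<beta>)) \<alpha> = 0"
  using g[of \<alpha>] by (simp add: zcoeff_fund_inv_at_mat_vec(2) pairing_mat_pairing mat_pairing_def)

lemma loop_point_potential: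
  assumes g: "\<And>k \<alpha>. k \<le> 0 \<Longrightarrow> zcoeff k (mat_vec fund_inv_at f \<alpha>) = 0"
  shows "zcoeff (- int a - 1) (f \<alpha>) = (- 1) ^ (a + 1) * pairing y (Omega J a) (\<lambda>d \<beta>. zcoeff (int d) (f \<beta>)) \<alpha>"
proof -
  let ?s = "\<lambda>X :: ('n mfps, 'n) sqm. smap (mfps_subst y) X"
  let ?q = "\<lambda>d \<beta>. zcoeff (int d) (f \<beta>)"
  let ?S = "\<lambda>d. ?s (alt_sign d * SQ (J d))" and ?L = "\<lambda>d. ?s (SQ (lower_Omega J d))"
  let ?g = "mat_vec fund_inv_at f"
  have f: "f = mat_vec fund_sol_at ?g"
    by (rule ext) (simp add: mat_vec_mult[symmetric] fund_at_inverse mat_vec_simps)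
  let ?T = "\<lambda>j b. mat_vec (?S (j + Suc a) * ?L b) (?q (j + b)) \<alpha>"
  have ordT: "ord_ge (j + b) (?T j b)" for j b
  proof -
    have "ord_ge (j + Suc a) (entry (?S (j + Suc a)) i k)" for i k
      unfolding entry_smap
      by (rule ord_ge_subst[of y, OF z])
        (use decaying_S[unfolded decaying_def, rule_format, of "j + Suc a" i k] in \<open>simp only: fps_nth_Abs_fps\<close>)
    then have o1: "ord_ge j (entry (?S (j + Suc a)) i k)" for i k by (rule ord_ge_mono) simp
    have o2: "ord_ge b (entry (?L b) i k)" for i k
      unfolding entry_smap
      by (rule ord_ge_subst[of y, OF z]) (use decaying_K in \<open>simp add: decaying_def\<close>)
    have "ord_ge (j + b) (entry (?S (j + Suc a) * ?L b) \<alpha> \<beta>)" for \<beta>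
      unfolding entry_times by (intro vge_sum ord_ge_times o1 o2)
    then have "ord_ge (j + b + 0) (entry (?S (j + Suc a) * ?L b) \<alpha> \<beta> * ?q (j + b) \<beta>)" for \<beta>
      by (rule ord_ge_times) simp
    then show ?thesis unfolding mat_vec_def by (intro vge_sum) simp
  qed
  have sT: "mfps_summable (\<lambda>(j, b). ?T j b)"
    unfolding mfps_summable_def
  proof
    fix m
    have "{x. mfps_coeff (case x of (j, b) \<Rightarrow> ?T j b) m \<noteq> 0} \<subseteq> {..size m} \<times> {..size m}"
    proof
      fix x assume "x \<in> {x. mfps_coeff (case x of (j, b) \<Rightarrow> ?T j b) m \<noteq> 0}"
      then obtain j b where x: "x = (j, b)" "mfps_coeff (?T j b) m \<noteq> 0" by (cases x) auto
      then have "j + b \<le> size m" using ord_geD[OF ordT[of j b]] not_le_imp_less by blast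
      then show "x \<in> {..size m} \<times> {..size m}" by (simp add: x)
    qed
    then show "finite {x. mfps_coeff (case x of (j, b) \<Rightarrow> ?T j b) m \<noteq> 0}" by (rule finite_subset) simp
  qed
  have T: "mat_vec (?S (j + Suc a)) (\<lambda>\<beta>. zcoeff (int j) (?g \<beta>)) \<alpha> = mfps_Sum (?T j)" for j
  proof -
    have "(\<lambda>\<beta>. zcoeff (int j) (?g \<beta>)) = (\<lambda>\<beta>. mfps_Sum (\<lambda>b. mat_vec (?L b) (?q (j + b)) \<beta>))"
      by (rule ext) (simp add: zcoeff_fund_inv_at_mat_vec(2))
    then have "mat_vec (?S (j + Suc a)) (\<lambda>\<beta>. zcoeff (int j) (?g \<beta>)) \<alpha> =
        mfps_Sum (\<lambda>b. mat_vec (?S (j + Suc a)) (\<lambda>\<beta>. mat_vec (?L b) (?q (j + b)) \<beta>) \<alpha>)"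
      by (simp only:) (rule mat_vec_Sum, use zcoeff_fund_inv_at_mat_vec(1)[of "int j" f] in simp)
    then show ?thesis by (simp add: mat_vec_mult)
  qed
  have O: "(\<Sum>j\<le>c. ?S (j + Suc a) * ?L (c - j)) = alt_sign (Suc a) * ?s (SQ (Omega J a c))" for c
  proof -
    have "(\<Sum>j\<le>c. (alt_sign (j + Suc a) * SQ (J (j + Suc a))) * SQ (lower_Omega J (c - j))) =
        (\<Sum>j\<le>c. alt_sign (Suc a) * (alt_sign c * (SQ (J (j + Suc a)) * SQ (series_inv J (c - j)))))"
    proof (rule sum.cong[OF refl])
      fix j assume "j \<in> {..c}"
      then have "even (j + Suc a + (c - j)) \<longleftrightarrow> (even (Suc a) \<longleftrightarrow> even c)" by auto
      then show "(alt_sign (j + Suc a) * SQ (J (j + Suc a))) * SQ (lower_Omega J (c - j)) =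
          alt_sign (Suc a) * (alt_sign c * (SQ (J (j + Suc a)) * SQ (series_inv J (c - j))))"
        unfolding SQ_lower_Omega alt_sign_simps(1) by (auto simp: alt_sign_def)
    qed
    also have "\<dots> = alt_sign (Suc a) * SQ (Omega J a c)"
      by (simp add: SQ_Omega[OF cal] fps_mult_nth sum_distrib_left atLeast0AtMost)
    finally have "?s (\<Sum>j\<le>c. (alt_sign (j + Suc a) * SQ (J (j + Suc a))) * SQ (lower_Omega J (c - j))) =
        ?s (alt_sign (Suc a) * SQ (Omega J a c))" by (rule arg_cong)
    then show ?thesis
      by (simp add: smap_subst_hom[of y, OF z] alt_sign_def)
  qed
  have "zcoeff (- int a - 1) (f \<alpha>) = mfps_Sum (\<lambda>b. mat_vec (?S b) (\<lambda>\<beta>. zcoeff (- int a - 1 + int b) (?g \<beta>)) \<alpha>)"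
    by (subst f) (rule zcoeff_fund_sol_at_mat_vec(2))
  also have "\<dots> = (\<Sum>b<Suc a. mat_vec (?S b) (\<lambda>\<beta>. zcoeff (- int a - 1 + int b) (?g \<beta>)) \<alpha>) +
      mfps_Sum (\<lambda>j. mat_vec (?S (j + Suc a)) (\<lambda>\<beta>. zcoeff (- int a - 1 + int (j + Suc a)) (?g \<beta>)) \<alpha>)"
    by (rule mfps_Sum_split[OF zcoeff_fund_sol_at_mat_vec(1)])
  also have "(\<Sum>b<Suc a. mat_vec (?S b) (\<lambda>\<beta>. zcoeff (- int a - 1 + int b) (?g \<beta>)) \<alpha>) = 0"
  proof (rule sum.neutral, intro ballI)
    fix b assume "b \<in> {..<Suc a}"
    then have "(\<lambda>\<beta>. zcoeff (- int a - 1 + int b) (?g \<beta>)) = (\<lambda>\<beta>. 0)" by (intro ext g) simp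
    then show "mat_vec (?S b) (\<lambda>\<beta>. zcoeff (- int a - 1 + int b) (?g \<beta>)) \<alpha> = 0" by (simp add: mat_vec_def)
  qed
  also have "mfps_Sum (\<lambda>j. mat_vec (?S (j + Suc a)) (\<lambda>\<beta>. zcoeff (- int a - 1 + int (j + Suc a)) (?g \<beta>)) \<alpha>) =
      mfps_Sum (\<lambda>j. mfps_Sum (?T j))"
    using T by (intro mfps_Sum_cong) simp
  also have "\<dots> = mfps_Sum (\<lambda>c. \<Sum>j\<le>c. ?T j (c - j))"
    by (rule mfps_Sum_antidiagonal[OF sT])
  also have "\<dots> = mfps_Sum (\<lambda>c. mat_vec (\<Sum>j\<le>c. ?S (j + Suc a) * ?L (c - j)) (?q c) \<alpha>)"
    by (simp add: mat_vec_sum)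
  also have "\<dots> = mfps_Sum (\<lambda>c. (- 1) ^ (a + 1) * mat_vec (?s (SQ (Omega J a c))) (?q c) \<alpha>)"
    unfolding O by (simp add: alt_sign_def mat_vec_simps minus_one_power_iff)
  also have "\<dots> = (- 1) ^ (a + 1) * pairing y (Omega J a) ?q \<alpha>"
    unfolding pairing_mat_pairing mat_pairing_def
  proof (rule mfps_Sum_mult_left, rule mfps_summable_ord)
    fix c
    have "ord_ge c (entry (?s (SQ (Omega J a c))) \<alpha> \<beta>)" for \<beta>
      unfolding entry_smap entry_SQ
      by (rule ord_ge_subst[of y, OF z]) (rule ord_ge_mono[OF ord_ge_Omega[OF cal n]], simp)
    then have "ord_ge (c + 0) (entry (?s (SQ (Omega J a c))) \<alpha> \<beta> * ?q c \<beta>)" for \<beta>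
      by (rule ord_ge_times) simp
    then show "ord_ge c (mat_vec (?s (SQ (Omega J a c))) (?q c) \<alpha>)"
      unfolding mat_vec_def by (intro vge_sum) simp
  qed
  finally show ?thesis by simp
qed

end

end

lemma mat_vec_diff: "mat_vec X (\<lambda>\<beta>. f \<beta> - g \<beta>) \<alpha> = mat_vec X f \<alpha> - mat_vec X g \<alpha>"
  by (simp add: mat_vec_def ring_distribs sum_subtractf)

lemma cone_point_simps:
  assumes "cone_data F A J w C"
  shows "cone_point C (int d) = q_point A J d"
    and "cone_point C (- int a - 1) \<alpha> = (- 1) ^ (a + 1) * pairing w (Omega J a) (q_point A J) \<alpha>"
proof -
  note c = assms[unfolded cone_data_def]
  show "cone_point C (int d) = q_point A J d" using c by (intro ext) (simp add: cone_point_def)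
  have "nat (- (- int a - 1)) = a + 1" "nat (- (- int a - 1) - 1) = a" by auto
  then show "cone_point C (- int a - 1) \<alpha> = (- 1) ^ (a + 1) * pairing w (Omega J a) (q_point A J) \<alpha>"
    using c by (simp add: cone_point_def)
qed

lemma int_cases_split:
  obtains d where "k = int d" | a where "k = - int a - 1"
proof (cases "0 \<le> k")
  case True
  then show ?thesis using that(1)[of "nat k"] by simp
next
  case False
  then show ?thesis using that(2)[of "nat (- k - 1)"] by simp
qed

text \<open>
  The series \<open>g\<close> is the positive part of \<open>S(w)\<inverse> q\<close>, whose coefficient of \<open>z\<^sup>0\<close> vanishes by the
  Euler-Lagrange equation.
\<close>

lemma cone_loop_point:
  assumes cd: "cone_data F A J w C" and n: "normalised J"
  obtains g where "\<And>k \<alpha>. k \<le> 0 \<Longrightarrow> zcoeff k (g \<alpha>) = 0"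
    and "\<And>k \<alpha>. zcoeff k (mat_vec (fund_sol_at J w) g \<alpha>) = cone_point C k \<alpha>"
proof -
  note c = cd[unfolded cone_data_def]
  have cal: "calibration F J" using c by blast
  have z: "mfps_coeff (w \<alpha>) {#} = 0" for \<alpha> using c by (simp add: euler_solution_def)
  let ?S = "fund_sol_at J w" and ?K = "fund_inv_at J w"
  note SK = fund_at_inverse[OF cal n, of w, OF z]
  note S_av = zcoeff_fund_sol_at_mat_vec(2)[OF cal n, of w, OF z] and K_av = zcoeff_fund_inv_at_mat_vec(2)[OF cal n, of w, OF z]
  define qh where "qh \<alpha> = pack (\<lambda>k. if 0 \<le> k then q_point A J (nat k) \<alpha> else 0)" for \<alpha>
  have qh: "zcoeff k (qh \<alpha>) = (if 0 \<le> k then q_point A J (nat k) \<alpha> else 0)" for k \<alpha>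
    unfolding qh_def by (subst zcoeff_pack) (auto simp: loop_bounded_def)
  define g where "g \<alpha> = pack (\<lambda>k. if 0 < k then zcoeff k (mat_vec ?K qh \<alpha>) else 0)" for \<alpha>
  have g: "zcoeff k (g \<alpha>) = (if 0 < k then zcoeff k (mat_vec ?K qh \<alpha>) else 0)" for k \<alpha>
    unfolding g_def by (subst zcoeff_pack) (auto simp: loop_bounded_def)
  have E: "zcoeff 0 (mat_vec ?K qh \<alpha>) = 0" for \<alpha>
    using c by (simp add: K_av qh euler_solution_def pairing_mat_pairing mat_pairing_def)
  \<comment> \<open>What is cut off from \<open>S(w)^{-1} q\<close> has negative powers only, and \<open>S(w)\<close> keeps it so.\<close>
  have neg: "zcoeff k (mat_vec ?K qh \<alpha> - g \<alpha>) = 0" if "0 \<le> k" for k \<alpha>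
    using that E by (cases "k = 0") (simp_all add: g)
  have Sg: "zcoeff k (mat_vec ?S g \<alpha>) = zcoeff k (qh \<alpha>)" if k: "0 \<le> k" for k \<alpha>
  proof -
    have "(\<lambda>\<beta>. zcoeff (k + int b) (mat_vec ?K qh \<beta> - g \<beta>)) = (\<lambda>\<beta>. 0)" for b
      using k by (intro ext neg) simp
    then have "zcoeff k (mat_vec ?S (\<lambda>\<beta>. mat_vec ?K qh \<beta> - g \<beta>) \<alpha>) = 0"
      by (simp only: S_av) (simp add: mat_vec_def)
    then show ?thesis by (simp add: mat_vec_diff mat_vec_mult[symmetric] SK mat_vec_simps)
  qed
  have "zcoeff k (mat_vec ?S g \<alpha>) = cone_point C k \<alpha>" for k \<alpha>
  proof (cases k rule: int_cases_split)
    case (1 d)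
    then show ?thesis by (simp add: Sg qh cone_point_simps[OF cd])
  next
    case (2 a)
    have K: "mat_vec ?K (mat_vec ?S g) \<alpha> = g \<alpha>" for \<alpha> by (simp add: mat_vec_mult[symmetric] SK mat_vec_simps)
    have "(\<lambda>d \<beta>. zcoeff (int d) (mat_vec ?S g \<beta>)) = q_point A J" by (intro ext) (simp add: Sg qh)
    then show ?thesis
      using loop_point_potential[OF cal n, of w "mat_vec ?S g" a \<alpha>, OF z] cone_point_simps(2)[OF cd, of a \<alpha>]
      by (simp add: K g 2)
  qed
  then show ?thesis using that[of g] g by simp
qed

text \<open>
  Multiplication by \<open>G\<close>, free of negative powers of \<open>z\<close>, preserves the series divisible by \<open>z\<close> from
  which the points of both cones are built.
\<close>

lemma G_plus_maps:
  assumes cd1: "cone_data F1 A J1 w1 C1" and n1: "normalised J1"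
    and cd2: "cone_data F2 A J2 w2 C2" and n2: "normalised J2"
    and R0: "R 0 = mat 1" and y: "\<And>\<alpha>. mfps_coeff (y \<alpha>) {#} = 0"
    and G: "\<And>k i j. k < 0 \<Longrightarrow> zcoeff k (entry G i j) = 0"
    and eq: "plus_loop (const_loop R) * fund_sol_at J1 w1 = fund_sol_at J2 y * G"
  shows "maps_into (laurent_plus R) C1 C2"
proof -
  note c1 = cd1[unfolded cone_data_def] and c2 = cd2[unfolded cone_data_def]
  have cal2: "calibration F2 J2" using c2 by blast
  obtain g where g: "\<And>k \<alpha>. k \<le> 0 \<Longrightarrow> zcoeff k (g \<alpha>) = 0"
    and p: "\<And>k \<alpha>. zcoeff k (mat_vec (fund_sol_at J1 w1) g \<alpha>) = cone_point C1 k \<alpha>"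
    using cone_loop_point[OF cd1 n1] by blast
  let ?f = "laurent_mult (laurent_plus R) (cone_point C1)"
  let ?R = "plus_loop (const_loop R) :: (('a \<times> nat) option mfps, 'a) sqm"
  let ?h = "mat_vec ?R (mat_vec (fund_sol_at J1 w1) g)"
  have inj: "inj int" by (simp add: inj_def)
  have rg: "i < 0" if "i \<notin> range int" for i
    using that by (metis linorder_not_le nonneg_int_cases rangeI)
  have ps: "mfps_summable (\<lambda>j :: nat. cone_point C1 (k - int j) \<beta>)" for k \<beta>
    unfolding mfps_summable_def
  proof
    fix m
    have "{j. mfps_coeff (cone_point C1 (k - int j) \<beta>) m \<noteq> 0} \<subseteq> {..nat (k + int (size m))}"
    proof
      fix j assume "j \<in> {j. mfps_coeff (cone_point C1 (k - int j) \<beta>) m \<noteq> 0}"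
      then have "mfps_coeff (zcoeff (k - int j) (mat_vec (fund_sol_at J1 w1) g \<beta>)) m \<noteq> 0" by (simp add: p)
      then have "0 \<le> k - int j + int (size m)" by (auto simp: coeff_zcoeff split: if_splits)
      then show "j \<in> {..nat (k + int (size m))}" by simp
    qed
    then show "finite {j. mfps_coeff (cone_point C1 (k - int j) \<beta>) m \<noteq> 0}" by (rule finite_subset) simp
  qed
  have out: "laurent_plus R i = 0" if "i \<notin> range int" for i
    using rg[OF that] by (simp add: laurent_plus_def)
  note lm = laurent_mult_nat[of int "laurent_plus R" "cone_point C1", OF inj out ps]
  have Rz: "smap (zcoeff (int b)) ?R = const_mat (R b)" for b
    by (rule sqm_eqI) (simp add: zcoeff_plus_loop)
  have Rout: "zcoeff i (entry ?R \<alpha> \<beta>) = 0" if "i \<notin> range int" for i \<alpha> \<beta>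
    using rg[OF that] by (simp add: zcoeff_plus_loop)
  have f: "?f k \<alpha> = mfps_Sum (\<lambda>j. mat_vec (const_mat (R j)) (cone_point C1 (k - int j)) \<alpha>)" for k \<alpha>
    by (subst lm(2)) (simp_all add: laurent_plus_def)
  have fh: "zcoeff k (?h \<alpha>) = ?f k \<alpha>" for k \<alpha>
    by (subst zcoeff_mat_vec(2)[OF inj Rout]) (simp_all add: Rz p f)
  \<comment> \<open>The image of the point \<open>S_1(w1) g\<close> is presented as \<open>S_2(y)\<close> applied to \<open>G g\<close>, still divisible by \<open>z\<close>.\<close>
  have "?h = mat_vec (fund_sol_at J2 y) (mat_vec G g)"
    by (simp add: mat_vec_mult[symmetric] eq)
  then have Kf: "mat_vec (fund_inv_at J2 y) ?h \<alpha> = mat_vec G g \<alpha>" for \<alpha>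
    by (simp add: mat_vec_mult[symmetric] mult.assoc[symmetric] fund_at_inverse[OF cal2 n2, of y, OF y])
  have Gg: "zcoeff k (mat_vec G g \<alpha>) = 0" if "k \<le> 0" for k \<alpha>
    unfolding mat_vec_def zcoeff_sum zcoeff_mult
  proof (rule sum.neutral, intro ballI)
    fix \<beta>
    have "zcoeff i (entry G \<alpha> \<beta>) * zcoeff (k - i) (g \<beta>) = 0" for i
      using G[of i] g[of "k - i"] that by (cases "i < 0") auto
    then show "mfps_Sum (\<lambda>i. zcoeff i (entry G \<alpha> \<beta>) * zcoeff (k - i) (g \<beta>)) = 0" by simp
  qed
  have q: "(\<lambda>d \<beta>. zcoeff (int d) (?h \<beta>)) = (\<lambda>d. ?f (int d))" by (intro ext) (rule fh)
  have p0: "mfps_coeff (cone_point C1 k \<beta>) {#} = (if k = 1 then - (A $ \<beta>) else 0)" if "k \<le> 1" for k \<beta>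
  proof (cases k rule: int_cases_split)
    case (1 d)
    then show ?thesis
      using that by (simp add: cone_point_simps[OF cd1] coeff_q_coord_empty cone_base_def cal_shift_normalised[OF n1])
  next
    case (2 a)
    have "cone_point C1 k \<beta> = (- 1) ^ (a + 1) * pot C1 a \<beta>"
      using c1 by (simp only: 2 cone_point_simps(2)[OF cd1])
    then show ?thesis using ord_geD[OF pot_ord[OF cd1 n1, of a \<beta>], of "{#}"] 2 by simp
  qed
  have co: "mfps_coeff (?f k \<alpha>) {#} = (\<Sum>\<beta>\<in>UNIV. (if \<alpha> = \<beta> then 1 else 0) * mfps_coeff (cone_point C1 k \<beta>) {#})"
    if "k \<le> 1" for k \<alpha>
  proof -
    have "mfps_coeff (?f k \<alpha>) {#} = (\<Sum>j\<in>{0}. mfps_coeff (mat_vec (const_mat (R j)) (cone_point C1 (k - int j)) \<alpha>) {#})"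
      unfolding f
    proof (rule mfps_coeff_Sum_superset)
      fix j assume "mfps_coeff (mat_vec (const_mat (R j)) (cone_point C1 (k - int j)) \<alpha>) {#} \<noteq> 0"
      then have "\<exists>\<beta>. mfps_coeff (cone_point C1 (k - int j) \<beta>) {#} \<noteq> 0"
        unfolding mat_vec_def by (auto dest: sum.not_neutral_contains_not_neutral)
      then have "k - int j = 1" using p0[of "k - int j"] that by (auto split: if_splits)
      then show "j \<in> {0}" using that by simp
    qed simp
    then show ?thesis by (simp add: mat_vec_def R0 mat_def)
  qed
  have "point_on_germ ?f C2"
  proof (rule point_criterion_ancestor[OF cd2 n2 _ _ y])
    show "mfps_coeff (?f 0 \<alpha>) {#} = 0" for \<alpha> by (simp add: co p0)
    show "mfps_coeff (?f 1 \<alpha>) {#} = - (A $ \<alpha>)" for \<alpha>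
      by (simp add: co p0 sum_negf if_distrib[of "\<lambda>x. x * _"] cong: if_cong)
    show "pairing y (lower_Omega J2) (\<lambda>d. ?f (int d)) \<alpha> = 0" for \<alpha>
      using loop_point_euler[OF cal2 n2, of y ?h \<alpha>, OF y] Gg by (simp add: Kf q)
    show "?f (- int a - 1) \<alpha> = (- 1) ^ (a + 1) * pairing y (Omega J2 a) (\<lambda>d. ?f (int d)) \<alpha>" for a \<alpha>
      using loop_point_potential[OF cal2 n2, of y ?h a \<alpha>, OF y] Gg by (simp add: Kf q fh)
  qed
  then show ?thesis using lm(1) by (simp add: maps_into_def)
qed

section \<open>Horizontal idempotents of a semisimple flat F-manifold\<close>

lemma fps_zero_below_mult:
  fixes P Q :: "'a :: ring_1 fps"
  shows fps_nth_mult_below_right: "(\<And>j. j < k \<Longrightarrow> fps_nth Q j = 0) \<Longrightarrow> n \<le> k \<Longrightarrow> fps_nth (P * Q) n = (if n = k then fps_nth P 0 * fps_nth Q k else 0)"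
    and fps_nth_mult_below_left: "(\<And>j. j < k \<Longrightarrow> fps_nth P j = 0) \<Longrightarrow> n \<le> k \<Longrightarrow> fps_nth (P * Q) n = (if n = k then fps_nth P k * fps_nth Q 0 else 0)"
proof -
  assume Q: "\<And>j. j < k \<Longrightarrow> fps_nth Q j = 0" and n: "n \<le> k"
  have "fps_nth (P * Q) n = (\<Sum>i\<in>{0..n}. if i = 0 then fps_nth P 0 * fps_nth Q n else 0)"
    unfolding fps_mult_nth by (rule sum.cong) (use Q n in auto)
  then show "fps_nth (P * Q) n = (if n = k then fps_nth P 0 * fps_nth Q k else 0)"
    using Q n by auto
next
  assume P: "\<And>j. j < k \<Longrightarrow> fps_nth P j = 0" and n: "n \<le> k"
  have "fps_nth (P * Q) n = (\<Sum>i\<in>{0..n}. if i = n then fps_nth P n * fps_nth Q 0 else 0)"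
    unfolding fps_mult_nth by (rule sum.cong) (use P n in auto)
  then show "fps_nth (P * Q) n = (if n = k then fps_nth P k * fps_nth Q 0 else 0)"
    using P n by auto
qed

text \<open>
  The covariant derivative \<open>z \<partial>_\<gamma> - [C_\<gamma>, \<cdot>]\<close> of a field of matrices.
\<close>

definition horiz :: "('n :: finite \<Rightarrow> 'n mfps) \<Rightarrow> 'n \<Rightarrow> ('n mfps, 'n) sqm fps \<Rightarrow> ('n mfps, 'n) sqm fps" where
  "horiz F \<gamma> P = fps_X * fderiv \<gamma> P - (fps_const (struct_mat F \<gamma>) * P - P * fps_const (struct_mat F \<gamma>))"

lemma horiz_nth:
  "fps_nth (horiz F \<gamma> P) n = (if n = 0 then 0 else sderiv \<gamma> (fps_nth P (n - 1))) -
    (struct_mat F \<gamma> * fps_nth P n - fps_nth P n * struct_mat F \<gamma>)"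
  by (simp add: horiz_def)

lemma horiz_linear: "horiz F \<gamma> (P + Q) = horiz F \<gamma> P + horiz F \<gamma> Q" "horiz F \<gamma> (P - Q) = horiz F \<gamma> P - horiz F \<gamma> Q"
  by (simp_all add: horiz_def fderiv_simps algebra_simps)

lemma horiz_mult: "horiz F \<gamma> (P * Q) = horiz F \<gamma> P * Q + P * horiz F \<gamma> Q"
proof -
  have "P * (fps_X * D) = fps_X * (P * D)" for D by (metis fps_mult_fps_X_commute mult.assoc)
  then show ?thesis by (simp add: horiz_def fderiv_simps algebra_simps)
qed

text \<open>
  Flatness of the connection: the matrices \<open>C_\<gamma>\<close> commute and \<open>\<partial>_\<gamma> C_\<delta>\<close> is symmetric.
\<close>

lemma horiz_commute:
  assumes flat: "flat_F_manifold F A"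
  shows "horiz F \<gamma> (horiz F \<delta> P) = horiz F \<delta> (horiz F \<gamma> P)"
proof (rule fps_ext)
  fix n
  have d: "sderiv \<gamma> (sderiv \<delta> X) = sderiv \<delta> (sderiv \<gamma> X)" for X :: "('a mfps, 'a) sqm"
    by (rule sqm_eqI) (simp add: mfps_deriv_commute[of \<gamma> \<delta>])
  note C = struct_mat_commute[OF flat, of \<gamma> \<delta>]
  have C': "struct_mat F \<gamma> * (struct_mat F \<delta> * X) = struct_mat F \<delta> * (struct_mat F \<gamma> * X)" for X
    by (simp only: mult.assoc[symmetric] C)
  show "fps_nth (horiz F \<gamma> (horiz F \<delta> P)) n = fps_nth (horiz F \<delta> (horiz F \<gamma> P)) n"
    by (simp add: horiz_nth sderiv_simps d struct_mat_deriv_sym[of \<gamma> F \<delta>] algebra_simps C C')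
qed

definition mult_by :: "('n :: finite \<Rightarrow> 'n mfps) \<Rightarrow> ('n \<Rightarrow> 'n mfps) \<Rightarrow> ('n mfps, 'n) sqm" where
  "mult_by F x = (\<Sum>\<gamma>\<in>UNIV. scal (x \<gamma>) (struct_mat F \<gamma>))"

context
  fixes F :: "'n :: finite \<Rightarrow> 'n mfps" and A :: "complex^'n"
  assumes flat: "flat_F_manifold F A"
begin

lemma mult_by_commute_C: "mult_by F x * struct_mat F \<gamma> = struct_mat F \<gamma> * mult_by F x"
  by (simp add: mult_by_def sum_distrib_left sum_distrib_right scal_simps struct_mat_commute[OF flat, of _ \<gamma>])

lemma mat_vec_mult_by: "mat_vec (mult_by F x) y \<alpha> = (\<Sum>\<beta>\<in>UNIV. \<Sum>\<gamma>\<in>UNIV. x \<gamma> * structure_const F \<alpha> \<gamma> \<beta> * y \<beta>)"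
  by (simp add: mat_vec_def mult_by_def sum_distrib_right)

lemma mat_vec_mult_by_sym: "mat_vec (mult_by F x) y = mat_vec (mult_by F y) x"
proof
  fix \<alpha>
  have "mat_vec (mult_by F x) y \<alpha> = (\<Sum>\<gamma>\<in>UNIV. \<Sum>\<beta>\<in>UNIV. x \<gamma> * structure_const F \<alpha> \<gamma> \<beta> * y \<beta>)"
    unfolding mat_vec_mult_by by (rule sum.swap)
  also have "\<dots> = mat_vec (mult_by F y) x \<alpha>"
    unfolding mat_vec_mult_by by (intro sum.cong refl) (subst structure_const_sym, simp add: mult_ac)
  finally show "mat_vec (mult_by F x) y \<alpha> = mat_vec (mult_by F y) x \<alpha>" .
qed

lemma mult_by_column: "entry (mult_by F x) \<alpha> \<delta> = mat_vec (struct_mat F \<delta>) x \<alpha>"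
proof -
  have "entry (mult_by F x) \<alpha> \<delta> = (\<Sum>\<gamma>\<in>UNIV. structure_const F \<alpha> \<delta> \<gamma> * x \<gamma>)"
    unfolding mult_by_def entry_sum entry_scal entry_struct_mat
    by (intro sum.cong refl) (subst structure_const_sym, simp add: mult.commute)
  then show ?thesis by (simp add: mat_vec_def)
qed

text \<open>
  A matrix commuting with all multiplications is itself a multiplication.
\<close>

lemma mult_by_mat_vec:
  assumes X: "\<And>\<gamma>. X * struct_mat F \<gamma> = struct_mat F \<gamma> * X"
  shows "mult_by F (mat_vec X y) = X * mult_by F y"
proof (rule sqm_eqI)
  fix \<alpha> \<delta>
  have "entry (mult_by F (mat_vec X y)) \<alpha> \<delta> = mat_vec (struct_mat F \<delta>) (mat_vec X y) \<alpha>" by (rule mult_by_column)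
  also have "\<dots> = mat_vec X (mat_vec (struct_mat F \<delta>) y) \<alpha>" by (simp only: mat_vec_mult[symmetric] X)
  also have "\<dots> = entry (X * mult_by F y) \<alpha> \<delta>" by (simp add: mat_vec_def entry_times mult_by_column)
  finally show "entry (mult_by F (mat_vec X y)) \<alpha> \<delta> = entry (X * mult_by F y) \<alpha> \<delta>" .
qed

lemma mult_by_mult: "mult_by F (mat_vec (mult_by F x) y) = mult_by F x * mult_by F y"
  by (rule mult_by_mat_vec) (rule mult_by_commute_C)

lemma mult_by_linear:
  "mult_by F (\<lambda>\<alpha>. x \<alpha> + y \<alpha>) = mult_by F x + mult_by F y" "mult_by F (\<lambda>\<alpha>. x \<alpha> - y \<alpha>) = mult_by F x - mult_by F y"
  "mult_by F (\<lambda>\<alpha>. c * x \<alpha>) = scal c (mult_by F x)" "mult_by F (\<lambda>\<alpha>. \<Sum>i\<in>I. z i \<alpha>) = (\<Sum>i\<in>I. mult_by F (z i))"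
  subgoal by (simp add: mult_by_def scal_simps sum.distrib)
  subgoal by (rule sqm_eqI) (simp add: mult_by_def sum_subtractf ring_distribs)
  subgoal by (simp add: mult_by_def scal_simps scal_sum)
  subgoal by (rule sqm_eqI) (simp add: mult_by_def sum_distrib_right, rule sum.swap)
  done

lemma mult_by_unit: "mult_by F (\<lambda>\<alpha>. mfps_const (A $ \<alpha>)) = 1"
  by (rule sqm_eqI) (simp add: mult_by_def flat_unit[OF flat])

text \<open>
  In lowest degree a matrix acts through its value at the origin.
\<close>

lemma coeff_mat_vec_ord:
  assumes "\<And>\<beta>. ord_ge d (x \<beta>)" and "size m \<le> d"
  shows "mfps_coeff (mat_vec X x \<alpha>) m = (\<Sum>\<beta>\<in>UNIV. mfps_coeff (entry X \<alpha> \<beta>) {#} * mfps_coeff (x \<beta>) m)"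
proof -
  have "mfps_coeff (entry X \<alpha> \<beta> * x \<beta>) m = mfps_coeff (entry X \<alpha> \<beta>) {#} * mfps_coeff (x \<beta>) m" for \<beta>
  proof -
    have "agree {m. size m < d} (x \<beta>) 0" using ord_geD[OF assms(1)] by (simp add: agree_def)
    from coeff_times_diff[OF this assms(2), of "entry X \<alpha> \<beta>"] show ?thesis by (simp add: mult.commute)
  qed
  then show ?thesis by (simp add: mat_vec_def)
qed

text \<open>The order of vanishing of \<open>x = x \<circ> x\<close> is at least twice itself.\<close>

lemma idempotent_zero:
  assumes id: "mat_vec (mult_by F x) x = x" and z: "\<And>\<alpha>. mfps_coeff (x \<alpha>) {#} = 0"
  shows "x \<alpha> = 0"
proof -
  have "\<forall>\<alpha>. ord_ge d (x \<alpha>)" for d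
  proof (induction d)
    case (Suc d)
    show ?case
    proof
      fix \<alpha>
      show "ord_ge (Suc d) (x \<alpha>)"
      proof (cases "d = 0")
        case True
        then show ?thesis using iffD2[OF ord_ge_1, of "x \<alpha>"] z by simp
      next
        case False
        have "ord_ge (0 + d) (structure_const F \<alpha> \<gamma> \<beta> * x \<beta>)" for \<gamma> \<beta>
          by (rule ord_ge_times) (use Suc in simp_all)
        then have "ord_ge (d + d) (x \<gamma> * (structure_const F \<alpha> \<gamma> \<beta> * x \<beta>))" for \<gamma> \<beta>
          by (intro ord_ge_times) (use Suc in simp_all)
        then have "ord_ge (d + d) (mat_vec (mult_by F x) x \<alpha>)"
          unfolding mat_vec_mult_by by (intro vge_sum) (simp add: mult.assoc)
        then show ?thesis unfolding id by (rule ord_ge_mono) (use False in simp)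
      qed
    qed
  qed simp
  then show ?thesis by (intro mfps_eqI) (metis lessI mfps_coeff_basic(1) ord_geD)
qed

text \<open>
  Lifting an idempotent from the origin: Newton's iteration with the derivative \<open>2 \<pi> - 1\<close> frozen
  at the origin, where it is its own inverse.
\<close>

lemma idempotent_lift:
  assumes id: "\<And>\<alpha>. (\<Sum>\<beta>\<in>UNIV. \<Sum>\<gamma>\<in>UNIV. p \<gamma> * mfps_coeff (structure_const F \<alpha> \<gamma> \<beta>) {#} * p \<beta>) = p \<alpha>"
  obtains x where "\<And>\<alpha>. mfps_coeff (x \<alpha>) {#} = p \<alpha>" "mat_vec (mult_by F x) x = x"
proof -
  define e where "e y \<alpha> = mfps_const (p \<alpha>) + y \<alpha>" for y :: "'n \<Rightarrow> 'n mfps" and \<alpha>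
  define E :: "('n mfps, 'n) sqm" where "E = const_mat (\<chi> \<alpha> \<beta>. \<Sum>\<gamma>\<in>UNIV. p \<gamma> * mfps_coeff (structure_const F \<alpha> \<gamma> \<beta>) {#})"
  define G where "G y \<alpha> = mat_vec (mult_by F (e y)) (e y) \<alpha> - e y \<alpha>" for y \<alpha>
  define L where "L = E + E - (1 :: ('n mfps, 'n) sqm)"
  let ?x0 = "\<lambda>\<gamma>. mfps_const (p \<gamma>) :: 'n mfps"
  have EE: "E * E = E"
  proof -
    let ?c = "\<lambda>f. mfps_const (mfps_coeff f {#}) :: 'n mfps"
    have hom: "smap ?c (X * Y) = smap ?c X * smap ?c Y" for X Y :: "('n mfps, 'n) sqm"
      by (rule sqm_eqI) (simp add: entry_times mfps_const_sum mfps_const_simps)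
    have E: "E = smap ?c (mult_by F ?x0)"
      by (rule sqm_eqI) (simp add: E_def mult_by_def)
    have "E * E = smap ?c (mult_by F (mat_vec (mult_by F ?x0) ?x0))" unfolding E hom[symmetric] mult_by_mult ..
    also have "\<dots> = smap ?c (mult_by F ?x0)"
    proof (rule sqm_eqI)
      fix i j
      have "mfps_coeff (mat_vec (mult_by F ?x0) ?x0 \<alpha>) {#} = p \<alpha>" for \<alpha>
        using id[of \<alpha>] by (simp add: mat_vec_mult_by)
      then show "entry (smap ?c (mult_by F (mat_vec (mult_by F ?x0) ?x0))) i j = entry (smap ?c (mult_by F ?x0)) i j"
        by (simp add: mult_by_def)
    qed
    finally show ?thesis by (simp add: E)
  qed
  have LL: "L * L = 1" by (simp add: L_def algebra_simps EE)
  have L0: "mfps_coeff (entry (mult_by F (e y) + mult_by F (e y')) \<alpha> \<beta> - entry 1 \<alpha> \<beta>) {#} = mfps_coeff (entry L \<alpha> \<beta>) {#}"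
    if "\<And>a. mfps_coeff (y a) {#} = 0" "\<And>a. mfps_coeff (y' a) {#} = 0" for y y' \<alpha> \<beta>
    by (simp add: L_def E_def mult_by_def e_def that mfps_const_two[symmetric])
  obtain y where y: "\<And>a. mfps_coeff (y a) {#} = 0" "(\<lambda>\<alpha>. y \<alpha> - mat_vec L (G y) \<alpha>) = y"
  proof (rule formal_fixpoint[of "\<lambda>y \<alpha>. y \<alpha> - mat_vec L (G y) \<alpha>"])
    fix y :: "'n \<Rightarrow> 'n mfps" and a assume z: "\<And>a. mfps_coeff (y a) {#} = 0"
    have "mfps_coeff (G y \<alpha>) {#} = 0" for \<alpha>
      using id[of \<alpha>] by (simp add: G_def e_def mat_vec_mult_by z)
    then show "mfps_coeff (y a - mat_vec L (G y) a) {#} = 0" by (simp add: mat_vec_def z)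
  next
    fix y y' :: "'n \<Rightarrow> 'n mfps" and d a
    assume z: "\<And>a. mfps_coeff (y a) {#} = 0" "\<And>a. mfps_coeff (y' a) {#} = 0"
      and ag: "\<And>a. agree {m. size m < d} (y a) (y' a)"
    let ?d = "\<lambda>\<alpha>. y \<alpha> - y' \<alpha>"
    let ?X = "mult_by F (e y) + mult_by F (e y') - 1"
    have od: "ord_ge d (?d \<alpha>)" for \<alpha> using ag[of \<alpha>] by (simp add: ord_ge_def' agree_def)
    have ed: "?d = (\<lambda>\<alpha>. e y \<alpha> - e y' \<alpha>)" by (simp add: e_def)
    have GX: "G y \<alpha> - G y' \<alpha> = mat_vec ?X ?d \<alpha>" for \<alpha>
    proof -
      have "mat_vec (mult_by F (e y)) (e y') \<alpha> = mat_vec (mult_by F (e y')) (e y) \<alpha>" by (simp only: mat_vec_mult_by_sym)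
      then have "mat_vec (mult_by F (e y) + mult_by F (e y')) ?d \<alpha> = mat_vec (mult_by F (e y)) (e y) \<alpha> - mat_vec (mult_by F (e y')) (e y') \<alpha>"
        unfolding ed mat_vec_diff by (simp add: mat_vec_simps)
      moreover have "mat_vec ?X ?d \<alpha> = mat_vec (mult_by F (e y) + mult_by F (e y')) ?d \<alpha> - ?d \<alpha>"
        by (simp add: mat_vec_def ring_distribs sum_subtractf sum.distrib if_distrib[of "\<lambda>x. x * _"] cong: if_cong)
      moreover have "e y' \<alpha> - e y \<alpha> = y' \<alpha> - y \<alpha>" by (simp add: e_def)
      ultimately show ?thesis by (simp add: G_def ed)
    qed
    have "mat_vec L (G y) a - mat_vec L (G y') a = mat_vec (L * ?X) ?d a"
      unfolding mat_vec_diff[symmetric] mat_vec_mult by (simp add: GX[abs_def])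
    have "mfps_coeff (y a - mat_vec L (G y) a) m = mfps_coeff (y' a - mat_vec L (G y') a) m" if m: "size m \<le> d" for m
    proof -
      have "mfps_coeff (mat_vec L (G y) a - mat_vec L (G y') a) m = mfps_coeff (mat_vec (L * ?X) ?d a) m"
        by (simp only: \<open>mat_vec L (G y) a - mat_vec L (G y') a = mat_vec (L * ?X) ?d a\<close>)
      also have "\<dots> = (\<Sum>\<beta>\<in>UNIV. mfps_coeff (entry (L * L) a \<beta>) {#} * mfps_coeff (?d \<beta>) m)"
        unfolding coeff_mat_vec_ord[OF od m]
        by (intro sum.cong refl) (simp add: entry_times L0[OF z, simplified])
      also have "\<dots> = mfps_coeff (?d a) m"
        by (simp add: LL if_distrib[of "\<lambda>x. mfps_coeff x _"] if_distrib[of "\<lambda>x. x * _"] cong: if_cong)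
      finally show ?thesis by (simp add: algebra_simps)
    qed
    then show "agree {m. size m < Suc d} (y a - mat_vec L (G y) a) (y' a - mat_vec L (G y') a)"
      by (simp add: agree_def)
  qed blast
  have "mat_vec L (G y) \<alpha> = 0" for \<alpha> using fun_cong[OF y(2), of \<alpha>] by simp
  then have "mat_vec L (mat_vec L (G y)) \<alpha> = 0" for \<alpha> by (simp add: mat_vec_def)
  then have "G y \<alpha> = 0" for \<alpha> by (simp add: mat_vec_mult[symmetric] LL mat_vec_simps)
  then have "mat_vec (mult_by F (e y)) (e y) = e y" by (intro ext) (simp add: G_def)
  moreover have "mfps_coeff (e y \<alpha>) {#} = p \<alpha>" for \<alpha> by (simp add: e_def y)
  ultimately show ?thesis using that by blast
qed

text \<open>
  One step of the lift in powers of \<open>z\<close>.  The error \<open>Z\<close> of horizontality satisfies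
  \<open>[C\<^sub>\<gamma>, Z\<^sub>\<delta>] = [C\<^sub>\<delta>, Z\<^sub>\<gamma>]\<close> because the connection is flat and is off-diagonal with respect to
  the idempotent, so that it is removed by the commutator with \<open>[E, Z\<^sub>e]\<close>.
\<close>

lemma horizontal_step:
  assumes e: "mat_vec (mult_by F e) e = e" and k: "0 < k" and P0: "fps_nth P 0 = mult_by F e"
    and N: "\<And>j. j < k \<Longrightarrow> fps_nth (P * P - P) j = 0"
    and H: "\<And>\<gamma> j. j < k \<Longrightarrow> fps_nth (horiz F \<gamma> P) j = 0"
  shows "\<exists>Q. (\<forall>j<k. fps_nth Q j = fps_nth P j) \<and> (\<forall>j<Suc k. fps_nth (Q * Q - Q) j = 0) \<and>
    (\<forall>\<gamma>. \<forall>j<Suc k. fps_nth (horiz F \<gamma> Q) j = 0)"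
proof -
  let ?E = "mult_by F e"
  have EE: "?E * ?E = ?E" by (simp add: mult_by_mult[symmetric] e)
  have EE': "?E * (?E * X) = ?E * X" for X by (simp only: mult.assoc[symmetric] EE)
  note EC = mult_by_commute_C[of e]
  have EC': "?E * (struct_mat F \<gamma> * X) = struct_mat F \<gamma> * (?E * X)" for \<gamma> X by (simp only: mult.assoc[symmetric] EC)
  have corr: "fps_nth (P + fps_X ^ k * fps_const Y) j = (if j = k then fps_nth P k + Y else fps_nth P j)"
    if "j \<le> k" for P :: "('n mfps, 'n) sqm fps" and Y j
    using that by (simp add: fps_X_power_mult_nth)
  have corrN: "fps_nth ((P + fps_X ^ k * fps_const Y) * (P + fps_X ^ k * fps_const Y) - (P + fps_X ^ k * fps_const Y)) j =
      (if j = k then fps_nth (P * P - P) k + ?E * Y + Y * ?E - Y else fps_nth (P * P - P) j)"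
    if "j \<le> k" "fps_nth P 0 = ?E" for P Y j
  proof -
    let ?Y = "fps_X ^ k * fps_const Y"
    have Y0: "fps_nth ?Y i = 0" if "i < k" for i using that by (simp add: fps_X_power_mult_nth)
    have Yk: "fps_nth ?Y k = Y" by (simp add: fps_X_power_mult_nth)
    have 1: "fps_nth (P * ?Y) j = (if j = k then ?E * Y else 0)"
      using fps_nth_mult_below_right[of k ?Y j P] Y0 Yk that by simp
    have 2: "fps_nth (?Y * Q) j = (if j = k then Y * fps_nth Q 0 else 0)" for Q
      using fps_nth_mult_below_left[of k ?Y j Q] Y0 Yk that by simp
    have "(P + ?Y) * (P + ?Y) - (P + ?Y) = (P * P - P) + P * ?Y + ?Y * P + ?Y * ?Y - ?Y"
      by (simp add: algebra_simps)
    then show ?thesis using Y0[of j] Yk Y0[of 0] k that by (simp add: 1 2)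
  qed
  have corrH: "fps_nth (horiz F \<gamma> (P + fps_X ^ k * fps_const Y)) j =
      (if j = k then fps_nth (horiz F \<gamma> P) k - (struct_mat F \<gamma> * Y - Y * struct_mat F \<gamma>) else fps_nth (horiz F \<gamma> P) j)"
    if "j \<le> k" for P Y j \<gamma>
  proof (cases "j = k")
    case True
    moreover have "k - 1 \<noteq> k" using k by simp
    ultimately show ?thesis using k by (simp add: horiz_nth corr algebra_simps)
  next
    case False
    then have "j < k" "j - 1 < k" using that k by auto
    then show ?thesis by (simp add: horiz_nth corr)
  qed
  \<comment> \<open>First restore idempotency in order \<open>k\<close>.\<close>
  define T where "T = fps_nth (P * P - P) k"
  have ET: "?E * T = T * ?E"
  proof -
    have "fps_nth (P * (P * P - P)) k = fps_nth ((P * P - P) * P) k" by (simp add: algebra_simps)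
    then show ?thesis
      using fps_nth_mult_below_right[of k "P * P - P" k P] fps_nth_mult_below_left[of k "P * P - P" k P] N
      by (simp add: T_def P0)
  qed
  have ET': "?E * (T * X) = T * (?E * X)" for X by (simp only: mult.assoc[symmetric] ET)
  \<comment> \<open>The Newton correction of an approximate idempotent by its error \<open>T\<close>.\<close>
  define Y1 where "Y1 = T - (?E * T + ?E * T)"
  define P1 where "P1 = P + fps_X ^ k * fps_const Y1"
  have P10: "fps_nth P1 0 = ?E" using corr[of 0 P Y1] k P0 by (simp add: P1_def)
  have N1: "fps_nth (P1 * P1 - P1) j = 0" if "j \<le> k" for j
  proof -
    have "T + ?E * Y1 + Y1 * ?E - Y1 = 0"
      by (simp add: Y1_def algebra_simps ET ET' EE EE')
    then show ?thesis
      unfolding P1_def corrN[OF that P0] using N that by (simp add: T_def)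
  qed
  have H1: "fps_nth (horiz F \<gamma> P1) j = 0" if "j < k" for \<gamma> j
    using that corrH[of j \<gamma> P Y1] H by (simp add: P1_def)
  \<comment> \<open>Then horizontality.\<close>
  define Z where "Z \<gamma> = fps_nth (horiz F \<gamma> P1) k" for \<gamma>
  have Zoff: "?E * Z \<gamma> + Z \<gamma> * ?E = Z \<gamma>" for \<gamma>
  proof -
    have "fps_nth (horiz F \<gamma> (P1 * P1 - P1)) k = 0" using N1 k by (simp add: horiz_nth sderiv_simps)
    then have "fps_nth (horiz F \<gamma> P1 * P1 + P1 * horiz F \<gamma> P1 - horiz F \<gamma> P1) k = 0"
      by (simp add: horiz_linear horiz_mult)
    then show ?thesis
      using fps_nth_mult_below_right[of k "horiz F \<gamma> P1" k P1] fps_nth_mult_below_left[of k "horiz F \<gamma> P1" k P1] H1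
      by (simp add: Z_def P10 algebra_simps)
  qed
  have Zflat: "struct_mat F \<gamma> * Z \<delta> - Z \<delta> * struct_mat F \<gamma> = struct_mat F \<delta> * Z \<gamma> - Z \<gamma> * struct_mat F \<delta>" for \<gamma> \<delta>
  proof -
    have "fps_nth (horiz F \<gamma> (horiz F \<delta> P1)) k = fps_nth (horiz F \<delta> (horiz F \<gamma> P1)) k"
      by (simp only: horiz_commute[OF flat, of \<gamma> \<delta>])
    then have "Z \<delta> * struct_mat F \<gamma> - struct_mat F \<gamma> * Z \<delta> = Z \<gamma> * struct_mat F \<delta> - struct_mat F \<delta> * Z \<gamma>"
      using k H1 by (simp add: horiz_nth[of F _ "horiz F _ P1"] sderiv_simps Z_def)
    then show ?thesis by (metis minus_diff_eq)
  qed
  define Ze where "Ze = (\<Sum>\<delta>\<in>UNIV. scal (e \<delta>) (Z \<delta>))"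
  have Zeflat: "struct_mat F \<gamma> * Ze - Ze * struct_mat F \<gamma> = ?E * Z \<gamma> - Z \<gamma> * ?E" for \<gamma>
  proof -
    have "struct_mat F \<gamma> * Ze - Ze * struct_mat F \<gamma> = (\<Sum>\<delta>\<in>UNIV. scal (e \<delta>) (struct_mat F \<gamma> * Z \<delta> - Z \<delta> * struct_mat F \<gamma>))"
      by (simp add: Ze_def sum_distrib_left sum_distrib_right scal_simps sum_subtractf)
    also have "\<dots> = (\<Sum>\<delta>\<in>UNIV. scal (e \<delta>) (struct_mat F \<delta> * Z \<gamma> - Z \<gamma> * struct_mat F \<delta>))" by (simp only: Zflat)
    also have "\<dots> = ?E * Z \<gamma> - Z \<gamma> * ?E"
      by (simp add: mult_by_def sum_distrib_left sum_distrib_right scal_simps sum_subtractf)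
    finally show ?thesis .
  qed
  have EZE: "?E * (Z \<gamma> * ?E) = 0" for \<gamma>
  proof -
    have "?E * Z \<gamma> = ?E * (?E * Z \<gamma> + Z \<gamma> * ?E)" by (simp only: Zoff)
    then show ?thesis by (simp add: ring_distribs EE')
  qed
  \<comment> \<open>The gauge transformation with generator \<open>Ze\<close>, projected to the off-diagonal blocks.\<close>
  define Y2 where "Y2 = ?E * Ze - Ze * ?E"
  have "struct_mat F \<gamma> * Y2 - Y2 * struct_mat F \<gamma> = Z \<gamma>" for \<gamma>
  proof -
    have "struct_mat F \<gamma> * Y2 - Y2 * struct_mat F \<gamma> = ?E * (struct_mat F \<gamma> * Ze - Ze * struct_mat F \<gamma>) - (struct_mat F \<gamma> * Ze - Ze * struct_mat F \<gamma>) * ?E"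
      by (simp add: Y2_def algebra_simps EC EC')
    also have "\<dots> = ?E * Z \<gamma> + Z \<gamma> * ?E"
      unfolding Zeflat by (simp add: algebra_simps EE EE' EZE)
    finally show ?thesis by (simp only: Zoff)
  qed
  moreover have "?E * Y2 + Y2 * ?E - Y2 = 0"
    by (simp add: Y2_def algebra_simps EE EE')
  ultimately show ?thesis
    using N1 H1 corrN[OF _ P10, of _ Y2] corrH[of _ _ P1 Y2] corr[of _ P1 Y2] corr[of _ P Y1]
    by (intro exI[of _ "P1 + fps_X ^ k * fps_const Y2"])
      (auto simp: less_Suc_eq_le Z_def P1_def[symmetric] add_diff_eq[symmetric] add.assoc)
qed

text \<open>
  The lift is built order by order in \<open>z\<close>, starting from the idempotent itself, which is horizontal
  in order zero because it commutes with the structure matrices.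
\<close>

lemma horizontal_idempotent:
  assumes e: "mat_vec (mult_by F e) e = e"
  shows "\<exists>P. fps_nth P 0 = mult_by F e \<and> P * P = P \<and> (\<forall>\<gamma>. horiz F \<gamma> P = 0)"
proof -
  let ?E = "mult_by F e"
  let ?lev = "\<lambda>k P. fps_nth P 0 = ?E \<and> (\<forall>j<Suc k. fps_nth (P * P - P) j = 0) \<and> (\<forall>\<gamma>. \<forall>j<Suc k. fps_nth (horiz F \<gamma> P) j = 0)"
  have EE: "?E * ?E = ?E" by (simp add: mult_by_mult[symmetric] e)
  have base: "?lev 0 (fps_const ?E)"
    by (simp add: horiz_nth EE mult_by_commute_C)
  have step: "\<exists>Q. ?lev (Suc k) Q \<and> (\<forall>j<Suc k. fps_nth Q j = fps_nth P j)" if "?lev k P" for k P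
  proof -
    from that have "\<exists>Q. (\<forall>j<Suc k. fps_nth Q j = fps_nth P j) \<and> (\<forall>j<Suc (Suc k). fps_nth (Q * Q - Q) j = 0) \<and>
        (\<forall>\<gamma>. \<forall>j<Suc (Suc k). fps_nth (horiz F \<gamma> Q) j = 0)"
      by (intro horizontal_step[OF e]) auto
    then show ?thesis using that by (metis zero_less_Suc)
  qed
  have "\<exists>f. \<forall>k. ?lev k (f k) \<and> (\<forall>j<Suc k. fps_nth (f (Suc k)) j = fps_nth (f k) j)"
    by (rule dependent_nat_choice[of ?lev "\<lambda>k P Q. \<forall>j<Suc k. fps_nth Q j = fps_nth P j"])
      (rule exI, rule base, rule step)
  then obtain f where f0: "\<forall>k. ?lev k (f k) \<and> (\<forall>j<Suc k. fps_nth (f (Suc k)) j = fps_nth (f k) j)" ..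
  note f = f0[THEN spec, THEN conjunct1] f0[THEN spec, THEN conjunct2]
  define P where "P = Abs_fps (\<lambda>n. fps_nth (f n) n)"
  have agree: "fps_nth P j = fps_nth (f k) j" if "j \<le> k" for j k
    using that
  proof (induction k)
    case (Suc k)
    then show ?case using f(2)[of k] by (cases "j = Suc k") (auto simp: P_def)
  qed (simp add: P_def)
  have "P * P - P = 0"
  proof (rule fps_ext)
    fix n
    have "fps_nth (P * P - P) n = fps_nth (f n * f n - f n) n"
      using agree[of _ n] by (simp add: fps_mult_nth)
    then show "fps_nth (P * P - P) n = fps_nth 0 n" using f(1)[of n] by simp
  qed
  moreover have "horiz F \<gamma> P = 0" for \<gamma>
  proof (rule fps_ext)
    fix n
    have "fps_nth (horiz F \<gamma> P) n = fps_nth (horiz F \<gamma> (f n)) n"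
      using agree[of n n] agree[of "n - 1" n] by (simp add: horiz_nth)
    then show "fps_nth (horiz F \<gamma> P) n = fps_nth 0 n" using f(1)[of n] by simp
  qed
  moreover have "fps_nth P 0 = ?E" using agree[of 0 0] f(1)[of 0] by simp
  ultimately show ?thesis by auto
qed

text \<open>
  The product is horizontal, so its lowest coefficient commutes with the structure matrices, hence
  with both idempotents, between which it is sandwiched.
\<close>

lemma horizontal_orthogonal:
  assumes P: "P * P = P" "\<And>\<gamma>. horiz F \<gamma> P = 0" "fps_nth P 0 = mult_by F e"
    and Q: "Q * Q = Q" "\<And>\<gamma>. horiz F \<gamma> Q = 0" "fps_nth Q 0 = mult_by F e'"
    and orth: "mult_by F e' * mult_by F e = 0"
  shows "P * Q = 0"
proof (rule fps_ext)
  fix n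
  have h: "horiz F \<gamma> (P * Q) = 0" for \<gamma> by (simp add: horiz_mult P Q)
  have "fps_nth (P * Q) n = 0"
  proof (induction n rule: less_induct)
    case (less n)
    let ?R = "fps_nth (P * Q) n"
    \<comment> \<open>In lowest order horizontality has no derivative term.\<close>
    have C: "struct_mat F \<gamma> * ?R = ?R * struct_mat F \<gamma>" for \<gamma>
      using arg_cong[OF h[of \<gamma>], of "\<lambda>x. fps_nth x n"] less[of "n - 1"]
      by (cases "n = 0") (simp_all add: horiz_nth sderiv_simps)
    have E: "mult_by F e * ?R = ?R * mult_by F e"
      by (simp add: mult_by_def sum_distrib_left sum_distrib_right scal_simps C)
    have "?R = fps_nth (P * (P * Q)) n" by (simp only: mult.assoc[symmetric] P)
    also have "\<dots> = mult_by F e * ?R"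
      using fps_nth_mult_below_right[of n "P * Q" n P] less by (simp add: P)
    finally have 1: "?R = mult_by F e * ?R" .
    have "?R = fps_nth ((P * Q) * Q) n" by (simp only: mult.assoc Q)
    also have "\<dots> = ?R * mult_by F e'"
      using fps_nth_mult_below_left[of n "P * Q" n Q] less by (simp add: Q)
    finally have 2: "?R = ?R * mult_by F e'" .
    have "?R = ?R * mult_by F e" using 1 E by simp
    also have "\<dots> = (?R * mult_by F e') * mult_by F e" using 2 by simp
    also have "\<dots> = 0" by (simp add: mult.assoc orth)
    finally show ?case .
  qed
  then show "fps_nth (P * Q) n = fps_nth 0 n" by simp
qed

end

section \<open>Canonical coordinates\<close>

text \<open>
  The coefficient of the primitive at \<open>m\<close> can be read off from \<open>\<theta> \<gamma>\<close> for any variable \<open>\<gamma>\<close> in \<open>m\<close>;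
  closedness says that the choice does not matter.
\<close>

lemma formal_poincare:
  assumes closed: "\<And>\<gamma> \<delta>. mfps_deriv \<gamma> (\<theta> \<delta>) = mfps_deriv \<delta> (\<theta> \<gamma>)"
  obtains U where "mfps_coeff U {#} = 0" "\<And>\<gamma>. mfps_deriv \<gamma> U = \<theta> \<gamma>"
proof -
  let ?u = "\<lambda>m \<gamma>. mfps_coeff (\<theta> \<gamma>) (m - {#\<gamma>#}) / of_nat (count m \<gamma>)"
  define U where "U = Abs_mfps (\<lambda>m. if m = {#} then 0 else ?u m (SOME \<gamma>. \<gamma> \<in># m))"
  have indep: "?u m \<gamma> = ?u m \<delta>" if g: "\<gamma> \<in># m" and d: "\<delta> \<in># m" for m \<gamma> \<delta>
  proof (cases "\<gamma> = \<delta>")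
    case False
    obtain k where k: "m = add_mset \<gamma> k" using g by (meson multi_member_split)
    then have "\<delta> \<in># k" using d False by simp
    then obtain n where n: "k = add_mset \<delta> n" by (meson multi_member_split)
    have m: "m = add_mset \<gamma> (add_mset \<delta> n)" using k n by simp
    have "mfps_coeff (mfps_deriv \<delta> (\<theta> \<gamma>)) n = mfps_coeff (mfps_deriv \<gamma> (\<theta> \<delta>)) n" by (simp only: closed)
    then have "of_nat (Suc (count n \<delta>)) * mfps_coeff (\<theta> \<gamma>) (add_mset \<delta> n) =
        of_nat (Suc (count n \<gamma>)) * mfps_coeff (\<theta> \<delta>) (add_mset \<gamma> n)"
      by (simp only: mfps_coeff_basic)
    moreover have "count m \<gamma> = Suc (count n \<gamma>)" "count m \<delta> = Suc (count n \<delta>)" using False by (simp_all add: m)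
    moreover have "m - {#\<gamma>#} = add_mset \<delta> n" "m - {#\<delta>#} = add_mset \<gamma> n" using False by (simp_all add: m)
    ultimately show ?thesis by (simp add: frac_eq_eq mult.commute del: of_nat_Suc)
  qed simp
  have "mfps_deriv \<gamma> U = \<theta> \<gamma>" for \<gamma>
  proof (rule mfps_eqI)
    fix m
    let ?m = "add_mset \<gamma> m"
    have "(SOME \<delta>. \<delta> \<in># ?m) \<in># ?m" by (rule someI[of _ \<gamma>]) simp
    then have "mfps_coeff U ?m = ?u ?m \<gamma>" using indep[of "SOME \<delta>. \<delta> \<in># ?m" ?m \<gamma>] by (simp add: U_def)
    then show "mfps_coeff (mfps_deriv \<gamma> U) m = mfps_coeff (\<theta> \<gamma>) m"
      by (simp del: of_nat_Suc)
  qed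
  then show ?thesis using that[of U] by (simp add: U_def)
qed

definition tr :: "('a :: comm_ring_1, 'n :: finite) sqm \<Rightarrow> 'a" where
  "tr X = (\<Sum>i\<in>UNIV. entry X i i)"

lemma tr_simps: "tr (X + Y) = tr X + tr Y" "tr (X - Y) = tr X - tr Y" "tr (scal c X) = c * tr X"
  "tr (sum f S) = (\<Sum>s\<in>S. tr (f s))"
  by (simp_all add: tr_def sum.distrib sum_subtractf sum_distrib_left) (rule sum.swap)

lemma tr_commute: "tr (X * Y) = tr (Y * X)"
  unfolding tr_def entry_times by (subst sum.swap) (simp add: mult.commute)

lemma tr_deriv: "mfps_deriv v (tr X) = tr (sderiv v X)"
  by (simp add: tr_def mfps_deriv_sum)

abbreviation at_origin :: "('v mfps, 'n :: finite) sqm \<Rightarrow> complex^'n^'n" where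
  "at_origin X \<equiv> (\<chi> i j. mfps_coeff (entry X i j) {#})"

context
  fixes F :: "'n :: finite \<Rightarrow> 'n mfps" and A :: "complex^'n" and p :: "'n \<Rightarrow> complex^'n"
  assumes flat: "flat_F_manifold F A"
    and span: "vec.span (range p) = UNIV"
    and pp: "\<And>k l. origin_mult F (p k) (p l) = (if k = l then p k else 0)"
begin

definition idem_basis :: "complex^'n^'n" where "idem_basis = (\<chi> i k. p k $ i)"

text \<open>
  Multiplication by the \<open>k\<close>-th idempotent in the algebra at the origin.
\<close>

definition idem_mult :: "'n \<Rightarrow> complex^'n^'n" where
  "idem_mult k = (\<chi> \<alpha> \<beta>. \<Sum>\<gamma>\<in>UNIV. p k $ \<gamma> * mfps_coeff (structure_const F \<alpha> \<gamma> \<beta>) {#})"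

lemma invertible_idem_basis: "invertible idem_basis"
proof -
  have "columns idem_basis = range p" by (auto simp: columns_def column_def idem_basis_def vec_eq_iff image_def)
  then have "\<exists>B. idem_basis ** B = mat 1"
    using span matrix_right_invertible_span_columns[of idem_basis] by simp
  then show ?thesis using invertible_right_inverse by blast
qed

lemma idem_basis_cancel: "X ** idem_basis = Y ** idem_basis \<Longrightarrow> X = Y"
proof -
  obtain N where N: "idem_basis ** N = mat 1" using invertible_idem_basis invertible_right_inverse by blast
  assume "X ** idem_basis = Y ** idem_basis"
  then have "X ** idem_basis ** N = Y ** idem_basis ** N" by simp
  then show ?thesis by (simp add: matrix_mul_assoc[symmetric] N)
qed

lemma idem_mult_p: "idem_mult k *v p l = (if k = l then p k else 0)"
proof -
  have "idem_mult k *v p l = origin_mult F (p k) (p l)"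
    unfolding origin_mult_def idem_mult_def matrix_vector_mult_def vec_eq_iff
    by (simp add: sum_distrib_right) (intro allI, subst sum.swap, simp add: mult_ac)
  then show ?thesis by (simp add: pp)
qed

text \<open>
  In the basis of idempotents multiplication by an idempotent is a coordinate projection.
\<close>

lemma idem_mult_idem_basis: "idem_mult k ** idem_basis = idem_basis ** triv_C k"
proof -
  have "(idem_mult k ** idem_basis) $ i $ l = (idem_mult k *v p l) $ i" for i l
    by (simp add: matrix_matrix_mult_def matrix_vector_mult_def idem_basis_def)
  moreover have "(idem_basis ** triv_C k) $ i $ l = (if k = l then p k else 0) $ i" for i l
    by (auto simp: matrix_matrix_mult_def idem_basis_def triv_C_def if_distrib[of "\<lambda>x. _ * x"] cong: if_cong)
  ultimately show ?thesis by (simp add: vec_eq_iff idem_mult_p)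
qed

lemma sum_idem_mult: "(\<Sum>k\<in>UNIV. idem_mult k) = mat 1"
proof (rule idem_basis_cancel)
  have "(\<Sum>k\<in>UNIV. idem_mult k) ** idem_basis = (\<Sum>k\<in>UNIV. idem_mult k ** idem_basis)"
    by (simp add: vec_eq_iff matrix_matrix_mult_def sum_distrib_right) (intro allI, rule sum.swap)
  also have "\<dots> = idem_basis ** (\<Sum>k\<in>UNIV. triv_C k)"
    unfolding idem_mult_idem_basis by (simp add: vec_eq_iff matrix_matrix_mult_def sum_distrib_left) (intro allI, rule sum.swap)
  also have "(\<Sum>k\<in>UNIV. triv_C k) = (mat 1 :: complex^'n^'n)"
  proof -
    have "(\<Sum>k\<in>UNIV. if i = k \<and> j = k then 1 else 0) = (if i = j then 1 else 0 :: complex)" for i j :: 'n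
    proof -
      have "(\<Sum>k\<in>UNIV. if i = k \<and> j = k then 1 else 0) = (\<Sum>k\<in>UNIV. if k = i then (if i = j then 1 else 0) else 0 :: complex)"
        by (rule sum.cong) auto
      then show ?thesis by simp
    qed
    then show ?thesis by (simp add: vec_eq_iff triv_C_def mat_def)
  qed
  finally show "(\<Sum>k\<in>UNIV. idem_mult k) ** idem_basis = mat 1 ** idem_basis" by simp
qed

lemma trace_idem_mult: "(\<Sum>i\<in>UNIV. idem_mult k $ i $ i) = 1"
proof -
  obtain N where N: "idem_basis ** N = mat 1" "N ** idem_basis = mat 1" using invertible_idem_basis by (auto simp: invertible_def)
  have "idem_mult k = idem_basis ** triv_C k ** N"
    by (rule idem_basis_cancel) (simp add: matrix_mul_assoc[symmetric] N idem_mult_idem_basis)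
  then have "trace (idem_mult k) = trace (triv_C k :: complex^'n^'n)"
    using trace_mul_sym[of "idem_basis ** triv_C k" N] by (simp add: matrix_mul_assoc N)
  also have "\<dots> = 1" by (simp add: trace_def triv_C_def)
  finally show ?thesis by (simp add: trace_def)
qed

lemma idem_mult_fixed:
  assumes "idem_mult k *v v = v"
  shows "\<exists>u. v = u *s p k"
proof -
  obtain N where N: "idem_basis ** N = mat 1" using invertible_idem_basis invertible_right_inverse by blast
  have "v = idem_mult k *v (idem_basis *v (N *v v))" by (simp add: matrix_vector_mul_assoc N assms)
  also have "\<dots> = idem_basis *v (triv_C k *v (N *v v))"
    by (simp only: matrix_vector_mul_assoc[of "idem_mult k" idem_basis] idem_mult_idem_basis matrix_vector_mul_assoc[of idem_basis "triv_C k"])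
  also have "triv_C k *v (N *v v) = (N *v v) $ k *s axis k 1"
    by (auto simp: vec_eq_iff matrix_vector_mult_def triv_C_def axis_def if_distrib[of "\<lambda>x. x * _"] cong: if_cong)
  also have "idem_basis *v ((N *v v) $ k *s axis k 1) = (N *v v) $ k *s p k"
    by (simp add: vec_eq_iff matrix_vector_mult_def idem_basis_def axis_def if_distrib[of "\<lambda>x. _ * x"] if_distrib[of "\<lambda>x. x * _"] mult.commute cong: if_cong)
  finally show ?thesis by blast
qed

lemma unit_sum: "A = (\<Sum>k\<in>UNIV. p k)"
proof -
  have e: "mfps_coeff (\<Sum>\<mu>\<in>UNIV. mfps_const (A $ \<mu>) * structure_const F \<alpha> \<gamma> \<mu>) {#} = (if \<alpha> = \<gamma> then 1 else 0)" for \<alpha> \<gamma>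
    unfolding flat_unit'[OF flat] by simp
  have "idem_mult k *v A = p k" for k
  proof -
    have "(idem_mult k *v A) $ \<alpha> = p k $ \<alpha>" for \<alpha>
    proof -
      have "(idem_mult k *v A) $ \<alpha> = (\<Sum>\<gamma>\<in>UNIV. p k $ \<gamma> * mfps_coeff (\<Sum>\<mu>\<in>UNIV. mfps_const (A $ \<mu>) * structure_const F \<alpha> \<gamma> \<mu>) {#})"
        by (simp add: idem_mult_def matrix_vector_mult_def sum_distrib_left sum_distrib_right, subst sum.swap, simp add: mult_ac)
      then show ?thesis unfolding e by (simp add: if_distrib[of "\<lambda>x. _ * x"] cong: if_cong)
    qed
    then show ?thesis by (simp add: vec_eq_iff)
  qed
  then have "(\<Sum>k\<in>UNIV. p k) = (\<Sum>k\<in>UNIV. idem_mult k *v A)" by simp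
  also have "\<dots> = (\<Sum>k\<in>UNIV. idem_mult k) *v A"
    by (simp add: vec_eq_iff matrix_vector_mult_def sum_distrib_right) (intro allI, rule sum.swap)
  finally show ?thesis by (simp add: sum_idem_mult)
qed

text \<open>
  The idempotent vector fields \<open>x k\<close>, their horizontal lifts \<open>P k\<close>, and the eigenvalue 1-forms
  \<open>\<theta> k\<close>.  The eigenvalues are obtained as traces, so that their closedness follows from
  \<open>\<partial>E = [C, P\<^sub>1]\<close> and the symmetry of \<open>\<partial>C\<close>.
\<close>

lemma semisimple_data:
  obtains P \<theta> where
    "\<And>k. at_origin (fps_nth (P k) 0) = idem_mult k"
    and "\<And>k l. k \<noteq> l \<Longrightarrow> P k * P l = 0" and "\<And>k. P k * P k = P k" and "\<And>k \<gamma>. horiz F \<gamma> (P k) = 0"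
    and "\<And>\<gamma>. struct_mat F \<gamma> = (\<Sum>k\<in>UNIV. scal (\<theta> k \<gamma>) (fps_nth (P k) 0))"
    and "\<And>k \<gamma> \<delta>. mfps_deriv \<gamma> (\<theta> k \<delta>) = mfps_deriv \<delta> (\<theta> k \<gamma>)"
    and "\<And>\<alpha> \<delta>. (\<Sum>k\<in>UNIV. p k $ \<alpha> * mfps_coeff (\<theta> k \<delta>) {#}) = (if \<alpha> = \<delta> then 1 else 0)"
proof -
  have "\<exists>x. (\<forall>\<alpha>. mfps_coeff (x \<alpha>) {#} = p k $ \<alpha>) \<and> mat_vec (mult_by F x) x = x" for k
  proof -
    have "(\<Sum>\<beta>\<in>UNIV. \<Sum>\<gamma>\<in>UNIV. p k $ \<gamma> * mfps_coeff (structure_const F \<alpha> \<gamma> \<beta>) {#} * p k $ \<beta>) = p k $ \<alpha>" for \<alpha>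
      using idem_mult_p[of k k] by (simp add: idem_mult_def matrix_vector_mult_def sum_distrib_right vec_eq_iff)
    from idempotent_lift[OF flat, of "\<lambda>\<alpha>. p k $ \<alpha>", OF this] show ?thesis by metis
  qed
  then obtain x where x0: "\<And>k \<alpha>. mfps_coeff (x k \<alpha>) {#} = p k $ \<alpha>" and xx: "\<And>k. mat_vec (mult_by F (x k)) (x k) = x k"
    by metis
  define E where "E k = mult_by F (x k)" for k
  have EE: "E k * E k = E k" for k by (simp add: E_def mult_by_mult[OF flat, symmetric] xx)
  have EC: "E k * struct_mat F \<gamma> = struct_mat F \<gamma> * E k" for k \<gamma> unfolding E_def by (rule mult_by_commute_C[OF flat])
  have E_comm: "E k * mult_by F y = mult_by F y * E k" for k y
    by (simp add: mult_by_def sum_distrib_left sum_distrib_right scal_simps EC)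
  have E0: "at_origin (E k) = idem_mult k" for k
    by (simp add: vec_eq_iff E_def mult_by_def x0 idem_mult_def)
  have orth: "mat_vec (E k) (x l) \<alpha> = 0" if "k \<noteq> l" for k l \<alpha>
  proof (rule idempotent_zero[OF flat])
    have "mat_vec (mult_by F (mat_vec (E k) (x l))) (mat_vec (E k) (x l)) = mat_vec (E k * E l * E k) (x l)"
      unfolding E_def mult_by_mult[OF flat] mat_vec_mult ..
    also have "E k * E l * E k = E k * E l"
    proof -
      have "E l * E k = E k * E l" using E_comm[of k "x l"] by (simp add: E_def)
      then have "E k * E l * E k = E k * E k * E l" by (simp only: mult.assoc)
      then show ?thesis by (simp only: EE)
    qed
    also have "mat_vec (E k * E l) (x l) = mat_vec (E k) (x l)" by (simp only: mat_vec_mult E_def xx)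
    finally show "mat_vec (mult_by F (mat_vec (E k) (x l))) (mat_vec (E k) (x l)) = mat_vec (E k) (x l)" .
    show "mfps_coeff (mat_vec (E k) (x l) \<alpha>) {#} = 0" for \<alpha>
    proof -
      have "mfps_coeff (mat_vec (E k) (x l) \<alpha>) {#} = (at_origin (E k) *v p l) $ \<alpha>"
        by (simp add: mat_vec_def x0 matrix_vector_mult_def)
      then show ?thesis using that by (simp add: E0 idem_mult_p)
    qed
  qed
  have EEo: "E k * E l = 0" if "k \<noteq> l" for k l
  proof -
    have "E k * E l = mult_by F (mat_vec (E k) (x l))" unfolding E_def by (simp add: mult_by_mult[OF flat])
    also have "mat_vec (E k) (x l) = (\<lambda>\<alpha>. 0)" using orth[OF that] by (intro ext)
    finally show ?thesis by (simp add: mult_by_def scal_simps)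
  qed
  let ?A = "\<lambda>\<alpha>. mfps_const (A $ \<alpha>) :: 'n mfps"
  have xsum: "(\<Sum>k\<in>UNIV. x k \<alpha>) = ?A \<alpha>" for \<alpha>
  proof -
    let ?e = "\<lambda>\<alpha>. \<Sum>k\<in>UNIV. x k \<alpha>"
    let ?v = "\<lambda>\<alpha>. ?A \<alpha> - ?e \<alpha>"
    have CXe: "mult_by F ?e = (\<Sum>k\<in>UNIV. E k)" by (simp add: mult_by_linear[OF flat] E_def)
    have ek: "mat_vec (mult_by F ?e) (x l) = x l" for l
    proof
      fix \<alpha>
      have "mat_vec (mult_by F ?e) (x l) \<alpha> = (\<Sum>k\<in>UNIV. if k = l then x l \<alpha> else 0)"
        unfolding CXe mat_vec_sum
      proof (rule sum.cong[OF refl])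
        fix k show "mat_vec (E k) (x l) \<alpha> = (if k = l then x l \<alpha> else 0)"
          using orth[of k l \<alpha>] fun_cong[OF xx[of l], of \<alpha>] by (simp add: E_def)
      qed
      then show "mat_vec (mult_by F ?e) (x l) \<alpha> = x l \<alpha>" by simp
    qed
    have ee: "mat_vec (mult_by F ?e) ?e \<alpha> = ?e \<alpha>" for \<alpha>
    proof -
      have "mat_vec (mult_by F ?e) ?e \<alpha> = (\<Sum>l\<in>UNIV. mat_vec (mult_by F ?e) (x l) \<alpha>)"
        by (simp add: mat_vec_def[of _ ?e] mat_vec_def[of _ "x _"] sum_distrib_left, rule sum.swap)
      then show ?thesis by (simp only: ek)
    qed
    have eA: "mat_vec (mult_by F ?e) ?A \<alpha> = ?e \<alpha>" for \<alpha>
      unfolding mat_vec_mult_by_sym[OF flat, of ?e ?A] mult_by_unit[OF flat] by (simp add: mat_vec_simps)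
    have "?v \<alpha> = 0" for \<alpha>
    proof (rule idempotent_zero[OF flat])
      show "mat_vec (mult_by F ?v) ?v = ?v"
      proof
        fix \<alpha>
        have CXv: "mult_by F ?v = 1 - mult_by F ?e"
          by (simp only: mult_by_linear(2)[OF flat] mult_by_unit[OF flat])
        have "mat_vec (1 - X) y \<alpha> = y \<alpha> - mat_vec X y \<alpha>" for X and y :: "'n \<Rightarrow> 'n mfps"
          using mat_vec_simps(2)[of "1" "- X" y \<alpha>] by (simp add: mat_vec_simps)
        then show "mat_vec (mult_by F ?v) ?v \<alpha> = ?v \<alpha>"
          by (simp only: CXv mat_vec_diff ee eA) simp
      qed
      show "mfps_coeff (?v \<alpha>) {#} = 0" for \<alpha>
        using unit_sum by (simp add: x0)
    qed
    then show ?thesis by (metis eq_iff_diff_eq_0)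
  qed
  have Esum: "(\<Sum>k\<in>UNIV. E k) = 1"
  proof -
    have "(\<Sum>k\<in>UNIV. E k) = mult_by F (\<lambda>\<alpha>. \<Sum>k\<in>UNIV. x k \<alpha>)" by (simp add: mult_by_linear[OF flat] E_def)
    then show ?thesis by (simp add: xsum mult_by_unit[OF flat])
  qed
  have "\<exists>P. fps_nth P 0 = E k \<and> P * P = P \<and> (\<forall>\<gamma>. horiz F \<gamma> P = 0)" for k
    unfolding E_def by (rule horizontal_idempotent[OF flat xx])
  then obtain P where P: "\<And>k. fps_nth (P k) 0 = E k" "\<And>k. P k * P k = P k" "\<And>k \<gamma>. horiz F \<gamma> (P k) = 0"
    by metis
  have PP: "P k * P l = 0" if "k \<noteq> l" for k l
    by (rule horizontal_orthogonal[OF flat P(2,3) P(1)[unfolded E_def] P(2,3) P(1)[unfolded E_def]])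
      (use EEo[of l k] that in \<open>simp add: E_def\<close>)
  have dE: "sderiv \<gamma> (E k) = struct_mat F \<gamma> * fps_nth (P k) 1 - fps_nth (P k) 1 * struct_mat F \<gamma>" for \<gamma> k
    using arg_cong[OF P(3)[of \<gamma> k], of "\<lambda>x. fps_nth x 1"] by (simp add: horiz_nth P(1))
  have trE: "tr (E k) = 1" for k
  proof (rule mfps_eq_by_deriv)
    have "mfps_coeff (tr (E k)) {#} = (\<Sum>i\<in>UNIV. at_origin (E k) $ i $ i)" by (simp add: tr_def)
    then show "mfps_coeff (tr (E k)) {#} = mfps_coeff 1 {#}" by (simp only: E0 trace_idem_mult) simp
    show "mfps_deriv \<gamma> (tr (E k)) = mfps_deriv \<gamma> 1" for \<gamma>
      by (simp add: tr_deriv dE tr_simps tr_commute[of "struct_mat F \<gamma>"])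
  qed
  \<comment> \<open>The eigenvalue of \<open>C\<close> on the line spanned by \<open>x k\<close>, written as a trace since \<open>E k\<close> has trace one.\<close>
  define \<theta> where "\<theta> k \<delta> = tr (struct_mat F \<delta> * E k)" for k \<delta>
  have closed: "mfps_deriv \<gamma> (\<theta> k \<delta>) = mfps_deriv \<delta> (\<theta> k \<gamma>)" for k \<gamma> \<delta>
  proof -
    have "tr (struct_mat F \<delta> * (struct_mat F \<gamma> * X - X * struct_mat F \<gamma>)) = 0" for X \<gamma> \<delta>
    proof -
      have "tr (struct_mat F \<delta> * (X * struct_mat F \<gamma>)) = tr (struct_mat F \<gamma> * (struct_mat F \<delta> * X))"
        using tr_commute[of "struct_mat F \<delta> * X" "struct_mat F \<gamma>"] by (simp add: mult.assoc)
      also have "\<dots> = tr (struct_mat F \<delta> * (struct_mat F \<gamma> * X))"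
        by (simp only: mult.assoc[symmetric] struct_mat_commute[OF flat, of \<gamma>])
      finally show ?thesis by (simp add: ring_distribs tr_simps)
    qed
    then have "mfps_deriv \<gamma> (\<theta> k \<delta>) = tr (sderiv \<gamma> (struct_mat F \<delta>) * E k)" for \<gamma> \<delta>
      by (simp add: \<theta>_def tr_deriv sderiv_simps tr_simps dE)
    then show ?thesis by (simp add: struct_mat_deriv_sym[of \<gamma> F \<delta>])
  qed
  have eig: "mat_vec (struct_mat F \<delta>) (x k) \<alpha> = \<theta> k \<delta> * x k \<alpha>" for \<delta> k \<alpha>
  proof -
    \<comment> \<open>The failure \<open>y\<close> to be an eigenvector lies in the image of \<open>E k\<close> and has trace zero. In lowest degree the image is the line of \<open>p k\<close>, on which the trace is injective.\<close>
  define y where "y \<alpha> = mat_vec (struct_mat F \<delta>) (x k) \<alpha> - \<theta> k \<delta> * x k \<alpha>" for \<alpha>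
    have CXy: "mult_by F y = struct_mat F \<delta> * E k - scal (\<theta> k \<delta>) (E k)"
      unfolding y_def[abs_def] mult_by_linear[OF flat] E_def
      by (subst mult_by_mat_vec[OF flat]) (simp_all add: struct_mat_commute[OF flat, of \<delta>])
    have trCXy: "tr (mult_by F y) = 0" by (simp add: CXy tr_simps trE \<theta>_def)
    have Ey: "mat_vec (E k) y = y"
    proof
      fix \<alpha>
      have "mat_vec (E k) (mat_vec (struct_mat F \<delta>) (x k)) = mat_vec (struct_mat F \<delta>) (x k)"
        unfolding mat_vec_mult[symmetric] EC by (simp add: mat_vec_mult E_def xx)
      then show "mat_vec (E k) y \<alpha> = y \<alpha>"
        unfolding y_def[abs_def] mat_vec_diff mat_vec_simps by (simp add: E_def xx)
    qed
    have "\<forall>\<alpha>. ord_ge d (y \<alpha>)" for d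
    proof (induction d)
      case (Suc d)
      have "mfps_coeff (y \<alpha>) m = 0" if m: "size m \<le> d" for \<alpha> m
      proof -
        let ?v = "\<chi> \<beta>. mfps_coeff (y \<beta>) m"
        have "idem_mult k *v ?v = ?v"
        proof -
          have "(at_origin (E k) *v ?v) $ \<alpha> = ?v $ \<alpha>" for \<alpha>
            using coeff_mat_vec_ord[OF flat, of d y m "E k" \<alpha>] Suc m by (simp add: Ey matrix_vector_mult_def)
          then show ?thesis unfolding vec_eq_iff E0 by blast
        qed
        then obtain u where u: "?v = u *s p k" using idem_mult_fixed by blast
        have "tr (mult_by F y) = (\<Sum>\<gamma>\<in>UNIV. tr (struct_mat F \<gamma>) * y \<gamma>)"
          by (simp add: mult_by_def tr_simps mult.commute)
        moreover have "mfps_coeff (tr (struct_mat F \<gamma>) * y \<gamma>) m = mfps_coeff (tr (struct_mat F \<gamma>)) {#} * mfps_coeff (y \<gamma>) m" for \<gamma>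
        proof -
          have "agree {m. size m < d} (y \<gamma>) 0" using ord_geD Suc by (auto simp: agree_def)
          from coeff_times_diff[OF this m, of "tr (struct_mat F \<gamma>)"] show ?thesis by (simp add: mult.commute)
        qed
        ultimately have "0 = (\<Sum>\<gamma>\<in>UNIV. mfps_coeff (tr (struct_mat F \<gamma>)) {#} * mfps_coeff (y \<gamma>) m)"
          using trCXy by (metis (no_types, lifting) mfps_coeff_basic(1) mfps_coeff_sum sum.cong)
        also have "\<dots> = (\<Sum>\<gamma>\<in>UNIV. mfps_coeff (tr (struct_mat F \<gamma>)) {#} * (u * p k $ \<gamma>))"
          using u by (simp add: vec_eq_iff)
        also have "\<dots> = u * (\<Sum>i\<in>UNIV. idem_mult k $ i $ i)"
          unfolding tr_def idem_mult_def by (simp add: sum_distrib_left sum_distrib_right mult_ac, rule sum.swap)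
        finally have "u = 0" by (simp add: trace_idem_mult)
        then have "?v = 0" using u by simp
        then show ?thesis by (simp add: vec_eq_iff)
      qed
      then show ?case unfolding ord_ge_def' by (simp add: less_Suc_eq_le)
    qed simp
    then have "y \<alpha> = 0" by (intro mfps_eqI) (metis lessI mfps_coeff_basic(1) ord_geD)
    then show ?thesis by (simp add: y_def)
  qed
  have CE: "struct_mat F \<delta> * E k = scal (\<theta> k \<delta>) (E k)" for \<delta> k
  proof -
    have "struct_mat F \<delta> * E k = mult_by F (mat_vec (struct_mat F \<delta>) (x k))"
      unfolding E_def by (subst mult_by_mat_vec[OF flat]) (simp_all add: struct_mat_commute[OF flat, of \<delta>])
    also have "mat_vec (struct_mat F \<delta>) (x k) = (\<lambda>\<alpha>. \<theta> k \<delta> * x k \<alpha>)" by (rule ext) (rule eig)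
    finally show ?thesis by (simp add: mult_by_linear[OF flat] E_def)
  qed
  have Csum: "struct_mat F \<gamma> = (\<Sum>k\<in>UNIV. scal (\<theta> k \<gamma>) (E k))" for \<gamma>
  proof -
    have "struct_mat F \<gamma> = struct_mat F \<gamma> * (\<Sum>k\<in>UNIV. E k)" by (simp add: Esum)
    then show ?thesis by (simp add: sum_distrib_left CE)
  qed
  have lin: "(\<Sum>k\<in>UNIV. p k $ \<alpha> * mfps_coeff (\<theta> k \<delta>) {#}) = (if \<alpha> = \<delta> then 1 else 0)" for \<alpha> \<delta>
  proof -
    have "(\<Sum>k\<in>UNIV. \<theta> k \<delta> * x k \<alpha>) = mat_vec (struct_mat F \<delta>) ?A \<alpha>"
      unfolding eig[symmetric] xsum[symmetric]
      by (simp add: mat_vec_def[of _ "x _"] mat_vec_def[of _ "\<lambda>\<alpha>. \<Sum>k\<in>UNIV. x k \<alpha>"] sum_distrib_left, rule sum.swap)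
    also have "\<dots> = (if \<alpha> = \<delta> then 1 else 0)"
      using flat_unit'[OF flat, of \<alpha> \<delta>] by (simp add: mat_vec_def mult.commute)
    finally have e: "(\<Sum>k\<in>UNIV. \<theta> k \<delta> * x k \<alpha>) = (if \<alpha> = \<delta> then 1 else 0)" .
    from arg_cong[OF e, of "\<lambda>f. mfps_coeff f {#}"] show ?thesis by (simp add: x0 mult.commute split: if_splits)
  qed
  show ?thesis
    by (rule that[of P \<theta>]) (use E0 PP P Csum closed lin in \<open>simp_all\<close>)
qed

end

section \<open>The Birkhoff-type factorisation\<close>

definition iotam :: "('v mfps, 'n :: finite) sqm \<Rightarrow> ('v option mfps, 'n) sqm" where
  "iotam = smap iota"

abbreviation zcoeff_mat :: "int \<Rightarrow> ('v option mfps, 'n :: finite) sqm \<Rightarrow> ('v mfps, 'n) sqm" where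
  "zcoeff_mat k \<equiv> smap (zcoeff k)"

lemma zcoeff_mat_eqI: "(\<And>k. zcoeff_mat k X = zcoeff_mat k Y) \<Longrightarrow> X = Y"
  by (rule sqm_eqI, rule zcoeff_eqI) (metis entry_smap)

lemma zcoeff_mat_simps: "zcoeff_mat k (X + Y) = zcoeff_mat k X + zcoeff_mat k Y" "zcoeff_mat k (X - Y) = zcoeff_mat k X - zcoeff_mat k Y" "zcoeff_mat k (- X) = - zcoeff_mat k X" "zcoeff_mat k 0 = 0"
  "zcoeff_mat k (sum f S) = (\<Sum>s\<in>S. zcoeff_mat k (f s))"
  by (rule sqm_eqI, simp add: zcoeff_sum)+

lemma zcoeff_mat_deriv: "zcoeff_mat k (sderiv (Some v) X) = sderiv v (zcoeff_mat (k - 1) X)"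
  by (rule sqm_eqI) (simp add: zcoeff_deriv)

lemma zcoeff_mat_iotam_mult: "zcoeff_mat k (iotam c * X) = c * zcoeff_mat k X" "zcoeff_mat k (X * iotam c) = zcoeff_mat k X * c"
  by (rule sqm_eqI, simp add: entry_times zcoeff_sum iotam_def zcoeff_mult_single_left[OF single_iota]
      zcoeff_mult_single_right[OF single_iota])+

lemma zcoeff_mat_iotam: "zcoeff_mat k (iotam c) = (if k = 0 then c else 0)"
  by (rule sqm_eqI) (simp add: iotam_def single_iota[unfolded single_def, rule_format])

lemma zcoeff_mat_scal_iota: "zcoeff_mat k (scal (iota c) X) = scal c (zcoeff_mat k X)"
  by (rule sqm_eqI) (simp add: zcoeff_mult_single_left[OF single_iota])

lemma iotam_hom: "iotam (c * d) = iotam c * iotam d" "iotam (scal t c) = scal (iota t) (iotam c)"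
  "iotam (sum f S) = (\<Sum>s\<in>S. iotam (f s))"
  by (rule zcoeff_mat_eqI, simp add: zcoeff_mat_iotam_mult zcoeff_mat_iotam zcoeff_mat_scal_iota zcoeff_mat_simps scal_simps)+

lemma zcoeff_mat_plus_loop: "zcoeff_mat k (plus_loop P) = (if 0 \<le> k then fps_nth P (nat k) else 0)"
  by (rule sqm_eqI) (simp add: zcoeff_plus_loop)

lemma plus_loop_linear: "plus_loop (P - Q) = plus_loop P - plus_loop Q" "plus_loop (fps_const c) = iotam c" "plus_loop 0 = 0"
  by (rule zcoeff_mat_eqI, auto simp: zcoeff_mat_plus_loop zcoeff_mat_simps zcoeff_mat_iotam)+

text \<open>
  Setting \<open>x = 0\<close> with \<open>z\<close> kept fixed, as for initial values of differential equations in \<open>x\<close>; this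
  is not the same as setting all variables to zero.
\<close>

definition agree_at_0 :: "('v option mfps, 'n :: finite) sqm \<Rightarrow> ('v option mfps, 'n) sqm \<Rightarrow> bool" where
  "agree_at_0 X Y \<longleftrightarrow> (\<forall>i j. agree {M. x_part M = {#}} (entry X i j) (entry Y i j))"

text \<open>
  Setting \<open>x = 0\<close> means evaluating every coefficient of the Laurent series at the origin.
\<close>

lemma agree_at_0_iff: "agree_at_0 X Y \<longleftrightarrow> (\<forall>k. at_origin (zcoeff_mat k X) = at_origin (zcoeff_mat k Y))"
proof
  assume m: "agree_at_0 X Y"
  show "\<forall>k. at_origin (zcoeff_mat k X) = at_origin (zcoeff_mat k Y)"
    using m by (simp add: vec_eq_iff coeff_zcoeff agree_at_0_def agree_def)
next
  assume e: "\<forall>k. at_origin (zcoeff_mat k X) = at_origin (zcoeff_mat k Y)"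
  show "agree_at_0 X Y"
    unfolding agree_at_0_def agree_def
  proof (intro allI ballI)
    fix i j M assume "M \<in> {M :: 'a option multiset. x_part M = {#}}"
    then have M: "x_part M = {#}" by simp
    have "at_origin (zcoeff_mat (zdeg M) X) $ i $ j = at_origin (zcoeff_mat (zdeg M) Y) $ i $ j" using e by simp
    then show "mfps_coeff (entry X i j) M = mfps_coeff (entry Y i j) M"
      by (simp add: coeff_eq_zcoeff[of _ M] M)
  qed
qed

lemma agree_sum: "(\<And>i. i \<in> I \<Longrightarrow> agree D (f i) (g i)) \<Longrightarrow> agree D (sum f I) (sum g I)"
  by (simp add: agree_def)

lemma agree_at_0_mult: "agree_at_0 X X' \<Longrightarrow> agree_at_0 Y Y' \<Longrightarrow> agree_at_0 (X * Y) (X' * Y')"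
proof -
  assume m: "agree_at_0 X X'" "agree_at_0 Y Y'"
  have "x_part k \<subseteq># x_part m" if "k \<subseteq># m" for k m :: "'a option multiset"
  proof -
    from that obtain l where "m = k + l" by (meson subset_mset.le_iff_add)
    then show ?thesis by simp
  qed
  then have D: "divisor_closed {M :: 'a option multiset. x_part M = {#}}"
    unfolding divisor_closed_def by fastforce
  show ?thesis
    unfolding agree_at_0_def entry_times
    by (intro allI agree_sum agree_times[OF D]) (use m in \<open>simp_all add: agree_at_0_def\<close>)
qed

lemma agree_at_0_diff: "agree_at_0 X X' \<Longrightarrow> agree_at_0 Y Y' \<Longrightarrow> agree_at_0 (X - Y) (X' - Y')"
  by (simp add: agree_at_0_def agree_def)

lemma agree_at_0_refl [simp]: "agree_at_0 X X" by (simp add: agree_at_0_def)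

lemma agree_at_0_one_mult: "agree_at_0 K 1 \<Longrightarrow> agree_at_0 E 1 \<Longrightarrow> agree_at_0 (K * R * E) R"
  using agree_at_0_mult[OF agree_at_0_mult[of K 1 R R], of E 1] by simp

lemma agree_at_0_plus_loop: "agree_at_0 (plus_loop P) (plus_loop (const_loop (\<lambda>n. at_origin (fps_nth P n))))"
  unfolding agree_at_0_iff by (simp add: zcoeff_mat_plus_loop vec_eq_iff)

lemma zero_by_order:
  assumes "\<And>d i j. ord_ge d (entry X i j)"
  shows "X = 0"
  by (rule sqm_eqI, rule mfps_eqI) (metis assms entry_simps(1) lessI mfps_coeff_basic(1) ord_geD)

lemma ord_ge_entry_mult:
  assumes "\<And>i j. ord_ge d (entry X i j)"
  shows "ord_ge d (entry (C * X) i j)" "ord_ge d (entry (X * C) i j)"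
proof -
  have "ord_ge (0 + d) (entry C i k * entry X k j)" "ord_ge (d + 0) (entry X i k * entry C k j)" for k
    by (rule ord_ge_times; simp add: assms)+
  then show "ord_ge d (entry (C * X) i j)" "ord_ge d (entry (X * C) i j)"
    by (simp_all add: entry_times vge_sum)
qed

text \<open>
  The equation expresses the derivatives of the coefficient of \<open>z^k\<close> through the coefficient of
  \<open>z^{k+1}\<close>, so the order of vanishing of all coefficients grows simultaneously.
\<close>

lemma linear_system_unique:
  assumes D: "\<And>\<gamma>. sderiv (Some \<gamma>) X = iotam (C \<gamma>) * X - X * iotam (T \<gamma>)" and z: "agree_at_0 X 0"
  shows "X = 0"
proof (rule zcoeff_mat_eqI)
  fix k
  have "\<forall>k i j. ord_ge d (entry (zcoeff_mat k X) i j)" for d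
  proof (induction d)
    case (Suc d)
    show ?case
    proof (intro allI)
      fix k i j
      show "ord_ge (Suc d) (entry (zcoeff_mat k X) i j)"
      proof (rule ord_ge_deriv)
        have "at_origin (zcoeff_mat k X) = 0" using z by (simp add: agree_at_0_iff zcoeff_mat_simps vec_eq_iff)
        then show "mfps_coeff (entry (zcoeff_mat k X) i j) {#} = 0" by (simp add: vec_eq_iff)
        fix \<gamma>
        have "sderiv \<gamma> (zcoeff_mat k X) = zcoeff_mat (k + 1) (sderiv (Some \<gamma>) X)" by (simp add: zcoeff_mat_deriv)
        also have "\<dots> = C \<gamma> * zcoeff_mat (k + 1) X - zcoeff_mat (k + 1) X * T \<gamma>"
          by (simp add: D zcoeff_mat_simps zcoeff_mat_iotam_mult)
        finally have e: "mfps_deriv \<gamma> (entry (zcoeff_mat k X) i j) = entry (C \<gamma> * zcoeff_mat (k + 1) X - zcoeff_mat (k + 1) X * T \<gamma>) i j"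
          by (metis entry_smap)
        have "ord_ge d (entry (zcoeff_mat (k + 1) X) i j)" for i j using Suc by blast
        from ord_ge_entry_mult[OF this]
        show "ord_ge d (mfps_deriv \<gamma> (entry (zcoeff_mat k X) i j))"
          unfolding e entry_simps by (intro vge_diff)
      qed
    qed
  qed simp
  then have "zcoeff_mat k X = 0" by (intro zero_by_order) blast
  then show "zcoeff_mat k X = zcoeff_mat k 0" by (simp add: zcoeff_mat_simps)
qed

definition nonneg :: "('v option mfps, 'n :: finite) sqm \<Rightarrow> bool" where
  "nonneg X \<longleftrightarrow> (\<forall>k<0. zcoeff_mat k X = 0)"

text \<open>
  If the coefficient matrix is divisible by \<open>z\<close>, the derivative of a negative coefficient of the
  solution involves no coefficient of a higher power of \<open>z\<close>; hence the order of vanishing of all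
  negative coefficients grows simultaneously.
\<close>

lemma nonneg_by_system:
  assumes D: "\<And>\<gamma>. sderiv (Some \<gamma>) G = (if left then V \<gamma> * G else G * V \<gamma>)"
    and V: "\<And>\<gamma> i. i \<le> 0 \<Longrightarrow> zcoeff_mat i (V \<gamma>) = 0"
    and z: "agree_at_0 G (plus_loop R)"
  shows "nonneg G"
proof -
  have Ve: "zcoeff l (entry (V \<gamma>) i j) = 0" if "l \<le> 0" for l \<gamma> i j
    using V[OF that, of \<gamma>] by (metis entry_simps(1) entry_smap)
  have "\<forall>k<0. \<forall>i j. ord_ge d (entry (zcoeff_mat k G) i j)" for d
  proof (induction d)
    case (Suc d)
    show ?case
    proof (intro allI impI)
      fix k :: int and i j assume k: "k < 0"
      show "ord_ge (Suc d) (entry (zcoeff_mat k G) i j)"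
      proof (rule ord_ge_deriv)
        have "at_origin (zcoeff_mat k G) = 0" using z k by (simp add: agree_at_0_iff zcoeff_mat_plus_loop vec_eq_iff)
        then show "mfps_coeff (entry (zcoeff_mat k G) i j) {#} = 0" by (simp add: vec_eq_iff)
        fix \<gamma>
        have "mfps_deriv \<gamma> (entry (zcoeff_mat k G) i j) = entry (zcoeff_mat (k + 1) (sderiv (Some \<gamma>) G)) i j"
          by (simp add: zcoeff_mat_deriv)
        also have "\<dots> = zcoeff (k + 1) (entry (if left then V \<gamma> * G else G * V \<gamma>) i j)" by (simp add: D)
        also have "ord_ge d \<dots>"
        proof -
          have G: "ord_ge d (zcoeff l (entry G a b))" if "l < 0" for l a b
            using Suc that by auto
          have "ord_ge d (zcoeff l (entry (V \<gamma>) a b) * zcoeff (k + 1 - l) (entry G b c))" for l a b c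
          proof (cases "l \<le> 0")
            case False
            then have "ord_ge (0 + d) (zcoeff l (entry (V \<gamma>) a b) * zcoeff (k + 1 - l) (entry G b c))"
              by (intro ord_ge_times G) (use k in simp_all)
            then show ?thesis by simp
          qed (simp add: Ve)
          moreover have "ord_ge d (zcoeff l (entry G a b) * zcoeff (k + 1 - l) (entry (V \<gamma>) b c))" for l a b c
          proof (cases "k + 1 - l \<le> 0")
            case False
            then have "ord_ge (d + 0) (zcoeff l (entry G a b) * zcoeff (k + 1 - l) (entry (V \<gamma>) b c))"
              by (intro ord_ge_times G) (use k in simp_all)
            then show ?thesis by simp
          qed (simp add: Ve)
          ultimately show ?thesis
            by (auto simp: entry_times zcoeff_sum zcoeff_mult intro!: vge_sum vge_Sum)
        qed
        finally show "ord_ge d (mfps_deriv \<gamma> (entry (zcoeff_mat k G) i j))" .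
      qed
    qed
  qed simp
  then show ?thesis
    unfolding nonneg_def by (intro allI impI zero_by_order) blast
qed

text \<open>
  The defining equations of a calibration, summed up.
\<close>

lemma sderiv_fund_sol:
  assumes cal: "calibration F J" and n: "normalised J"
  shows "sderiv (Some \<gamma>) (fund_sol J) = - (fund_sol J * iotam (struct_mat F \<gamma>))"
proof (rule zcoeff_mat_eqI)
  fix k
  have z: "zcoeff_mat k (fund_sol J) = (if k \<le> 0 then alt_sign (nat (- k)) * SQ (J (nat (- k))) else 0)" for k
    by (rule sqm_eqI) (simp add: zcoeff_fund_sol[OF cal n] alt_sign_def)
  show "zcoeff_mat k (sderiv (Some \<gamma>) (fund_sol J)) = zcoeff_mat k (- (fund_sol J * iotam (struct_mat F \<gamma>)))"
  proof (cases "k \<le> 0")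
    case True
    then have "nat (- (k - 1)) = Suc (nat (- k))" by simp
    then show ?thesis
      using True by (simp add: zcoeff_mat_deriv zcoeff_mat_simps zcoeff_mat_iotam_mult z alt_sign_def sderiv_simps calibration_deriv[OF cal])
  next
    case False
    then show ?thesis
      by (cases "k = 1") (simp_all add: zcoeff_mat_deriv zcoeff_mat_simps zcoeff_mat_iotam_mult z alt_sign_def sderiv_simps
          calibration_0[OF cal] SQ_simps)
  qed
qed

lemma sderiv_right_inverse:
  assumes "X * Y = (1 :: ('v mfps, 'n :: finite) sqm)" "Y * X = 1"
  shows "sderiv v Y = - (Y * sderiv v X * Y)"
proof -
  have "sderiv v (X * Y) = 0" by (simp add: assms sderiv_simps)
  then have "X * sderiv v Y = - (sderiv v X * Y)" by (simp add: sderiv_simps eq_neg_iff_add_eq_0 add.commute)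
  then have "Y * (X * sderiv v Y) = - (Y * sderiv v X * Y)" by (simp add: mult.assoc)
  then show ?thesis by (simp add: mult.assoc[symmetric] assms)
qed

lemma sderiv_fund_inv:
  assumes cal: "calibration F J" and n: "normalised J"
  shows "sderiv (Some \<gamma>) (fund_inv J) = iotam (struct_mat F \<gamma>) * fund_inv J"
  using sderiv_right_inverse[OF fund_inverse[OF assms], of "Some \<gamma>"]
  by (simp add: sderiv_fund_sol[OF assms] mult.assoc[symmetric] fund_inverse[OF assms])

lemma sderiv_plus_loop_horizontal:
  assumes "horiz F \<gamma> P = 0"
  shows "sderiv (Some \<gamma>) (plus_loop P) = iotam (struct_mat F \<gamma>) * plus_loop P - plus_loop P * iotam (struct_mat F \<gamma>)"
proof (rule zcoeff_mat_eqI)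
  fix k
  have h: "(if m = 0 then 0 else sderiv \<gamma> (fps_nth P (m - 1))) = struct_mat F \<gamma> * fps_nth P m - fps_nth P m * struct_mat F \<gamma>" for m
    using arg_cong[OF assms, of "\<lambda>x. fps_nth x m"] by (simp add: horiz_nth)
  show "zcoeff_mat k (sderiv (Some \<gamma>) (plus_loop P)) = zcoeff_mat k (iotam (struct_mat F \<gamma>) * plus_loop P - plus_loop P * iotam (struct_mat F \<gamma>))"
  proof (cases "0 \<le> k")
    case True
    have "zcoeff_mat k (sderiv (Some \<gamma>) (plus_loop P)) = (if nat k = 0 then 0 else sderiv \<gamma> (fps_nth P (nat k - 1)))"
      using True by (auto simp: zcoeff_mat_deriv zcoeff_mat_plus_loop sderiv_simps nat_diff_distrib)
    then show ?thesis using True by (simp only: h) (simp add: zcoeff_mat_simps zcoeff_mat_iotam_mult zcoeff_mat_plus_loop)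
  next
    case False
    then show ?thesis by (simp add: zcoeff_mat_deriv zcoeff_mat_simps zcoeff_mat_iotam_mult zcoeff_mat_plus_loop sderiv_simps)
  qed
qed

lemma sderiv_plus_loop_const: "sderiv (Some \<gamma>) (plus_loop (const_loop R)) = 0"
  by (rule zcoeff_mat_eqI) (simp add: zcoeff_mat_deriv zcoeff_mat_plus_loop zcoeff_mat_simps sderiv_simps)

text \<open>
  The chain rule, for constant structure matrices.
\<close>

lemma sderiv_fund_sol_at_const_alg:
  fixes \<phi> :: "'n :: finite \<Rightarrow> 'n mfps"
  assumes cal: "calibration F J" and n: "normalised J" and c: "const_alg F Cc"
    and z: "\<And>\<alpha>. mfps_coeff (\<phi> \<alpha>) {#} = 0"
  shows "sderiv (Some \<gamma>) (fund_sol_at J \<phi>) = - (fund_sol_at J \<phi> * iotam (\<Sum>\<mu>\<in>UNIV. scal (mfps_deriv \<gamma> (\<phi> \<mu>)) (const_mat (Cc \<mu>))))"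
proof (rule zcoeff_mat_eqI)
  fix k
  let ?T = "\<Sum>\<mu>\<in>UNIV. scal (mfps_deriv \<gamma> (\<phi> \<mu>)) (const_mat (Cc \<mu>))"
  note Z = zcoeff_fund_sol_at[OF cal n, of \<phi>, OF z]
  have chain: "sderiv \<gamma> (smap (mfps_subst \<phi>) X) = (\<Sum>\<mu>\<in>UNIV. scal (mfps_deriv \<gamma> (\<phi> \<mu>)) (smap (mfps_subst \<phi>) (sderiv \<mu> X)))"
    for X :: "('n mfps, 'n) sqm"
    by (rule sqm_eqI) (simp add: mfps_deriv_subst[of \<phi>, OF z] mult.commute)
  have d: "sderiv \<gamma> (smap (mfps_subst \<phi>) (SQ (J (Suc m)))) = smap (mfps_subst \<phi>) (SQ (J m)) * ?T" for m
  proof -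
    have "sderiv \<mu> (SQ (J (Suc m))) = SQ (J m) * const_mat (Cc \<mu>)" for \<mu>
      using calibration_deriv[OF cal, of \<mu> m] c by (simp add: const_alg_def)
    then show ?thesis
      by (simp add: chain smap_subst_hom[of \<phi>, OF z] sum_distrib_left scal_simps)
  qed
  show "zcoeff_mat k (sderiv (Some \<gamma>) (fund_sol_at J \<phi>)) = zcoeff_mat k (- (fund_sol_at J \<phi> * iotam ?T))"
  proof (cases "k \<le> 0")
    case True
    then have "nat (- (k - 1)) = Suc (nat (- k))" by simp
    then show ?thesis
      using True by (simp add: zcoeff_mat_deriv zcoeff_mat_simps zcoeff_mat_iotam_mult Z alt_sign_def sderiv_simps smap_subst_hom[of \<phi>, OF z] d)
  next
    case False
    then show ?thesis
      by (cases "k = 1") (simp_all add: zcoeff_mat_deriv zcoeff_mat_simps zcoeff_mat_iotam_mult Z alt_sign_def sderiv_simps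
          smap_subst_hom[of \<phi>, OF z] calibration_0[OF cal] SQ_simps)
  qed
qed

lemma agree_at_0_fund_sol_at:
  assumes cal: "calibration F J" and n: "normalised J" and z: "\<And>\<alpha>. mfps_coeff (y \<alpha>) {#} = 0"
  shows "agree_at_0 (fund_sol_at J y) 1" "agree_at_0 (fund_inv_at J y) 1"
proof -
  note a = assms(1,2)
  have one: "at_origin (zcoeff_mat k (1 :: ('v option mfps, 'n :: finite) sqm)) = (if k = 0 then mat 1 else 0)" for k
    by (auto simp: vec_eq_iff zcoeff_1 mat_def if_distrib[of "zcoeff k"])
  have J: "mfps_coeff (J d $ i $ j) {#} = (if d = 0 \<and> i = j then 1 else 0)" for d i j
    using n calibration_0[OF cal] by (cases "d = 0") (auto simp: normalised_def mat_def)
  have L: "mfps_coeff (lower_Omega J d $ i $ j) {#} = (if d = 0 \<and> i = j then 1 else 0)" for d i j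
  proof (cases "d = 0")
    case False
    then show ?thesis using ord_geD[OF ord_ge_lower_Omega[OF cal n, of d i j], of "{#}"] by simp
  qed (auto simp: lower_Omega_0[OF cal] mat_def)
  show "agree_at_0 (fund_sol_at J y) 1" "agree_at_0 (fund_inv_at J y) 1"
    unfolding agree_at_0_iff one
    by (auto simp: zcoeff_fund_sol_at[OF a, of y, OF z] zcoeff_fund_inv_at[OF a, of y, OF z] vec_eq_iff
        coeff_subst_empty[of y, OF z] J L alt_sign_def mat_def)
qed

lemma agree_at_0_fund_sol:
  assumes cal: "calibration F J" and n: "normalised J"
  shows "agree_at_0 (fund_sol J) 1" "agree_at_0 (fund_inv J) 1"
proof -
  have z: "mfps_coeff (mfps_var \<alpha>) {#} = 0" for \<alpha> :: 'a by simp
  have id: "mfps_subst mfps_var f = f" for f :: "'a mfps"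
  proof -
    have "gpow mfps_var m = Abs_mfps (\<lambda>k. if k = m then 1 else 0)" for m :: "'a multiset"
    proof (rule mfps_eqI)
      fix k
      have "mfps_coeff (gpow mfps_var m) k = (if k = m then 1 else 0)"
      proof (induction m arbitrary: k)
        case (add v m)
        have "mfps_coeff (mfps_var v * gpow mfps_var m) k = (\<Sum>p\<in>msplits k. if p = ({#v#}, m) then 1 else 0)"
          unfolding mfps_coeff_times by (rule sum.cong) (auto simp: add)
        also have "\<dots> = (if ({#v#}, m) \<in> msplits k then 1 else 0)" by (rule sum.delta) simp
        finally show ?case by (auto simp: msplits_def)
      qed simp
      then show "mfps_coeff (gpow mfps_var m) k = mfps_coeff (Abs_mfps (\<lambda>k. if k = m then 1 else 0)) k" by simp
    qed
    note g = this
    show ?thesis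
    proof (rule mfps_eqI)
      fix k
      have "mfps_coeff (mfps_subst mfps_var f) k = (\<Sum>n\<in>{k}. mfps_coeff (mfps_const (mfps_coeff f n) * gpow mfps_var n) k)"
        unfolding mfps_subst_eq by (rule mfps_coeff_Sum_superset) (auto simp: g split: if_splits)
      then show "mfps_coeff (mfps_subst mfps_var f) k = mfps_coeff f k" by (simp add: g)
    qed
  qed
  have "ysub mfps_var G = G" for G :: "'a option mfps"
    by (rule zcoeff_eqI) (simp add: zcoeff_ysub[of mfps_var, OF z] id)
  then have "smap (ysub mfps_var) X = X" for X :: "('a option mfps, 'a) sqm" by (intro sqm_eqI) simp
  then show "agree_at_0 (fund_sol J) 1" "agree_at_0 (fund_inv J) 1"
    using agree_at_0_fund_sol_at[OF assms, of mfps_var, OF z] by (simp_all add: fund_sol_at_def[OF assms] fund_inv_at_def[OF assms])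
qed

section \<open>Reconstruction of a semisimple cone\<close>

text \<open>
  The inverse function theorem for a map tangent to the identity.
\<close>

lemma solve_near_identity:
  fixes \<phi> :: "'n :: finite \<Rightarrow> 'n mfps" and w :: "'n \<Rightarrow> 'v mfps"
  assumes z: "\<And>\<alpha>. mfps_coeff (\<phi> \<alpha>) {#} = 0"
    and lin: "\<And>\<alpha> \<delta>. mfps_coeff (\<phi> \<alpha>) {#\<delta>#} = (if \<alpha> = \<delta> then 1 else 0)"
    and w: "\<And>\<alpha>. mfps_coeff (w \<alpha>) {#} = 0"
  obtains y where "\<And>\<alpha>. mfps_coeff (y \<alpha>) {#} = 0" "(\<lambda>\<alpha>. mfps_subst y (\<phi> \<alpha>)) = w"
proof -
  let ?\<Phi> = "\<lambda>y \<alpha>. w \<alpha> + y \<alpha> - mfps_subst y (\<phi> \<alpha>)"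
  obtain y where y: "\<And>\<alpha>. mfps_coeff (y \<alpha>) {#} = 0" "?\<Phi> y = y"
  proof (rule formal_fixpoint[of ?\<Phi>])
    fix y :: "'n \<Rightarrow> 'v mfps" and a assume zy: "\<And>a. mfps_coeff (y a) {#} = 0"
    then show "mfps_coeff (w a + y a - mfps_subst y (\<phi> a)) {#} = 0"
      using coeff_subst_empty[of y "\<phi> a"] by (simp add: w z)
  next
    fix y y' :: "'n \<Rightarrow> 'v mfps" and d a
    assume zy: "\<And>a. mfps_coeff (y a) {#} = 0" "\<And>a. mfps_coeff (y' a) {#} = 0"
      and ag: "\<And>a. agree {m. size m < d} (y a) (y' a)"
    have "mfps_coeff (mfps_subst y (\<phi> a)) m - mfps_coeff (mfps_subst y' (\<phi> a)) m = mfps_coeff (y a) m - mfps_coeff (y' a) m"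
      if "size m \<le> d" for m
      using coeff_subst_diff[of y y' d m "\<phi> a", OF zy ag that]
      by (simp add: lin if_distrib[of "\<lambda>x. x * _"] cong: if_cong)
    then show "agree {m. size m < Suc d} (w a + y a - mfps_subst y (\<phi> a)) (w a + y' a - mfps_subst y' (\<phi> a))"
      by (auto simp: agree_def less_Suc_eq_le algebra_simps)
  qed blast
  have "mfps_subst y (\<phi> \<alpha>) = w \<alpha>" for \<alpha> using fun_cong[OF y(2), of \<alpha>] by (simp add: algebra_simps)
  then show ?thesis using that[of y] y(1) by blast
qed

context
  fixes y :: "'n :: finite \<Rightarrow> 'v mfps"
  assumes z: "\<And>\<alpha>. mfps_coeff (y \<alpha>) {#} = 0"
begin

lemma zcoeff_mat_ysub: "zcoeff_mat k (smap (ysub y) (X :: ('n option mfps, 'm :: finite) sqm)) = smap (mfps_subst y) (zcoeff_mat k X)"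
  by (rule sqm_eqI) (simp add: zcoeff_ysub[of y, OF z])

lemma ysub_plus_loop_const: "smap (ysub y) (plus_loop (const_loop R)) = plus_loop (const_loop R)"
  by (rule zcoeff_mat_eqI) (simp add: zcoeff_mat_ysub zcoeff_mat_plus_loop smap_subst_hom[of y, OF z])

lemma ysub_nonneg: "nonneg X \<Longrightarrow> nonneg (smap (ysub y) X)"
  by (simp add: nonneg_def zcoeff_mat_ysub smap_subst_hom[of y, OF z])

lemma ysub_fund_sol_at:
  fixes \<phi> :: "'n \<Rightarrow> 'n mfps"
  assumes cal: "calibration F J" and n: "normalised J" and zf: "\<And>\<alpha>. mfps_coeff (\<phi> \<alpha>) {#} = 0"
  shows "smap (ysub y) (fund_sol_at J \<phi>) = fund_sol_at J (\<lambda>\<alpha>. mfps_subst y (\<phi> \<alpha>))"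
proof (rule zcoeff_mat_eqI)
  fix k
  have zs: "mfps_coeff (mfps_subst y (\<phi> \<alpha>)) {#} = 0" for \<alpha>
    using coeff_subst_empty[of y "\<phi> \<alpha>", OF z] by (simp add: zf)
  have c: "mfps_subst y (mfps_subst \<phi> f) = mfps_subst (\<lambda>\<alpha>. mfps_subst y (\<phi> \<alpha>)) f" for f
    by (rule subst_subst(2)[OF subst_adm_finite[of \<phi>, OF zf] subst_adm_finite[of y, OF z]])
      (simp_all add: submonoid_def supp_in_def)
  have "smap (mfps_subst y) (smap (mfps_subst \<phi>) X) = smap (mfps_subst (\<lambda>\<alpha>. mfps_subst y (\<phi> \<alpha>))) X"
    for X :: "('n mfps, 'n) sqm"
    by (rule sqm_eqI) (simp add: c)
  then show "zcoeff_mat k (smap (ysub y) (fund_sol_at J \<phi>)) = zcoeff_mat k (fund_sol_at J (\<lambda>\<alpha>. mfps_subst y (\<phi> \<alpha>)))"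
    unfolding zcoeff_mat_ysub zcoeff_fund_sol_at[OF cal n, of \<phi>, OF zf] zcoeff_fund_sol_at[OF cal n, of "\<lambda>\<alpha>. mfps_subst y (\<phi> \<alpha>)", OF zs]
    by (simp add: smap_subst_hom[of y, OF z])
qed

end

lemma commutator_identity:
  fixes C P G T D :: "'a :: ring_1"
  assumes "T * D = D * T"
  shows "(C * P - P * C) * G + P * (C * G - G * T) - (C * G - G * T) * D = C * (P * G - G * D) - (P * G - G * D) * T"
  by (simp add: left_diff_distrib right_diff_distrib mult.assoc assms)

lemma sderiv_iotam_const: "sderiv (Some v) (iotam (const_mat M)) = 0"
  by (rule zcoeff_mat_eqI) (simp add: zcoeff_mat_deriv zcoeff_mat_iotam zcoeff_mat_simps sderiv_simps)

text \<open>
  The data of the factorisation: \<open>P k\<close> are horizontal idempotents diagonalising the structure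
  matrices, \<open>\<theta> k\<close> the eigenvalues, \<open>D k\<close> the idempotents at the origin; \<open>\<phi>\<close> pulls the multiplication of
  the constant algebra back to the matrix with the same eigenvalues.
\<close>

context
  fixes F :: "'n :: finite \<Rightarrow> 'n mfps" and A :: "complex^'n" and J J1 :: "nat \<Rightarrow> 'n mfps^'n^'n"
    and P :: "'n \<Rightarrow> ('n mfps, 'n) sqm fps" and \<theta> :: "'n \<Rightarrow> 'n \<Rightarrow> 'n mfps" and D :: "'n \<Rightarrow> complex^'n^'n"
    and R :: "nat \<Rightarrow> complex^'n^'n" and F1 :: "'n \<Rightarrow> 'n mfps" and Cc :: "'n \<Rightarrow> complex^'n^'n" and \<phi> :: "'n \<Rightarrow> 'n mfps"
  assumes cal: "calibration F J" and n: "normalised J"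
    and horiz: "\<And>k \<gamma>. horiz F \<gamma> (P k) = 0"
    and PP: "\<And>k l. P k * P l = (if k = l then P k else 0)"
    and diag: "\<And>\<gamma>. struct_mat F \<gamma> = (\<Sum>k\<in>UNIV. scal (\<theta> k \<gamma>) (fps_nth (P k) 0))"
    and DD: "\<And>k l. D k ** D l = (if k = l then D k else 0)"
    and sumD: "(\<Sum>k\<in>UNIV. D k) = mat 1"
    and P0: "\<And>k. at_origin (fps_nth (P k) 0) = D k"
    and R: "R = (\<lambda>n. \<Sum>k\<in>UNIV. at_origin (fps_nth (P k) n) ** D k)"
    and cal1: "calibration F1 J1" and n1: "normalised J1" and alg1: "const_alg F1 Cc"
    and zf: "\<And>\<alpha>. mfps_coeff (\<phi> \<alpha>) {#} = 0"
    and T: "\<And>\<gamma>. (\<Sum>\<mu>\<in>UNIV. scal (mfps_deriv \<gamma> (\<phi> \<mu>)) (const_mat (Cc \<mu>))) = (\<Sum>k\<in>UNIV. scal (\<theta> k \<gamma>) (const_mat (D k)))"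
begin

lemma R_0: "R 0 = mat 1"
  by (simp add: R P0 DD sumD)

text \<open>
  The values at the origin of the horizontal idempotents are orthogonal idempotents with leading
  terms \<open>D k\<close>; the sum of the products \<open>P_k(0) D k\<close> conjugates one system into the other.
\<close>

lemma conjugating_R: "const_loop (\<lambda>n. at_origin (fps_nth (P k) n)) * const_loop R = (const_loop R * fps_const (const_mat (D k)) :: ('v mfps, 'n) sqm fps)"
proof -
  let ?Q = "\<lambda>k. const_loop (\<lambda>n. at_origin (fps_nth (P k) n)) :: ('v mfps, 'n) sqm fps"
  have QQ: "?Q k * ?Q l = (if k = l then ?Q k else 0)" for k l
  proof (rule fps_ext)
    fix n
    have "fps_nth (?Q k * ?Q l) n = const_mat (at_origin (fps_nth (P k * P l) n))"
      by (rule sqm_eqI) (simp add: fps_mult_nth entry_times mfps_const_sum mfps_const_simps)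
    moreover have "const_mat (at_origin (fps_nth (0 :: ('n mfps, 'n) sqm fps) n)) = (0 :: ('v mfps, 'n) sqm)"
      by (rule sqm_eqI) (simp add: mfps_const_simps)
    ultimately show "fps_nth (?Q k * ?Q l) n = fps_nth (if k = l then ?Q k else 0) n"
      unfolding PP by (cases "k = l") simp_all
  qed
  have RQ: "const_loop R = (\<Sum>l\<in>UNIV. ?Q l * fps_const (const_mat (D l)))"
    by (rule fps_ext) (simp add: R const_mat_sum const_mat_simps fps_sum_nth)
  have dd: "fps_const (const_mat (D l)) * fps_const (const_mat (D k)) = (if l = k then fps_const (const_mat (D k)) else 0)" for l
    by (simp add: const_mat_simps(5)[symmetric] DD const_mat_simps(2))
  have "?Q k * const_loop R = (\<Sum>l\<in>UNIV. if k = l then ?Q k * fps_const (const_mat (D k)) else 0)"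
    unfolding RQ sum_distrib_left mult.assoc[symmetric] QQ by (rule sum.cong) auto
  moreover have "const_loop R * fps_const (const_mat (D k)) = (\<Sum>l\<in>UNIV. if k = l then ?Q k * fps_const (const_mat (D k)) else 0)"
    unfolding RQ sum_distrib_right mult.assoc dd by (rule sum.cong) auto
  ultimately show ?thesis by simp
qed

text \<open>
  The equation for the product \<open>G = S_2^{-1} R S_1(\<phi>)\<close> has the form \<open>z \<partial>G = C G - G T\<close> with
  \<open>T = \<Sum>k. \<theta>_k D_k\<close>.  Once \<open>P_k G = G D_k\<close> is known, \<open>T\<close> can be moved to the left, where it cancels
  \<open>C\<close> at \<open>z = 0\<close>.
\<close>

lemma factorisation:
  obtains G H where "nonneg G" "nonneg H" "fund_sol J * G = plus_loop (const_loop R) * fund_sol_at J1 \<phi>"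
    "fund_sol_at J1 \<phi> * H = plus_loop (const_loop (series_inv R)) * fund_sol J"
proof -
  let ?E = "fund_sol_at J1 \<phi>" and ?E' = "fund_inv_at J1 \<phi>" and ?R = "plus_loop (const_loop R) :: ('n option mfps, 'n) sqm"
    and ?R' = "plus_loop (const_loop (series_inv R)) :: ('n option mfps, 'n) sqm"
  let ?T = "\<lambda>\<gamma>. \<Sum>k\<in>UNIV. scal (\<theta> k \<gamma>) (const_mat (D k) :: ('n mfps, 'n) sqm)"
  let ?C = "\<lambda>\<gamma>. iotam (struct_mat F \<gamma>)"
  note E = fund_at_inverse[OF cal1 n1, of \<phi>, OF zf]
  note S = fund_inverse[OF cal n]
  have RR: "?R * ?R' = 1" "?R' * ?R = 1"
    by (simp_all only: plus_loop_mult[symmetric] const_loop_inverse[of R, OF R_0] plus_loop_minus_loop_1)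
  define G H where "G = fund_inv J * ?R * ?E" and "H = ?E' * ?R' * fund_sol J"
  have GH: "G * H = 1"
  proof -
    have "G * H = fund_inv J * (?R * ((?E * ?E') * ?R')) * fund_sol J" by (simp add: G_def H_def mult.assoc)
    then show ?thesis by (simp add: E S RR)
  qed
  have HG: "H * G = 1"
  proof -
    have "H * G = ?E' * (?R' * ((fund_sol J * fund_inv J) * ?R)) * ?E" by (simp add: G_def H_def mult.assoc)
    then show ?thesis by (simp add: E S RR)
  qed
  have mG: "agree_at_0 G ?R" unfolding G_def
    by (rule agree_at_0_one_mult[OF agree_at_0_fund_sol(2)[OF cal n] agree_at_0_fund_sol_at(1)[OF cal1 n1, of \<phi>, OF zf]])
  have mH: "agree_at_0 H ?R'" unfolding H_def
    by (rule agree_at_0_one_mult[OF agree_at_0_fund_sol_at(2)[OF cal1 n1, of \<phi>, OF zf] agree_at_0_fund_sol(1)[OF cal n]])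
  have dG: "sderiv (Some \<gamma>) G = ?C \<gamma> * G - G * iotam (?T \<gamma>)" for \<gamma>
    by (simp add: G_def sderiv_simps sderiv_fund_inv[OF cal n] sderiv_plus_loop_const
        sderiv_fund_sol_at_const_alg[OF cal1 n1 alg1, of \<phi>, OF zf] T mult.assoc)
  have eig: "plus_loop (P k) * G = G * iotam (const_mat (D k))" for k
  proof -
    have TD: "?T \<gamma> * const_mat (D k) = const_mat (D k) * ?T \<gamma>" for \<gamma>
    proof -
      have "const_mat (D l) * const_mat (D k) = (const_mat (D k) * const_mat (D l) :: ('n mfps, 'n) sqm)" for l
        by (simp add: const_mat_simps(5)[symmetric] DD)
      then show ?thesis by (simp add: sum_distrib_left sum_distrib_right scal_simps)
    qed
    let ?X = "plus_loop (P k) * G - G * iotam (const_mat (D k))"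
    have "?X = 0"
    proof (rule linear_system_unique)
      fix \<gamma>
      have c: "iotam (?T \<gamma>) * iotam (const_mat (D k)) = iotam (const_mat (D k)) * iotam (?T \<gamma>)"
        by (simp only: iotam_hom(1)[symmetric] TD)
      have "sderiv (Some \<gamma>) ?X = (?C \<gamma> * plus_loop (P k) - plus_loop (P k) * ?C \<gamma>) * G +
          plus_loop (P k) * (?C \<gamma> * G - G * iotam (?T \<gamma>)) - (?C \<gamma> * G - G * iotam (?T \<gamma>)) * iotam (const_mat (D k))"
        by (simp only: sderiv_simps sderiv_plus_loop_horizontal[OF horiz] dG sderiv_iotam_const mult_zero_right add_0_right)
      also have "\<dots> = ?C \<gamma> * ?X - ?X * iotam (?T \<gamma>)"
        by (rule commutator_identity[OF c])
      finally show "sderiv (Some \<gamma>) ?X = ?C \<gamma> * ?X - ?X * iotam (?T \<gamma>)" .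
    next
      have "agree_at_0 ?X (plus_loop (const_loop (\<lambda>n. at_origin (fps_nth (P k) n))) * ?R - ?R * iotam (const_mat (D k)))"
        by (intro agree_at_0_diff agree_at_0_mult agree_at_0_plus_loop mG agree_at_0_refl)
      also have "plus_loop (const_loop (\<lambda>n. at_origin (fps_nth (P k) n))) * ?R - ?R * iotam (const_mat (D k)) = 0"
        by (simp add: plus_loop_mult[symmetric] plus_loop_linear(2)[symmetric] conjugating_R)
      finally show "agree_at_0 ?X 0" .
    qed
    then show ?thesis by simp
  qed
  \<comment> \<open>\<open>V\<close> is the coefficient of the system in the form \<open>z \<partial>G = V G\<close>; it vanishes at \<open>z = 0\<close>.\<close>
  define V where "V \<gamma> = ?C \<gamma> - (\<Sum>k\<in>UNIV. scal (iota (\<theta> k \<gamma>)) (plus_loop (P k)))" for \<gamma>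
  have Vz: "zcoeff_mat i (V \<gamma>) = 0" if "i \<le> 0" for i \<gamma>
    using that by (auto simp: V_def zcoeff_mat_simps zcoeff_mat_iotam zcoeff_mat_scal_iota zcoeff_mat_plus_loop diag scal_simps)
  have dGV: "sderiv (Some \<gamma>) G = V \<gamma> * G" for \<gamma>
  proof -
    have "G * iotam (?T \<gamma>) = (\<Sum>k\<in>UNIV. scal (iota (\<theta> k \<gamma>)) (plus_loop (P k))) * G"
      by (simp add: iotam_hom sum_distrib_left sum_distrib_right scal_simps eig)
    then show ?thesis by (simp add: dG V_def algebra_simps)
  qed
  have "nonneg G"
    by (rule nonneg_by_system[where left = True and V = V, OF _ Vz mG]) (simp_all add: dGV)
  moreover have "nonneg H"
  proof (rule nonneg_by_system[where left = False and V = "\<lambda>\<gamma>. - V \<gamma>", OF _ _ mH])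
    show "sderiv (Some \<gamma>) H = (if False then - V \<gamma> * H else H * - V \<gamma>)" for \<gamma>
      using sderiv_right_inverse[OF GH HG, of "Some \<gamma>"] by (simp add: dGV mult.assoc GH)
    show "zcoeff_mat i (- V \<gamma>) = 0" if "i \<le> 0" for i \<gamma> using Vz[OF that, of \<gamma>] by (simp add: zcoeff_mat_simps)
  qed
  moreover have "fund_sol J * G = ?R * ?E"
    by (simp add: G_def mult.assoc[symmetric] S)
  moreover have "?E * H = ?R' * fund_sol J"
    by (simp add: H_def mult.assoc[symmetric] E)
  ultimately show ?thesis using that by blast
qed

end

section \<open>Normalised calibrations\<close>

text \<open>
  Left multiplication by a constant loop preserves the equations of a calibration, so the value at
  the origin can be divided out.
\<close>

lemma normalise_calibration:
  fixes F :: "'n :: finite \<Rightarrow> 'n mfps"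
  assumes cal: "calibration F J"
  obtains L J2 where "L 0 = mat 1" "calibration F J2" "normalised J2" "sq_fps J = const_loop L * sq_fps J2"
    "sq_fps J2 = const_loop (series_inv L) * sq_fps J"
proof -
  define L where "L d = at_origin (SQ (J d))" for d
  define J2 where "J2 d = unsq (fps_nth (const_loop (series_inv L) * sq_fps J) d)" for d
  have L0: "L 0 = mat 1" by (simp add: L_def calibration_0[OF cal] vec_eq_iff mat_def)
  have J2: "sq_fps J2 = const_loop (series_inv L) * sq_fps J"
    by (rule fps_ext) (simp add: J2_def)
  have SJ2: "SQ (J2 d) = fps_nth (const_loop (series_inv L) * sq_fps J) d" for d by (simp add: J2_def)
  have "calibration F J2"
  proof (rule calibrationI)
    have "SQ (J2 0) = SQ (mat 1)" unfolding SJ2 by (simp add: calibration_0[OF cal] SQ_simps const_mat_simps)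
    then show "J2 0 = mat 1" by (simp only: SQ_inject[OF UNIV_I UNIV_I])
    fix d \<gamma>
    have "fderiv \<gamma> (const_loop (series_inv L) * sq_fps J) = const_loop (series_inv L) * (fps_X * (sq_fps J * fps_const (struct_mat F \<gamma>)))"
    proof -
      have "fderiv \<gamma> (const_loop (series_inv L) :: ('n mfps, 'n) sqm fps) = 0" by (rule fps_ext) simp
      then show ?thesis by (simp add: fderiv_simps fderiv_calibration[OF cal])
    qed
    also have "\<dots> = fps_X * (const_loop (series_inv L) * sq_fps J * fps_const (struct_mat F \<gamma>))"
    proof -
      have "B * (fps_X * Y) = fps_X * (B * Y)" for B Y :: "('n mfps, 'n) sqm fps"
        by (metis fps_mult_fps_X_commute mult.assoc)
      then show ?thesis by (simp only: mult.assoc)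
    qed
    finally have e: "fderiv \<gamma> (const_loop (series_inv L) * sq_fps J) = fps_X * (const_loop (series_inv L) * sq_fps J * fps_const (struct_mat F \<gamma>))" .
    show "sderiv \<gamma> (SQ (J2 (Suc d))) = SQ (J2 d) * struct_mat F \<gamma>"
      using arg_cong[OF e, of "\<lambda>P. fps_nth P (Suc d)"] unfolding SJ2 by simp
  qed
  moreover have "normalised J2"
    unfolding normalised_def
  proof (intro allI impI)
    fix d \<alpha> \<beta> assume d: "(1::nat) \<le> d"
    have "at_origin (SQ (J2 d)) = (\<Sum>i\<le>d. series_inv L i ** L (d - i))"
      unfolding SJ2 by (simp add: vec_eq_iff fps_mult_nth entry_times L_def matrix_matrix_mult_def atLeast0AtMost)
    also have "\<dots> = 0" using series_inv_left[of L d, OF L0] d by simp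
    finally show "mfps_coeff (J2 d $ \<alpha> $ \<beta>) {#} = 0" by (simp add: vec_eq_iff)
  qed
  moreover have "sq_fps J = const_loop L * sq_fps J2"
    unfolding J2 mult.assoc[symmetric] by (simp add: const_loop_inverse[of L, OF L0])
  ultimately show ?thesis using that[of L J2] L0 J2 by blast
qed

section \<open>The constant algebra at the origin\<close>

definition origin_C :: "('n :: finite \<Rightarrow> 'n mfps) \<Rightarrow> 'n \<Rightarrow> complex^'n^'n" where
  "origin_C F \<gamma> = at_origin (struct_mat F \<gamma>)"

lemma origin_const_alg: "const_alg (quad_F (origin_C F)) (origin_C F)"
  by (rule quad_const_alg) (simp add: origin_C_def structure_const_sym)

lemma structure_const_quad:
  "structure_const (quad_F (origin_C F)) \<alpha> \<beta> \<gamma> = mfps_const (mfps_coeff (structure_const F \<alpha> \<beta> \<gamma>) {#})"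
proof -
  have "entry (struct_mat (quad_F (origin_C F)) \<beta>) \<alpha> \<gamma> = entry (const_mat (origin_C F \<beta>)) \<alpha> \<gamma>"
    using origin_const_alg[of F] by (simp add: const_alg_def)
  then show ?thesis by (simp add: origin_C_def)
qed

text \<open>
  The axioms are polynomial identities between structure constants, so they hold at the origin.
\<close>

lemma origin_flat:
  assumes "flat_F_manifold F A"
  shows "flat_F_manifold (quad_F (origin_C F)) A"
proof -
  let ?c = "\<lambda>f :: 'a mfps. mfps_const (mfps_coeff f {#}) :: 'a mfps"
  have a: "(\<Sum>\<mu>\<in>UNIV. mfps_const (A $ \<mu>) * ?c (structure_const F \<alpha> \<mu> \<beta>)) = (if \<alpha> = \<beta> then 1 else 0)" for \<alpha> \<beta>
  proof -
    have "(\<Sum>\<mu>\<in>UNIV. mfps_const (A $ \<mu>) * ?c (structure_const F \<alpha> \<mu> \<beta>)) =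
        ?c (\<Sum>\<mu>\<in>UNIV. mfps_const (A $ \<mu>) * structure_const F \<alpha> \<mu> \<beta>)"
      by (simp add: mfps_const_sum mfps_const_simps)
    then show ?thesis by (simp only: flat_unit[OF assms]) (simp add: mfps_const_simps)
  qed
  have b: "(\<Sum>\<mu>\<in>UNIV. ?c (structure_const F \<alpha> \<beta> \<mu>) * ?c (structure_const F \<mu> \<gamma> \<delta>)) =
      ?c (\<Sum>\<mu>\<in>UNIV. structure_const F \<alpha> \<beta> \<mu> * structure_const F \<mu> \<gamma> \<delta>)" for \<alpha> \<beta> \<gamma> \<delta>
    by (simp add: mfps_const_sum mfps_const_simps)
  have "(\<Sum>\<mu>\<in>UNIV. structure_const F \<alpha> \<beta> \<mu> * structure_const F \<mu> \<gamma> \<delta>) =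
      (\<Sum>\<mu>\<in>UNIV. structure_const F \<alpha> \<gamma> \<mu> * structure_const F \<mu> \<beta> \<delta>)" for \<alpha> \<beta> \<gamma> \<delta>
    using assms by (simp add: flat_F_manifold_def)
  then show ?thesis
    unfolding flat_F_manifold_def structure_const_quad a b by simp
qed

context
  fixes F :: "'n :: finite \<Rightarrow> 'n mfps" and A :: "complex^'n" and p :: "'n \<Rightarrow> complex^'n"
  assumes flat: "flat_F_manifold F A"
    and span: "vec.span (range p) = UNIV"
    and pp: "\<And>k l. origin_mult F (p k) (p l) = (if k = l then p k else 0)"
begin

lemma idem_mult_mult: "idem_mult F p k ** idem_mult F p l = (if k = l then idem_mult F p k else 0)"
proof (rule idem_basis_cancel[OF flat span pp])
  note D = idem_mult_idem_basis[OF flat span pp]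
  have t: "triv_C k ** triv_C l = (if k = l then triv_C k else 0 :: complex^'n^'n)"
    by (auto simp: vec_eq_iff matrix_matrix_mult_def triv_C_def if_distrib[of "\<lambda>x. x * _"] cong: if_cong intro!: sum.neutral)
  have "idem_mult F p k ** idem_mult F p l ** idem_basis p = idem_basis p ** (triv_C k ** triv_C l)"
    by (simp add: matrix_mul_assoc[symmetric] D) (simp add: matrix_mul_assoc D)
  also have "\<dots> = (if k = l then idem_mult F p k else 0) ** idem_basis p"
    by (simp add: t D)
  finally show "idem_mult F p k ** idem_mult F p l ** idem_basis p = (if k = l then idem_mult F p k else 0) ** idem_basis p" .
qed

lemma const_mat_idem_mult: "const_mat (idem_mult F p k) = (\<Sum>\<gamma>\<in>UNIV. scal (mfps_const (p k $ \<gamma>)) (const_mat (origin_C F \<gamma>)))"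
  by (rule sqm_eqI) (simp add: idem_mult_def[OF flat span pp] origin_C_def mfps_const_sum mfps_const_simps)

text \<open>
  The matrix with the idempotents as columns is an isomorphism from the trivial algebra.
\<close>

lemma GL_acts_trivial:
  assumes cd: "cone_data (quad_F (origin_C F)) A (exp_cal (origin_C F)) w C"
  shows "GL_acts (idem_basis p) triv_cone C"
proof -
  obtain w0 where cd0: "cone_data triv_F (\<chi> \<alpha>. 1) (exp_cal triv_C) w0 (triv_cone :: 'n germ)"
    using triv_cone_data by blast
  let ?N = "matrix_inv (idem_basis p)"
  have N: "idem_basis p ** ?N = mat 1" "?N ** idem_basis p = mat 1"
    using someI_ex[OF invertible_idem_basis[OF flat span pp, unfolded invertible_def]]
    unfolding matrix_inv_def by blast+
  have z: "mfps_coeff (w v) {#} = 0" "mfps_coeff (w0 v) {#} = 0" for v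
    using cd cd0 by (simp_all add: cone_data_def euler_solution_def)
  have M: "(\<Sum>\<gamma>\<in>UNIV. scal (mfps_const (idem_basis p $ \<gamma> $ \<beta>)) (const_mat (origin_C F \<gamma>))) = (const_mat (idem_mult F p \<beta>) :: ('v mfps, 'n) sqm)" for \<beta>
    by (simp add: const_mat_idem_mult idem_basis_def[OF flat span pp])
  have DM: "const_mat (idem_mult F p \<beta>) * const_mat (idem_basis p) = (const_mat (idem_basis p) * const_mat (triv_C \<beta>) :: ('v mfps, 'n) sqm)" for \<beta>
    by (simp only: const_mat_simps(5)[symmetric] idem_mult_idem_basis[OF flat span pp])
  have ND: "triv_C k ** ?N = ?N ** idem_mult F p k" for k
    by (rule idem_basis_cancel[OF flat span pp])
      (simp add: matrix_mul_assoc[symmetric] N idem_mult_idem_basis[OF flat span pp], simp add: matrix_mul_assoc N)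
  have NM: "(\<Sum>k\<in>UNIV. scal (mfps_const (?N $ k $ \<beta>)) (const_mat (idem_mult F p k))) = (const_mat (origin_C F \<beta>) :: ('v mfps, 'n) sqm)" for \<beta>
  proof -
    have e: "(\<Sum>k\<in>UNIV. p k $ \<gamma> * ?N $ k $ \<beta>) = (if \<gamma> = \<beta> then 1 else 0)" for \<gamma>
      using N(1) by (simp add: vec_eq_iff matrix_matrix_mult_def mat_def idem_basis_def[OF flat span pp])
    have "(\<Sum>k\<in>UNIV. scal (mfps_const (?N $ k $ \<beta>)) (const_mat (idem_mult F p k))) =
        (\<Sum>\<gamma>\<in>UNIV. scal (mfps_const (\<Sum>k\<in>UNIV. p k $ \<gamma> * ?N $ k $ \<beta>)) (const_mat (origin_C F \<gamma>) :: ('v mfps, 'n) sqm))"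
      unfolding const_mat_idem_mult
      by (rule sqm_eqI) (simp add: mfps_const_sum mfps_const_simps sum_distrib_left sum_distrib_right mult_ac, rule sum.swap)
    also have "\<dots> = (\<Sum>\<gamma>\<in>UNIV. if \<gamma> = \<beta> then const_mat (origin_C F \<beta>) else 0)"
      unfolding e by (rule sum.cong) (auto simp: mfps_const_simps scal_simps)
    finally show ?thesis by simp
  qed
  have A: "A = idem_basis p *v (\<chi> \<alpha>. 1)"
    by (subst unit_sum[OF flat span pp]) (simp add: vec_eq_iff matrix_vector_mult_def idem_basis_def[OF flat span pp])
  have A': "(\<chi> \<alpha>. 1) = ?N *v A" by (simp add: A matrix_vector_mul_assoc N)
  have "maps_base (laurent_const (idem_basis p)) triv_cone C \<and> maps_into (laurent_const (idem_basis p)) triv_cone C"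
  proof (rule GL_maps[OF cd0 cd A exp_cal_normalised exp_cal_normalised refl])
    show "smap (mfps_subst (mat_vec (const_mat (idem_basis p)) w0)) (SQ (exp_cal (origin_C F) d)) * const_mat (idem_basis p) =
        const_mat (idem_basis p) * smap (mfps_subst w0) (SQ (exp_cal triv_C d))" for d
      by (rule exp_cal_intertwine[of w0, OF z(2)]) (simp only: M DM)
  qed
  moreover have "maps_base (laurent_const ?N) C triv_cone \<and> maps_into (laurent_const ?N) C triv_cone"
  proof (rule GL_maps[OF cd cd0 A' exp_cal_normalised exp_cal_normalised refl])
    have "(\<Sum>\<gamma>\<in>UNIV. scal (mfps_const (?N $ \<gamma> $ \<beta>)) (const_mat (triv_C \<gamma>))) * const_mat ?N =
        (const_mat ?N * const_mat (origin_C F \<beta>) :: (('n \<times> nat) mfps, 'n) sqm)" for \<beta>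
    proof -
      have "(\<Sum>\<gamma>\<in>UNIV. scal (mfps_const (?N $ \<gamma> $ \<beta>)) (const_mat (triv_C \<gamma>))) * const_mat ?N =
          (\<Sum>\<gamma>\<in>UNIV. scal (mfps_const (?N $ \<gamma> $ \<beta>)) (const_mat (triv_C \<gamma> ** ?N)))"
        by (simp only: sum_distrib_right scal_simps const_mat_simps)
      also have "\<dots> = const_mat ?N * (\<Sum>k\<in>UNIV. scal (mfps_const (?N $ k $ \<beta>)) (const_mat (idem_mult F p k)))"
        by (simp only: sum_distrib_left scal_simps const_mat_simps ND)
      finally show ?thesis by (simp only: NM)
    qed
    then show "smap (mfps_subst (mat_vec (const_mat ?N) w)) (SQ (exp_cal triv_C d)) * const_mat ?N =
        const_mat ?N * smap (mfps_subst w) (SQ (exp_cal (origin_C F) d))" for d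
      by (rule exp_cal_intertwine[of w, OF z(1)])
  qed
  ultimately show ?thesis by (simp add: GL_acts_def)
qed

text \<open>
  The factorisation is an identity over the manifold with coordinates \<open>v\<close>.  It is pulled back in the
  one direction along \<open>y\<close> with \<open>\<phi>(y) = w1\<close>, in the other along \<open>w2\<close>; the canonical coordinates are
  normalised so that \<open>\<phi>\<close> is tangent to the identity and \<open>y\<close> exists.
\<close>

lemma G_plus_acts_ancestor:
  assumes cd1: "cone_data (quad_F (origin_C F)) A (exp_cal (origin_C F)) w1 C1"
    and cd2: "cone_data F A J w2 C2" and n2: "normalised J"
  obtains R where "R 0 = mat 1" "G_plus_acts R C1 C2"
proof -
  let ?F1 = "quad_F (origin_C F)" and ?J1 = "exp_cal (origin_C F)"
  obtain P \<theta> where P0: "\<And>k. at_origin (fps_nth (P k) 0) = idem_mult F p k"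
    and Pl: "\<And>k l. k \<noteq> l \<Longrightarrow> P k * P l = 0" and Pk: "\<And>k. P k * P k = P k" and horiz: "\<And>k \<gamma>. horiz F \<gamma> (P k) = 0"
    and diag: "\<And>\<gamma>. struct_mat F \<gamma> = (\<Sum>k\<in>UNIV. scal (\<theta> k \<gamma>) (fps_nth (P k) 0))"
    and closed: "\<And>k \<gamma> \<delta>. mfps_deriv \<gamma> (\<theta> k \<delta>) = mfps_deriv \<delta> (\<theta> k \<gamma>)"
    and lin: "\<And>\<alpha> \<delta>. (\<Sum>k\<in>UNIV. p k $ \<alpha> * mfps_coeff (\<theta> k \<delta>) {#}) = (if \<alpha> = \<delta> then 1 else 0)"
    using semisimple_data[OF flat span pp] by blast
  have "\<exists>U. mfps_coeff U {#} = 0 \<and> (\<forall>\<gamma>. mfps_deriv \<gamma> U = \<theta> k \<gamma>)" for k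
    using formal_poincare[of "\<theta> k", OF closed] by metis
  then obtain U where U: "\<And>k. mfps_coeff (U k) {#} = 0" "\<And>k \<gamma>. mfps_deriv \<gamma> (U k) = \<theta> k \<gamma>" by metis
  define \<phi> where "\<phi> \<alpha> = (\<Sum>k\<in>UNIV. mfps_const (p k $ \<alpha>) * U k)" for \<alpha>
  have d\<phi>: "mfps_deriv \<gamma> (\<phi> \<alpha>) = (\<Sum>k\<in>UNIV. mfps_const (p k $ \<alpha>) * \<theta> k \<gamma>)" for \<gamma> \<alpha>
    by (simp add: \<phi>_def mfps_deriv_sum mfps_deriv_const_mult U)
  have z\<phi>: "mfps_coeff (\<phi> \<alpha>) {#} = 0" for \<alpha> by (simp add: \<phi>_def U)
  have l\<phi>: "mfps_coeff (\<phi> \<alpha>) {#\<delta>#} = (if \<alpha> = \<delta> then 1 else 0)" for \<alpha> \<delta>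
  proof -
    have "mfps_coeff (mfps_deriv \<delta> (\<phi> \<alpha>)) {#} = (if \<alpha> = \<delta> then 1 else 0)"
      unfolding d\<phi> using lin[of \<alpha> \<delta>] by simp
    then show ?thesis by simp
  qed
  have T: "(\<Sum>\<mu>\<in>UNIV. scal (mfps_deriv \<gamma> (\<phi> \<mu>)) (const_mat (origin_C F \<mu>))) = (\<Sum>k\<in>UNIV. scal (\<theta> k \<gamma>) (const_mat (idem_mult F p k)))" for \<gamma>
    unfolding const_mat_idem_mult d\<phi>
    by (rule sqm_eqI) (simp add: sum_distrib_left sum_distrib_right mult_ac, rule sum.swap)
  define R where "R = (\<lambda>n. \<Sum>k\<in>UNIV. at_origin (fps_nth (P k) n) ** idem_mult F p k)"
  have cal: "calibration F J" using cd2 by (simp add: cone_data_def)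
  have cal1: "calibration ?F1 ?J1" using cd1 by (simp add: cone_data_def)
  have n1: "normalised ?J1" by (rule exp_cal_normalised)
  have PP: "P k * P l = (if k = l then P k else 0)" for k l using Pk Pl by auto
  note fac = cal n2 horiz PP diag idem_mult_mult sum_idem_mult[OF flat span pp] P0 R_def cal1 n1 origin_const_alg z\<phi> T
  have R0: "R 0 = mat 1" by (rule R_0[OF fac])
  obtain G H where G: "nonneg G" and H: "nonneg H" and eG: "fund_sol J * G = plus_loop (const_loop R) * fund_sol_at ?J1 \<phi>"
    and eH: "fund_sol_at ?J1 \<phi> * H = plus_loop (const_loop (series_inv R)) * fund_sol J"
    by (rule factorisation[OF fac])
  have w: "mfps_coeff (w1 v) {#} = 0" "mfps_coeff (w2 v) {#} = 0" for v
    using cd1 cd2 by (simp_all add: cone_data_def euler_solution_def)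
  have nn: "zcoeff k (entry X i j) = 0" if "nonneg X" "k < 0" for X k i j
    using that unfolding nonneg_def by (metis entry_simps(1) entry_smap)
  obtain y where y: "\<And>\<alpha>. mfps_coeff (y \<alpha>) {#} = 0" and yw: "(\<lambda>\<alpha>. mfps_subst y (\<phi> \<alpha>)) = w1"
    by (rule solve_near_identity[of \<phi> w1, OF z\<phi> l\<phi> w(1)]) blast
  have fwd: "maps_into (laurent_plus R) C1 C2"
  proof (rule G_plus_maps[where R = R and y = y, OF cd1 n1 cd2 n2 R0 y])
    show "plus_loop (const_loop R) * fund_sol_at ?J1 w1 = fund_sol_at J y * smap (ysub y) G"
      using arg_cong[OF eG, of "smap (ysub y)"]
      by (simp add: smap_ysub_hom(1)[OF cal n2, of y, OF y] ysub_plus_loop_const[of y, OF y] yw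
          ysub_fund_sol_at[of y, OF y cal1 n1 z\<phi>] fund_sol_at_def[OF cal n2, of y, OF y])
    show "zcoeff k (entry (smap (ysub y) G) i j) = 0" if "k < 0" for k i j
      by (rule nn[OF ysub_nonneg[of y, OF y G] that])
  qed
  define y' where "y' \<alpha> = mfps_subst w2 (\<phi> \<alpha>)" for \<alpha>
  have y': "mfps_coeff (y' \<alpha>) {#} = 0" for \<alpha>
    using coeff_subst_empty[of w2 "\<phi> \<alpha>", OF w(2)] by (simp add: y'_def z\<phi>)
  have bwd: "maps_into (laurent_plus (series_inv R)) C2 C1"
  proof (rule G_plus_maps[where R = "series_inv R" and y = y', OF cd2 n2 cd1 n1 series_inv_0 y'])
    show "plus_loop (const_loop (series_inv R)) * fund_sol_at J w2 = fund_sol_at ?J1 y' * smap (ysub w2) H"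
      using arg_cong[OF eH, of "smap (ysub w2)"]
      by (simp add: smap_ysub_hom(1)[OF cal n2, of w2, OF w(2)] ysub_plus_loop_const[of w2, OF w(2)] y'_def[abs_def]
          ysub_fund_sol_at[of w2, OF w(2) cal1 n1 z\<phi>] fund_sol_at_def[OF cal n2, of w2, OF w(2)])
    show "zcoeff k (entry (smap (ysub w2) H) i j) = 0" if "k < 0" for k i j
      by (rule nn[OF ysub_nonneg[of w2, OF w(2) H] that])
  qed
  have "base C2 = base C1"
    using cd1 cd2 cal_shift_normalised[OF n1, of A] cal_shift_normalised[OF n2, of A] by (simp add: cone_data_def)
  then have "G_plus_acts R C1 C2"
    unfolding G_plus_acts_def
    using fwd bwd ancestor_coneI[OF cd1 n1] ancestor_coneI[OF cd2 n2] by simp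
  then show ?thesis using that R0 by blast
qed

end

theorem theorem2p15:
  fixes t_orig A :: "complex^'n"
    and F :: "'n \<Rightarrow> 'n mfps"
    and J :: "nat \<Rightarrow> 'n mfps^'n^'n"
    and C :: "'n germ"
  assumes "flat_F_manifold F A"
    and "calibration F J"
    and "cone_of t_orig A J C"
    and "semisimple_at_origin F"
  shows "\<exists>S\<in>G_minus. \<exists>R\<in>G_plus. \<exists>M :: complex^'n^'n. invertible M \<and>
           (\<exists>C1 C2. GL_acts M triv_cone C1 \<and> G_plus_acts R C1 C2 \<and> G_minus_acts S C2 C)"
proof -
  note flat = assms(1) and cal = assms(2)
  obtain p :: "'n \<Rightarrow> complex^'n" where p: "vec.span (range p) = UNIV \<and>
      (\<forall>k l. origin_mult F (p k) (p l) = (if k = l then p k else 0))"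
    using assms(4) unfolding semisimple_at_origin_def by blast
  then have span: "vec.span (range p) = UNIV" ..
  have pp: "origin_mult F (p k) (p l) = (if k = l then p k else 0)" for k l using p by blast
  obtain w where cd: "cone_data F A J w C"
    using assms(3) cone_of_iff[OF flat cal] by blast
  obtain L J2 where L0: "L 0 = mat 1" and cal2: "calibration F J2" and n2: "normalised J2"
    and JL: "sq_fps J = const_loop L * sq_fps J2" and JL': "sq_fps J2 = const_loop (series_inv L) * sq_fps J"
    by (rule normalise_calibration[OF cal])
  obtain C2 w2 where cd2: "cone_data F A J2 w2 C2" using cone_data_exists[OF flat cal2] by blast
  let ?S = "\<lambda>d. if even d then L d else - L d"
  have S0: "?S 0 = mat 1" by (simp add: L0)
  have S': "series_inv ?S = (\<lambda>d. if even d then series_inv L d else - series_inv L d)"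
    by (rule ext) (rule series_inv_sign[of L, OF L0])
  have minus: "G_minus_acts ?S C2 C"
    unfolding G_minus_acts_def
    using G_minus_maps[OF cal cal2 JL refl cd cd2 L0] G_minus_maps[OF cal2 cal JL' S' cd2 cd series_inv_0] by blast
  have alg: "const_alg (quad_F (origin_C F)) (origin_C F)" by (rule origin_const_alg)
  have flat1: "flat_F_manifold (quad_F (origin_C F)) A" by (rule origin_flat[OF flat])
  obtain C1 w1 where cd1: "cone_data (quad_F (origin_C F)) A (exp_cal (origin_C F)) w1 C1"
    using cone_data_exists[OF flat1 exp_cal_calibration[OF alg struct_mat_commute[OF flat1]]] by blast
  obtain R where R0: "R 0 = mat 1" and plus: "G_plus_acts R C1 C2"
    by (rule G_plus_acts_ancestor[OF flat span pp cd1 cd2 n2])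
  show ?thesis
    using S0 R0 minus plus GL_acts_trivial[OF flat span pp cd1] invertible_idem_basis[OF flat span pp]
    unfolding G_minus_def G_plus_def by blast
qed

end
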